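(* With the notation, spaces, norms, stabilization forms $s_K$ and bilinear form $a=a_{\alpha,t}$ described in the context, the following hold. (1) (Inf-sup condition) For every $t\in\mathbb{R}$ there exists $\alpha_0>0$, depending on $t$ but independent of the mesh size parameters $h_K$ and $h_e$, such that for every $\alpha$ with $0<\alpha<\alpha_0$ there exists a constant $c_\alpha>0$, depending on $t$ and $\alpha$ but independent of the mesh size parameters $h_K$ and $h_e$, such that $$\inf_{(u,\lambda)\in\mathbb{V}_h\setminus\{0\}}\ \sup_{(v,\mu)\in\mathbb{V}_h\setminus\{0\}}\frac{a(u,\lambda;v,\mu)}{\|u,\lambda\|_{\mathbb{V}}\,\|v,\mu\|_{\mathbb{V}}}\ \ge\ c_\alpha .$$ (2) (Conditional continuity) There exists a constant $C$, independent of the mesh size parameters $h_K$ and $h_e$ (but possibly depending on the fixed parameters $\alpha>0$, $t\in\mathbb{R}$), such that for all $u,v\in\prod_{K}H^1(K)$ and all $\lambda,\mu\in L^2(\Sigma)$: if $\int_K u^K=0$ and $\langle\gamma_K^*\lambda,1\rangle=0$ for all $K\in\mathcal{T}_h$, then $$a(u,\lambda;v,\mu)\le C\,\|u,\lambda\|_{\mathbb{V}}\,\|v,\mu\|_{\mathbb{V}} .$$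
   Context: Mesh. $\Omega\subset\mathbb{R}^2$ is a bounded polygonal domain and $\mathcal{T}_h$ is a tessellation of $\Omega$ into polygons $K$ with diameter $h_K$. There is a fixed constant $\rho^\star>0$ such that every $K\in\mathcal{T}_h$ is star shaped with respect to all points of some disc of diameter $\ge\rho^\star h_K$ (shape regularity). No lower bound on edge lengths, no bound on the number of edges, and no comparability of diameters of adjacent elements is assumed. $\mathcal{E}^K$ is the set of edges of $K$, $\mathcal{E}_h$ the set of all edges of the tessellation (each edge belongs to the boundary of one or two elements), $\Sigma=\bigcup_{e\in\mathcal{E}_h}\bar e$ the skeleton. For $e\in\mathcal{E}_h$: $h_e=|e|$ and $H_e=\max_{K:\,e\subset\partial K}h_K$. $\nu_K$ is the outer unit normal to $K$; on $\Sigma$ a unit normal $\nu$ is chosen on each edge, pointing outwards on $\partial\Omega$. Average and jumps. $\fint_K\phi=|K|^{-1}\int_K\phi$. For $u=(u^K)_K\in\prod_K H^1(K)$, the jump is the vector function on $\Sigma$ given on each edge $e$ by $[\![u]\!]|_e=\sum_{K:\,e\subset\partial K}u^K\nu_K$. $\bar u=(\bar u^K)_K$ denotes the piecewise constant function with $\bar u^K=\fint_K u^K$; $[\![\bar u]\!]$ is constant on each edge. Norms. $|\phi|_{1,K}=\|\nabla\phi\|_{L^2(K)}$. For $F\in(H^1(K))'$, $|F|_{-1,K}=\sup\{\langle F,\phi\rangle/|\phi|_{1,K}:\ \phi\in H^1(K)\setminus\{0\},\ \int_K\phi=0\}$ and $\|F\|_{-1,K}^2=|\langle F,1\rangle|^2+|F|_{-1,K}^2$.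 Operators. $\mathcal{D}_K:H^1(K)\to(H^1(K))'$, $\langle\mathcal{D}_Ku,v\rangle=\int_K\nabla u\cdot\nabla v$. $\gamma_K^*:L^2(\Sigma)\to(H^1(K))'$, $\langle\gamma_K^*\lambda,v\rangle=\int_{\partial K}\lambda(\nu\cdot\nu_K)v$. Global norms. On $L^2(\Sigma)$: $\|\lambda\|_{-1/2,*}^2=\sum_K\|\gamma_K^*\lambda\|_{-1,K}^2$. On $\prod_KH^1(K)$: $\|u\|_{1,*}^2=\sum_K|u^K|_{1,K}^2+\sum_{e\in\mathcal{E}_h}\frac{h_e}{H_e}\big|[\![\bar u]\!]|_e\big|^2$. And $\|u,\lambda\|_{\mathbb{V}}^2=\|u\|_{1,*}^2+\|\lambda\|_{-1/2,*}^2$. Discrete spaces. $k\ge1$, $k'\in\{k,k-1\}$; $\mathbb{P}_n(D)$ denotes polynomials on $D$ of total degree $\le n$. $V_h=\prod_K\mathbb{P}_k(K)$, $\Lambda_h=\{\lambda\in L^2(\Sigma):\lambda|_e\in\mathbb{P}_{k'}(e)\ \forall e\in\mathcal{E}_h\}$, $\mathbb{V}_h=V_h\times\Lambda_h$. Stabilization. For each $K\in\mathcal{T}_h$, $s_K:(H^1(K))'\times(H^1(K))'\to\mathbb{R}$ is a bilinear form such that, with constants $C_s,c_s>0$ independent of the $h_K$'s and $h_e$'s (possibly depending on $\rho^\star$ and $k$): $s_K(F,G)\le C_s|F|_{-1,K}|G|_{-1,K}$ for all $F,G\in(H^1(K))'$, and $s_K(\gamma_K^*\lambda,\gamma_K^*\lambda)\ge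 c_s|\gamma_K^*\lambda|_{-1,K}^2$ for all $\lambda\in\Lambda_h$. Bilinear form. For parameters $\alpha>0$, $t\in\mathbb{R}$ (independent of the tessellation), $$a(u,\lambda;v,\mu)=\sum_K\int_K\nabla u^K\cdot\nabla v^K-\int_\Sigma\lambda[\![v]\!]\cdot\nu+\int_\Sigma\mu[\![u]\!]\cdot\nu+\alpha\sum_Ks_K(\mathcal{D}_Ku^K-\gamma_K^*\lambda,\ t\mathcal{D}_Kv^K-\gamma_K^*\mu).$$ Convention on constants: all constants in the statement may depend on $\rho^\star$, $k$, $\Omega$ and $C_s,c_s$, besides the quantities explicitly mentioned. *)

theory Defs
  imports "HOL-Analysis.Analysis"
begin

type_synonym point = "real^2"

section \<open>Square integrable functions and the Sobolev space on a planar open set\<close>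

text \<open>Elements of Lebesgue and Sobolev spaces are represented by functions; identification up to
  null sets is made explicit wherever it matters (namely in the meaning of ``nonzero'').
  Representatives are Borel, which loses nothing.\<close>

definition square_integrable :: "'a measure \<Rightarrow> ('a \<Rightarrow> 'b::euclidean_space) \<Rightarrow> bool" where
  "square_integrable M f \<longleftrightarrow> f \<in> borel_measurable M \<and> integrable M (\<lambda>x. (norm (f x))\<^sup>2)"

definition L2_norm :: "'a measure \<Rightarrow> ('a \<Rightarrow> 'b::euclidean_space) \<Rightarrow> real" where
  "L2_norm M f = sqrt (LINT x|M. (norm (f x))\<^sup>2)"

abbreviation area_on :: "point set \<Rightarrow> point measure" where
  "area_on K \<equiv> restrict_space lborel K"

fun times_differentiable :: "nat \<Rightarrow> (point \<Rightarrow> real) \<Rightarrow> bool" where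
  "times_differentiable 0 f \<longleftrightarrow> continuous_on UNIV f"
| "times_differentiable (Suc n) f \<longleftrightarrow>
     (\<exists>g. (\<forall>x. GDERIV f x :> g x) \<and> (\<forall>i. times_differentiable n (\<lambda>x. g x $ i)))"

definition smooth :: "(point \<Rightarrow> real) \<Rightarrow> bool" where
  "smooth f \<longleftrightarrow> (\<forall>n. times_differentiable n f)"

definition test_function :: "point set \<Rightarrow> (point \<Rightarrow> real) \<Rightarrow> bool" where
  "test_function K \<phi> \<longleftrightarrow>
     smooth \<phi> \<and> compact (closure {x. \<phi> x \<noteq> 0}) \<and> closure {x. \<phi> x \<noteq> 0} \<subseteq> K"

definition has_weak_gradient :: "point set \<Rightarrow> (point \<Rightarrow> real) \<Rightarrow> (point \<Rightarrow> point) \<Rightarrow> bool" where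
  "has_weak_gradient K u g \<longleftrightarrow>
     (\<forall>\<phi> d\<phi>. test_function K \<phi> \<longrightarrow> (\<forall>x. GDERIV \<phi> x :> d\<phi> x) \<longrightarrow>
        (LINT x|area_on K. u x *\<^sub>R d\<phi> x) = - (LINT x|area_on K. \<phi> x *\<^sub>R g x))"

definition H1 :: "point set \<Rightarrow> (point \<Rightarrow> real) set" where
  "H1 K = {u. square_integrable (area_on K) u \<and>
              (\<exists>g. square_integrable (area_on K) g \<and> has_weak_gradient K u g)}"

text \<open>The weak gradient is unique up to null sets, so the choice below is harmless.\<close>

definition grad :: "point set \<Rightarrow> (point \<Rightarrow> real) \<Rightarrow> point \<Rightarrow> point" where
  "grad K u = (SOME g. square_integrable (area_on K) g \<and> has_weak_gradient K u g)"

definition H1_seminorm :: "point set \<Rightarrow> (point \<Rightarrow> real) \<Rightarrow> real" where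
  "H1_seminorm K u = L2_norm (area_on K) (grad K u)"

definition H1_norm :: "point set \<Rightarrow> (point \<Rightarrow> real) \<Rightarrow> real" where
  "H1_norm K u = sqrt ((L2_norm (area_on K) u)\<^sup>2 + (H1_seminorm K u)\<^sup>2)"

definition average :: "point set \<Rightarrow> (point \<Rightarrow> real) \<Rightarrow> real" where
  "average K u = (LINT x|area_on K. u x) / measure lborel K"

text \<open>A functional on \<open>H1 K\<close> is a total function on representatives of which only the values
  on \<open>H1 K\<close> matter. Boundedness forces it to respect equality almost everywhere.\<close>

type_synonym functional = "(point \<Rightarrow> real) \<Rightarrow> real"

definition H1_dual :: "point set \<Rightarrow> functional set" where
  "H1_dual K = {F.
     (\<forall>u\<in>H1 K. \<forall>v\<in>H1 K. F (\<lambda>x. u x + v x) = F u + F v) \<and>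
     (\<forall>c. \<forall>u\<in>H1 K. F (\<lambda>x. c * u x) = c * F u) \<and>
     (\<exists>C. \<forall>u\<in>H1 K. \<bar>F u\<bar> \<le> C * H1_norm K u)}"

definition dual_seminorm :: "point set \<Rightarrow> functional \<Rightarrow> real" where
  "dual_seminorm K F =
     Sup {F \<phi> / H1_seminorm K \<phi> | \<phi>.
            \<phi> \<in> H1 K \<and> \<not> (AE x in area_on K. \<phi> x = 0) \<and> (LINT x|area_on K. \<phi> x) = 0}"

definition dual_norm :: "point set \<Rightarrow> functional \<Rightarrow> real" where
  "dual_norm K F = sqrt (\<bar>F (\<lambda>x. 1)\<bar>\<^sup>2 + (dual_seminorm K F)\<^sup>2)"

definition stiffness :: "point set \<Rightarrow> (point \<Rightarrow> real) \<Rightarrow> functional" where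
  "stiffness K u = (\<lambda>v. LINT x|area_on K. grad K u x \<bullet> grad K v x)"


section \<open>Edges and tessellations\<close>

text \<open>An edge is the pair of its end points. Their order carries no meaning: a tessellation
  contains at most one of the two pairs.\<close>

type_synonym edge = "point \<times> point"

definition segment :: "edge \<Rightarrow> point set" where
  "segment e = closed_segment (fst e) (snd e)"

definition rel_segment :: "edge \<Rightarrow> point set" where
  "rel_segment e = open_segment (fst e) (snd e)"

definition edge_length :: "edge \<Rightarrow> real" where
  "edge_length e = dist (fst e) (snd e)"

text \<open>Arc length on an edge, as a measure on the plane.\<close>

definition arclength :: "edge \<Rightarrow> point measure" where
  "arclength e = distr (restrict_space lborel {0..edge_length e}) borel
     (\<lambda>s. fst e + (s / edge_length e) *\<^sub>R (snd e - fst e))"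

text \<open>The condition \<open>interior (closure S) = S\<close> excludes slits and punctures. Holes are allowed.\<close>

definition polygonal_domain :: "point set \<Rightarrow> bool" where
  "polygonal_domain S \<longleftrightarrow> S \<noteq> {} \<and> open S \<and> connected S \<and> bounded S \<and> interior (closure S) = S \<and>
     (\<exists>B. finite B \<and> frontier S = \<Union>(segment ` B))"

definition shape_regular :: "real \<Rightarrow> point set \<Rightarrow> bool" where
  "shape_regular \<rho> K \<longleftrightarrow> (\<exists>c r. 2 * r \<ge> \<rho> * diameter K \<and>
     (\<forall>y\<in>ball c r. y \<in> K \<and> (\<forall>z\<in>K. closed_segment y z \<subseteq> K)))"

definition edges_of :: "edge set \<Rightarrow> point set \<Rightarrow> edge set" where
  "edges_of E K = {e\<in>E. segment e \<subseteq> frontier K}"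

definition elems_at :: "point set set \<Rightarrow> edge \<Rightarrow> point set set" where
  "elems_at T e = {K\<in>T. segment e \<subseteq> frontier K}"

definition unit_normal :: "edge \<Rightarrow> point \<Rightarrow> bool" where
  "unit_normal e n \<longleftrightarrow> norm n = 1 \<and> n \<bullet> (snd e - fst e) = 0"

definition outer_normal :: "point set \<Rightarrow> edge \<Rightarrow> point" where
  "outer_normal K e = (THE n. unit_normal e n \<and>
     (\<forall>x\<in>rel_segment e. \<forall>\<^sub>F s in at_right 0. x + s *\<^sub>R n \<notin> closure K \<and> x - s *\<^sub>R n \<in> K))"

text \<open>\<open>T\<close> is the set of (open) elements, \<open>E\<close> the set of edges and \<open>\<nu>\<close> the chosen normal on the
  skeleton. The edges are part of the data since a vertex of an element may have a straight angle
  (hanging nodes).\<close>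

definition tessellation ::
  "point set \<Rightarrow> real \<Rightarrow> point set set \<Rightarrow> edge set \<Rightarrow> (edge \<Rightarrow> point) \<Rightarrow> bool" where
  "tessellation \<Omega> \<rho> T E \<nu> \<longleftrightarrow>
     finite T \<and>
     (\<forall>K\<in>T. polygonal_domain K \<and> K \<subseteq> \<Omega> \<and> shape_regular \<rho> K) \<and>
     (\<forall>K\<in>T. \<forall>K'\<in>T. K \<noteq> K' \<longrightarrow> K \<inter> K' = {}) \<and>
     closure \<Omega> = \<Union>(closure ` T) \<and>
     finite E \<and>
     (\<forall>e\<in>E. fst e \<noteq> snd e) \<and>
     (\<forall>e\<in>E. \<forall>e'\<in>E. e \<noteq> e' \<longrightarrow> rel_segment e \<inter> rel_segment e' = {}) \<and>
     (\<forall>K\<in>T. frontier K = \<Union>(segment ` edges_of E K)) \<and>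
     (\<forall>e\<in>E. card (elems_at T e) \<in> {1, 2}) \<and>
     (\<forall>e\<in>E. unit_normal e (\<nu> e)) \<and>
     (\<forall>e\<in>E. segment e \<subseteq> frontier \<Omega> \<longrightarrow> (\<forall>K\<in>elems_at T e. \<nu> e = outer_normal K e))"

definition edge_scale :: "point set set \<Rightarrow> edge \<Rightarrow> real" where
  "edge_scale T e = Max (diameter ` elems_at T e)"


section \<open>Traces, jumps and the operators on the skeleton\<close>

text \<open>The trace operator is the continuous extension to \<open>H1 K\<close>, with values in square integrable
  functions on the boundary, of the restriction of smooth functions to the boundary.\<close>

definition has_trace :: "edge set \<Rightarrow> point set \<Rightarrow> (point \<Rightarrow> real) \<Rightarrow> (point \<Rightarrow> real) \<Rightarrow> bool" where
  "has_trace E K u g \<longleftrightarrow>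
     (\<forall>e\<in>edges_of E K. square_integrable (arclength e) g) \<and>
     (\<exists>\<phi>. (\<forall>n. smooth (\<phi> n)) \<and>
          (\<lambda>n::nat. H1_norm K (\<lambda>x. \<phi> n x - u x)) \<longlonglongrightarrow> 0 \<and>
          (\<forall>e\<in>edges_of E K. (\<lambda>n. L2_norm (arclength e) (\<lambda>x. \<phi> n x - g x)) \<longlonglongrightarrow> 0))"

definition H1_trace :: "edge set \<Rightarrow> point set \<Rightarrow> (point \<Rightarrow> real) \<Rightarrow> point \<Rightarrow> real" where
  "H1_trace E K u = (SOME g. has_trace E K u g)"

text \<open>The jump across \<open>e\<close> of the element values \<open>w\<close> (at one point of \<open>e\<close>, or of a piecewise
  constant function).\<close>

definition jump :: "point set set \<Rightarrow> edge \<Rightarrow> (point set \<Rightarrow> real) \<Rightarrow> point" where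
  "jump T e w = (\<Sum>K\<in>elems_at T e. w K *\<^sub>R outer_normal K e)"

definition L2_skeleton :: "edge set \<Rightarrow> (point \<Rightarrow> real) set" where
  "L2_skeleton E = {l. \<forall>e\<in>E. square_integrable (arclength e) l}"

definition flux :: "edge set \<Rightarrow> (edge \<Rightarrow> point) \<Rightarrow> point set \<Rightarrow> (point \<Rightarrow> real) \<Rightarrow> functional" where
  "flux E \<nu> K l =
     (\<lambda>v. \<Sum>e\<in>edges_of E K. LINT x|arclength e. l x * (\<nu> e \<bullet> outer_normal K e) * H1_trace E K v x)"

type_synonym broken = "point set \<Rightarrow> point \<Rightarrow> real"

definition H1_broken :: "point set set \<Rightarrow> broken set" where
  "H1_broken T = {u. \<forall>K\<in>T. u K \<in> H1 K}"

definition skeleton_norm ::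
  "point set set \<Rightarrow> edge set \<Rightarrow> (edge \<Rightarrow> point) \<Rightarrow> (point \<Rightarrow> real) \<Rightarrow> real" where
  "skeleton_norm T E \<nu> l = sqrt (\<Sum>K\<in>T. (dual_norm K (flux E \<nu> K l))\<^sup>2)"

definition broken_norm :: "point set set \<Rightarrow> edge set \<Rightarrow> broken \<Rightarrow> real" where
  "broken_norm T E u = sqrt ((\<Sum>K\<in>T. (H1_seminorm K (u K))\<^sup>2) +
     (\<Sum>e\<in>E. edge_length e / edge_scale T e * (norm (jump T e (\<lambda>K. average K (u K))))\<^sup>2))"

definition V_norm ::
  "point set set \<Rightarrow> edge set \<Rightarrow> (edge \<Rightarrow> point) \<Rightarrow> broken \<times> (point \<Rightarrow> real) \<Rightarrow> real" where
  "V_norm T E \<nu> p = sqrt ((broken_norm T E (fst p))\<^sup>2 + (skeleton_norm T E \<nu> (snd p))\<^sup>2)"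


section \<open>Discrete spaces, stabilization and the bilinear form\<close>

definition polys_on :: "nat \<Rightarrow> point set \<Rightarrow> (point \<Rightarrow> real) set" where
  "polys_on n D = {f. \<exists>c :: nat \<Rightarrow> nat \<Rightarrow> real. \<forall>x\<in>D.
     f x = (\<Sum>i\<le>n. \<Sum>j\<le>n - i. c i j * (x $ 1) ^ i * (x $ 2) ^ j)}"

definition V_discrete :: "point set set \<Rightarrow> nat \<Rightarrow> broken set" where
  "V_discrete T k = {u. \<forall>K\<in>T. u K \<in> polys_on k K}"

definition Lambda_discrete :: "edge set \<Rightarrow> nat \<Rightarrow> (point \<Rightarrow> real) set" where
  "Lambda_discrete E k' = {l \<in> L2_skeleton E. \<forall>e\<in>E. l \<in> polys_on k' (rel_segment e)}"

definition V_zero :: "point set set \<Rightarrow> edge set \<Rightarrow> broken \<times> (point \<Rightarrow> real) \<Rightarrow> bool" where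
  "V_zero T E p \<longleftrightarrow> (\<forall>K\<in>T. AE x in area_on K. fst p K x = 0) \<and>
     (\<forall>e\<in>E. AE x in arclength e. snd p x = 0)"

definition V_discrete_nonzero ::
  "point set set \<Rightarrow> edge set \<Rightarrow> nat \<Rightarrow> nat \<Rightarrow> (broken \<times> (point \<Rightarrow> real)) set" where
  "V_discrete_nonzero T E k k' = {p \<in> V_discrete T k \<times> Lambda_discrete E k'. \<not> V_zero T E p}"

definition bilinear_dual :: "point set \<Rightarrow> (functional \<Rightarrow> functional \<Rightarrow> real) \<Rightarrow> bool" where
  "bilinear_dual K s \<longleftrightarrow>
     (\<forall>F\<in>H1_dual K. \<forall>G\<in>H1_dual K. \<forall>H\<in>H1_dual K.
        s (\<lambda>\<phi>. F \<phi> + G \<phi>) H = s F H + s G H \<and> s H (\<lambda>\<phi>. F \<phi> + G \<phi>) = s H F + s H G) \<and>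
     (\<forall>c. \<forall>F\<in>H1_dual K. \<forall>G\<in>H1_dual K.
        s (\<lambda>\<phi>. c * F \<phi>) G = c * s F G \<and> s F (\<lambda>\<phi>. c * G \<phi>) = c * s F G)"

definition stabilization ::
  "real \<Rightarrow> real \<Rightarrow> point set set \<Rightarrow> edge set \<Rightarrow> (edge \<Rightarrow> point) \<Rightarrow> nat \<Rightarrow>
   (point set \<Rightarrow> functional \<Rightarrow> functional \<Rightarrow> real) \<Rightarrow> bool" where
  "stabilization Cs cs T E \<nu> k' s \<longleftrightarrow> (\<forall>K\<in>T.
     bilinear_dual K (s K) \<and>
     (\<forall>F\<in>H1_dual K. \<forall>G\<in>H1_dual K. s K F G \<le> Cs * dual_seminorm K F * dual_seminorm K G) \<and>
     (\<forall>l\<in>Lambda_discrete E k'.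
        s K (flux E \<nu> K l) (flux E \<nu> K l) \<ge> cs * (dual_seminorm K (flux E \<nu> K l))\<^sup>2))"

definition stab_form ::
  "point set set \<Rightarrow> edge set \<Rightarrow> (edge \<Rightarrow> point) \<Rightarrow>
   (point set \<Rightarrow> functional \<Rightarrow> functional \<Rightarrow> real) \<Rightarrow> real \<Rightarrow> real \<Rightarrow>
   broken \<times> (point \<Rightarrow> real) \<Rightarrow> broken \<times> (point \<Rightarrow> real) \<Rightarrow> real" where
  "stab_form T E \<nu> s \<alpha> t p q = (case (p, q) of ((u, l), (v, m)) \<Rightarrow>
     (\<Sum>K\<in>T. LINT x|area_on K. grad K (u K) x \<bullet> grad K (v K) x)
     - (\<Sum>e\<in>E. LINT x|arclength e. l x * (jump T e (\<lambda>K. H1_trace E K (v K) x) \<bullet> \<nu> e))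
     + (\<Sum>e\<in>E. LINT x|arclength e. m x * (jump T e (\<lambda>K. H1_trace E K (u K) x) \<bullet> \<nu> e))
     + \<alpha> * (\<Sum>K\<in>T. s K
         (\<lambda>\<phi>. stiffness K (u K) \<phi> - flux E \<nu> K l \<phi>)
         (\<lambda>\<phi>. t * stiffness K (v K) \<phi> - flux E \<nu> K m \<phi>)))"

end

theory Submission
  imports Defs
begin

text \<open>The test pair for \<open>(u, l)\<close> is built element by element. Subtracting from \<open>u\<close> on each \<open>K\<close> the
  number \<open>\<langle>\<gamma>\<^sub>K\<^sup>* l, 1\<rangle>\<close> produces the square of that number, since constants are in the kernel of
  \<open>\<D>\<^sub>K\<close>. Adding to \<open>l\<close> a small multiple of the edgewise constant function equal to the normal jump
  of the averages of \<open>u\<close> divided by \<open>H\<^sub>e\<close> produces the jump part of the norm. The stabilization produces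
  the dual seminorms of the fluxes \<open>\<gamma>\<^sub>K\<^sup>* l\<close>, and for small \<open>\<alpha>\<close> all mixed terms are absorbed. The only
  analytic input is that on an element the trace minus the average of \<open>\<phi>\<close> is bounded in \<open>L\<^sup>2\<close> of the whole
  boundary by \<open>sqrt (C h\<^sub>K)\<close> times the seminorm of \<open>\<phi>\<close>, with \<open>C\<close> depending on \<open>\<rho>\<close> only. As the
  estimate is on the whole boundary, neither the number nor the lengths of the edges enter.
  It is proved for smooth functions by integrating along the segments from points of the inscribed
  disc, and carried over to Sobolev functions by density; here star-shapedness gives approximation by
  functions smooth on the whole plane.\<close>

section \<open>Square integrable and smooth functions\<close>

text \<open>The norm sees the averages of \<open>u\<close> only through their jumps, so it gives no
  direct bound for products of an average with the flux of a constant. Hence continuity is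
  conditional, and the test pair has to treat averages and fluxes of constants separately. The
  weight \<open>h_e / H_e\<close> is made for this. Since \<open>h_K \<le> H_e\<close>, the edge
  function \<open>J / H_e\<close> costs at most \<open>(h_e / H_e) J^2\<close> on the edge after
  multiplication of its squared norm by \<open>h_K\<close>; and since the perimeter of
  \<open>K\<close> is at most a multiple of \<open>h_K\<close> (the trace estimate for the constant
  1), the weights around one element have a bounded sum. Tested with \<open>t\<close> times the
  stiffness functional, the stabilization may cost a multiple of the squared seminorm of
  \<open>u\<close>, whatever the sign of \<open>t\<close>; this is the origin of
  \<open>\<alpha>0\<close>. Shrinking \<open>K\<close> towards its disc by the factor
  \<open>1 - e\<close> leaves room for mollification inside \<open>K\<close>, which is why the
  approximation works up to the boundary. Finally, division by zero gives 0, so the norm must be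
  shown to be definite on discrete pairs before the infimum can be positive.\<close>

lemma square_integrableI:
  "f \<in> borel_measurable M \<Longrightarrow> integrable M (\<lambda>x. (norm (f x))\<^sup>2) \<Longrightarrow> square_integrable M f"
  by (simp add: square_integrable_def)

lemma square_integrable_measurable: "square_integrable M f \<Longrightarrow> f \<in> borel_measurable M"
  by (simp add: square_integrable_def)

lemma square_integrable_inner:
  assumes "square_integrable M f" "square_integrable M g"
  shows "integrable M (\<lambda>x. f x \<bullet> g x)"
proof (rule Bochner_Integration.integrable_bound)
  show "integrable M (\<lambda>x. (norm (f x))\<^sup>2 + (norm (g x))\<^sup>2)"
    using assms by (auto simp: square_integrable_def)
  show "(\<lambda>x. f x \<bullet> g x) \<in> borel_measurable M"
    using assms by (auto simp: square_integrable_def)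
  show "AE x in M. norm (f x \<bullet> g x) \<le> norm ((norm (f x))\<^sup>2 + (norm (g x))\<^sup>2)"
  proof (rule AE_I2)
    fix x
    have "\<bar>f x \<bullet> g x\<bar> \<le> norm (f x) * norm (g x)" by (rule Cauchy_Schwarz_ineq2)
    also have "\<dots> \<le> (norm (f x))\<^sup>2 + (norm (g x))\<^sup>2"
      using sum_squares_bound[of "norm (f x)" "norm (g x)"] 
        mult_nonneg_nonneg[OF norm_ge_zero[of "f x"] norm_ge_zero[of "g x"]] by linarith
    finally show "norm (f x \<bullet> g x) \<le> norm ((norm (f x))\<^sup>2 + (norm (g x))\<^sup>2)" by simp
  qed
qed

lemma square_integrable_mult:
  fixes f g :: "'a \<Rightarrow> real"
  shows "square_integrable M f \<Longrightarrow> square_integrable M g \<Longrightarrow> integrable M (\<lambda>x. f x * g x)"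
  using square_integrable_inner[of M f g] by simp

lemma square_integrable_power2:
  fixes f :: "'a \<Rightarrow> real"
  shows "square_integrable M f \<Longrightarrow> integrable M (\<lambda>x. (f x)\<^sup>2)"
  by (simp add: square_integrable_def)

lemma square_integrable_scaleR:
  assumes "square_integrable M f" shows "square_integrable M (\<lambda>x. c *\<^sub>R f x)"
  using assms by (auto simp: square_integrable_def power_mult_distrib)

lemma square_integrable_cmult:
  fixes f :: "'a \<Rightarrow> real"
  assumes "square_integrable M f" shows "square_integrable M (\<lambda>x. c * f x)"
  using square_integrable_scaleR[OF assms, of c] by simp

lemma square_integrable_add:
  assumes "square_integrable M f" "square_integrable M g"
  shows "square_integrable M (\<lambda>x. f x + g x)"
proof (rule square_integrableI)
  show "(\<lambda>x. f x + g x) \<in> borel_measurable M" using assms by (auto simp: square_integrable_def)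
  have "integrable M (\<lambda>x. (norm (f x))\<^sup>2 + 2 * (f x \<bullet> g x) + (norm (g x))\<^sup>2)"
    using assms square_integrable_inner[OF assms] by (auto simp: square_integrable_def)
  then show "integrable M (\<lambda>x. (norm (f x + g x))\<^sup>2)"
    by (simp add: power2_norm_eq_inner inner_add inner_commute algebra_simps)
qed

lemma square_integrable_minus:
  "square_integrable M f \<Longrightarrow> square_integrable M (\<lambda>x. - f x)"
  using square_integrable_scaleR[of M f "-1"] by simp

lemma square_integrable_diff:
  assumes "square_integrable M f" "square_integrable M g"
  shows "square_integrable M (\<lambda>x. f x - g x)"
  using square_integrable_add[OF assms(1) square_integrable_minus[OF assms(2)]] by simp

lemma square_integrable_const:
  "finite_measure M \<Longrightarrow> square_integrable M (\<lambda>x. c)"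
  by (simp add: square_integrable_def finite_measure.integrable_const)

lemma square_integrable_cong_AE:
  assumes "square_integrable M f" "g \<in> borel_measurable M" "AE x in M. f x = g x"
  shows "square_integrable M g"
proof (rule square_integrableI[OF assms(2)])
  have "integrable M (\<lambda>x. (norm (f x))\<^sup>2)" using assms by (simp add: square_integrable_def)
  then show "integrable M (\<lambda>x. (norm (g x))\<^sup>2)"
    by (rule integrable_cong_AE_imp) (use assms in auto)
qed

lemma L2_norm_nonneg [simp]: "0 \<le> L2_norm M f"
  by (simp add: L2_norm_def)

lemma L2_norm_power2: "(L2_norm M f)\<^sup>2 = (LINT x|M. (norm (f x))\<^sup>2)"
  by (simp add: L2_norm_def)

lemma L2_norm_cong_AE:
  assumes "f \<in> borel_measurable M" "g \<in> borel_measurable M" "AE x in M. f x = g x"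
  shows "L2_norm M f = L2_norm M g"
  unfolding L2_norm_def
  by (rule arg_cong[of _ _ sqrt], rule integral_cong_AE) (use assms in auto)

lemma L2_norm_scaleR: "L2_norm M (\<lambda>x. c *\<^sub>R f x) = \<bar>c\<bar> * L2_norm M f"
  by (simp add: L2_norm_def power_mult_distrib real_sqrt_mult)

lemma L2_norm_minus: "L2_norm M (\<lambda>x. - f x) = L2_norm M f"
  by (simp add: L2_norm_def)

lemma L2_norm_diff_commute: "L2_norm M (\<lambda>x. f x - g x) = L2_norm M (\<lambda>x. g x - f x)"
  by (simp add: L2_norm_def norm_minus_commute)

lemma L2_Cauchy_Schwarz:
  assumes f: "square_integrable M f" and g: "square_integrable M g"
  shows "\<bar>LINT x|M. f x \<bullet> g x\<bar> \<le> L2_norm M f * L2_norm M g"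
proof -
  define a b d where "a = (LINT x|M. (norm (f x))\<^sup>2)" and "b = (LINT x|M. (norm (g x))\<^sup>2)"
    and "d = (LINT x|M. f x \<bullet> g x)"
  have i: "integrable M (\<lambda>x. (norm (f x))\<^sup>2)" "integrable M (\<lambda>x. (norm (g x))\<^sup>2)"
    "integrable M (\<lambda>x. f x \<bullet> g x)"
    using f g square_integrable_inner[OF f g] by (auto simp: square_integrable_def)
  \<comment> \<open>The squared norm of \<open>s *\<^sub>R f + g\<close> as a quadratic polynomial
    in \<open>s\<close>; being nonnegative for all \<open>s\<close>, it has a discriminant of at
    most 0.\<close>
  have q: "0 \<le> s\<^sup>2 * a + 2 * s * d + b" for s
  proof -
    have "0 \<le> (LINT x|M. (norm (s *\<^sub>R f x + g x))\<^sup>2)" by simp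
    also have "\<dots> = (LINT x|M. s\<^sup>2 * (norm (f x))\<^sup>2 + (2 * s) * (f x \<bullet> g x) + (norm (g x))\<^sup>2)"
      by (intro Bochner_Integration.integral_cong refl, unfold power2_norm_eq_inner)
        (simp add: inner_add inner_commute algebra_simps power2_eq_square)
    also have "\<dots> = s\<^sup>2 * a + 2 * s * d + b" using i by (simp add: a_def b_def d_def)
    finally show ?thesis .
  qed
  have a0: "a \<ge> 0" and b0: "b \<ge> 0" by (auto simp: a_def b_def)
  have "d\<^sup>2 \<le> a * b"
  proof (cases "a = 0")
    case True
    have "d = 0"
    proof (rule ccontr)
      assume "d \<noteq> 0"
      \<comment> \<open>At this \<open>s\<close> the polynomial, which is affine because
        \<open>a = 0\<close>, takes the value -1.\<close>
      with q[of "- (b + 1) / (2 * d)"] True show False using b0 by (simp add: field_simps)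
    qed
    then show ?thesis using True by simp
  next
    case False
    have "0 \<le> a * ((- d / a)\<^sup>2 * a + 2 * (- d / a) * d + b)" using q a0 by (intro mult_nonneg_nonneg)
    also have "\<dots> = a * b - d\<^sup>2" using False by (simp add: field_simps power2_eq_square)
    finally show ?thesis by simp
  qed
  then have "\<bar>d\<bar> \<le> sqrt (a * b)" by (metis real_sqrt_abs real_sqrt_le_iff)
  then show ?thesis by (simp add: L2_norm_def a_def b_def d_def real_sqrt_mult)
qed

lemma L2_norm_triangle:
  assumes f: "square_integrable M f" and g: "square_integrable M g"
  shows "L2_norm M (\<lambda>x. f x + g x) \<le> L2_norm M f + L2_norm M g"
proof (rule power2_le_imp_le)
  have "(L2_norm M (\<lambda>x. f x + g x))\<^sup>2
      = (LINT x|M. (norm (f x))\<^sup>2 + 2 * (f x \<bullet> g x) + (norm (g x))\<^sup>2)"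
    unfolding L2_norm_power2
    by (rule Bochner_Integration.integral_cong)
       (auto simp: power2_norm_eq_inner inner_add inner_commute algebra_simps)
  also have "\<dots> = (L2_norm M f)\<^sup>2 + 2 * (LINT x|M. f x \<bullet> g x) + (L2_norm M g)\<^sup>2"
    using f g square_integrable_inner[OF f g] by (simp add: L2_norm_power2 square_integrable_def)
  also have "\<dots> \<le> (L2_norm M f + L2_norm M g)\<^sup>2"
    using L2_Cauchy_Schwarz[OF f g] by (simp add: power2_sum)
  finally show "(L2_norm M (\<lambda>x. f x + g x))\<^sup>2 \<le> (L2_norm M f + L2_norm M g)\<^sup>2" .
qed auto

lemma L2_norm_triangle_diff:
  assumes "square_integrable M f" "square_integrable M g"
  shows "L2_norm M f \<le> L2_norm M (\<lambda>x. f x - g x) + L2_norm M g"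
  using L2_norm_triangle[OF square_integrable_diff[OF assms] assms(2)] by simp

lemma L2_norm_eq_0_iff:
  assumes "square_integrable M f"
  shows "L2_norm M f = 0 \<longleftrightarrow> (AE x in M. f x = 0)"
proof -
  have "L2_norm M f = 0 \<longleftrightarrow> (LINT x|M. (norm (f x))\<^sup>2) = 0" by (simp add: L2_norm_def)
  also have "\<dots> \<longleftrightarrow> (AE x in M. (norm (f x))\<^sup>2 = 0)"
    using assms by (intro integral_nonneg_eq_0_iff_AE) (auto simp: square_integrable_def)
  finally show ?thesis by simp
qed

section \<open>Classical gradients and differentiability of every order\<close>

lemma GDERIV_unique:
  fixes f :: "point \<Rightarrow> real"
  assumes "GDERIV f x :> D" "GDERIV f x :> D'" shows "D = D'"
proof -
  have "(\<lambda>h. h \<bullet> D) = (\<lambda>h. h \<bullet> D')"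
    using assms unfolding gderiv_def by (rule has_derivative_unique)
  then show ?thesis by (metis inner_commute vector_eq_rdot)
qed

lemma GDERIV_continuous:
  fixes f :: "point \<Rightarrow> real"
  shows "(\<And>x. GDERIV f x :> g x) \<Longrightarrow> continuous_on S f"
  unfolding gderiv_def
  by (meson continuous_at_imp_continuous_on has_derivative_continuous)

text \<open>The classical gradient, as opposed to the weak gradient \<open>grad\<close>; for smooth
  functions the two agree almost everywhere (\<open>grad_smooth\<close>).\<close>

definition gradient :: "(point \<Rightarrow> real) \<Rightarrow> point \<Rightarrow> point" where
  "gradient f x = (SOME D. GDERIV f x :> D)"

lemma gradient_eq: "GDERIV f x :> D \<Longrightarrow> gradient f x = D"
  unfolding gradient_def by (metis GDERIV_unique someI)

lemma times_differentiable_cont: "times_differentiable n f \<Longrightarrow> continuous_on UNIV f"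
  by (cases n) (auto intro: GDERIV_continuous)

lemma times_differentiable_pred: "times_differentiable (Suc n) f \<Longrightarrow> times_differentiable n f"
proof (induction n arbitrary: f)
  case 0 then show ?case by (auto intro: GDERIV_continuous)
next
  case (Suc n)
  obtain g where g: "\<forall>x. GDERIV f x :> g x"
     and "\<forall>i. times_differentiable (Suc n) (\<lambda>x. g x $ i)"
    using Suc.prems[THEN times_differentiable.simps(2)[THEN iffD1]] by (elim exE conjE)
  then have "\<forall>i. times_differentiable n (\<lambda>x. g x $ i)" using Suc.IH by blast
  with g show ?case by (intro times_differentiable.simps(2)[THEN iffD2] exI[of _ g] conjI)
qed

text \<open>For every order the definition of smoothness provides a gradient field of its own;
  uniqueness of derivatives identifies them all.\<close>

lemma smooth_gradient:
  assumes "smooth f"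
  shows "GDERIV f x :> gradient f x" and "smooth (\<lambda>x. gradient f x $ i)"
proof -
  have "times_differentiable (Suc n) f" for n using assms by (simp add: smooth_def)
  then have *: "\<exists>g. (\<forall>x. GDERIV f x :> g x) \<and> (\<forall>i. times_differentiable n (\<lambda>x. g x $ i))" for n
    by simp
  from *[of 0] have g: "GDERIV f x :> gradient f x" for x by (metis gradient_eq)
  show "GDERIV f x :> gradient f x" by (rule g)
  have "times_differentiable n (\<lambda>x. gradient f x $ i)" for n
  proof -
    from *[of n] obtain g' where g': "\<forall>x. GDERIV f x :> g' x"
      "\<forall>i. times_differentiable n (\<lambda>x. g' x $ i)" by blast
    then have "g' = gradient f" using gradient_eq by (metis ext)
    then show ?thesis using g' by simp
  qed
  then show "smooth (\<lambda>x. gradient f x $ i)" by (simp add: smooth_def)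
qed

lemma smooth_continuous: "smooth f \<Longrightarrow> continuous_on S f"
  by (meson continuous_on_subset smooth_def subset_UNIV times_differentiable_cont)

lemma smooth_gradient_continuous: "smooth f \<Longrightarrow> continuous_on S (gradient f)"
  using continuous_on_vec_lambda[of S "\<lambda>i x. gradient f x $ i"] smooth_continuous[OF smooth_gradient(2)]
  by (simp add: vec_lambda_eta)

lemma times_differentiable_const: "times_differentiable n (\<lambda>x. c)"
proof (induction n arbitrary: c)
  case (Suc n)
  show ?case
    by (simp del: times_differentiable.simps(1), rule exI[of _ "\<lambda>x. 0"]) (simp add: GDERIV_const Suc)
qed simp

lemma GDERIV_nth: "GDERIV (\<lambda>x::point. x $ i) x :> axis i 1"
  unfolding gderiv_def by (rule has_derivative_eq_rhs[OF bounded_linear_imp_has_derivative[OF bounded_linear_vec_nth]]) 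
     (simp add: inner_axis)

lemma times_differentiable_nth: "times_differentiable n (\<lambda>x. x $ i)"
proof (cases n)
  case 0 then show ?thesis by (simp add: continuous_on_component)
next
  case (Suc m)
  show ?thesis unfolding Suc
    by (simp del: times_differentiable.simps(1), rule exI[of _ "\<lambda>x. axis i 1"]) 
      (simp add: GDERIV_nth times_differentiable_const)
qed

lemma times_differentiable_add:
  "times_differentiable n f \<Longrightarrow> times_differentiable n g \<Longrightarrow> times_differentiable n (\<lambda>x. f x + g x)"
proof (induction n arbitrary: f g)
  case 0 then show ?case by (auto intro: continuous_intros)
next
  case (Suc n)
  from Suc.prems obtain df dg where d: "\<forall>x. GDERIV f x :> df x"
     "\<forall>i. times_differentiable n (\<lambda>x. df x $ i)" "\<forall>x. GDERIV g x :> dg x"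
     "\<forall>i. times_differentiable n (\<lambda>x. dg x $ i)" by auto
  show ?case 
    unfolding times_differentiable.simps(2)
    by (rule exI[of _ "\<lambda>x. df x + dg x"]) (use d Suc.IH in \<open>auto intro: GDERIV_add\<close>)
qed

lemma times_differentiable_mult:
  "times_differentiable n f \<Longrightarrow> times_differentiable n g \<Longrightarrow> times_differentiable n (\<lambda>x. f x * g x)"
proof (induction n arbitrary: f g)
  case 0 then show ?case by (auto intro: continuous_intros)
next
  case (Suc n)
  from Suc.prems obtain df dg where d: "\<forall>x. GDERIV f x :> df x"
     "\<forall>i. times_differentiable n (\<lambda>x. df x $ i)" "\<forall>x. GDERIV g x :> dg x"
     "\<forall>i. times_differentiable n (\<lambda>x. dg x $ i)" by auto
  have fg: "times_differentiable n f" "times_differentiable n g"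
    using Suc.prems times_differentiable_pred by auto
  have *: "GDERIV (\<lambda>x. f x * g x) x :> f x *\<^sub>R dg x + g x *\<^sub>R df x" for x
    using d by (intro GDERIV_mult) auto
  show ?case 
    unfolding times_differentiable.simps(2)
    by (rule exI[of _ "\<lambda>x. f x *\<^sub>R dg x + g x *\<^sub>R df x"]) 
       (use d * fg Suc.IH in \<open>auto intro!: times_differentiable_add\<close>)
qed

lemma smooth_const: "smooth (\<lambda>x. c)" by (simp add: smooth_def times_differentiable_const)
lemma smooth_nth: "smooth (\<lambda>x. x $ i)" by (simp add: smooth_def times_differentiable_nth)
lemma smooth_add: "smooth f \<Longrightarrow> smooth g \<Longrightarrow> smooth (\<lambda>x. f x + g x)"
  by (simp add: smooth_def times_differentiable_add)
lemma smooth_mult: "smooth f \<Longrightarrow> smooth g \<Longrightarrow> smooth (\<lambda>x. f x * g x)"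
  by (simp add: smooth_def times_differentiable_mult)
lemma smooth_cmult: "smooth f \<Longrightarrow> smooth (\<lambda>x. c * f x)"
  by (intro smooth_mult smooth_const)
lemma smooth_diff: assumes "smooth f" "smooth g" shows "smooth (\<lambda>x. f x - g x)"
  using smooth_add[OF assms(1) smooth_cmult[OF assms(2), of "-1"]] by simp
lemma smooth_sum: "(\<And>i. i \<in> I \<Longrightarrow> smooth (f i)) \<Longrightarrow> smooth (\<lambda>x. \<Sum>i\<in>I. f i x)"
  by (induction I rule: infinite_finite_induct) (auto intro: smooth_const smooth_add)
lemma smooth_power: "smooth f \<Longrightarrow> smooth (\<lambda>x. f x ^ n)"
  by (induction n) (auto intro: smooth_const smooth_mult)

text \<open>Induction on the order for all members at once, as differentiation does not leave the
  family. Proofs of smoothness below only exhibit a family closed under partial derivatives and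
  never need formulas for higher ones.\<close>

lemma smoothI_family:
  assumes "f \<in> F" and "\<And>f. f \<in> F \<Longrightarrow> \<exists>g. (\<forall>x. GDERIV f x :> g x) \<and> (\<forall>i. (\<lambda>x. g x $ i) \<in> F)"
  shows "smooth f"
proof -
  have "\<forall>f\<in>F. times_differentiable n f" for n
  proof (induction n)
    case 0 show ?case
    proof
      fix f assume "f \<in> F"
      from assms(2)[OF this] obtain g where "\<forall>x. GDERIV f x :> g x" by blast
      then show "times_differentiable 0 f" by (auto intro: GDERIV_continuous)
    qed
  next
    case (Suc n) then show ?case using assms(2) by fastforce
  qed
  then show ?thesis using assms(1) by (auto simp: smooth_def)
qed

lemma smooth_affine:
  assumes "smooth f" shows "smooth (\<lambda>x. f (a *\<^sub>R x + b))"
\<comment> \<open>The factor \<open>d\<close> collects the powers of \<open>a\<close> that the chain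
  rule produces.\<close>
proof (rule smoothI_family[where F = "{\<lambda>x. d * f (a *\<^sub>R x + b) |f d. smooth f}"])
  show "(\<lambda>x. f (a *\<^sub>R x + b)) \<in> {\<lambda>x. d * f (a *\<^sub>R x + b) |f d. smooth f}"
    using assms by (auto intro!: exI[of _ f] exI[of _ 1])
next
  fix h assume "h \<in> {\<lambda>x. d * f (a *\<^sub>R x + b) |f d. smooth f}"
  then obtain f d where f: "smooth f" and h: "h = (\<lambda>x. d * f (a *\<^sub>R x + b))" by auto
  have "GDERIV h x :> (d * a) *\<^sub>R gradient f (a *\<^sub>R x + b)" for x
  proof -
    have "((\<lambda>x. a *\<^sub>R x + b) has_derivative (\<lambda>h. a *\<^sub>R h)) (at x)"
      by (auto intro!: derivative_eq_intros)
    from has_derivative_compose[OF this smooth_gradient(1)[OF f, unfolded gderiv_def]]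
    have "((\<lambda>x. d * f (a *\<^sub>R x + b)) has_derivative
        (\<lambda>h. d * (a *\<^sub>R h \<bullet> gradient f (a *\<^sub>R x + b)))) (at x)"
      by (rule has_derivative_mult_right)
    then show ?thesis by (simp add: h gderiv_def mult.assoc)
  qed
  moreover have "(\<lambda>x. ((d * a) *\<^sub>R gradient f (a *\<^sub>R x + b)) $ i)
      \<in> {\<lambda>x. d * f (a *\<^sub>R x + b) |f d. smooth f}" for i
    using smooth_gradient(2)[OF f, of i]
    by (auto intro!: exI[of _ "\<lambda>x. gradient f x $ i"] exI[of _ "d * a"])
  ultimately show "\<exists>g. (\<forall>x. GDERIV h x :> g x) \<and>
      (\<forall>i. (\<lambda>x. g x $ i) \<in> {\<lambda>x. d * f (a *\<^sub>R x + b) |f d. smooth f})"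
    by (intro exI[of _ "\<lambda>x. (d * a) *\<^sub>R gradient f (a *\<^sub>R x + b)"]) auto
qed

text \<open>For polynomials \<open>p\<close> these functions form a class closed under differentiation, hence all of
  them are smooth.\<close>

definition flat :: "real poly \<Rightarrow> real \<Rightarrow> real" where
  "flat p x = (if x > 0 then poly p (1 / x) * exp (- (1 / x)) else 0)"

lemma poly_exp_tendsto_0: "((\<lambda>y::real. poly p y * exp (- y)) \<longlongrightarrow> 0) at_top"
proof -
  have "((\<lambda>y::real. \<Sum>i\<le>degree p. coeff p i * (y ^ i / exp y)) \<longlongrightarrow> 0) at_top"
    by (rule tendsto_eq_intros tendsto_null_sum tendsto_mult_right_zero tendsto_power_div_exp_0)+
  then show ?thesis
    by (simp add: poly_altdef sum_distrib_right exp_minus divide_inverse mult.assoc)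
qed

text \<open>With y = 1/x the derivative of p(y) exp(-y) is y^2 (p(y) - p'(y)) exp(-y), because dy/dx
  = -y^2. At 0 only the right limit of the difference quotient needs work; there the exponential
  decay beats every polynomial in 1/x.\<close>

lemma flat_has_derivative: "DERIV (flat p) x :> flat ([:0, 0, 1:] * (p - pderiv p)) x"
proof -
  consider "x > 0" | "x < 0" | "x = 0" by linarith
  then show ?thesis
  proof cases
    case 1
    have "DERIV (\<lambda>x. poly p (1 / x) * exp (- (1 / x))) x :>
        flat ([:0, 0, 1:] * (p - pderiv p)) x"
      using 1 by (auto intro!: derivative_eq_intros simp: flat_def field_simps power2_eq_square)
    moreover have "\<forall>\<^sub>F y in nhds x. flat p y = poly p (1 / y) * exp (- (1 / y))"
      using eventually_nhds_in_open[of "{0<..}" x] 1 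
      by (auto elim!: eventually_mono simp: flat_def)
    ultimately show ?thesis
      using DERIV_cong_ev[of x x "flat p" "\<lambda>y. poly p (1 / y) * exp (- (1 / y))"] by blast
  next
    case 2
    have "\<forall>\<^sub>F y in nhds x. flat p y = 0"
      using eventually_nhds_in_open[of "{..<0}" x] 2
      by (auto elim!: eventually_mono simp: flat_def)
    then show ?thesis using DERIV_cong_ev[of x x "flat p" "\<lambda>_. 0" _ 0] 2 by (auto simp: flat_def)
  next
    case 3
    have "((\<lambda>h. flat p h / h) \<longlongrightarrow> 0) (at_right 0)"
    proof -
      \<comment> \<open>Division by \<open>h\<close> multiplies the polynomial in
        \<open>1 / h\<close> by its variable, so the quotient is of the same kind.\<close>
      have "((\<lambda>h::real. poly (pCons 0 p) (1 / h) * exp (- (1 / h))) \<longlongrightarrow> 0) (at_right 0)"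
        by (rule filterlim_compose[OF poly_exp_tendsto_0])
           (simp add: filterlim_inverse_at_top_right inverse_eq_divide[symmetric])
      then show ?thesis
        by (rule Lim_transform_eventually)
           (auto simp: eventually_at_right_less flat_def eventually_at_filter)
    qed
    moreover have "((\<lambda>h. flat p h / h) \<longlongrightarrow> 0) (at_left 0)"
      by (rule Lim_transform_eventually[of "\<lambda>_. 0"]) (auto simp: flat_def eventually_at_filter)
    ultimately have "((\<lambda>h. flat p h / h) \<longlongrightarrow> 0) (at 0)" by (simp add: filterlim_split_at)
    then show ?thesis using 3 by (simp add: DERIV_def flat_def)
  qed
qed

lemma smooth_flat: "smooth (\<lambda>x. flat p (a * x $ i + b))"
proof (rule smoothI_family[where F = "{\<lambda>x. d * flat p (a * x $ i + b) |p d. True}"])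
  show "(\<lambda>x. flat p (a * x $ i + b)) \<in> {\<lambda>x. d * flat p (a * x $ i + b) |p d. True}"
    by (intro CollectI exI[of _ p] exI[of _ 1]) simp
next
  fix h assume "h \<in> {\<lambda>x. d * flat p (a * x $ i + b) |p d. True}"
  then obtain p d where h: "h = (\<lambda>x. d * flat p (a * x $ i + b))" by auto
  let ?p = "[:0, 0, 1:] * (p - pderiv p)"
  have *: "DERIV (\<lambda>y. d * flat p (a * y + b)) y :> d * (flat ?p (a * y + b) * a)" for y
    by (rule DERIV_cmult, rule DERIV_chain2[OF flat_has_derivative])
       (auto intro!: derivative_eq_intros)
  have "GDERIV h x :> (d * (flat ?p (a * x $ i + b) * a)) *\<^sub>R axis i 1" for x
    unfolding h by (rule GDERIV_DERIV_compose[OF GDERIV_nth *])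
  moreover have "(\<lambda>x. ((d * (flat ?p (a * x $ i + b) * a)) *\<^sub>R axis i 1) $ j)
      \<in> {\<lambda>x. d * flat p (a * x $ i + b) |p d. True}" for j
    by (auto intro!: exI[of _ ?p] exI[of _ "d * a * axis i 1 $ j"] simp del: mult_pCons_left)
  ultimately show "\<exists>g. (\<forall>x. GDERIV h x :> g x) \<and>
      (\<forall>j. (\<lambda>x. g x $ j) \<in> {\<lambda>x. d * flat p (a * x $ i + b) |p d. True})"
    by (intro exI[of _ "\<lambda>x. (d * (flat ?p (a * x $ i + b) * a)) *\<^sub>R axis i 1"]) simp
qed

text \<open>\<open>flat 1\<close> is exp(-1/x) continued by 0 to the left, so each factor vanishes
  beyond one side of the box.\<close>

definition box_bump :: "point \<Rightarrow> point \<Rightarrow> point \<Rightarrow> real" where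
  "box_bump a b x = flat 1 (x $ 1 - a $ 1) * flat 1 (b $ 1 - x $ 1)
    * (flat 1 (x $ 2 - a $ 2) * flat 1 (b $ 2 - x $ 2))"

lemma smooth_box_bump: "smooth (box_bump a b)"
proof -
  have "smooth (\<lambda>x. flat 1 (1 * x $ 1 + - a $ 1) * flat 1 (-1 * x $ 1 + b $ 1)
    * (flat 1 (1 * x $ 2 + - a $ 2) * flat 1 (-1 * x $ 2 + b $ 2)))"
    by (intro smooth_mult smooth_flat)
  then show ?thesis by (simp add: box_bump_def[abs_def])
qed

lemma mem_box_2: "x \<in> box a b \<longleftrightarrow> a $ 1 < x $ 1 \<and> x $ 1 < b $ 1 \<and> a $ 2 < x $ 2 \<and> x $ 2 < b $ 2"
  for x :: point
  by (auto simp: mem_box_cart forall_2)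

lemma box_bump_nonneg: "box_bump a b x \<ge> 0"
  by (simp add: box_bump_def flat_def)

lemma box_bump_pos_iff: "box_bump a b x > 0 \<longleftrightarrow> x \<in> box a b"
  by (auto simp: box_bump_def flat_def mem_box_2)

lemma box_bump_eq_0_iff: "box_bump a b x = 0 \<longleftrightarrow> x \<notin> box a b"
  by (metis box_bump_nonneg box_bump_pos_iff less_eq_real_def less_irrefl)

section \<open>Uniform bounds for smooth functions with bounded support\<close>

lemma continuous_bounded_support:
  fixes f :: "point \<Rightarrow> 'b::real_normed_vector"
  assumes "continuous_on UNIV f" "bounded {x. f x \<noteq> 0}"
  obtains B where "B \<ge> 0" "\<And>x. norm (f x) \<le> B"
proof -
  have "compact (closure {x. f x \<noteq> 0})" using assms(2) by simp
  then have "bounded (f ` closure {x. f x \<noteq> 0})"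
    by (intro compact_imp_bounded compact_continuous_image continuous_on_subset[OF assms(1)]) auto
  then obtain B where B: "\<And>x. x \<in> closure {x. f x \<noteq> 0} \<Longrightarrow> norm (f x) \<le> B"
    by (auto simp: bounded_iff)
  have "norm (f x) \<le> max B 0" for x
    using B[of x] closure_subset[of "{x. f x \<noteq> 0}"] by (cases "f x = 0") auto
  then show ?thesis using that[of "max B 0"] by auto
qed

lemma gradient_support:
  assumes "smooth \<psi>" shows "{x. gradient \<psi> x \<noteq> 0} \<subseteq> closure {x. \<psi> x \<noteq> 0}"
proof
  fix x assume x: "x \<in> {x. gradient \<psi> x \<noteq> 0}"
  show "x \<in> closure {x. \<psi> x \<noteq> 0}"
  proof (rule ccontr)
    assume n: "x \<notin> closure {x. \<psi> x \<noteq> 0}"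
    have "((\<lambda>x. 0) has_derivative (\<lambda>h. 0)) (at x)" by simp
    then have "(\<psi> has_derivative (\<lambda>h. 0)) (at x)"
      by (rule has_derivative_transform_within_open[where s = "- closure {x. \<psi> x \<noteq> 0}"])
         (use n closure_subset[of "{x. \<psi> x \<noteq> 0}"] in auto)
    then have "GDERIV \<psi> x :> 0" by (simp add: gderiv_def)
    then show False using x gradient_eq by auto
  qed
qed

lemma gradient_bounded_support:
  assumes "smooth \<psi>" "bounded {x. \<psi> x \<noteq> 0}"
  shows "bounded {x. gradient \<psi> x \<noteq> 0}" "bounded {x. gradient \<psi> x $ i \<noteq> 0}"
proof -
  show *: "bounded {x. gradient \<psi> x \<noteq> 0}"
    using bounded_subset[OF bounded_closure[OF assms(2)] gradient_support[OF assms(1)]] .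
  show "bounded {x. gradient \<psi> x $ i \<noteq> 0}" by (rule bounded_subset[OF *]) auto
qed

lemma smooth_has_derivative:
  "smooth f \<Longrightarrow> (f has_derivative (\<lambda>h. h \<bullet> gradient f x)) (at x within S)"
  using smooth_gradient(1)[unfolded gderiv_def] has_derivative_at_withinI by blast

lemma onorm_inner_le: "onorm (\<lambda>h. h \<bullet> (g::point)) \<le> norm g"
  by (rule onorm_bound) (auto simp: Cauchy_Schwarz_ineq2 mult.commute[of "norm g"])

lemma smooth_Lipschitz:
  assumes "smooth \<psi>" "bounded {x. \<psi> x \<noteq> 0}"
  obtains L where "L \<ge> 0" "\<And>x y. \<bar>\<psi> x - \<psi> y\<bar> \<le> L * norm (x - y)"
proof -
  obtain B where B: "B \<ge> 0" "\<And>x. norm (gradient \<psi> x) \<le> B"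
    using continuous_bounded_support[OF smooth_gradient_continuous[OF assms(1)]
        gradient_bounded_support(1)[OF assms]] by blast
  have "norm (\<psi> x - \<psi> y) \<le> B * norm (x - y)" for x y
    by (rule differentiable_bound[OF convex_UNIV smooth_has_derivative[OF assms(1)]])
       (use order_trans[OF onorm_inner_le B(2)] in auto)
  then show ?thesis using that[of B] B(1) by auto
qed

lemma gradient_Lipschitz:
  assumes "smooth \<psi>" "bounded {x. \<psi> x \<noteq> 0}"
  obtains L where "L \<ge> 0" "\<And>x y. norm (gradient \<psi> x - gradient \<psi> y) \<le> L * norm (x - y)"
proof -
  have "\<exists>L\<ge>0. \<forall>x y. \<bar>gradient \<psi> x $ i - gradient \<psi> y $ i\<bar> \<le> L * norm (x - y)" for i
    using smooth_Lipschitz[OF smooth_gradient(2)[OF assms(1)] gradient_bounded_support(2)[OF assms]]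
    by metis
  then obtain L where L: "\<And>i. L i \<ge> 0"
    "\<And>i x y. \<bar>gradient \<psi> x $ i - gradient \<psi> y $ i\<bar> \<le> L i * norm (x - y)" by metis
  have "norm (gradient \<psi> x - gradient \<psi> y) \<le> (\<Sum>i\<in>UNIV. L i) * norm (x - y)" for x y
  proof -
    have "norm (gradient \<psi> x - gradient \<psi> y) \<le> (\<Sum>i\<in>UNIV. \<bar>(gradient \<psi> x - gradient \<psi> y) $ i\<bar>)"
      by (rule norm_le_l1_cart)
    also have "\<dots> \<le> (\<Sum>i\<in>UNIV. L i * norm (x - y))" using L(2) by (intro sum_mono) simp
    finally show ?thesis by (simp add: sum_distrib_right)
  qed
  then show ?thesis using that[of "\<Sum>i\<in>UNIV. L i"] L(1) by (simp add: sum_nonneg)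
qed

text \<open>Linearization with a Lipschitz gradient. The constant is uniform in the base point, so
  the estimate can be integrated against a weight and yields differentiation under the integral sign
  directly.\<close>

lemma smooth_taylor_bound:
  assumes "smooth \<psi>" "bounded {x. \<psi> x \<noteq> 0}"
  obtains C where "C \<ge> 0" "\<And>x y. \<bar>\<psi> y - \<psi> x - (y - x) \<bullet> gradient \<psi> x\<bar> \<le> C * (norm (y - x))\<^sup>2"
proof -
  obtain L where L: "L \<ge> 0" "\<And>x y. norm (gradient \<psi> x - gradient \<psi> y) \<le> L * norm (x - y)"
    using gradient_Lipschitz[OF assms] by blast
  have "norm (\<psi> y - \<psi> x - (y - x) \<bullet> gradient \<psi> x) \<le> norm (y - x) * (L * norm (y - x))" for x y
  proof (rule differentiable_bound_linearization[where S = "closed_segment x y"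
        and f' = "\<lambda>z h. h \<bullet> gradient \<psi> z" and ?x0.0 = x])
    show "x + t *\<^sub>R (y - x) \<in> closed_segment x y" if "t \<in> {0..1}" for t
      using that by (auto simp: in_segment algebra_simps)
    show "(\<psi> has_derivative (\<lambda>h. h \<bullet> gradient \<psi> z)) (at z within closed_segment x y)" for z
      by (rule smooth_has_derivative[OF assms(1)])
    show "x \<in> closed_segment x y" by simp
    fix z assume z: "z \<in> closed_segment x y"
    have "(\<lambda>h. h \<bullet> gradient \<psi> z - h \<bullet> gradient \<psi> x) = (\<lambda>h. h \<bullet> (gradient \<psi> z - gradient \<psi> x))"
      by (simp add: inner_diff_right)
    then have "onorm ((\<lambda>h. h \<bullet> gradient \<psi> z) - (\<lambda>h. h \<bullet> gradient \<psi> x)) \<le> norm (gradient \<psi> z - gradient \<psi> x)"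
      using onorm_inner_le[of "gradient \<psi> z - gradient \<psi> x"] by (simp add: fun_diff_def)
    also have "\<dots> \<le> L * norm (z - x)" by (rule L)
    also have "\<dots> \<le> L * norm (y - x)"
      using z L(1) segment_bound1[OF z] by (intro mult_left_mono) (auto simp: norm_minus_commute)
    finally show "onorm ((\<lambda>h. h \<bullet> gradient \<psi> z) - (\<lambda>h. h \<bullet> gradient \<psi> x)) \<le> L * norm (y - x)" .
  qed
  then show ?thesis using that[of L] L(1) by (auto simp: power2_eq_square mult_ac)
qed

section \<open>Convolution and weak gradients\<close>

lemma integrable_mult_bounded:
  fixes w :: "'a \<Rightarrow> real" and f :: "'a \<Rightarrow> 'b::{banach, second_countable_topology}"
  assumes "integrable M w" "f \<in> borel_measurable M" "\<And>x. norm (f x) \<le> B"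
  shows "integrable M (\<lambda>x. w x *\<^sub>R f x)"
proof (rule Bochner_Integration.integrable_bound)
  show "integrable M (\<lambda>x. B * w x)" using assms by simp
  show "(\<lambda>x. w x *\<^sub>R f x) \<in> borel_measurable M" using assms by auto
  show "AE x in M. norm (w x *\<^sub>R f x) \<le> norm (B * w x)"
  proof (rule AE_I2)
    fix x show "norm (w x *\<^sub>R f x) \<le> norm (B * w x)"
      using mult_left_mono[OF order_trans[OF assms(3)[of x] abs_ge_self], of "\<bar>w x\<bar>"]
      by (simp add: abs_mult mult.commute)
  qed
qed

lemma measurable_continuous_compose:
  fixes f :: "point \<Rightarrow> 'b::topological_space"
  assumes "(\<lambda>z. z) \<in> borel_measurable M" "continuous_on UNIV f"
  shows "(\<lambda>z. f (a *\<^sub>R z + b)) \<in> borel_measurable M"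
proof -
  have "continuous_on UNIV (\<lambda>z. f (a *\<^sub>R z + b))"
    by (rule continuous_on_compose2[OF assms(2)]) (auto intro!: continuous_intros)
  then have "(\<lambda>z. f (a *\<^sub>R z + b)) \<in> borel_measurable borel" by (rule borel_measurable_continuous_onI)
  from measurable_compose[OF assms(1) this] show ?thesis .
qed

text \<open>The second order remainder of \<open>\<psi>\<close> is bounded uniformly, so its
  integral against \<open>w\<close> is still of second order. The factor \<open>s\<close> covers two
  uses: \<open>1 - e\<close> for averages and -1 for translations.\<close>

lemma GDERIV_convolution:
  fixes w :: "point \<Rightarrow> real"
  assumes M: "(\<lambda>z. z) \<in> borel_measurable M" and w: "integrable M w"
    and \<psi>: "smooth \<psi>" "bounded {x. \<psi> x \<noteq> 0}"
  shows "GDERIV (\<lambda>x. LINT z|M. w z * \<psi> (z - s *\<^sub>R x)) x :>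
     (- s) *\<^sub>R (LINT z|M. w z *\<^sub>R gradient \<psi> (z - s *\<^sub>R x))"
proof -
  let ?F = "\<lambda>x. LINT z|M. w z * \<psi> (z - s *\<^sub>R x)"
  obtain C where C: "C \<ge> 0" "\<And>x y. \<bar>\<psi> y - \<psi> x - (y - x) \<bullet> gradient \<psi> x\<bar> \<le> C * (norm (y - x))\<^sup>2"
    using smooth_taylor_bound[OF \<psi>] by blast
  obtain B where B: "\<And>x. norm (\<psi> x) \<le> B"
    using continuous_bounded_support[OF smooth_continuous[OF \<psi>(1)] \<psi>(2)] by blast
  obtain B' where B': "\<And>x. norm (gradient \<psi> x) \<le> B'"
    using continuous_bounded_support[OF smooth_gradient_continuous[OF \<psi>(1)]
        gradient_bounded_support(1)[OF \<psi>]] by blast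
  have i1: "integrable M (\<lambda>z. w z * \<psi> (z - s *\<^sub>R x))" for x
    using integrable_mult_bounded[OF w _ B, of "\<lambda>z. z - s *\<^sub>R x"]
      measurable_continuous_compose[OF M smooth_continuous[OF \<psi>(1)], of 1 "- s *\<^sub>R x"] by simp
  have i2: "integrable M (\<lambda>z. w z *\<^sub>R gradient \<psi> (z - s *\<^sub>R x))" for x
    using integrable_mult_bounded[OF w _ B', of "\<lambda>z. z - s *\<^sub>R x"]
      measurable_continuous_compose[OF M smooth_gradient_continuous[OF \<psi>(1)], of 1 "- s *\<^sub>R x"] by simp
  let ?D = "(- s) *\<^sub>R (LINT z|M. w z *\<^sub>R gradient \<psi> (z - s *\<^sub>R x))"
  have bound: "norm (?F y - ?F x - (y - x) \<bullet> ?D) \<le> (LINT z|M. \<bar>w z\<bar>) * C * s\<^sup>2 * (norm (y - x))\<^sup>2" for y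
  proof -
    let ?R = "\<lambda>z. \<psi> (z - s *\<^sub>R y) - \<psi> (z - s *\<^sub>R x)
        - ((z - s *\<^sub>R y) - (z - s *\<^sub>R x)) \<bullet> gradient \<psi> (z - s *\<^sub>R x)"
    have "(y - x) \<bullet> ?D = (LINT z|M. (- s * w z) * ((y - x) \<bullet> gradient \<psi> (z - s *\<^sub>R x)))"
    proof -
      have "(y - x) \<bullet> ?D = (LINT z|M. ((- s) *\<^sub>R (y - x)) \<bullet> (w z *\<^sub>R gradient \<psi> (z - s *\<^sub>R x)))"
        using integral_inner_right[OF i2, of "(- s) *\<^sub>R (y - x)" x] by simp
      also have "\<dots> = (LINT z|M. (- s * w z) * ((y - x) \<bullet> gradient \<psi> (z - s *\<^sub>R x)))"
        by (intro Bochner_Integration.integral_cong) auto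
      finally show ?thesis .
    qed
    moreover have i3: "integrable M (\<lambda>z. (- s * w z) * ((y - x) \<bullet> gradient \<psi> (z - s *\<^sub>R x)))"
      using integrable_inner_right[OF i2, of "(- s) *\<^sub>R (y - x)" x] by (simp add: mult_ac)
    moreover have eq: "w z * ?R z
        = w z * \<psi> (z - s *\<^sub>R y) - w z * \<psi> (z - s *\<^sub>R x)
        - (- s * w z) * ((y - x) \<bullet> gradient \<psi> (z - s *\<^sub>R x))" for z
      by (simp add: algebra_simps inner_diff_left)
    ultimately have h1: "?F y - ?F x - (y - x) \<bullet> ?D = (LINT z|M. w z * ?R z)"
      unfolding eq using i1 by simp
    have h2: "norm (LINT z|M. w z * ?R z) \<le> (LINT z|M. \<bar>w z\<bar> * (C * s\<^sup>2 * (norm (y - x))\<^sup>2))"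
    proof (rule Bochner_Integration.integral_norm_bound_integral)
      show "integrable M (\<lambda>z. w z * ?R z)"
        unfolding eq by (intro Bochner_Integration.integrable_diff i1 i3)
      show "integrable M (\<lambda>z. \<bar>w z\<bar> * (C * s\<^sup>2 * (norm (y - x))\<^sup>2))" using w by simp
      fix z assume "z \<in> space M"
      have "(z - s *\<^sub>R y) - (z - s *\<^sub>R x) = (- s) *\<^sub>R (y - x)" by (simp add: algebra_simps)
      then have "norm ((z - s *\<^sub>R y) - (z - s *\<^sub>R x)) = \<bar>s\<bar> * norm (y - x)"
        by (metis abs_minus_cancel norm_scaleR)
      then have "\<bar>?R z\<bar> \<le> C * s\<^sup>2 * (norm (y - x))\<^sup>2"
        using C(2)[of "z - s *\<^sub>R y" "z - s *\<^sub>R x"] by (simp add: power_mult_distrib mult_ac)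
      then show "norm (w z * ?R z) \<le> \<bar>w z\<bar> * (C * s\<^sup>2 * (norm (y - x))\<^sup>2)"
        unfolding real_norm_def abs_mult by (rule mult_left_mono) simp
    qed
    show ?thesis unfolding h1 using h2 by simp
  qed
  show ?thesis
    unfolding gderiv_def
  proof (rule has_derivativeI_sandwich[where e = 1 and H = "\<lambda>y. (LINT z|M. \<bar>w z\<bar>) * C * s\<^sup>2 * norm (y - x)"])
    show "bounded_linear (\<lambda>h. h \<bullet> ?D)" by (rule bounded_linear_inner_left)
    show "((\<lambda>y. (LINT z|M. \<bar>w z\<bar>) * C * s\<^sup>2 * norm (y - x)) \<longlongrightarrow> 0) (at x)"
      by (auto intro!: tendsto_eq_intros)
    fix y :: point assume "y \<noteq> x"
    then show "norm (?F y - ?F x - (y - x) \<bullet> ?D) / norm (y - x) \<le> (LINT z|M. \<bar>w z\<bar>) * C * s\<^sup>2 * norm (y - x)"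
      using bound[of y] by (simp add: divide_le_eq power2_eq_square mult.assoc)
  qed simp
qed

lemma smooth_convolution:
  assumes M: "(\<lambda>z. z) \<in> borel_measurable M" and w: "integrable M w"
    and \<psi>: "smooth \<psi>" "bounded {x. \<psi> x \<noteq> 0}"
  shows "smooth (\<lambda>x. LINT z|M. w z * \<psi> (z - s *\<^sub>R x))"
\<comment> \<open>A partial derivative of a member is the same integral with a multiple of a partial
  derivative of \<open>\<psi>\<close>, which is again smooth with bounded support.\<close>
proof (rule smoothI_family[where F = "{\<lambda>x. LINT z|M. w z * \<psi> (z - s *\<^sub>R x) |\<psi>.
      smooth \<psi> \<and> bounded {x. \<psi> x \<noteq> 0}}"])
  show "(\<lambda>x. LINT z|M. w z * \<psi> (z - s *\<^sub>R x)) \<in> {\<lambda>x. LINT z|M. w z * \<psi> (z - s *\<^sub>R x) |\<psi>.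
      smooth \<psi> \<and> bounded {x. \<psi> x \<noteq> 0}}" using \<psi> by blast
next
  fix f assume "f \<in> {\<lambda>x. LINT z|M. w z * \<psi> (z - s *\<^sub>R x) |\<psi>. smooth \<psi> \<and> bounded {x. \<psi> x \<noteq> 0}}"
  then obtain \<psi> where \<psi>: "smooth \<psi>" "bounded {x. \<psi> x \<noteq> 0}"
    and f: "f = (\<lambda>x. LINT z|M. w z * \<psi> (z - s *\<^sub>R x))" by auto
  obtain B' where B': "\<And>x. norm (gradient \<psi> x) \<le> B'"
    using continuous_bounded_support[OF smooth_gradient_continuous[OF \<psi>(1)]
        gradient_bounded_support(1)[OF \<psi>]] by blast
  have i2: "integrable M (\<lambda>z. w z *\<^sub>R gradient \<psi> (z - s *\<^sub>R x))" for x
    using integrable_mult_bounded[OF w _ B', of "\<lambda>z. z - s *\<^sub>R x"]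
      measurable_continuous_compose[OF M smooth_gradient_continuous[OF \<psi>(1)], of 1 "- s *\<^sub>R x"] by simp
  let ?g = "\<lambda>x. (- s) *\<^sub>R (LINT z|M. w z *\<^sub>R gradient \<psi> (z - s *\<^sub>R x))"
  have "(\<lambda>x. ?g x $ i) = (\<lambda>x. LINT z|M. w z * (- s * gradient \<psi> (z - s *\<^sub>R x) $ i))" for i
  proof
    fix x
    have "(LINT z|M. w z *\<^sub>R gradient \<psi> (z - s *\<^sub>R x)) $ i = (LINT z|M. (w z *\<^sub>R gradient \<psi> (z - s *\<^sub>R x)) $ i)"
      using integral_bounded_linear[OF bounded_linear_vec_nth i2] by simp
    then show "?g x $ i = (LINT z|M. w z * (- s * gradient \<psi> (z - s *\<^sub>R x) $ i))"
      by (simp add: mult.left_commute[of _ s])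
  qed
  moreover have "smooth (\<lambda>x. - s * gradient \<psi> x $ i)" "bounded {x. - s * gradient \<psi> x $ i \<noteq> 0}" for i
    by (rule smooth_cmult[OF smooth_gradient(2)[OF \<psi>(1)]])
       (rule bounded_subset[OF gradient_bounded_support(2)[OF \<psi>, of i]], auto)
  ultimately have "\<forall>i. (\<lambda>x. ?g x $ i) \<in> {\<lambda>x. LINT z|M. w z * \<psi> (z - s *\<^sub>R x) |\<psi>.
      smooth \<psi> \<and> bounded {x. \<psi> x \<noteq> 0}}"
    by (intro allI CollectI) (rule exI, intro conjI, assumption+)
  then show "\<exists>g. (\<forall>x. GDERIV f x :> g x) \<and> (\<forall>i. (\<lambda>x. g x $ i) \<in>
     {\<lambda>x. LINT z|M. w z * \<psi> (z - s *\<^sub>R x) |\<psi>. smooth \<psi> \<and> bounded {x. \<psi> x \<noteq> 0}})"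
    unfolding f using GDERIV_convolution[OF M w \<psi>] by (intro exI[of _ ?g]) blast
qed

lemma integrable_continuous_bounded_support:
  fixes f :: "point \<Rightarrow> 'b::{banach, second_countable_topology}"
  assumes "continuous_on UNIV f" "bounded {x. f x \<noteq> 0}"
  shows "integrable lborel f"
proof -
  have "compact (closure {x. f x \<noteq> 0})" using assms(2) by simp
  then have "integrable lborel (\<lambda>x. indicator (closure {x. f x \<noteq> 0}) x *\<^sub>R f x)"
    by (rule borel_integrable_compact) (rule continuous_on_subset[OF assms(1)], simp)
  moreover have "(\<lambda>x. indicator (closure {x. f x \<noteq> 0}) x *\<^sub>R f x) = f"
    using subsetD[OF closure_subset[of "{x. f x \<noteq> 0}"]] by (auto simp: indicator_def fun_eq_iff)
  ultimately show ?thesis by simp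
qed

text \<open>The integral of a translate of \<open>\<psi>\<close> does not depend on the translation,
  so its derivative is zero; differentiation under the integral sign identifies this derivative with
  the integral of the gradient.\<close>

lemma integral_gradient_eq_0:
  assumes \<psi>: "smooth \<psi>" "bounded {x. \<psi> x \<noteq> 0}"
  shows "(LINT x|lborel. gradient \<psi> x) = 0"
proof -
  obtain R where R: "\<And>x. \<psi> x \<noteq> 0 \<Longrightarrow> norm x \<le> R" using \<psi>(2) by (auto simp: bounded_iff)
  \<comment> \<open>A weight has to be integrable, hence the cut-off. The radius
    \<open>R + 1\<close> still contains the support of \<open>\<psi>\<close> after a translation by
    less than 1.\<close>
  define w :: "point \<Rightarrow> real" where "w = indicator (cball 0 (R + 1))"
  have w: "integrable lborel w" 
    using emeasure_bounded_finite[of "cball 0 (R + 1) :: point set"] by (simp add: w_def integrable_indicator_iff)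
  have g: "GDERIV (\<lambda>x. LINT z|lborel. w z * \<psi> (z - (-1) *\<^sub>R x)) 0 :>
      (- (-1)) *\<^sub>R (LINT z|lborel. w z *\<^sub>R gradient \<psi> (z - (-1) *\<^sub>R 0))"
    by (rule GDERIV_convolution[OF _ w \<psi>]) simp
  have "(LINT z|lborel. w z * \<psi> (z - (-1) *\<^sub>R x)) = (LINT z|lborel. \<psi> z)" if x: "x \<in> ball 0 1" for x
  proof -
    have "(LINT z|lborel. w z * \<psi> (z - (-1) *\<^sub>R x)) = (LINT z|lborel. \<psi> (x + z))"
    proof (rule Bochner_Integration.integral_cong[OF refl])
      fix z
      show "w z * \<psi> (z - (-1) *\<^sub>R x) = \<psi> (x + z)"
      proof (cases "\<psi> (x + z) = 0")
        case False
        then have "norm (x + z) \<le> R" by (rule R)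
        then have "norm z \<le> R + 1" using x norm_diff_ineq[of z x] by (simp add: add.commute)
        then show ?thesis by (simp add: w_def add.commute)
      qed (simp add: add.commute)
    qed
    also have "\<dots> = (LINT z|distr lborel borel ((+) x). \<psi> z)"
      using smooth_continuous[OF \<psi>(1)] by (subst integral_distr) (auto intro: borel_measurable_continuous_onI)
    also have "\<dots> = (LINT z|lborel. \<psi> z)" by (simp add: lborel_distr_plus)
    finally show ?thesis .
  qed
  then have "((\<lambda>x. LINT z|lborel. w z * \<psi> (z - (-1) *\<^sub>R x)) has_derivative (\<lambda>h. 0)) (at 0)"
    by (intro has_derivative_transform_within_open[OF has_derivative_const[of "LINT z|lborel. \<psi> z"],
          where s = "ball 0 1"]) simp_all
  then have "GDERIV (\<lambda>x. LINT z|lborel. w z * \<psi> (z - (-1) *\<^sub>R x)) 0 :> 0" by (simp add: gderiv_def)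
  from GDERIV_unique[OF g this]
  have 0: "(LINT z|lborel. w z *\<^sub>R gradient \<psi> z) = 0" by simp
  have "closure {x. \<psi> x \<noteq> 0} \<subseteq> cball 0 R" using R by (intro closure_minimal) auto
  then have "w z *\<^sub>R gradient \<psi> z = gradient \<psi> z" for z
    using gradient_support[OF \<psi>(1)] by (auto simp: w_def indicator_def)
  then show ?thesis using 0 by simp
qed

section \<open>Weak gradients of smooth functions\<close>

lemma integral_area_on:
  fixes f :: "point \<Rightarrow> 'b::{banach, second_countable_topology}"
  assumes "open K" shows "(LINT x|area_on K. f x) = (LINT x|lborel. indicator K x *\<^sub>R f x)"
  using assms by (intro integral_restrict_space) auto

lemma finite_area_on: "bounded K \<Longrightarrow> open K \<Longrightarrow> finite_measure (area_on K)"
  using emeasure_bounded_finite[of K]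
  by (intro finite_measureI) (simp add: emeasure_restrict_space space_restrict_space)

text \<open>Integration by parts: the gradient of \<open>f * \<phi>\<close> integrates to zero over
  the plane since the test function has compact support, and both terms of the product rule vanish
  outside \<open>K\<close>.\<close>

lemma smooth_has_weak_gradient:
  assumes "open K" "smooth f"
  shows "has_weak_gradient K f (gradient f)"
  unfolding has_weak_gradient_def
proof (intro allI impI)
  fix \<phi> d\<phi> assume t: "test_function K \<phi>" and d: "\<forall>x. GDERIV \<phi> x :> d\<phi> x"
  then have \<phi>: "smooth \<phi>" and c: "compact (closure {x. \<phi> x \<noteq> 0})" "closure {x. \<phi> x \<noteq> 0} \<subseteq> K"
    by (auto simp: test_function_def)
  have d\<phi>: "d\<phi> = gradient \<phi>" using d gradient_eq by (metis ext)
  have b: "bounded {x. \<phi> x \<noteq> 0}" using c(1) by (meson bounded_subset closure_subset compact_imp_bounded)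
  have s: "smooth (\<lambda>x. f x * \<phi> x)" using \<phi> assms by (intro smooth_mult)
  have g: "gradient (\<lambda>x. f x * \<phi> x) x = f x *\<^sub>R gradient \<phi> x + \<phi> x *\<^sub>R gradient f x" for x
    by (intro gradient_eq GDERIV_mult smooth_gradient(1) \<phi> assms)
  have b2: "bounded {x. f x * \<phi> x \<noteq> 0}" by (rule bounded_subset[OF b]) auto
  have i1: "integrable lborel (\<lambda>x. f x *\<^sub>R gradient \<phi> x)"
    by (intro integrable_continuous_bounded_support continuous_intros smooth_continuous
        smooth_gradient_continuous \<phi> assms bounded_subset[OF gradient_bounded_support(1)[OF \<phi> b]]) auto
  have i2: "integrable lborel (\<lambda>x. \<phi> x *\<^sub>R gradient f x)"
    by (intro integrable_continuous_bounded_support continuous_intros smooth_continuous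
        smooth_gradient_continuous \<phi> assms bounded_subset[OF b]) auto
  note i = i1 i2
  have "(LINT x|lborel. f x *\<^sub>R gradient \<phi> x) + (LINT x|lborel. \<phi> x *\<^sub>R gradient f x) = 0"
    using integral_gradient_eq_0[OF s b2] i by (simp add: g)
  moreover have "(LINT x|area_on K. f x *\<^sub>R gradient \<phi> x) = (LINT x|lborel. f x *\<^sub>R gradient \<phi> x)"
    unfolding integral_area_on[OF assms(1)]
    by (rule Bochner_Integration.integral_cong) (use gradient_support[OF \<phi>] c(2) in \<open>auto simp: indicator_def\<close>)
  moreover have "(LINT x|area_on K. \<phi> x *\<^sub>R gradient f x) = (LINT x|lborel. \<phi> x *\<^sub>R gradient f x)"
    unfolding integral_area_on[OF assms(1)]
    by (rule Bochner_Integration.integral_cong)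
       (use subsetD[OF order_trans[OF closure_subset c(2)]] in \<open>auto simp: indicator_def\<close>)
  ultimately show "(LINT x|area_on K. f x *\<^sub>R d\<phi> x) = - (LINT x|area_on K. \<phi> x *\<^sub>R gradient f x)"
    unfolding d\<phi> by (simp add: eq_neg_iff_add_eq_0)
qed

lemma measurable_area_on:
  "f \<in> borel_measurable borel \<Longrightarrow> f \<in> borel_measurable (area_on K)"
  by (rule measurable_restrict_space1) simp

lemma square_integrable_continuous:
  fixes f :: "point \<Rightarrow> 'b::euclidean_space"
  assumes "open K" "bounded K" "continuous_on UNIV f"
  shows "square_integrable (area_on K) f"
proof (rule square_integrableI)
  show m: "f \<in> borel_measurable (area_on K)"
    using assms(3) by (intro measurable_area_on borel_measurable_continuous_onI)
  have "compact ((\<lambda>x. norm (f x)) ` closure K)"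
    using assms by (intro compact_continuous_image continuous_intros) (auto intro: continuous_on_subset)
  then obtain B where "\<forall>x\<in>closure K. norm (f x) \<le> B"
    by (auto dest!: compact_imp_bounded simp: bounded_iff)
  then have B: "\<And>x. x \<in> K \<Longrightarrow> norm (f x) \<le> B" using subsetD[OF closure_subset[of K]] by blast
  show "integrable (area_on K) (\<lambda>x. (norm (f x))\<^sup>2)"
  proof (rule finite_measure.integrable_const_bound[OF finite_area_on[OF assms(2,1)], where B = "B\<^sup>2"])
    show "AE x in area_on K. norm ((norm (f x))\<^sup>2) \<le> B\<^sup>2"
      by (rule AE_I2) (auto simp: space_restrict_space intro!: power_mono B)
  qed (use m in measurable)
qed

lemma smooth_in_H1:
  assumes "open K" "bounded K" "smooth f"
  shows "f \<in> H1 K" "square_integrable (area_on K) (gradient f)"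
  using square_integrable_continuous[OF assms(1,2) smooth_continuous[OF assms(3)]] 
    square_integrable_continuous[OF assms(1,2) smooth_gradient_continuous[OF assms(3)]]
    smooth_has_weak_gradient[OF assms(1,3)]
  unfolding H1_def by blast+

section \<open>Approximation on star-shaped sets\<close>

lemma nn_integral_affine:
  fixes f :: "point \<Rightarrow> ennreal"
  assumes [measurable]: "f \<in> borel_measurable borel" and a: "a \<noteq> 0"
  shows "(\<integral>\<^sup>+y. f y \<partial>lborel) = ennreal (a\<^sup>2) * (\<integral>\<^sup>+x. f (a *\<^sub>R x + b) \<partial>lborel)"
proof -
  have "(\<integral>\<^sup>+y. f y \<partial>lborel) = (\<integral>\<^sup>+y. f y \<partial>density (distr lborel borel (\<lambda>x. b + a *\<^sub>R x)) (\<lambda>_. ennreal (\<bar>a\<bar> ^ DIM(point))))"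
    using lborel_affine[OF a, of b] by (simp only:)
  also have "\<dots> = ennreal (\<bar>a\<bar> ^ DIM(point)) * (\<integral>\<^sup>+x. f (b + a *\<^sub>R x) \<partial>lborel)"
    by (simp add: nn_integral_density nn_integral_distr nn_integral_cmult)
  finally show ?thesis by (simp add: add.commute power2_eq_square)
qed

text \<open>Truncation makes \<open>f\<close> bounded up to a small error. Truncated continuous
  functions that converge to \<open>f\<close> almost everywhere are then dominated by a constant,
  which is integrable because \<open>K\<close> has finite measure.\<close>

lemma L2_dense_continuous:
  fixes f :: "point \<Rightarrow> real"
  assumes K: "open K" "bounded K" and f: "square_integrable (area_on K) f" and \<delta>: "\<delta> > 0"
  obtains g where "continuous_on UNIV g" "L2_norm (area_on K) (\<lambda>x. f x - g x) < \<delta>"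
proof -
  let ?M = "area_on K"
  interpret finite_measure ?M by (rule finite_area_on[OF K(2,1)])
  define T where "T B y = max (- B) (min B y)" for B y :: real
  have T_bound: "B \<ge> 0 \<Longrightarrow> \<bar>T B y\<bar> \<le> B" for B y by (auto simp: T_def)
  have T_diff: "B \<ge> 0 \<Longrightarrow> \<bar>y - T B y\<bar> \<le> \<bar>y\<bar>" for B y by (auto simp: T_def)
  have fm [measurable]: "f \<in> borel_measurable ?M" using f by (rule square_integrable_measurable)
  have Tm [measurable]: "T B \<in> borel_measurable borel" for B unfolding T_def by measurable
  have "(\<lambda>n. LINT x|?M. (f x - T (real n) (f x))\<^sup>2) \<longlonglongrightarrow> (LINT x|?M. 0)"
  proof (rule integral_dominated_convergence[where w = "\<lambda>x. (f x)\<^sup>2"])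
    show "integrable ?M (\<lambda>x. (f x)\<^sup>2)" using f by (rule square_integrable_power2)
    show "AE x in ?M. (\<lambda>n. (f x - T (real n) (f x))\<^sup>2) \<longlonglongrightarrow> 0"
    proof (rule AE_I2)
      fix x
      obtain N where N: "real N \<ge> \<bar>f x\<bar>" using real_arch_simple by blast
      have "\<forall>\<^sub>F n in sequentially. (f x - T (real n) (f x))\<^sup>2 = 0"
        using eventually_ge_at_top[of N] by eventually_elim (use N in \<open>auto simp: T_def\<close>)
      then show "(\<lambda>n. (f x - T (real n) (f x))\<^sup>2) \<longlonglongrightarrow> 0" by (rule tendsto_eventually)
    qed
    show "AE x in ?M. norm ((f x - T (real n) (f x))\<^sup>2) \<le> (f x)\<^sup>2" for n
    proof (rule AE_I2)
      fix x show "norm ((f x - T (real n) (f x))\<^sup>2) \<le> (f x)\<^sup>2"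
        using power_mono[OF T_diff[of "real n" "f x"] abs_ge_zero, of 2] by simp
    qed
  qed auto
  then have "\<forall>\<^sub>F n in sequentially. (LINT x|?M. (f x - T (real n) (f x))\<^sup>2) < (\<delta>/2)\<^sup>2"
    using order_tendstoD(2)[of _ 0 sequentially "(\<delta>/2)\<^sup>2"] \<delta> by simp
  then obtain N where N: "(LINT x|?M. (f x - T (real N) (f x))\<^sup>2) < (\<delta>/2)\<^sup>2"
    using eventually_happens'[OF sequentially_bot] by blast
  have "(\<lambda>x. if x \<in> K then f x else 0) \<in> borel_measurable lebesgue"
  proof -
    have "(\<lambda>x. if x \<in> K then f x else 0) \<in> borel_measurable lborel"
    proof -
      have "(\<lambda>x. indicat_real K x *\<^sub>R f x) = (\<lambda>x. if x \<in> K then f x else 0)" by auto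
      then show ?thesis using fm K(1) borel_measurable_restrict_space_iff[of K lborel f] by simp
    qed
    then show ?thesis by (rule measurable_completion)
  qed
  then have "f \<in> borel_measurable (lebesgue_on K)" by (rule borel_measurable_if_D)
  then have "f measurable_on K" using K(1) by (simp add: measurable_on_iff_borel_measurable)
  then obtain Z g where Z: "negligible Z" and gc: "\<And>n. continuous_on UNIV (g n)"
    and gl: "\<And>x. x \<notin> Z \<Longrightarrow> (\<lambda>n. g n x) \<longlonglongrightarrow> (if x \<in> K then f x else 0)"
    unfolding measurable_on_def by blast
  have Tc: "continuous_on UNIV (\<lambda>x. T B (g n x))" for B n
    unfolding T_def by (intro continuous_intros gc)
  have gm [measurable]: "(\<lambda>x. T B (g n x)) \<in> borel_measurable ?M" for B n
    by (intro measurable_area_on borel_measurable_continuous_onI Tc)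
  have "AE x in lebesgue. x \<notin> Z"
    using Z by (intro AE_not_in) (simp add: negligible_iff_null_sets)
  then have "AE x in lborel. x \<notin> Z" by (simp add: AE_completion_iff)
  then have AE: "AE x in ?M. x \<notin> Z" using K(1) by (subst AE_restrict_space_iff) auto
  have "(\<lambda>n. LINT x|?M. (T (real N) (f x) - T (real N) (g n x))\<^sup>2) \<longlonglongrightarrow> (LINT x|?M. 0)"
  proof (rule integral_dominated_convergence[where w = "\<lambda>x. (2 * real N)\<^sup>2"])
    show "AE x in ?M. (\<lambda>n. (T (real N) (f x) - T (real N) (g n x))\<^sup>2) \<longlonglongrightarrow> 0"
      using AE AE_space
    proof eventually_elim
      case (elim x)
      then have "(\<lambda>n. g n x) \<longlonglongrightarrow> f x" using gl[of x] by (simp add: space_restrict_space)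
      then have "(\<lambda>n. (T (real N) (f x) - T (real N) (g n x))\<^sup>2) \<longlonglongrightarrow> (T (real N) (f x) - T (real N) (f x))\<^sup>2"
        unfolding T_def by (intro tendsto_intros)
      then show ?case by simp
    qed
    show "AE x in ?M. norm ((T (real N) (f x) - T (real N) (g n x))\<^sup>2) \<le> (2 * real N)\<^sup>2" for n
    proof (rule AE_I2)
      fix x
      have "\<bar>T (real N) (f x) - T (real N) (g n x)\<bar> \<le> 2 * real N"
        using T_bound[of "real N" "f x"] T_bound[of "real N" "g n x"] by linarith
      then have "\<bar>T (real N) (f x) - T (real N) (g n x)\<bar>\<^sup>2 \<le> (2 * real N)\<^sup>2"
        by (intro power_mono) auto
      then show "norm ((T (real N) (f x) - T (real N) (g n x))\<^sup>2) \<le> (2 * real N)\<^sup>2" by simp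
    qed
  qed auto
  then have "\<forall>\<^sub>F n in sequentially. (LINT x|?M. (T (real N) (f x) - T (real N) (g n x))\<^sup>2) < (\<delta>/2)\<^sup>2"
    using order_tendstoD(2)[of _ 0 sequentially "(\<delta>/2)\<^sup>2"] \<delta> by simp
  then obtain n where n: "(LINT x|?M. (T (real N) (f x) - T (real N) (g n x))\<^sup>2) < (\<delta>/2)\<^sup>2"
    using eventually_happens'[OF sequentially_bot] by blast
  have sT: "square_integrable ?M (\<lambda>x. T (real N) (f x))"
  proof (rule square_integrableI)
    show "integrable ?M (\<lambda>x. (norm (T (real N) (f x)))\<^sup>2)"
    proof (rule integrable_const_bound[where B = "(real N)\<^sup>2"])
      show "AE x in ?M. norm ((norm (T (real N) (f x)))\<^sup>2) \<le> (real N)\<^sup>2"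
      proof (rule AE_I2)
        fix x show "norm ((norm (T (real N) (f x)))\<^sup>2) \<le> (real N)\<^sup>2"
          using power_mono[OF T_bound[of "real N" "f x"] abs_ge_zero, of 2] by simp
      qed
    qed (use Tm fm in measurable)
  qed (use Tm fm in measurable)
  have sg: "square_integrable ?M (\<lambda>x. T (real N) (g n x))"
    by (rule square_integrable_continuous[OF K Tc])
  have 1: "L2_norm ?M (\<lambda>x. f x - T (real N) (f x)) < \<delta>/2"
    unfolding L2_norm_def using N \<delta> by (intro real_less_lsqrt) auto
  have 2: "L2_norm ?M (\<lambda>x. T (real N) (f x) - T (real N) (g n x)) < \<delta>/2"
    unfolding L2_norm_def using n \<delta> by (intro real_less_lsqrt) auto
  have "L2_norm ?M (\<lambda>x. f x - T (real N) (g n x)) < \<delta>"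
    using L2_norm_triangle[OF square_integrable_diff[OF f sT] square_integrable_diff[OF sT sg]] 1 2 by simp
  then show ?thesis using that[OF Tc] by blast
qed

text \<open>A mollifier of mass 1. Coordinates between -1/3 and 1/3 put the support within radius
  2/3, strictly inside the unit disc; the room left makes the supports of the kernels below compact
  in \<open>K\<close>.\<close>

definition eta :: "point \<Rightarrow> real" where
  "eta x = box_bump (\<chi> i. - 1/3) (\<chi> i. 1/3) x / (LINT z|lborel. box_bump (\<chi> i. - 1/3) (\<chi> i. 1/3) z)"

lemma bounded_box_bump: "bounded {x. box_bump a b x \<noteq> 0}"
  by (rule bounded_subset[OF bounded_box[of a b]]) (use box_bump_eq_0_iff in auto)

lemma integrable_box_bump: "integrable lborel (box_bump a b)"
  by (intro integrable_continuous_bounded_support smooth_continuous smooth_box_bump bounded_box_bump)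

lemma integral_box_bump_pos:
  assumes "box a b \<noteq> {}" shows "(LINT z|lborel. box_bump a b z) > 0"
proof -
  have "(LINT z|lborel. box_bump a b z) \<noteq> 0"
  proof
    assume "(LINT z|lborel. box_bump a b z) = 0"
    then have "AE z in lborel. box_bump a b z = 0"
      by (subst (asm) integral_nonneg_eq_0_iff_AE) (auto simp: integrable_box_bump box_bump_nonneg)
    then have "AE z in lborel. z \<notin> box a b" by (simp add: box_bump_eq_0_iff)
    then have "box a b \<in> null_sets lborel" by (subst AE_iff_null_sets) auto
    then have "negligible (box a b)" by (simp add: negligible_iff_null_sets null_sets_completionI)
    then show False using assms negligible_interval(2)[of a b] by simp
  qed
  then show ?thesis
    using Bochner_Integration.integral_nonneg[of lborel "box_bump a b"] box_bump_nonneg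
    by (metis less_eq_real_def)
qed

lemma eta_denom_pos: "(LINT z|lborel. box_bump (\<chi> i. - 1/3) (\<chi> i. 1/3) z) > 0"
proof (rule integral_box_bump_pos)
  have "0 \<in> box ((\<chi> i. - 1/3) :: point) (\<chi> i. 1/3)" by (simp add: mem_box_2)
  then show "box ((\<chi> i. - 1/3) :: point) (\<chi> i. 1/3) \<noteq> {}" by blast
qed

lemma smooth_eta: "smooth eta"
  using smooth_cmult[OF smooth_box_bump, of "1 / (LINT z|lborel. box_bump (\<chi> i. - 1/3) (\<chi> i. 1/3) z)"]
  by (simp add: eta_def[abs_def])

lemma eta_nonneg: "eta x \<ge> 0"
  using eta_denom_pos box_bump_nonneg by (simp add: eta_def)

lemma eta_support: "eta x \<noteq> 0 \<Longrightarrow> norm x \<le> 2/3"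
proof -
  assume "eta x \<noteq> 0"
  then have "x \<in> box (\<chi> i. - 1/3) (\<chi> i. 1/3)" using box_bump_eq_0_iff by (auto simp: eta_def)
  then have "\<bar>x $ 1\<bar> < 1/3" "\<bar>x $ 2\<bar> < 1/3" unfolding mem_box_2 by (auto simp: abs_if)
  then show ?thesis using norm_le_l1_cart[of x] unfolding sum_2 by linarith
qed

lemma eta_measurable [measurable]: "eta \<in> borel_measurable borel"
  by (intro borel_measurable_continuous_onI smooth_continuous smooth_eta)

lemma nn_integral_eta: "(\<integral>\<^sup>+x. ennreal (eta x) \<partial>lborel) = 1"
proof -
  have "(LINT x|lborel. eta x) = 1" using eta_denom_pos by (simp add: eta_def)
  moreover have "integrable lborel eta" using integrable_box_bump by (simp add: eta_def[abs_def])
  ultimately show ?thesis using eta_nonneg by (simp add: nn_integral_eq_integral)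
qed

lemma power2_sum3_le: "(a + b + c)\<^sup>2 \<le> 3 * a\<^sup>2 + 3 * b\<^sup>2 + 3 * (c::real)\<^sup>2"
  using sum_squares_bound[of a b] sum_squares_bound[of a c] sum_squares_bound[of b c]
  by (simp add: power2_eq_square algebra_simps)

section \<open>Averages over shrunken copies of the disc\<close>

locale star_cell =
  fixes K :: "point set" and c :: point and r :: real
  assumes open_K: "open K" and bounded_K: "bounded K" and r_pos: "0 < r"
    and star: "\<And>y z. y \<in> ball c r \<Longrightarrow> z \<in> K \<Longrightarrow> closed_segment y z \<subseteq> K"
    and ball_subset: "ball c r \<subseteq> K"
begin

abbreviation M where "M \<equiv> area_on K"

lemma finite_M: "finite_measure M" by (rule finite_area_on[OF bounded_K open_K])

lemma space_M: "space M = K" by (simp add: space_restrict_space)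

lemma id_measurable_M: "(\<lambda>x. x) \<in> borel_measurable M" by (rule measurable_area_on) simp

text \<open>\<open>avg e f x\<close> is a weighted mean of \<open>f\<close> over the points \<open>(1 - e) *\<^sub>R x + e *\<^sub>R y\<close> with \<open>y\<close> in the disc.
  For \<open>x\<close> in the closure of \<open>K\<close> these points stay away from the boundary of \<open>K\<close>, so no extension of \<open>f\<close>
  is needed.\<close>

definition psi :: "real \<Rightarrow> point \<Rightarrow> real" where
  "psi e y = eta ((1 / (e * r)) *\<^sub>R y + (- (1 / r)) *\<^sub>R c) / (e * r)\<^sup>2"

definition kernel :: "real \<Rightarrow> point \<Rightarrow> point \<Rightarrow> real" where
  "kernel e x z = psi e (z - (1 - e) *\<^sub>R x)"

definition avg :: "real \<Rightarrow> (point \<Rightarrow> real) \<Rightarrow> point \<Rightarrow> real" where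
  "avg e f x = (LINT z|M. f z * kernel e x z)"

lemma smooth_psi: "smooth (psi e)"
  using smooth_cmult[OF smooth_affine[OF smooth_eta], of "1 / (e * r)\<^sup>2" "1 / (e * r)" "(- (1 / r)) *\<^sub>R c"]
  by (simp add: psi_def[abs_def])

lemma psi_nonneg: "psi e y \<ge> 0" by (simp add: psi_def eta_nonneg)

lemma psi_support:
  assumes "e > 0" "psi e y \<noteq> 0" shows "norm (y - e *\<^sub>R c) \<le> 2/3 * (e * r)"
proof -
  have "norm ((1 / (e * r)) *\<^sub>R y + (- (1 / r)) *\<^sub>R c) \<le> 2/3"
    using assms(2) by (intro eta_support) (auto simp: psi_def)
  moreover have "(1 / (e * r)) *\<^sub>R y + (- (1 / r)) *\<^sub>R c = (1 / (e * r)) *\<^sub>R (y - e *\<^sub>R c)"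
    using assms(1) by (simp add: scaleR_diff_right)
  ultimately show ?thesis using assms(1) r_pos by (simp add: divide_le_eq mult.commute)
qed

lemma psi_bounded_support: "e > 0 \<Longrightarrow> bounded {y. psi e y \<noteq> 0}"
proof -
  assume "e > 0"
  then have "{y. psi e y \<noteq> 0} \<subseteq> cball (e *\<^sub>R c) (2/3 * (e * r))"
    using psi_support by (auto simp: dist_norm norm_minus_commute)
  then show ?thesis by (rule bounded_subset[OF bounded_cball])
qed

lemma psi_measurable [measurable]: "psi e \<in> borel_measurable borel"
  by (intro borel_measurable_continuous_onI smooth_continuous smooth_psi)

lemma kernel_measurable [measurable]:
  "(\<lambda>z. kernel e x z) \<in> borel_measurable borel" "(\<lambda>x. kernel e x z) \<in> borel_measurable borel"
  "(\<lambda>p. kernel e (fst p) (snd p)) \<in> borel_measurable (borel \<Otimes>\<^sub>M borel)"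
  unfolding kernel_def by measurable

lemma kernel_nonneg: "kernel e x z \<ge> 0" by (simp add: kernel_def psi_nonneg)

text \<open>Such a \<open>z\<close> is a convex combination of \<open>x\<close> and a point of the
  disc. Formulated for the closed ball that contains the support, this also gives the compact
  support required of a test function.\<close>

lemma kernel_support_closed:
  assumes "0 < e" "e < 1" "x \<in> K" "norm (z - (1 - e) *\<^sub>R x - e *\<^sub>R c) \<le> 2/3 * (e * r)"
  shows "z \<in> K"
proof -
  define y where "y = c + (1 / e) *\<^sub>R (z - (1 - e) *\<^sub>R x - e *\<^sub>R c)"
  have "norm (y - c) \<le> 2/3 * r" using assms(1,4) by (simp add: y_def divide_le_eq mult.assoc mult.commute)
  then have "y \<in> ball c r" using r_pos by (simp add: dist_norm norm_minus_commute)
  from star[OF this assms(3)] have "closed_segment y x \<subseteq> K" .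
  moreover have "z = (1 - (1 - e)) *\<^sub>R y + (1 - e) *\<^sub>R x"
    using assms(1) by (simp add: y_def scaleR_add_right)
  then have "z \<in> closed_segment y x" using assms by (auto simp: in_segment intro!: exI[of _ "1 - e"])
  ultimately show ?thesis by blast
qed

text \<open>The distance bound tends to 0 with \<open>e\<close>, uniformly because \<open>K\<close>
  is bounded: averaging uses only values near \<open>x\<close>.\<close>

lemma kernel_support:
  assumes "0 < e" "e < 1" "x \<in> K" "kernel e x z \<noteq> 0"
  shows "z \<in> K" "norm (z - x) \<le> e * (norm (x - c) + r)"
proof -
  have n: "norm (z - (1 - e) *\<^sub>R x - e *\<^sub>R c) \<le> 2/3 * (e * r)"
    using psi_support[OF assms(1), of "z - (1 - e) *\<^sub>R x"] assms(4) by (simp add: kernel_def)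
  show "z \<in> K" by (rule kernel_support_closed[OF assms(1-3) n])
  have "z - x = (z - (1 - e) *\<^sub>R x - e *\<^sub>R c) - e *\<^sub>R (x - c)" by (simp add: algebra_simps)
  then have "norm (z - x) \<le> norm (z - (1 - e) *\<^sub>R x - e *\<^sub>R c) + norm (e *\<^sub>R (x - c))"
    by (metis norm_triangle_ineq4)
  also have "\<dots> \<le> 2/3 * (e * r) + e * norm (x - c)" using n assms(1) by simp
  also have "\<dots> \<le> e * (norm (x - c) + r)" using assms(1) r_pos by (simp add: algebra_simps)
  finally show "norm (z - x) \<le> e * (norm (x - c) + r)" .
qed

lemma nn_integral_psi:
  assumes "e > 0" shows "(\<integral>\<^sup>+y. ennreal (psi e y) \<partial>lborel) = 1"
proof -
  have "1 = ennreal ((1 / (e * r))\<^sup>2) * (\<integral>\<^sup>+y. ennreal (eta ((1 / (e * r)) *\<^sub>R y + (- (1 / r)) *\<^sub>R c)) \<partial>lborel)"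
    using nn_integral_affine[of "\<lambda>x. ennreal (eta x)" "1 / (e * r)" "(- (1 / r)) *\<^sub>R c"] assms r_pos
    by (simp add: nn_integral_eta)
  also have "\<dots> = (\<integral>\<^sup>+y. ennreal (psi e y) \<partial>lborel)"
    by (subst nn_integral_cmult[symmetric]) 
       (auto intro!: nn_integral_cong simp: psi_def ennreal_mult'[symmetric] power_divide)
  finally show ?thesis by simp
qed

lemma nn_integral_kernel:
  assumes "0 < e" "e < 1" "x \<in> K"
  shows "(\<integral>\<^sup>+z. ennreal (kernel e x z) \<partial>M) = 1"
proof -
  have "(\<integral>\<^sup>+z. ennreal (kernel e x z) \<partial>M) = (\<integral>\<^sup>+z. ennreal (kernel e x z) * indicator K z \<partial>lborel)"
    using open_K by (intro nn_integral_restrict_space) auto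
  also have "\<dots> = (\<integral>\<^sup>+z. ennreal (psi e (1 *\<^sub>R z + (- ((1 - e) *\<^sub>R x)))) \<partial>lborel)"
  proof (rule nn_integral_cong)
    fix z show "ennreal (kernel e x z) * indicator K z = ennreal (psi e (1 *\<^sub>R z + (- ((1 - e) *\<^sub>R x))))"
      using kernel_support(1)[OF assms, of z] by (cases "kernel e x z = 0") (auto simp: kernel_def)
  qed
  also have "\<dots> = (\<integral>\<^sup>+y. ennreal (psi e y) \<partial>lborel)"
    by (subst nn_integral_affine[of "\<lambda>x. ennreal (psi e x)" 1 "- ((1 - e) *\<^sub>R x)"]) auto
  finally show ?thesis using nn_integral_psi[OF assms(1)] by simp
qed

text \<open>Integration in the first variable amounts to the dilation by \<open>1 - e\<close>, whose
  Jacobian is at least 1/4 for \<open>e \<le> 1/2\<close>. Together with mass 1 in the second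
  variable this makes averaging bounded in the square norm.\<close>

lemma nn_integral_kernel_left:
  assumes "0 < e" "e \<le> 1/2"
  shows "(\<integral>\<^sup>+x. ennreal (kernel e x z) \<partial>M) \<le> 4"
proof -
  have "(\<integral>\<^sup>+x. ennreal (kernel e x z) \<partial>M) = (\<integral>\<^sup>+x. ennreal (kernel e x z) * indicator K x \<partial>lborel)"
    using open_K by (intro nn_integral_restrict_space) auto
  also have "\<dots> \<le> (\<integral>\<^sup>+x. ennreal (kernel e x z) \<partial>lborel)"
    by (rule nn_integral_mono) (auto simp: indicator_def)
  also have "\<dots> = (\<integral>\<^sup>+x. ennreal (psi e ((- (1 - e)) *\<^sub>R x + z)) \<partial>lborel)"
    by (rule nn_integral_cong) (simp add: kernel_def algebra_simps)
  also have "\<dots> \<le> 4 * (ennreal ((- (1 - e))\<^sup>2) * \<dots>)"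
  proof -
    have "(1 :: real) \<le> 4 * (- (1 - e))\<^sup>2"
      using assms power_mono[of "1/2" "1 - e" 2] by (simp add: power2_eq_square algebra_simps)
    then have "1 \<le> ennreal (4 * (- (1 - e))\<^sup>2)" by (simp add: ennreal_ge_1)
    then have "1 \<le> 4 * ennreal ((- (1 - e))\<^sup>2)" by (simp add: ennreal_mult)
    from mult_right_mono[OF this] show ?thesis by (simp add: mult.assoc)
  qed
  also have "(ennreal ((- (1 - e))\<^sup>2) * (\<integral>\<^sup>+x. ennreal (psi e ((- (1 - e)) *\<^sub>R x + z)) \<partial>lborel)) = 1"
    using nn_integral_affine[of "\<lambda>x. ennreal (psi e x)" "- (1 - e)" z] assms nn_integral_psi[OF assms(1)] by simp
  finally show ?thesis by simp
qed

lemma kernel_bounded: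
  assumes "e > 0" obtains B where "\<And>x z. norm (kernel e x z) \<le> B"
  using continuous_bounded_support[OF smooth_continuous[OF smooth_psi] psi_bounded_support[OF assms]]
  unfolding kernel_def by metis

lemma integrable_kernel_mult:
  assumes "e > 0" "integrable M f"
  shows "integrable M (\<lambda>z. f z * kernel e x z)"
proof -
  obtain B where "\<And>x z. norm (kernel e x z) \<le> B" using kernel_bounded[OF assms(1)] by blast
  from integrable_mult_bounded[OF assms(2) measurable_area_on[OF kernel_measurable(1)] this]
  show ?thesis by simp
qed

lemma square_integrable_integrable:
  fixes f :: "point \<Rightarrow> 'b::euclidean_space"
  assumes "square_integrable M f" shows "integrable M f"
proof (rule Bochner_Integration.integrable_bound)
  show "integrable M (\<lambda>x. 1 + (norm (f x))\<^sup>2)"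
    using assms finite_measure.integrable_const[OF finite_M, of "1::real"] by (auto simp: square_integrable_def)
  show "AE x in M. norm (f x) \<le> norm (1 + (norm (f x))\<^sup>2)"
  proof (rule AE_I2)
    fix x
    have "2 * norm (f x) \<le> 1 + (norm (f x))\<^sup>2" using sum_squares_bound[of 1 "norm (f x)"] by simp
    then have "norm (f x) \<le> 1 + (norm (f x))\<^sup>2" using norm_ge_zero[of "f x"] by linarith
    then show "norm (f x) \<le> norm (1 + (norm (f x))\<^sup>2)" by simp
  qed
qed (use assms square_integrable_measurable in auto)

lemma smooth_avg:
  assumes "square_integrable M f" "e > 0" shows "smooth (avg e f)"
  unfolding avg_def[abs_def] kernel_def
  by (rule smooth_convolution[OF id_measurable_M square_integrable_integrable[OF assms(1)]
        smooth_psi psi_bounded_support[OF assms(2)]])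

lemma avg_Jensen:
  assumes f: "square_integrable M f" and e: "0 < e" "e < 1" and x: "x \<in> K"
  shows "ennreal ((avg e f x - f x)\<^sup>2) \<le> (\<integral>\<^sup>+z. ennreal (kernel e x z * (f z - f x)\<^sup>2) \<partial>M)"
proof -
  let ?k = "kernel e x"
  define g where "g z = f z - f x" for z
  have g: "square_integrable M g" unfolding g_def
    by (intro square_integrable_diff f square_integrable_const finite_M)
  have i0: "integrable M ?k" using integrable_kernel_mult[OF e(1), of "\<lambda>_. 1"] 
    finite_measure.integrable_const[OF finite_M, of "1::real"] by simp
  have i1: "integrable M (\<lambda>z. g z * ?k z)"
    by (rule integrable_kernel_mult[OF e(1) square_integrable_integrable[OF g]])
  have i2: "integrable M (\<lambda>z. (g z)\<^sup>2 * ?k z)"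
    by (rule integrable_kernel_mult[OF e(1) square_integrable_power2[OF g]])
  have i3: "integrable M (\<lambda>z. f z * ?k z)"
    by (rule integrable_kernel_mult[OF e(1) square_integrable_integrable[OF f]])
  have one: "(LINT z|M. ?k z) = 1"
    using nn_integral_kernel[OF e x] nn_integral_eq_integral[OF i0] kernel_nonneg
    by (metis AE_I2 ennreal_eq_1)
  define m where "m = (LINT z|M. g z * ?k z)"
  have m: "m = avg e f x - f x"
    using i3 i0 one by (simp add: m_def g_def avg_def left_diff_distrib)
  \<comment> \<open>Nonnegativity of the variance of \<open>g\<close> under the probability density
    \<open>?k\<close>.\<close>
  have "0 \<le> (LINT z|M. (g z - m)\<^sup>2 * ?k z)" by (simp add: kernel_nonneg)
  also have "\<dots> = (LINT z|M. (g z)\<^sup>2 * ?k z - (2 * m) * (g z * ?k z) + m\<^sup>2 * ?k z)"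
    by (intro Bochner_Integration.integral_cong) (auto simp: power2_eq_square algebra_simps)
  also have "\<dots> = (LINT z|M. (g z)\<^sup>2 * ?k z) - (2 * m) * m + m\<^sup>2"
    using i0 i1 i2 one by (simp add: m_def)
  finally have "m\<^sup>2 \<le> (LINT z|M. (g z)\<^sup>2 * ?k z)" by (simp add: power2_eq_square)
  then have "ennreal (m\<^sup>2) \<le> ennreal (LINT z|M. (g z)\<^sup>2 * ?k z)" by (rule ennreal_leI)
  also have "\<dots> = (\<integral>\<^sup>+z. ennreal ((g z)\<^sup>2 * ?k z) \<partial>M)"
    by (rule nn_integral_eq_integral[symmetric, OF i2]) (simp add: kernel_nonneg)
  finally show ?thesis by (simp add: m g_def mult.commute)
qed

text \<open>Passing through a continuous \<open>g\<close> at both points splits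
  \<open>f z - f x\<close> into three differences, which gives the factors 3. The two differences of
  \<open>f\<close> and \<open>g\<close> contribute \<open>3 * 4 + 3 = 15\<close>, with 4 from
  \<open>nn_integral_kernel_left\<close>; the difference of values of \<open>g\<close> is small
  because the kernel lives near \<open>x\<close>.\<close>

lemma avg_error_bound:
  assumes f: "square_integrable M f" and g: "continuous_on UNIV g" and e: "0 < e" "e \<le> 1/2"
    and \<omega>: "\<And>x z. x \<in> K \<Longrightarrow> z \<in> K \<Longrightarrow> norm (z - x) \<le> e * (norm (x - c) + r) \<Longrightarrow> \<bar>g z - g x\<bar> \<le> \<omega>"
  shows "(L2_norm M (\<lambda>x. avg e f x - f x))\<^sup>2 \<le> 15 * (L2_norm M (\<lambda>x. f x - g x))\<^sup>2 + 3 * \<omega>\<^sup>2 * measure lborel K"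
proof -
  interpret finite_measure M by (rule finite_M)
  interpret P: pair_sigma_finite M M ..
  have e1: "e < 1" using e by simp
  have fm [measurable]: "f \<in> borel_measurable M" by (rule square_integrable_measurable[OF f])
  have gs: "square_integrable M g" by (rule square_integrable_continuous[OF open_K bounded_K g])
  have gm [measurable]: "g \<in> borel_measurable M" by (rule square_integrable_measurable[OF gs])
  note [measurable] = id_measurable_M
  have km [measurable]: "(\<lambda>p. kernel e (fst p) (snd p)) \<in> borel_measurable (M \<Otimes>\<^sub>M M)"
    "(\<lambda>z. kernel e x z) \<in> borel_measurable M" "(\<lambda>x. kernel e x z) \<in> borel_measurable M" for x z
    unfolding kernel_def by measurable
  have fgs: "square_integrable M (\<lambda>x. f x - g x)" by (rule square_integrable_diff[OF f gs])
  define J where "J = (\<integral>\<^sup>+x. (\<integral>\<^sup>+z. ennreal (kernel e x z) * ennreal ((f z - g z)\<^sup>2) \<partial>M) \<partial>M)"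
  define I where "I = (\<integral>\<^sup>+x. ennreal ((f x - g x)\<^sup>2) \<partial>M)"
  have I: "I = ennreal ((L2_norm M (\<lambda>x. f x - g x))\<^sup>2)"
    unfolding I_def L2_norm_power2 using square_integrable_power2[OF fgs]
    by (subst nn_integral_eq_integral) auto
  have sa: "square_integrable M (avg e f)"
    by (rule square_integrable_continuous[OF open_K bounded_K smooth_continuous[OF smooth_avg[OF f e(1)]]])
  have pt: "ennreal ((avg e f x - f x)\<^sup>2) \<le> 3 * (\<integral>\<^sup>+z. ennreal (kernel e x z) * ennreal ((f z - g z)\<^sup>2) \<partial>M)
      + 3 * ennreal (\<omega>\<^sup>2) + 3 * ennreal ((f x - g x)\<^sup>2)" if x: "x \<in> K" for x
  proof -
    have "ennreal ((avg e f x - f x)\<^sup>2) \<le> (\<integral>\<^sup>+z. ennreal (kernel e x z * (f z - f x)\<^sup>2) \<partial>M)"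
      by (rule avg_Jensen[OF f e(1) e1 x])
    also have "\<dots> \<le> (\<integral>\<^sup>+z. (3 * (ennreal (kernel e x z) * ennreal ((f z - g z)\<^sup>2))
         + (3 * ennreal (\<omega>\<^sup>2)) * ennreal (kernel e x z)) + (3 * ennreal ((f x - g x)\<^sup>2)) * ennreal (kernel e x z) \<partial>M)"
    proof (rule nn_integral_mono)
      fix z assume "z \<in> space M"
      then have z: "z \<in> K" by (simp add: space_M)
      have "kernel e x z * (f z - f x)\<^sup>2 \<le> (3 * (kernel e x z * (f z - g z)\<^sup>2)
         + (3 * \<omega>\<^sup>2) * kernel e x z) + (3 * (f x - g x)\<^sup>2) * kernel e x z"
      proof (cases "kernel e x z = 0")
        case False
        have "\<bar>g z - g x\<bar> \<le> \<omega>" using kernel_support[OF e(1) e1 x False] by (intro \<omega> x z)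
        then have w: "(g z - g x)\<^sup>2 \<le> \<omega>\<^sup>2" by (simp add: abs_le_square_iff[symmetric])
        have "(f z - f x)\<^sup>2 \<le> 3 * (f z - g z)\<^sup>2 + 3 * (g z - g x)\<^sup>2 + 3 * (f x - g x)\<^sup>2"
          using power2_sum3_le[of "f z - g z" "g z - g x" "g x - f x"] by (simp add: power2_commute)
        also have "\<dots> \<le> 3 * (f z - g z)\<^sup>2 + 3 * \<omega>\<^sup>2 + 3 * (f x - g x)\<^sup>2" using w by simp
        finally have "kernel e x z * (f z - f x)\<^sup>2 \<le> kernel e x z * (3 * (f z - g z)\<^sup>2 + 3 * \<omega>\<^sup>2 + 3 * (f x - g x)\<^sup>2)"
          by (rule mult_left_mono[OF _ kernel_nonneg])
        then show ?thesis by (simp add: algebra_simps)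
      qed simp
      then have "ennreal (kernel e x z * (f z - f x)\<^sup>2) \<le> ennreal ((3 * (kernel e x z * (f z - g z)\<^sup>2)
         + (3 * \<omega>\<^sup>2) * kernel e x z) + (3 * (f x - g x)\<^sup>2) * kernel e x z)" by (rule ennreal_leI)
      then show "ennreal (kernel e x z * (f z - f x)\<^sup>2) \<le> (3 * (ennreal (kernel e x z) * ennreal ((f z - g z)\<^sup>2))
         + (3 * ennreal (\<omega>\<^sup>2)) * ennreal (kernel e x z)) + (3 * ennreal ((f x - g x)\<^sup>2)) * ennreal (kernel e x z)"
        using kernel_nonneg by (simp add: ennreal_mult)
    qed
    also have "\<dots> = 3 * (\<integral>\<^sup>+z. ennreal (kernel e x z) * ennreal ((f z - g z)\<^sup>2) \<partial>M)
      + 3 * ennreal (\<omega>\<^sup>2) + 3 * ennreal ((f x - g x)\<^sup>2)"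
      using nn_integral_kernel[OF e(1) e1 x] by (simp add: nn_integral_add nn_integral_cmult)
    finally show ?thesis .
  qed
  have "ennreal ((L2_norm M (\<lambda>x. avg e f x - f x))\<^sup>2) = (\<integral>\<^sup>+x. ennreal ((avg e f x - f x)\<^sup>2) \<partial>M)"
    unfolding L2_norm_power2 using square_integrable_power2[OF square_integrable_diff[OF sa f]]
    by (subst nn_integral_eq_integral) auto
  also have "\<dots> \<le> (\<integral>\<^sup>+x. 3 * (\<integral>\<^sup>+z. ennreal (kernel e x z) * ennreal ((f z - g z)\<^sup>2) \<partial>M)
      + 3 * ennreal (\<omega>\<^sup>2) + 3 * ennreal ((f x - g x)\<^sup>2) \<partial>M)"
    by (rule nn_integral_mono) (use pt in \<open>simp add: space_M\<close>)
  also have "\<dots> = 3 * J + 3 * ennreal (\<omega>\<^sup>2) * emeasure M (space M) + 3 * I"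
    by (simp add: nn_integral_add nn_integral_cmult I_def J_def)
  finally have le: "ennreal ((L2_norm M (\<lambda>x. avg e f x - f x))\<^sup>2)
      \<le> 3 * J + 3 * ennreal (\<omega>\<^sup>2) * emeasure M (space M) + 3 * I" .
  have "J = (\<integral>\<^sup>+z. (\<integral>\<^sup>+x. ennreal (kernel e x z) * ennreal ((f z - g z)\<^sup>2) \<partial>M) \<partial>M)"
    unfolding J_def by (rule P.Fubini'[symmetric]) measurable
  also have "\<dots> = (\<integral>\<^sup>+z. (\<integral>\<^sup>+x. ennreal (kernel e x z) \<partial>M) * ennreal ((f z - g z)\<^sup>2) \<partial>M)"
    by (intro nn_integral_cong nn_integral_multc) measurable
  also have "\<dots> \<le> (\<integral>\<^sup>+z. 4 * ennreal ((f z - g z)\<^sup>2) \<partial>M)"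
    by (intro nn_integral_mono mult_right_mono nn_integral_kernel_left[OF e]) simp
  also have "\<dots> = 4 * I" by (simp add: nn_integral_cmult I_def)
  finally have J: "J \<le> 4 * I" .
  have ms: "emeasure M (space M) = ennreal (measure lborel K)"
    using open_K emeasure_bounded_finite[OF bounded_K]
    by (simp add: space_M emeasure_restrict_space emeasure_eq_ennreal_measure[of lborel K])
  have "3 * (4 * I) + 3 * ennreal (\<omega>\<^sup>2) * ennreal (measure lborel K) + 3 * I
      = ennreal (15 * (L2_norm M (\<lambda>x. f x - g x))\<^sup>2 + 3 * \<omega>\<^sup>2 * measure lborel K)"
  proof -
    have "ennreal (15 * (L2_norm M (\<lambda>x. f x - g x))\<^sup>2 + 3 * \<omega>\<^sup>2 * measure lborel K)
      = ennreal (3 * (4 * (L2_norm M (\<lambda>x. f x - g x))\<^sup>2) + 3 * \<omega>\<^sup>2 * measure lborel K + 3 * (L2_norm M (\<lambda>x. f x - g x))\<^sup>2)"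
      by (rule arg_cong[of _ _ ennreal]) simp
    also have "\<dots> = 3 * (4 * I) + 3 * ennreal (\<omega>\<^sup>2) * ennreal (measure lborel K) + 3 * I"
      unfolding I by (simp only: ennreal_plus ennreal_mult ennreal_numeral zero_le_power2 measure_nonneg
          mult_nonneg_nonneg add_nonneg_nonneg zero_le_numeral)
    finally show ?thesis by (rule sym)
  qed
  note eq = this
  have "3 * J + 3 * ennreal (\<omega>\<^sup>2) * emeasure M (space M) + 3 * I
      \<le> 3 * (4 * I) + 3 * ennreal (\<omega>\<^sup>2) * emeasure M (space M) + 3 * I"
    by (intro add_right_mono mult_left_mono J) simp
  from order_trans[OF le this] have "ennreal ((L2_norm M (\<lambda>x. avg e f x - f x))\<^sup>2)
      \<le> ennreal (15 * (L2_norm M (\<lambda>x. f x - g x))\<^sup>2 + 3 * \<omega>\<^sup>2 * measure lborel K)"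
    unfolding ms eq .
  then show ?thesis by (subst (asm) ennreal_le_iff) auto
qed

text \<open>The shift by 2 keeps the scale at most 1/2, as \<open>avg_error_bound\<close>
  requires.\<close>

abbreviation eseq :: "nat \<Rightarrow> real" where "eseq n \<equiv> 1 / (real n + 2)"

lemma avg_tendsto:
  assumes f: "square_integrable M f"
  shows "(\<lambda>n. L2_norm M (\<lambda>x. avg (eseq n) f x - f x)) \<longlonglongrightarrow> 0"
proof (rule LIMSEQ_I)
  fix \<epsilon> :: real assume \<epsilon>: "\<epsilon> > 0"
  \<comment> \<open>With the error \<open>\<epsilon> / 6\<close> the bound becomes
    \<open>(15 / 36) \<epsilon>^2\<close> plus at most \<open>(3 / 36) \<epsilon>^2\<close> from the
    choice of \<open>\<omega>\<close>, which is together below \<open>\<epsilon>^2\<close>.\<close>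
  obtain g where gc: "continuous_on UNIV g" and g: "L2_norm M (\<lambda>x. f x - g x) < \<epsilon> / 6"
    using L2_dense_continuous[OF open_K bounded_K f, of "\<epsilon> / 6"] \<epsilon> by auto
  define m where "m = measure lborel K"
  have m: "m \<ge> 0" by (simp add: m_def)
  define \<omega> where "\<omega> = \<epsilon> / (6 * (m + 1))"
  have \<omega>: "\<omega> > 0" using \<epsilon> m by (simp add: \<omega>_def)
  have "uniformly_continuous_on (closure K) g"
    using bounded_K by (intro compact_uniformly_continuous continuous_on_subset[OF gc]) auto
  then obtain \<delta> where \<delta>: "\<delta> > 0" and uc: "\<And>x z. x \<in> closure K \<Longrightarrow> z \<in> closure K \<Longrightarrow> dist z x < \<delta> \<Longrightarrow> dist (g z) (g x) < \<omega>"
    unfolding uniformly_continuous_on_def using \<omega> by metis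
  obtain R where R: "\<And>x. x \<in> K \<Longrightarrow> norm (x - c) \<le> R"
    using bounded_K[THEN bounded_translation, of "- c"] by (auto simp: bounded_iff)
  have R0: "R + r > 0" using R[OF subsetD[OF ball_subset, of c]] r_pos by simp
  obtain N where N: "real N > (R + r) / \<delta>" using reals_Archimedean2 by blast
  have "norm (L2_norm M (\<lambda>x. avg (eseq n) f x - f x) - 0) < \<epsilon>" if n: "n \<ge> N" for n
  proof -
    have "eseq n * (R + r) < \<delta>"
    proof -
      have "(R + r) / \<delta> < real n + 2" using N n by linarith
      then have "R + r < \<delta> * (real n + 2)" using \<delta> by (simp add: pos_divide_less_eq mult.commute)
      then show ?thesis by (simp add: pos_divide_less_eq)
    qed
    then have "\<bar>g z - g x\<bar> \<le> \<omega>" if "x \<in> K" "z \<in> K" "norm (z - x) \<le> eseq n * (norm (x - c) + r)" for x z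
    proof -
      have "eseq n * (norm (x - c) + r) \<le> eseq n * (R + r)" using R[OF that(1)] by (intro mult_left_mono) auto
      then show ?thesis using uc[of x z] that closure_subset[of K] \<open>eseq n * (R + r) < \<delta>\<close> 
        by (auto simp: dist_norm subset_iff)
    qed
    then have "(L2_norm M (\<lambda>x. avg (eseq n) f x - f x))\<^sup>2
        \<le> 15 * (L2_norm M (\<lambda>x. f x - g x))\<^sup>2 + 3 * \<omega>\<^sup>2 * m"
      unfolding m_def by (intro avg_error_bound[OF f gc]) auto
    also have "\<dots> \<le> 15 * (\<epsilon> / 6)\<^sup>2 + 3 * \<omega>\<^sup>2 * m"
      using g by (intro add_right_mono mult_left_mono power_mono) auto
    also have "\<dots> < \<epsilon>\<^sup>2"
    proof -
      have "\<omega>\<^sup>2 * m \<le> \<omega>\<^sup>2 * (m + 1)\<^sup>2" using m by (intro mult_left_mono) (auto simp: power2_eq_square algebra_simps)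
      also have "\<dots> = (\<omega> * (m + 1))\<^sup>2" by (simp add: power_mult_distrib)
      also have "\<omega> * (m + 1) = \<epsilon> / 6" using m by (simp add: \<omega>_def field_simps)
      finally have "\<omega>\<^sup>2 * m \<le> \<epsilon>\<^sup>2 / 36" by (simp add: power_divide)
      moreover have "\<epsilon>\<^sup>2 > 0" using \<epsilon> by simp
      moreover have "15 * (\<epsilon> / 6)\<^sup>2 = 15/36 * \<epsilon>\<^sup>2" by (simp add: power_divide)
      moreover have "3 * \<omega>\<^sup>2 * m = 3 * (\<omega>\<^sup>2 * m)" by simp
      ultimately show ?thesis by linarith
    qed
    finally have "L2_norm M (\<lambda>x. avg (eseq n) f x - f x) < \<epsilon>" by (rule power2_less_imp_less) (use \<epsilon> in simp)
    then show ?thesis by simp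
  qed
  then show "\<exists>no. \<forall>n\<ge>no. norm (L2_norm M (\<lambda>x. avg (eseq n) f x - f x) - 0) < \<epsilon>" by blast
qed

end

section \<open>The Sobolev space of a star-shaped set\<close>

lemma square_integrable_nth:
  fixes f :: "'a \<Rightarrow> point"
  assumes "square_integrable M f" shows "square_integrable M (\<lambda>x. f x $ i)"
proof (rule square_integrableI)
  show m: "(\<lambda>x. f x $ i) \<in> borel_measurable M"
    using assms unfolding square_integrable_def cart_eq_inner_axis by (intro borel_measurable_inner) auto
  show "integrable M (\<lambda>x. (norm (f x $ i))\<^sup>2)"
  proof (rule Bochner_Integration.integrable_bound)
    show "integrable M (\<lambda>x. (norm (f x))\<^sup>2)" using assms by (simp add: square_integrable_def)
    show "AE x in M. norm ((norm (f x $ i))\<^sup>2) \<le> norm ((norm (f x))\<^sup>2)"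
    proof (rule AE_I2)
      fix x show "norm ((norm (f x $ i))\<^sup>2) \<le> norm ((norm (f x))\<^sup>2)"
        using power_mono[OF component_le_norm_cart[of "f x" i] abs_ge_zero, of 2] by (simp add: add.commute)
    qed
  qed (use m in measurable)
qed

lemma norm_point_power2: "(norm (x::point))\<^sup>2 = (\<Sum>i\<in>UNIV. (x $ i)\<^sup>2)"
  by (simp add: norm_vec_def L2_set_def sum_nonneg)

lemma L2_norm_components:
  fixes f :: "'a \<Rightarrow> point"
  assumes "square_integrable M f"
  shows "(L2_norm M f)\<^sup>2 = (\<Sum>i\<in>UNIV. (L2_norm M (\<lambda>x. f x $ i))\<^sup>2)"
proof -
  have "integrable M (\<lambda>x. (f x $ i)\<^sup>2)" for i
    using square_integrable_power2[OF square_integrable_nth[OF assms]] .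
  then show ?thesis by (simp add: L2_norm_power2 norm_point_power2)
qed

lemma integrable_bounded_scaleR:
  fixes f :: "'a \<Rightarrow> 'b::{banach, second_countable_topology}"
  assumes "integrable M f" "w \<in> borel_measurable M" "\<And>x. \<bar>w x\<bar> \<le> B"
  shows "integrable M (\<lambda>x. w x *\<^sub>R f x)"
proof (rule Bochner_Integration.integrable_bound)
  show "integrable M (\<lambda>x. B *\<^sub>R f x)" using assms by simp
  show "(\<lambda>x. w x *\<^sub>R f x) \<in> borel_measurable M" using assms by auto
  show "AE x in M. norm (w x *\<^sub>R f x) \<le> norm (B *\<^sub>R f x)"
  proof (rule AE_I2)
    fix x show "norm (w x *\<^sub>R f x) \<le> norm (B *\<^sub>R f x)"
      using mult_right_mono[OF order_trans[OF assms(3)[of x] abs_ge_self], of "norm (f x)"] by simp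
  qed
qed

lemma test_function_bounded:
  assumes "test_function K \<phi>" "\<forall>x. GDERIV \<phi> x :> d\<phi> x"
  obtains B where "\<And>x. \<bar>\<phi> x\<bar> \<le> B" "\<And>x. norm (d\<phi> x) \<le> B" 
    "continuous_on UNIV \<phi>" "continuous_on UNIV d\<phi>"
proof -
  have s: "smooth \<phi>" and "compact (closure {x. \<phi> x \<noteq> 0})" using assms(1) by (auto simp: test_function_def)
  then have b: "bounded {x. \<phi> x \<noteq> 0}" by (meson bounded_subset closure_subset compact_imp_bounded)
  have d: "d\<phi> = gradient \<phi>" using assms(2) gradient_eq by (metis ext)
  obtain B1 where B1: "\<And>x. norm (\<phi> x) \<le> B1"
    using continuous_bounded_support[OF smooth_continuous[OF s] b] by blast
  obtain B2 where B2: "\<And>x. norm (d\<phi> x) \<le> B2" unfolding d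
    using continuous_bounded_support[OF smooth_gradient_continuous[OF s] gradient_bounded_support(1)[OF s b]] by blast
  show ?thesis
    using that[of "max B1 B2"] B1 B2 smooth_continuous[OF s] smooth_gradient_continuous[OF s]
    unfolding d by (simp add: max.coboundedI1 max.coboundedI2)
qed

section \<open>Weak gradients and the linear structure of the Sobolev space\<close>

context star_cell
begin

lemma square_integrable_smooth: "smooth f \<Longrightarrow> square_integrable M f"
  by (rule square_integrable_continuous[OF open_K bounded_K smooth_continuous])

lemma square_integrable_gradient: "smooth f \<Longrightarrow> square_integrable M (gradient f)"
  by (rule square_integrable_continuous[OF open_K bounded_K smooth_gradient_continuous])

text \<open>The link between averages and weak gradients: the defining identity of the weak gradient
  may be used with the kernel itself, as the dilation moves its support away from the boundary of
  \<open>K\<close>.\<close>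

lemma kernel_test_function:
  assumes "0 < e" "e < 1" "x \<in> K"
  shows "test_function K (kernel e x)" "GDERIV (kernel e x) z :> gradient (psi e) (z - (1 - e) *\<^sub>R x)"
proof -
  have s: "smooth (kernel e x)"
    using smooth_affine[OF smooth_psi, where a = 1 and b = "- ((1 - e) *\<^sub>R x)"] by (simp add: kernel_def[abs_def])
  let ?S = "cball ((1 - e) *\<^sub>R x + e *\<^sub>R c) (2/3 * (e * r))"
  have "{z. kernel e x z \<noteq> 0} \<subseteq> ?S"
  proof
    fix z assume "z \<in> {z. kernel e x z \<noteq> 0}"
    then have "norm (z - (1 - e) *\<^sub>R x - e *\<^sub>R c) \<le> 2/3 * (e * r)"
      using psi_support[OF assms(1)] by (simp add: kernel_def)
    then show "z \<in> ?S" by (simp add: dist_norm norm_minus_commute diff_diff_eq)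
  qed
  then have sub: "closure {z. kernel e x z \<noteq> 0} \<subseteq> ?S" by (intro closure_minimal) auto
  moreover have "?S \<subseteq> K"
    using kernel_support_closed[OF assms] by (auto simp: dist_norm norm_minus_commute algebra_simps)
  moreover have "compact (closure {z. kernel e x z \<noteq> 0})"
    using sub by (meson bounded_cball bounded_subset closed_closure compact_eq_bounded_closed)
  ultimately show "test_function K (kernel e x)" using s by (auto simp: test_function_def)
  have "((\<lambda>z. z - (1 - e) *\<^sub>R x) has_derivative (\<lambda>h. h)) (at z)"
    by (auto intro!: derivative_eq_intros)
  from has_derivative_compose[OF this smooth_has_derivative[OF smooth_psi]]
  show "GDERIV (kernel e x) z :> gradient (psi e) (z - (1 - e) *\<^sub>R x)"
    by (simp add: gderiv_def kernel_def[abs_def])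
qed

lemma avg_nth:
  assumes "square_integrable M g" "e > 0"
  shows "(LINT z|M. kernel e x z *\<^sub>R g z) $ i = avg e (\<lambda>z. g z $ i) x"
proof -
  obtain B where B: "\<And>x z. norm (kernel e x z) \<le> B" using kernel_bounded[OF assms(2)] by blast
  have "integrable M (\<lambda>z. kernel e x z *\<^sub>R g z)"
    by (rule integrable_bounded_scaleR[OF square_integrable_integrable[OF assms(1)] 
        measurable_area_on[OF kernel_measurable(1)], of _ _ B]) (use B in simp)
  from integral_bounded_linear[OF bounded_linear_vec_nth this]
  show ?thesis by (simp add: avg_def mult.commute)
qed

text \<open>The derivative of the kernel in \<open>x\<close> is \<open>-(1 - e)\<close> times its
  derivative in \<open>z\<close>, and the defining identity of the weak gradient moves the latter
  onto \<open>u\<close>. The factor \<open>1 - e\<close> stems from the dilation.\<close>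

lemma weak_gradient_avg:
  assumes u: "square_integrable M u" and g: "square_integrable M g" "has_weak_gradient K u g"
    and e: "0 < e" "e < 1" and x: "x \<in> K"
  shows "gradient (avg e u) x $ i = (1 - e) * avg e (\<lambda>z. g z $ i) x"
proof -
  have "GDERIV (avg e u) x :> (- (1 - e)) *\<^sub>R (LINT z|M. u z *\<^sub>R gradient (psi e) (z - (1 - e) *\<^sub>R x))"
    unfolding avg_def[abs_def] kernel_def
    by (rule GDERIV_convolution[OF id_measurable_M square_integrable_integrable[OF u] smooth_psi
          psi_bounded_support[OF e(1)]])
  moreover have "(LINT z|M. u z *\<^sub>R gradient (psi e) (z - (1 - e) *\<^sub>R x)) = - (LINT z|M. kernel e x z *\<^sub>R g z)"
    by (rule g(2)[unfolded has_weak_gradient_def, rule_format,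
          OF kernel_test_function(1)[OF e x] kernel_test_function(2)[OF e x]])
  ultimately have "gradient (avg e u) x = (1 - e) *\<^sub>R (LINT z|M. kernel e x z *\<^sub>R g z)"
    using gradient_eq[of "avg e u" x] by (simp add: algebra_simps)
  then show ?thesis using avg_nth[OF g(1) e(1)] by simp
qed

text \<open>Both fields have the same averages, and the averages of a field converge to it in the
  square norm.\<close>

lemma weak_gradient_unique:
  assumes g: "square_integrable M g" "has_weak_gradient K u g"
    and g': "square_integrable M g'" "has_weak_gradient K u g'"
  shows "AE x in M. g x = g' x"
proof -
  have "AE x in M. g x $ i - g' x $ i = 0" for i
  proof -
    let ?d = "\<lambda>x. g x $ i - g' x $ i"
    have d: "square_integrable M ?d" by (intro square_integrable_diff square_integrable_nth g g')
    have z: "avg e ?d x = 0" if e: "0 < e" "e < 1" and x: "x \<in> K" for e x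
    proof -
      have i: "integrable M (\<lambda>z. f z $ i * kernel e x z)" if "square_integrable M f" for f :: "point \<Rightarrow> point"
        by (rule integrable_kernel_mult[OF e(1) square_integrable_integrable[OF square_integrable_nth[OF that]]])
      have "(LINT z|M. kernel e x z *\<^sub>R g z) = (LINT z|M. kernel e x z *\<^sub>R g' z)"
        using g(2)[unfolded has_weak_gradient_def, rule_format,
            OF kernel_test_function(1)[OF e x] kernel_test_function(2)[OF e x]]
          g'(2)[unfolded has_weak_gradient_def, rule_format,
            OF kernel_test_function(1)[OF e x] kernel_test_function(2)[OF e x]]
        by simp
      then have "avg e (\<lambda>z. g z $ i) x = avg e (\<lambda>z. g' z $ i) x"
        using avg_nth[OF g(1) e(1), of x i] avg_nth[OF g'(1) e(1), of x i] by simp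
      then show ?thesis using i[OF g(1)] i[OF g'(1)] by (simp add: avg_def left_diff_distrib)
    qed
    \<comment> \<open>All averages of the difference vanish on \<open>K\<close>, so the
      approximation error is the constant \<open>L2_norm M ?d\<close>.\<close>
    have "L2_norm M (\<lambda>x. avg (eseq n) ?d x - ?d x) = L2_norm M ?d" for n
    proof -
      have "L2_norm M (\<lambda>x. avg (eseq n) ?d x - ?d x) = L2_norm M (\<lambda>x. - ?d x)"
        unfolding L2_norm_def
        by (rule arg_cong[of _ _ sqrt], rule Bochner_Integration.integral_cong[OF refl])
           (use z[of "eseq n"] in \<open>simp add: space_M\<close>)
      then show ?thesis by (simp only: L2_norm_minus)
    qed
    then have "(\<lambda>n. L2_norm M ?d) \<longlonglongrightarrow> 0" using avg_tendsto[OF d] by simp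
    then have "L2_norm M ?d = 0" by (simp add: LIMSEQ_const_iff)
    then show ?thesis using L2_norm_eq_0_iff[OF d] by simp
  qed
  then have "AE x in M. \<forall>i. g x $ i - g' x $ i = 0" by (simp add: AE_all_countable)
  then show ?thesis by eventually_elim (simp add: vec_eq_iff)
qed

lemma H1_square_integrable: "u \<in> H1 K \<Longrightarrow> square_integrable M u"
  by (simp add: H1_def)

lemma H1_I: "square_integrable M u \<Longrightarrow> square_integrable M g \<Longrightarrow> has_weak_gradient K u g \<Longrightarrow> u \<in> H1 K"
  by (auto simp: H1_def)

lemma grad_props:
  assumes "u \<in> H1 K"
  shows "square_integrable M (grad K u)" "has_weak_gradient K u (grad K u)"
proof -
  have "\<exists>g. square_integrable M g \<and> has_weak_gradient K u g" using assms by (simp add: H1_def)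
  from someI_ex[OF this] show "square_integrable M (grad K u)" "has_weak_gradient K u (grad K u)"
    by (auto simp: grad_def)
qed

lemma grad_eq:
  assumes "square_integrable M u" "square_integrable M g" "has_weak_gradient K u g"
  shows "u \<in> H1 K" "AE x in M. grad K u x = g x"
proof -
  show u: "u \<in> H1 K" using assms by (rule H1_I)
  show "AE x in M. grad K u x = g x"
    by (rule weak_gradient_unique[OF grad_props[OF u] assms(2,3)])
qed

lemma weak_gradient_lincomb:
  assumes u: "u \<in> H1 K" and v: "v \<in> H1 K"
  shows "has_weak_gradient K (\<lambda>x. a * u x + b * v x) (\<lambda>x. a *\<^sub>R grad K u x + b *\<^sub>R grad K v x)"
  unfolding has_weak_gradient_def
proof (intro allI impI)
  fix \<phi> d\<phi> assume t: "test_function K \<phi>" and d: "\<forall>x. GDERIV \<phi> x :> d\<phi> x"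
  obtain B where B: "\<And>x. \<bar>\<phi> x\<bar> \<le> B" "\<And>x. norm (d\<phi> x) \<le> B" 
    and c: "continuous_on UNIV \<phi>" "continuous_on UNIV d\<phi>"
    using test_function_bounded[OF t d] by blast
  have m: "\<phi> \<in> borel_measurable M" "d\<phi> \<in> borel_measurable M"
    using c by (auto intro: measurable_area_on borel_measurable_continuous_onI)
  have i1: "integrable M (\<lambda>x. w x *\<^sub>R d\<phi> x)" if "w \<in> H1 K" for w
    by (rule integrable_mult_bounded[OF square_integrable_integrable[OF H1_square_integrable[OF that]] m(2) B(2)])
  have i2: "integrable M (\<lambda>x. \<phi> x *\<^sub>R grad K w x)" if "w \<in> H1 K" for w
    by (rule integrable_bounded_scaleR[OF square_integrable_integrable[OF grad_props(1)[OF that]] m(1) B(1)])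
  have w: "(LINT x|M. w x *\<^sub>R d\<phi> x) = - (LINT x|M. \<phi> x *\<^sub>R grad K w x)" if "w \<in> H1 K" for w
    using grad_props(2)[OF that] t d unfolding has_weak_gradient_def by blast
  have "(LINT x|M. (a * u x + b * v x) *\<^sub>R d\<phi> x)
     = (LINT x|M. a *\<^sub>R (u x *\<^sub>R d\<phi> x) + b *\<^sub>R (v x *\<^sub>R d\<phi> x))"
    by (simp add: scaleR_add_left)
  also have "\<dots> = a *\<^sub>R (LINT x|M. u x *\<^sub>R d\<phi> x) + b *\<^sub>R (LINT x|M. v x *\<^sub>R d\<phi> x)"
    using i1[OF u] i1[OF v]
    by (subst Bochner_Integration.integral_add) (auto simp del: scaleR_scaleR)
  also have "\<dots> = - (a *\<^sub>R (LINT x|M. \<phi> x *\<^sub>R grad K u x) + b *\<^sub>R (LINT x|M. \<phi> x *\<^sub>R grad K v x))"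
    by (simp add: w u v)
  also have "a *\<^sub>R (LINT x|M. \<phi> x *\<^sub>R grad K u x) + b *\<^sub>R (LINT x|M. \<phi> x *\<^sub>R grad K v x)
     = (LINT x|M. a *\<^sub>R (\<phi> x *\<^sub>R grad K u x) + b *\<^sub>R (\<phi> x *\<^sub>R grad K v x))"
    using i2[OF u] i2[OF v]
    by (subst Bochner_Integration.integral_add) (auto simp del: scaleR_scaleR)
  also have "\<dots> = (LINT x|M. \<phi> x *\<^sub>R (a *\<^sub>R grad K u x + b *\<^sub>R grad K v x))"
    by (intro Bochner_Integration.integral_cong) (auto simp: scaleR_add_right mult.commute)
  finally show "(LINT x|M. (a * u x + b * v x) *\<^sub>R d\<phi> x)
     = - (LINT x|M. \<phi> x *\<^sub>R (a *\<^sub>R grad K u x + b *\<^sub>R grad K v x))" .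
qed

lemma H1_lincomb:
  assumes u: "u \<in> H1 K" and v: "v \<in> H1 K"
  shows "(\<lambda>x. a * u x + b * v x) \<in> H1 K"
    and "AE x in M. grad K (\<lambda>x. a * u x + b * v x) x = a *\<^sub>R grad K u x + b *\<^sub>R grad K v x"
  by (intro grad_eq[OF _ _ weak_gradient_lincomb[OF assms]] square_integrable_add square_integrable_cmult
      square_integrable_scaleR H1_square_integrable grad_props u v)+

lemma H1_add: "u \<in> H1 K \<Longrightarrow> v \<in> H1 K \<Longrightarrow> (\<lambda>x. u x + v x) \<in> H1 K"
  using H1_lincomb(1)[of u v 1 1] by simp

lemma H1_cmult: "u \<in> H1 K \<Longrightarrow> (\<lambda>x. a * u x) \<in> H1 K"
  using H1_lincomb(1)[of u u a 0] by simp

lemma H1_diff: "u \<in> H1 K \<Longrightarrow> v \<in> H1 K \<Longrightarrow> (\<lambda>x. u x - v x) \<in> H1 K"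
  using H1_lincomb(1)[of u v 1 "-1"] by simp

lemma grad_add: "u \<in> H1 K \<Longrightarrow> v \<in> H1 K \<Longrightarrow> AE x in M. grad K (\<lambda>x. u x + v x) x = grad K u x + grad K v x"
  using H1_lincomb(2)[of u v 1 1] by simp

lemma grad_diff: "u \<in> H1 K \<Longrightarrow> v \<in> H1 K \<Longrightarrow> AE x in M. grad K (\<lambda>x. u x - v x) x = grad K u x - grad K v x"
  using H1_lincomb(2)[of u v 1 "-1"] by simp

lemma grad_cmult: "u \<in> H1 K \<Longrightarrow> AE x in M. grad K (\<lambda>x. a * u x) x = a *\<^sub>R grad K u x"
  using H1_lincomb(2)[of u u a 0] by simp

lemma H1_smooth: "smooth f \<Longrightarrow> f \<in> H1 K"
  by (rule smooth_in_H1[OF open_K bounded_K])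

lemma grad_smooth: "smooth f \<Longrightarrow> AE x in M. grad K f x = gradient f x"
  by (intro grad_eq(2) square_integrable_smooth square_integrable_gradient smooth_has_weak_gradient open_K)

lemma H1_const: "(\<lambda>x. a) \<in> H1 K" by (rule H1_smooth[OF smooth_const])

lemma grad_const: "AE x in M. grad K (\<lambda>x. a) x = 0"
  using grad_smooth[OF smooth_const[of a]] gradient_eq[OF GDERIV_const] by simp

text \<open>Relates two notions of zero: \<open>dual_seminorm\<close> and \<open>V_zero\<close>
  refer to the values of a function, while the seminorm refers to its gradient.\<close>

lemma H1_AE_0:
  assumes "u \<in> borel_measurable M" "AE x in M. u x = 0"
  shows "u \<in> H1 K" "AE x in M. grad K u x = 0"
proof -
  have "square_integrable M (\<lambda>x. 0 :: real)" "square_integrable M (\<lambda>x. 0 :: point)"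
    by (intro square_integrable_const finite_M)+
  moreover from this(1) have "square_integrable M u"
    by (rule square_integrable_cong_AE) (use assms in auto)
  moreover have "has_weak_gradient K u (\<lambda>x. 0)"
    unfolding has_weak_gradient_def
  proof (intro allI impI)
    fix \<phi> d\<phi> assume t: "test_function K \<phi>" and d: "\<forall>x. GDERIV \<phi> x :> d\<phi> x"
    obtain B where "continuous_on UNIV d\<phi>" using test_function_bounded[OF t d] by blast
    then have "d\<phi> \<in> borel_measurable M" by (intro measurable_area_on borel_measurable_continuous_onI)
    then have "(LINT x|M. u x *\<^sub>R d\<phi> x) = (LINT x|M. 0)"
      by (intro integral_cong_AE) (use assms in auto)
    then show "(LINT x|M. u x *\<^sub>R d\<phi> x) = - (LINT x|M. \<phi> x *\<^sub>R 0)" by simp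
  qed
  ultimately show "u \<in> H1 K" "AE x in M. grad K u x = 0" using grad_eq by blast+
qed

text \<open>Discrete functions are polynomials on \<open>K\<close> only and arbitrary elsewhere, so
  the values outside must not matter.\<close>

lemma H1_cong:
  assumes "\<And>x. x \<in> K \<Longrightarrow> u x = v x" "v \<in> H1 K" shows "u \<in> H1 K"
proof -
  have "has_weak_gradient K u (grad K v)"
  proof -
    have "(LINT x|M. u x *\<^sub>R d\<phi> x) = (LINT x|M. v x *\<^sub>R d\<phi> x)" for d\<phi> :: "point \<Rightarrow> point"
      by (rule Bochner_Integration.integral_cong) (auto simp: space_M assms(1))
    then show ?thesis using grad_props(2)[OF assms(2)] unfolding has_weak_gradient_def by simp
  qed
  moreover have "square_integrable M u"
    using H1_square_integrable[OF assms(2)] assms(1) measurable_cong[of M u v borel]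
      Bochner_Integration.integrable_cong[of M M "\<lambda>x. (norm (u x))\<^sup>2" "\<lambda>x. (norm (v x))\<^sup>2"]
    by (simp add: square_integrable_def space_M)
  ultimately show ?thesis using grad_props(1)[OF assms(2)] H1_I by blast
qed

section \<open>Seminorm, norm and density of smooth functions\<close>

lemma H1_seminorm_nonneg [simp]: "0 \<le> H1_seminorm K u" by (simp add: H1_seminorm_def)

lemma H1_seminorm_eq:
  assumes "u \<in> H1 K" "g \<in> borel_measurable M" "AE x in M. grad K u x = g x"
  shows "H1_seminorm K u = L2_norm M g"
  unfolding H1_seminorm_def
  by (intro L2_norm_cong_AE assms square_integrable_measurable grad_props)

lemma H1_seminorm_smooth: "smooth f \<Longrightarrow> H1_seminorm K f = L2_norm M (gradient f)"
  by (intro H1_seminorm_eq H1_smooth grad_smooth square_integrable_measurable square_integrable_gradient)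

lemma H1_seminorm_cmult: "u \<in> H1 K \<Longrightarrow> H1_seminorm K (\<lambda>x. a * u x) = \<bar>a\<bar> * H1_seminorm K u"
  using H1_seminorm_eq[OF H1_cmult _ grad_cmult]
    square_integrable_measurable[OF square_integrable_scaleR[OF grad_props(1)]]
  by (simp add: L2_norm_scaleR H1_seminorm_def)

lemma H1_seminorm_add:
  assumes "u \<in> H1 K" "v \<in> H1 K"
  shows "H1_seminorm K (\<lambda>x. u x + v x) \<le> H1_seminorm K u + H1_seminorm K v"
proof -
  have "H1_seminorm K (\<lambda>x. u x + v x) = L2_norm M (\<lambda>x. grad K u x + grad K v x)"
    by (intro H1_seminorm_eq H1_add grad_add assms square_integrable_measurable square_integrable_add grad_props)
  then show ?thesis
    using L2_norm_triangle[OF grad_props(1)[OF assms(1)] grad_props(1)[OF assms(2)]] by (simp add: H1_seminorm_def)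
qed

lemma H1_seminorm_diff:
  assumes "u \<in> H1 K" "v \<in> H1 K"
  shows "H1_seminorm K (\<lambda>x. u x - v x) \<le> H1_seminorm K u + H1_seminorm K v"
  using H1_seminorm_add[OF assms(1) H1_cmult[OF assms(2), of "-1"]] H1_seminorm_cmult[OF assms(2), of "-1"]
  by simp

lemma H1_seminorm_const: "H1_seminorm K (\<lambda>x. a) = 0"
proof -
  have "H1_seminorm K (\<lambda>x. a) = L2_norm M (\<lambda>x. 0 :: point)"
    by (intro H1_seminorm_eq H1_const grad_const) auto
  then show ?thesis by (simp add: L2_norm_def)
qed

lemma H1_seminorm_add_const:
  assumes "u \<in> H1 K" shows "H1_seminorm K (\<lambda>x. u x + a) = H1_seminorm K u"
  using H1_seminorm_add[OF assms H1_const, of a] H1_seminorm_diff[OF H1_add[OF assms H1_const] H1_const, of a a]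
  by (simp add: H1_seminorm_const)

lemma L2_le_H1_norm: "L2_norm M u \<le> H1_norm K u"
  unfolding H1_norm_def by (intro real_le_rsqrt) simp

lemma H1_seminorm_le_norm: "H1_seminorm K u \<le> H1_norm K u"
  unfolding H1_norm_def by (intro real_le_rsqrt) simp

lemma H1_norm_le: "H1_norm K u \<le> L2_norm M u + H1_seminorm K u"
  unfolding H1_norm_def by (rule sqrt_sum_squares_le_sum) auto

lemma H1_norm_nonneg [simp]: "H1_norm K u \<ge> 0" by (simp add: H1_norm_def)

text \<open>By \<open>weak_gradient_avg\<close> the gradient of an average is, up to the factor
  \<open>1 - e\<close>, the average of the gradient, so values and gradients both converge by
  \<open>avg_tendsto\<close>. The averages are smooth on the whole plane.\<close>

lemma smooth_dense_H1:
  assumes u: "u \<in> H1 K"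
  obtains \<phi> where "\<And>n::nat. smooth (\<phi> n)" "(\<lambda>n. H1_norm K (\<lambda>x. \<phi> n x - u x)) \<longlonglongrightarrow> 0"
proof -
  have us: "square_integrable M u" by (rule H1_square_integrable[OF u])
  let ?g = "\<lambda>i x. grad K u x $ i"
  note gs = grad_props(1)[OF u]
  define \<phi> where "\<phi> n = avg (eseq n) u" for n
  have s: "smooth (\<phi> n)" for n unfolding \<phi>_def by (rule smooth_avg[OF us]) simp
  have comp: "(\<lambda>n. L2_norm M (\<lambda>x. gradient (\<phi> n) x $ i - ?g i x)) \<longlonglongrightarrow> 0" for i
  proof (rule tendsto_sandwich[OF _ _ tendsto_const])
    have gi: "square_integrable M (?g i)" by (rule square_integrable_nth[OF gs])
    show "\<forall>\<^sub>F n in sequentially. L2_norm M (\<lambda>x. gradient (\<phi> n) x $ i - ?g i x)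
        \<le> L2_norm M (\<lambda>x. avg (eseq n) (?g i) x - ?g i x) + eseq n * L2_norm M (?g i)"
    proof (rule always_eventually, rule allI)
      fix n
      have e: "0 < eseq n" "eseq n < 1" by auto
      have d: "square_integrable M (\<lambda>x. avg (eseq n) (?g i) x - ?g i x)"
        by (intro square_integrable_diff square_integrable_smooth smooth_avg gi e)
      have "L2_norm M (\<lambda>x. gradient (\<phi> n) x $ i - ?g i x)
          = L2_norm M (\<lambda>x. (1 - eseq n) *\<^sub>R (avg (eseq n) (?g i) x - ?g i x) + (- eseq n) *\<^sub>R ?g i x)"
      proof -
        \<comment> \<open>The factor \<open>1 - e\<close> leaves the extra term \<open>- e\<close>
          times the gradient, which tends to 0.\<close>
        have eq: "gradient (\<phi> n) x $ i - ?g i x = (1 - eseq n) *\<^sub>R (avg (eseq n) (?g i) x - ?g i x) + (- eseq n) *\<^sub>R ?g i x"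
          if "x \<in> K" for x
          using weak_gradient_avg[OF us grad_props[OF u] e that, of i] unfolding \<phi>_def
          by (simp add: algebra_simps)
        show ?thesis unfolding L2_norm_def
          by (rule arg_cong[of _ _ sqrt], rule Bochner_Integration.integral_cong[OF refl])
             (simp only: space_M eq)
      qed
      also have "\<dots> \<le> L2_norm M (\<lambda>x. (1 - eseq n) *\<^sub>R (avg (eseq n) (?g i) x - ?g i x))
          + L2_norm M (\<lambda>x. (- eseq n) *\<^sub>R ?g i x)"
        by (intro L2_norm_triangle square_integrable_scaleR d gi)
      also have "\<dots> = \<bar>1 - eseq n\<bar> * L2_norm M (\<lambda>x. avg (eseq n) (?g i) x - ?g i x) + eseq n * L2_norm M (?g i)"
        unfolding L2_norm_scaleR by simp
      also have "\<dots> \<le> 1 * L2_norm M (\<lambda>x. avg (eseq n) (?g i) x - ?g i x) + eseq n * L2_norm M (?g i)"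
        using e by (intro add_right_mono mult_right_mono) (auto simp: abs_le_iff)
      finally show "L2_norm M (\<lambda>x. gradient (\<phi> n) x $ i - ?g i x)
        \<le> L2_norm M (\<lambda>x. avg (eseq n) (?g i) x - ?g i x) + eseq n * L2_norm M (?g i)" by simp
    qed
    have "(\<lambda>n. eseq n) \<longlonglongrightarrow> 0"
      using LIMSEQ_ignore_initial_segment[OF lim_1_over_n[where 'a = real], of 2] by (simp add: add.commute)
    then show "(\<lambda>n. L2_norm M (\<lambda>x. avg (eseq n) (?g i) x - ?g i x) + eseq n * L2_norm M (?g i)) \<longlonglongrightarrow> 0"
      using tendsto_add[OF avg_tendsto[OF gi] tendsto_mult_left_zero[of eseq sequentially "L2_norm M (?g i)"]] by simp
  qed auto
  have semi: "(\<lambda>n. H1_seminorm K (\<lambda>x. \<phi> n x - u x)) \<longlonglongrightarrow> 0"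
  proof -
    have dd: "square_integrable M (\<lambda>x. gradient (\<phi> n) x - grad K u x)" for n
      by (intro square_integrable_diff square_integrable_gradient gs s)
    have "H1_seminorm K (\<lambda>x. \<phi> n x - u x) = L2_norm M (\<lambda>x. gradient (\<phi> n) x - grad K u x)" for n
    proof (rule H1_seminorm_eq[OF H1_diff[OF H1_smooth[OF s] u] square_integrable_measurable[OF dd]])
      show "AE x in M. grad K (\<lambda>x. \<phi> n x - u x) x = gradient (\<phi> n) x - grad K u x"
        using grad_diff[OF H1_smooth[OF s[of n]] u] grad_smooth[OF s[of n]] by eventually_elim simp
    qed
    then have eq: "H1_seminorm K (\<lambda>x. \<phi> n x - u x) = sqrt (\<Sum>i\<in>UNIV. (L2_norm M (\<lambda>x. gradient (\<phi> n) x $ i - ?g i x))\<^sup>2)" for n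
      using L2_norm_components[OF dd[of n]] by (simp add: real_sqrt_unique[symmetric])
    have "(\<lambda>n. sqrt (\<Sum>i\<in>UNIV. (L2_norm M (\<lambda>x. gradient (\<phi> n) x $ i - ?g i x))\<^sup>2)) \<longlonglongrightarrow> sqrt (\<Sum>i\<in>(UNIV::2 set). 0\<^sup>2)"
      by (intro tendsto_intros comp)
    then show ?thesis unfolding eq by simp
  qed
  have "(\<lambda>n. H1_norm K (\<lambda>x. \<phi> n x - u x)) \<longlonglongrightarrow> 0"
  proof (rule tendsto_sandwich[OF _ _ tendsto_const])
    show "(\<lambda>n. L2_norm M (\<lambda>x. \<phi> n x - u x) + H1_seminorm K (\<lambda>x. \<phi> n x - u x)) \<longlonglongrightarrow> 0"
      using tendsto_add[OF avg_tendsto[OF us] semi] by (simp add: \<phi>_def)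
  qed (auto simp: H1_norm_le)
  then show ?thesis using that s by blast
qed

end

section \<open>The Poincare inequality\<close>

text \<open>Cauchy-Schwarz on the unit interval. With values in \<open>ennreal\<close> the integrals
  can later be interchanged without integrability conditions.\<close>

lemma nn_integral_FTC_power2:
  fixes F f :: "real \<Rightarrow> real"
  assumes F: "\<And>x. DERIV F x :> f x" and f: "continuous_on UNIV f"
  shows "ennreal ((F 1 - F 0)\<^sup>2) \<le> (\<integral>\<^sup>+s. ennreal ((f s)\<^sup>2) * indicator {0..1} s \<partial>lborel)"
proof -
  have [measurable]: "f \<in> borel_measurable borel" using f by (rule borel_measurable_continuous_onI)
  have b: "has_bochner_integral lborel (\<lambda>x. f x * indicator {0..1} x) (F 1 - F 0)"
    by (rule has_bochner_integral_FTC_Icc_real) (use F f in \<open>auto simp: continuous_on_eq_continuous_at\<close>)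
  have "ennreal \<bar>F 1 - F 0\<bar> \<le> (\<integral>\<^sup>+s. ennreal \<bar>f s * indicator {0..1} s\<bar> \<partial>lborel)"
    using has_bochner_integral_norm_bound[OF b] by simp
  also have "\<dots> = (\<integral>\<^sup>+s. (ennreal \<bar>f s\<bar> * indicator {0..1} s) * indicator {0..1} s \<partial>lborel)"
    by (intro nn_integral_cong) (auto simp: indicator_def)
  finally have "(ennreal \<bar>F 1 - F 0\<bar>)\<^sup>2 \<le> (\<integral>\<^sup>+s. (ennreal \<bar>f s\<bar> * indicator {0..1} s) * indicator {0..1} s \<partial>lborel)\<^sup>2"
    by (rule power_mono) simp
  also have "\<dots> \<le> (\<integral>\<^sup>+s. (ennreal \<bar>f s\<bar> * indicator {0..1} s)\<^sup>2 \<partial>lborel) * (\<integral>\<^sup>+s. (indicator {0..1::real} s)\<^sup>2 \<partial>lborel)"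
    by (rule Cauchy_Schwarz_nn_integral[of "\<lambda>s. ennreal \<bar>f s\<bar> * indicator {0..1} s" lborel "indicator {0..1}"]) auto
  also have "(\<integral>\<^sup>+s. (indicator {0..1::real} s)\<^sup>2 \<partial>lborel) = (\<integral>\<^sup>+s. indicator {0..1::real} s \<partial>lborel)"
    by (intro nn_integral_cong) (auto simp: indicator_def)
  also have "\<dots> = 1" by simp
  also have "(\<integral>\<^sup>+s. (ennreal \<bar>f s\<bar> * indicator {0..1} s)\<^sup>2 \<partial>lborel) = (\<integral>\<^sup>+s. ennreal ((f s)\<^sup>2) * indicator {0..1} s \<partial>lborel)"
    by (intro nn_integral_cong) (auto simp: indicator_def ennreal_power)
  finally show ?thesis by (simp add: ennreal_power)
qed

text \<open>The one-sided companion: only an upper bound of the derivative enters, and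
  \<open>ennreal\<close> cuts off a negative left-hand side.\<close>

lemma nn_integral_FTC_upper:
  fixes F f g :: "real \<Rightarrow> real"
  assumes F: "\<And>x. DERIV F x :> f x" and f: "continuous_on UNIV f" 
    and g: "\<And>x. x \<in> {0..1} \<Longrightarrow> f x \<le> g x"
  shows "ennreal (F 1 - F 0) \<le> (\<integral>\<^sup>+s. ennreal (g s) * indicator {0..1} s \<partial>lborel)"
proof -
  have b: "has_bochner_integral lborel (\<lambda>x. f x * indicator {0..1} x) (F 1 - F 0)"
    by (rule has_bochner_integral_FTC_Icc_real) (use F f in \<open>auto simp: continuous_on_eq_continuous_at\<close>)
  have "ennreal (F 1 - F 0) \<le> (\<integral>\<^sup>+s. ennreal (f s * indicator {0..1} s) \<partial>lborel)"
  proof -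
    have "F 1 - F 0 \<le> (LINT s|lborel. max 0 (f s * indicator {0..1} s))"
      using b by (subst has_bochner_integral_integral_eq[OF b, symmetric])
        (intro integral_mono, auto simp: has_bochner_integral_iff)
    then have "ennreal (F 1 - F 0) \<le> ennreal (LINT s|lborel. max 0 (f s * indicator {0..1} s))"
      by (rule ennreal_leI)
    also have "\<dots> = (\<integral>\<^sup>+s. ennreal (max 0 (f s * indicator {0..1} s)) \<partial>lborel)"
      using b by (intro nn_integral_eq_integral[symmetric]) (auto simp: has_bochner_integral_iff)
    finally have "ennreal (F 1 - F 0) \<le> (\<integral>\<^sup>+s. ennreal (max 0 (f s * indicator {0..1} s)) \<partial>lborel)" .
    moreover have "ennreal (max 0 t) = ennreal t" for t by (auto simp: max_def ennreal_neg)
    ultimately show ?thesis by simp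
  qed
  also have "\<dots> \<le> (\<integral>\<^sup>+s. ennreal (g s) * indicator {0..1} s \<partial>lborel)"
    by (intro nn_integral_mono) (use g in \<open>auto simp: indicator_def intro: ennreal_leI\<close>)
  finally show ?thesis .
qed

lemma smooth_along_line:
  assumes "smooth \<phi>"
  shows "DERIV (\<lambda>s. \<phi> (y + s *\<^sub>R v)) s :> v \<bullet> gradient \<phi> (y + s *\<^sub>R v)"
proof -
  have "((\<lambda>s. y + s *\<^sub>R v) has_derivative (\<lambda>h. h *\<^sub>R v)) (at s)"
    by (auto intro!: derivative_eq_intros)
  from has_derivative_compose[OF this smooth_has_derivative[OF assms]]
  show ?thesis by (simp add: has_field_derivative_def mult.commute[of _ "v \<bullet> _"])
qed

section \<open>Differences along segments from the disc\<close>

context star_cell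
begin

lemma segment_subset_K: "x \<in> K \<Longrightarrow> y \<in> ball c r \<Longrightarrow> s \<in> {0..1} \<Longrightarrow> y + s *\<^sub>R (x - y) \<in> K"
proof -
  assume *: "x \<in> K" "y \<in> ball c r" "s \<in> {0..1}"
  have "y + s *\<^sub>R (x - y) = (1 - s) *\<^sub>R y + s *\<^sub>R x" by (simp add: algebra_simps)
  then have "y + s *\<^sub>R (x - y) \<in> closed_segment y x" using *(3) by (auto simp: in_segment)
  then show ?thesis using star[OF *(2,1)] by blast
qed

text \<open>One of \<open>s\<close> and \<open>1 - s\<close> is at least \<open>1/2\<close>, so that the change of variables \<open>z = y + s *\<^sub>R (x - y)\<close>
  in the corresponding variable costs at most the factor 4.\<close>

lemma nn_integral_segment_average:
  fixes G :: "point \<Rightarrow> ennreal"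
  assumes [measurable]: "G \<in> borel_measurable borel" and s: "s \<in> {0..1}"
  shows "(\<integral>\<^sup>+x. (\<integral>\<^sup>+y. G (y + s *\<^sub>R (x - y)) * indicator (ball c r) y \<partial>lborel) * indicator K x \<partial>lborel)
    \<le> 4 * emeasure lborel K * (\<integral>\<^sup>+z. G z \<partial>lborel)" (is "?L \<le> _")
proof -
  have [measurable]: "K \<in> sets borel" "ball c r \<in> sets borel" using open_K by auto
  have quarter: "J \<le> 4 * (ennreal (a\<^sup>2) * J)" if "1/2 \<le> a" for J :: ennreal and a :: real
  proof -
    have "(1 :: real) \<le> 4 * a\<^sup>2" using that power_mono[of "1/2" a 2] by (simp add: power2_eq_square)
    then have "1 \<le> ennreal (4 * a\<^sup>2)" by (simp add: ennreal_ge_1)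
    then have "1 \<le> 4 * ennreal (a\<^sup>2)" by (simp add: ennreal_mult)
    from mult_right_mono[OF this] show ?thesis by (simp add: mult.assoc)
  qed
  let ?I = "\<integral>\<^sup>+z. G z \<partial>lborel"
  show ?thesis
  proof (cases "s \<le> 1/2")
    case True
    have "?L \<le> (\<integral>\<^sup>+x. (4 * ?I) * indicator K x \<partial>lborel)"
    proof (intro nn_integral_mono mult_right_mono)
      fix x
      have "(\<integral>\<^sup>+y. G (y + s *\<^sub>R (x - y)) * indicator (ball c r) y \<partial>lborel) \<le> (\<integral>\<^sup>+y. G ((1 - s) *\<^sub>R y + s *\<^sub>R x) \<partial>lborel)"
        by (intro nn_integral_mono) (auto simp: indicator_def algebra_simps)
      also have "\<dots> \<le> 4 * (ennreal ((1 - s)\<^sup>2) * \<dots>)" by (rule quarter) (use True in simp)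
      also have "\<dots> = 4 * ?I"
        using nn_integral_affine[of G "1 - s" "s *\<^sub>R x"] True by simp
      finally show "(\<integral>\<^sup>+y. G (y + s *\<^sub>R (x - y)) * indicator (ball c r) y \<partial>lborel) \<le> 4 * ?I" .
    qed simp
    also have "\<dots> = 4 * ?I * emeasure lborel K" by (rule nn_integral_cmult_indicator) simp
    also have "\<dots> = 4 * emeasure lborel K * ?I" by (simp add: mult_ac)
    finally show ?thesis .
  next
    case False
    have "?L = (\<integral>\<^sup>+x. (\<integral>\<^sup>+y. G (y + s *\<^sub>R (x - y)) * indicator (ball c r) y * indicator K x \<partial>lborel) \<partial>lborel)"
      by (intro nn_integral_cong nn_integral_multc[symmetric]) measurable
    also have "\<dots> = (\<integral>\<^sup>+y. (\<integral>\<^sup>+x. G (y + s *\<^sub>R (x - y)) * indicator (ball c r) y * indicator K x \<partial>lborel) \<partial>lborel)"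
      by (rule lborel_pair.Fubini'[symmetric]) measurable
    also have "\<dots> \<le> (\<integral>\<^sup>+y. (4 * ?I) * indicator (ball c r) y \<partial>lborel)"
    proof (intro nn_integral_mono)
      fix y
      have "(\<integral>\<^sup>+x. G (y + s *\<^sub>R (x - y)) * indicator (ball c r) y * indicator K x \<partial>lborel)
         \<le> (\<integral>\<^sup>+x. G (s *\<^sub>R x + (1 - s) *\<^sub>R y) * indicator (ball c r) y \<partial>lborel)"
        by (intro nn_integral_mono) (auto simp: indicator_def algebra_simps)
      also have "\<dots> = (\<integral>\<^sup>+x. G (s *\<^sub>R x + (1 - s) *\<^sub>R y) \<partial>lborel) * indicator (ball c r) y"
        by (simp add: nn_integral_multc)
      also have "\<dots> \<le> (4 * (ennreal (s\<^sup>2) * (\<integral>\<^sup>+x. G (s *\<^sub>R x + (1 - s) *\<^sub>R y) \<partial>lborel))) * indicator (ball c r) y"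
        by (intro mult_right_mono quarter) (use False in auto)
      also have "\<dots> = (4 * ?I) * indicator (ball c r) y"
        using nn_integral_affine[of G s "(1 - s) *\<^sub>R y"] False by simp
      finally show "(\<integral>\<^sup>+x. G (y + s *\<^sub>R (x - y)) * indicator (ball c r) y * indicator K x \<partial>lborel) \<le> (4 * ?I) * indicator (ball c r) y" .
    qed
    also have "\<dots> = 4 * ?I * emeasure lborel (ball c r)" by (rule nn_integral_cmult_indicator) simp
    also have "\<dots> = 4 * emeasure lborel (ball c r) * ?I" by (simp add: mult_ac)
    also have "\<dots> \<le> 4 * emeasure lborel K * ?I"
      by (intro mult_right_mono mult_left_mono emeasure_mono ball_subset) auto
    finally show ?thesis .
  qed
qed

text \<open>Write \<open>\<phi> x - \<phi> y\<close> as an integral over the segment from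
  \<open>y\<close> to \<open>x\<close>, move the integral over the parameter \<open>s\<close>
  outermost, and apply \<open>nn_integral_segment_average\<close> for each fixed
  \<open>s\<close>.\<close>

lemma nn_integral_difference_quotients:
  assumes \<phi>: "smooth \<phi>" and h: "\<And>x y. x \<in> K \<Longrightarrow> y \<in> K \<Longrightarrow> norm (x - y) \<le> h"
  shows "(\<integral>\<^sup>+x. (\<integral>\<^sup>+y. ennreal ((\<phi> x - \<phi> y)\<^sup>2) * indicator (ball c r) y \<partial>lborel) * indicator K x \<partial>lborel)
    \<le> ennreal (4 * h\<^sup>2 * measure lborel K * (H1_seminorm K \<phi>)\<^sup>2)"
proof -
  have [measurable]: "K \<in> sets borel" "ball c r \<in> sets borel" using open_K by auto
  have gm [measurable]: "gradient \<phi> \<in> borel_measurable borel" 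
    by (intro borel_measurable_continuous_onI smooth_gradient_continuous \<phi>)
  have pm [measurable]: "\<phi> \<in> borel_measurable borel" 
    by (intro borel_measurable_continuous_onI smooth_continuous \<phi>)
  \<comment> \<open>The indicator of \<open>K\<close> allows \<open>G\<close> to be integrated over
    the whole plane; on the segments it equals 1 by star-shapedness.\<close>
  define G where "G z = ennreal ((norm (gradient \<phi> z))\<^sup>2) * indicator K z" for z
  have [measurable]: "G \<in> borel_measurable borel" unfolding G_def by measurable
  have IG: "(\<integral>\<^sup>+z. G z \<partial>lborel) = ennreal ((H1_seminorm K \<phi>)\<^sup>2)"
  proof -
    have "(\<integral>\<^sup>+z. G z \<partial>lborel) = (\<integral>\<^sup>+z. ennreal ((norm (gradient \<phi> z))\<^sup>2) \<partial>M)"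
      unfolding G_def using open_K by (intro nn_integral_restrict_space[symmetric]) auto
    also have "\<dots> = ennreal (LINT z|M. (norm (gradient \<phi> z))\<^sup>2)"
      using square_integrable_gradient[OF \<phi>] by (intro nn_integral_eq_integral) (auto simp: square_integrable_def)
    finally show ?thesis by (simp add: H1_seminorm_smooth[OF \<phi>] L2_norm_power2)
  qed
  have pt: "ennreal ((\<phi> x - \<phi> y)\<^sup>2) \<le> (\<integral>\<^sup>+s. ennreal (h\<^sup>2) * G (y + s *\<^sub>R (x - y)) * indicator {0..1} s \<partial>lborel)"
    if x: "x \<in> K" and y: "y \<in> ball c r" for x y
  proof -
    have "ennreal ((\<phi> (y + 1 *\<^sub>R (x - y)) - \<phi> (y + 0 *\<^sub>R (x - y)))\<^sup>2)
       \<le> (\<integral>\<^sup>+s. ennreal (((x - y) \<bullet> gradient \<phi> (y + s *\<^sub>R (x - y)))\<^sup>2) * indicator {0..1} s \<partial>lborel)"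
      by (intro nn_integral_FTC_power2 smooth_along_line[OF \<phi>] continuous_intros
          continuous_on_compose2[OF smooth_gradient_continuous[OF \<phi>]]) auto
    also have "\<dots> \<le> (\<integral>\<^sup>+s. ennreal (h\<^sup>2) * G (y + s *\<^sub>R (x - y)) * indicator {0..1} s \<partial>lborel)"
    proof (intro nn_integral_mono)
      fix s :: real
      show "ennreal (((x - y) \<bullet> gradient \<phi> (y + s *\<^sub>R (x - y)))\<^sup>2) * indicator {0..1} s
         \<le> ennreal (h\<^sup>2) * G (y + s *\<^sub>R (x - y)) * indicator {0..1} s"
      proof (cases "s \<in> {0..1}")
        case True
        have "\<bar>(x - y) \<bullet> gradient \<phi> (y + s *\<^sub>R (x - y))\<bar> \<le> norm (x - y) * norm (gradient \<phi> (y + s *\<^sub>R (x - y)))"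
          by (rule Cauchy_Schwarz_ineq2)
        also have "\<dots> \<le> h * norm (gradient \<phi> (y + s *\<^sub>R (x - y)))"
          using h[OF x subsetD[OF ball_subset y]] by (intro mult_right_mono) auto
        finally have "\<bar>(x - y) \<bullet> gradient \<phi> (y + s *\<^sub>R (x - y))\<bar>\<^sup>2 \<le> (h * norm (gradient \<phi> (y + s *\<^sub>R (x - y))))\<^sup>2"
          by (rule power_mono) simp
        then have "ennreal (((x - y) \<bullet> gradient \<phi> (y + s *\<^sub>R (x - y)))\<^sup>2) \<le> ennreal (h\<^sup>2 * (norm (gradient \<phi> (y + s *\<^sub>R (x - y))))\<^sup>2)"
          by (intro ennreal_leI) (simp add: power_mult_distrib)
        then show ?thesis using True segment_subset_K[OF x y True] by (simp add: G_def ennreal_mult)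
      qed simp
    qed
    finally show ?thesis by simp
  qed
  have "(\<integral>\<^sup>+x. (\<integral>\<^sup>+y. ennreal ((\<phi> x - \<phi> y)\<^sup>2) * indicator (ball c r) y \<partial>lborel) * indicator K x \<partial>lborel)
    \<le> (\<integral>\<^sup>+x. (\<integral>\<^sup>+y. (\<integral>\<^sup>+s. ennreal (h\<^sup>2) * G (y + s *\<^sub>R (x - y)) * indicator {0..1} s \<partial>lborel) * indicator (ball c r) y \<partial>lborel) * indicator K x \<partial>lborel)"
  proof (intro nn_integral_mono)
    fix x
    show "(\<integral>\<^sup>+y. ennreal ((\<phi> x - \<phi> y)\<^sup>2) * indicator (ball c r) y \<partial>lborel) * indicator K x
       \<le> (\<integral>\<^sup>+y. (\<integral>\<^sup>+s. ennreal (h\<^sup>2) * G (y + s *\<^sub>R (x - y)) * indicator {0..1} s \<partial>lborel) * indicator (ball c r) y \<partial>lborel) * indicator K x"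
      using pt[of x] by (cases "x \<in> K") (auto intro!: nn_integral_mono simp: indicator_def)
  qed
  also have "\<dots> = (\<integral>\<^sup>+x. (\<integral>\<^sup>+s. (\<integral>\<^sup>+y. ennreal (h\<^sup>2) * G (y + s *\<^sub>R (x - y)) * indicator {0..1} s * indicator (ball c r) y \<partial>lborel) \<partial>lborel) * indicator K x \<partial>lborel)"
  proof (intro nn_integral_cong arg_cong2[where f = "(*)"] refl)
    fix x
    have "(\<integral>\<^sup>+y. (\<integral>\<^sup>+s. ennreal (h\<^sup>2) * G (y + s *\<^sub>R (x - y)) * indicator {0..1} s \<partial>lborel) * indicator (ball c r) y \<partial>lborel)
       = (\<integral>\<^sup>+y. (\<integral>\<^sup>+s. ennreal (h\<^sup>2) * G (y + s *\<^sub>R (x - y)) * indicator {0..1} s * indicator (ball c r) y \<partial>lborel) \<partial>lborel)"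
      by (intro nn_integral_cong nn_integral_multc[symmetric]) measurable
    also have "\<dots> = (\<integral>\<^sup>+s. (\<integral>\<^sup>+y. ennreal (h\<^sup>2) * G (y + s *\<^sub>R (x - y)) * indicator {0..1} s * indicator (ball c r) y \<partial>lborel) \<partial>lborel)"
      by (rule lborel_pair.Fubini'[symmetric]) measurable
    finally show "(\<integral>\<^sup>+y. (\<integral>\<^sup>+s. ennreal (h\<^sup>2) * G (y + s *\<^sub>R (x - y)) * indicator {0..1} s \<partial>lborel) * indicator (ball c r) y \<partial>lborel)
       = (\<integral>\<^sup>+s. (\<integral>\<^sup>+y. ennreal (h\<^sup>2) * G (y + s *\<^sub>R (x - y)) * indicator {0..1} s * indicator (ball c r) y \<partial>lborel) \<partial>lborel)" .
  qed
  also have "\<dots> = (\<integral>\<^sup>+x. (\<integral>\<^sup>+s. (\<integral>\<^sup>+y. ennreal (h\<^sup>2) * G (y + s *\<^sub>R (x - y)) * indicator {0..1} s * indicator (ball c r) y \<partial>lborel) * indicator K x \<partial>lborel) \<partial>lborel)"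
    by (intro nn_integral_cong nn_integral_multc[symmetric]) measurable
  also have "\<dots> = (\<integral>\<^sup>+s. (\<integral>\<^sup>+x. (\<integral>\<^sup>+y. ennreal (h\<^sup>2) * G (y + s *\<^sub>R (x - y)) * indicator {0..1} s * indicator (ball c r) y \<partial>lborel) * indicator K x \<partial>lborel) \<partial>lborel)"
    by (rule lborel_pair.Fubini'[symmetric]) measurable
  also have "\<dots> = (\<integral>\<^sup>+s. (ennreal (h\<^sup>2) * indicator {0..1} s) * (\<integral>\<^sup>+x. (\<integral>\<^sup>+y. G (y + s *\<^sub>R (x - y)) * indicator (ball c r) y \<partial>lborel) * indicator K x \<partial>lborel) \<partial>lborel)"
  proof (intro nn_integral_cong)
    fix s :: real
    have "(\<integral>\<^sup>+x. (\<integral>\<^sup>+y. ennreal (h\<^sup>2) * G (y + s *\<^sub>R (x - y)) * indicator {0..1} s * indicator (ball c r) y \<partial>lborel) * indicator K x \<partial>lborel)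
      = (\<integral>\<^sup>+x. (ennreal (h\<^sup>2) * indicator {0..1} s) * ((\<integral>\<^sup>+y. G (y + s *\<^sub>R (x - y)) * indicator (ball c r) y \<partial>lborel) * indicator K x) \<partial>lborel)"
    proof (intro nn_integral_cong)
      fix x
      have "(\<integral>\<^sup>+y. ennreal (h\<^sup>2) * G (y + s *\<^sub>R (x - y)) * indicator {0..1} s * indicator (ball c r) y \<partial>lborel)
        = (\<integral>\<^sup>+y. (ennreal (h\<^sup>2) * indicator {0..1} s) * (G (y + s *\<^sub>R (x - y)) * indicator (ball c r) y) \<partial>lborel)"
        by (intro nn_integral_cong) (simp add: mult_ac)
      also have "\<dots> = (ennreal (h\<^sup>2) * indicator {0..1} s) * (\<integral>\<^sup>+y. G (y + s *\<^sub>R (x - y)) * indicator (ball c r) y \<partial>lborel)"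
        by (rule nn_integral_cmult) measurable
      finally show "(\<integral>\<^sup>+y. ennreal (h\<^sup>2) * G (y + s *\<^sub>R (x - y)) * indicator {0..1} s * indicator (ball c r) y \<partial>lborel) * indicator K x
        = (ennreal (h\<^sup>2) * indicator {0..1} s) * ((\<integral>\<^sup>+y. G (y + s *\<^sub>R (x - y)) * indicator (ball c r) y \<partial>lborel) * indicator K x)"
        by (simp add: mult.assoc)
    qed
    also have "\<dots> = (ennreal (h\<^sup>2) * indicator {0..1} s) * (\<integral>\<^sup>+x. (\<integral>\<^sup>+y. G (y + s *\<^sub>R (x - y)) * indicator (ball c r) y \<partial>lborel) * indicator K x \<partial>lborel)"
      by (rule nn_integral_cmult) measurable
    finally show "(\<integral>\<^sup>+x. (\<integral>\<^sup>+y. ennreal (h\<^sup>2) * G (y + s *\<^sub>R (x - y)) * indicator {0..1} s * indicator (ball c r) y \<partial>lborel) * indicator K x \<partial>lborel)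
      = (ennreal (h\<^sup>2) * indicator {0..1} s) * (\<integral>\<^sup>+x. (\<integral>\<^sup>+y. G (y + s *\<^sub>R (x - y)) * indicator (ball c r) y \<partial>lborel) * indicator K x \<partial>lborel)" .
  qed
  also have "\<dots> \<le> (\<integral>\<^sup>+s. ennreal (h\<^sup>2) * (4 * emeasure lborel K * (\<integral>\<^sup>+z. G z \<partial>lborel)) * indicator {0..1} (s::real) \<partial>lborel)"
  proof (intro nn_integral_mono)
    fix s :: real
    show "(ennreal (h\<^sup>2) * indicator {0..1} s) * (\<integral>\<^sup>+x. (\<integral>\<^sup>+y. G (y + s *\<^sub>R (x - y)) * indicator (ball c r) y \<partial>lborel) * indicator K x \<partial>lborel)
       \<le> ennreal (h\<^sup>2) * (4 * emeasure lborel K * (\<integral>\<^sup>+z. G z \<partial>lborel)) * indicator {0..1} s"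
      by (cases "s \<in> {0..1}") (auto intro!: mult_left_mono nn_integral_segment_average)
  qed
  also have "\<dots> = ennreal (h\<^sup>2) * (4 * emeasure lborel K * (\<integral>\<^sup>+z. G z \<partial>lborel))"
    by (subst nn_integral_cmult_indicator) auto
  also have "\<dots> = ennreal (4 * h\<^sup>2 * measure lborel K * (H1_seminorm K \<phi>)\<^sup>2)"
  proof -
    have "emeasure lborel K = ennreal (measure lborel K)"
      using emeasure_bounded_finite[OF bounded_K] by (simp add: emeasure_eq_ennreal_measure)
    then show ?thesis unfolding IG
      by (simp add: ennreal_mult mult_ac)
  qed
  finally show ?thesis .
qed

lemma measure_K_pos: "measure lborel (ball c r) > 0" "measure lborel K > 0"
proof -
  show b: "measure lborel (ball c r) > 0" using content_ball_pos[OF r_pos] by simp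
  have "measure lborel (ball c r) \<le> measure lborel K"
    using open_K emeasure_bounded_finite[OF bounded_K] ball_subset
    by (intro measure_mono_fmeasurable) (auto simp: fmeasurable_def)
  then show "measure lborel K > 0" using b by linarith
qed

lemma integral_const_M: "(LINT x|M. (a::real)) = a * measure lborel K"
  using open_K by (simp add: space_M measure_restrict_space mult.commute)

text \<open>Pythagoras: the deviation from the mean is orthogonal to constants. This lets the mean
  over the disc be replaced by the mean over \<open>K\<close>.\<close>

lemma average_minimizes:
  assumes f: "square_integrable M f"
  shows "(L2_norm M (\<lambda>x. f x - average K f))\<^sup>2 \<le> (L2_norm M (\<lambda>x. f x - b))\<^sup>2"
proof -
  let ?a = "average K f"
  have i: "integrable M (\<lambda>x. (f x - ?a)\<^sup>2)" "integrable M (\<lambda>x. f x - ?a)" "integrable M (\<lambda>x. (?a - b)\<^sup>2)"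
    by (intro square_integrable_power2 square_integrable_diff square_integrable_const
        Bochner_Integration.integrable_diff square_integrable_integrable[OF f]
        finite_measure.integrable_const[OF finite_M] f finite_M)+
  have 0: "(LINT x|M. f x - ?a) = 0"
    using square_integrable_integrable[OF f] finite_measure.integrable_const[OF finite_M] measure_K_pos(2)
    by (subst Bochner_Integration.integral_diff) (auto simp only: integral_const_M average_def, simp)
  have "(L2_norm M (\<lambda>x. f x - b))\<^sup>2 = (LINT x|M. (f x - ?a)\<^sup>2 + (2 * (?a - b)) * (f x - ?a) + (?a - b)\<^sup>2)"
    unfolding L2_norm_power2 by (intro Bochner_Integration.integral_cong) (auto simp: power2_eq_square algebra_simps)
  also have "\<dots> = (LINT x|M. (f x - ?a)\<^sup>2) + (LINT x|M. (?a - b)\<^sup>2)"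
    using i 0 by simp
  finally have "(L2_norm M (\<lambda>x. f x - b))\<^sup>2 = (L2_norm M (\<lambda>x. f x - ?a))\<^sup>2 + (LINT x|M. (?a - b)\<^sup>2)"
    by (simp only: L2_norm_power2 real_norm_def power2_abs)
  moreover have "(LINT x|M. (?a - b)\<^sup>2) \<ge> 0" by (rule Bochner_Integration.integral_nonneg) simp
  ultimately show ?thesis by linarith
qed

text \<open>The comparison value is the mean over the disc, whose points see all of \<open>K\<close>
  along segments. By Cauchy-Schwarz its squared deviation at \<open>x\<close> is at most the mean of
  the squared differences to points of the disc. The mean over \<open>K\<close> does no worse by
  \<open>average_minimizes\<close>.\<close>

lemma Poincare_smooth:
  assumes \<phi>: "smooth \<phi>" and h: "\<And>x y. x \<in> K \<Longrightarrow> y \<in> K \<Longrightarrow> norm (x - y) \<le> h"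
  shows "measure lborel (ball c r) * (L2_norm M (\<lambda>x. \<phi> x - average K \<phi>))\<^sup>2
     \<le> 4 * h\<^sup>2 * measure lborel K * (H1_seminorm K \<phi>)\<^sup>2"
proof -
  have [measurable]: "K \<in> sets borel" "ball c r \<in> sets borel" using open_K by auto
  have pm [measurable]: "\<phi> \<in> borel_measurable borel" 
    by (intro borel_measurable_continuous_onI smooth_continuous \<phi>)
  let ?B = "area_on (ball c r)"
  let ?m = "measure lborel (ball c r)"
  define b where "b = average (ball c r) \<phi>"
  have fB: "finite_measure ?B" by (rule finite_area_on) auto
  have mB: "(LINT x|?B. (a::real)) = a * ?m" for a
    by (simp add: measure_restrict_space mult.commute)
  have sB: "square_integrable ?B (\<lambda>y. \<phi> x - \<phi> y)" for x
    by (intro square_integrable_continuous continuous_intros smooth_continuous \<phi>) auto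
  have iB: "integrable ?B \<phi>"
  proof -
    have s: "square_integrable ?B \<phi>" by (intro square_integrable_continuous smooth_continuous \<phi>) auto
    have "integrable ?B (\<lambda>x. \<phi> x * 1)"
      by (intro square_integrable_mult s square_integrable_const fB)
    then show ?thesis by simp
  qed
  have pt: "ennreal (?m * (\<phi> x - b)\<^sup>2) \<le> (\<integral>\<^sup>+y. ennreal ((\<phi> x - \<phi> y)\<^sup>2) * indicator (ball c r) y \<partial>lborel)" for x
  proof -
    have "(LINT y|?B. \<phi> x - \<phi> y) = ?m * (\<phi> x - b)"
      using iB finite_measure.integrable_const[OF fB] measure_K_pos(1)
      by (subst Bochner_Integration.integral_diff) (auto simp only: mB, simp add: b_def average_def field_simps)
    then have "(?m * (\<phi> x - b))\<^sup>2 = \<bar>LINT y|?B. (\<phi> x - \<phi> y) \<bullet> 1\<bar>\<^sup>2" by simp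
    also have "\<dots> \<le> (L2_norm ?B (\<lambda>y. \<phi> x - \<phi> y) * L2_norm ?B (\<lambda>y. 1 :: real))\<^sup>2"
      by (intro power_mono L2_Cauchy_Schwarz sB square_integrable_const fB) auto
    also have "\<dots> = (LINT y|?B. (\<phi> x - \<phi> y)\<^sup>2) * ?m"
      unfolding power_mult_distrib L2_norm_power2 by (simp only: norm_one power_one mB real_norm_def power2_abs mult_1)
    finally have "?m * (\<phi> x - b)\<^sup>2 \<le> (LINT y|?B. (\<phi> x - \<phi> y)\<^sup>2)"
      using measure_K_pos(1) by (simp add: power_mult_distrib power2_eq_square[of ?m] mult.assoc)
    then have "ennreal (?m * (\<phi> x - b)\<^sup>2) \<le> ennreal (LINT y|?B. (\<phi> x - \<phi> y)\<^sup>2)" by (rule ennreal_leI)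
    also have "\<dots> = (\<integral>\<^sup>+y. ennreal ((\<phi> x - \<phi> y)\<^sup>2) \<partial>?B)"
      using square_integrable_power2[OF sB] by (intro nn_integral_eq_integral[symmetric]) auto
    also have "\<dots> = (\<integral>\<^sup>+y. ennreal ((\<phi> x - \<phi> y)\<^sup>2) * indicator (ball c r) y \<partial>lborel)"
      by (intro nn_integral_restrict_space) auto
    finally show ?thesis .
  qed
  have s: "square_integrable M (\<lambda>x. \<phi> x - b)"
    by (intro square_integrable_smooth smooth_diff \<phi> smooth_const)
  have "ennreal (?m * (L2_norm M (\<lambda>x. \<phi> x - b))\<^sup>2) = (\<integral>\<^sup>+x. ennreal (?m * (\<phi> x - b)\<^sup>2) \<partial>M)"
    using square_integrable_power2[OF s]
    by (subst nn_integral_eq_integral) (auto simp: L2_norm_power2)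
  also have "\<dots> = (\<integral>\<^sup>+x. ennreal (?m * (\<phi> x - b)\<^sup>2) * indicator K x \<partial>lborel)"
    by (intro nn_integral_restrict_space) auto
  also have "\<dots> \<le> (\<integral>\<^sup>+x. (\<integral>\<^sup>+y. ennreal ((\<phi> x - \<phi> y)\<^sup>2) * indicator (ball c r) y \<partial>lborel) * indicator K x \<partial>lborel)"
    by (intro nn_integral_mono mult_right_mono pt) simp
  also have "\<dots> \<le> ennreal (4 * h\<^sup>2 * measure lborel K * (H1_seminorm K \<phi>)\<^sup>2)"
    by (rule nn_integral_difference_quotients[OF \<phi> h])
  finally have "?m * (L2_norm M (\<lambda>x. \<phi> x - b))\<^sup>2 \<le> 4 * h\<^sup>2 * measure lborel K * (H1_seminorm K \<phi>)\<^sup>2"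
    by (subst (asm) ennreal_le_iff) auto
  moreover have "?m * (L2_norm M (\<lambda>x. \<phi> x - average K \<phi>))\<^sup>2 \<le> ?m * (L2_norm M (\<lambda>x. \<phi> x - b))\<^sup>2"
    by (intro mult_left_mono average_minimizes square_integrable_smooth \<phi>) simp
  ultimately show ?thesis by linarith
qed

end

section \<open>Edges and the trace inequality\<close>

definition vec2 :: "real \<Rightarrow> real \<Rightarrow> point" where
  "vec2 x y = (\<chi> i. if i = 1 then x else y)"

lemma vec2_nth [simp]: "vec2 x y $ 1 = x" "vec2 x y $ 2 = y" by (simp_all add: vec2_def)

lemma vec2_eq_iff: "u = v \<longleftrightarrow> u $ 1 = v $ 1 \<and> u $ 2 = v $ 2" for u v :: point
  by (simp add: vec_eq_iff forall_2)

lemma inner_point: "u \<bullet> v = u $ 1 * v $ 1 + u $ 2 * v $ 2" for u v :: point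
  by (simp add: inner_vec_def sum_2)

lemma norm_point: "norm u = sqrt ((u $ 1)\<^sup>2 + (u $ 2)\<^sup>2)" for u :: point
  by (simp add: norm_vec_def L2_set_def sum_2)

lemma vec2_measurable [measurable]: "(\<lambda>p. vec2 (fst p) (snd p)) \<in> borel_measurable (borel \<Otimes>\<^sub>M borel)"
proof -
  have "continuous_on UNIV (\<lambda>p :: real \<times> real. if i = (1::2) then fst p else snd p)" for i
    by (cases "i = 1") (auto intro!: continuous_intros)
  then have "continuous_on UNIV (\<lambda>p. vec2 (fst p) (snd p))"
    unfolding vec2_def by (rule continuous_on_vec_lambda)
  then show ?thesis by (simp add: borel_prod borel_measurable_continuous_onI)
qed

text \<open>Both measures agree on boxes. It makes iterated integrals over the two coordinates
  available.\<close>

lemma lborel_point: "lborel = distr (lborel \<Otimes>\<^sub>M lborel) borel (\<lambda>p. vec2 (fst p) (snd p))"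
proof (rule lborel_eqI)
  fix l u :: point assume le: "\<And>b. b \<in> Basis \<Longrightarrow> l \<bullet> b \<le> u \<bullet> b"
  have le': "l $ i \<le> u $ i" for i using le[of "axis i 1"] by (simp add: inner_axis)
  have m: "(\<lambda>p. vec2 (fst p) (snd p)) \<in> borel_measurable (lborel \<Otimes>\<^sub>M lborel)" by measurable
  have "emeasure (distr (lborel \<Otimes>\<^sub>M lborel) borel (\<lambda>p. vec2 (fst p) (snd p))) (box l u)
     = emeasure (lborel \<Otimes>\<^sub>M lborel) ({l $ 1<..<u $ 1} \<times> {l $ 2<..<u $ 2})"
    by (subst emeasure_distr[OF m]) (auto intro!: arg_cong2[where f = emeasure] simp: mem_box_2 space_pair_measure)
  also have "\<dots> = ennreal (u $ 1 - l $ 1) * ennreal (u $ 2 - l $ 2)"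
    using le' by (subst lborel.emeasure_pair_measure_Times) auto
  also have "\<dots> = ennreal ((u $ 1 - l $ 1) * (u $ 2 - l $ 2))"
    using le' by (simp add: ennreal_mult)
  also have "(u $ 1 - l $ 1) * (u $ 2 - l $ 2) = (\<Prod>b\<in>Basis. (u - l) \<bullet> b)"
  proof -
    have "(\<Prod>b\<in>Basis. (u - l) \<bullet> b) = (\<Prod>b\<in>range (\<lambda>i. axis i 1). (u - l) \<bullet> b)"
      by (rule prod.cong) (auto simp: Basis_vec_def)
    also have "\<dots> = (\<Prod>i\<in>UNIV. (u - l) \<bullet> axis i 1)"
      by (rule prod.reindex_cong[OF _ refl]) (auto simp: inj_on_def axis_eq_axis)
    also have "\<dots> = (u $ 1 - l $ 1) * (u $ 2 - l $ 2)"
      by (simp add: UNIV_2 inner_axis)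
    finally show ?thesis by simp
  qed
  finally show "emeasure (distr (lborel \<Otimes>\<^sub>M lborel) borel (\<lambda>p. vec2 (fst p) (snd p))) (box l u) = ennreal (\<Prod>b\<in>Basis. (u - l) \<bullet> b)" .
qed simp

lemma lborel_linear_point:
  fixes p w :: point
  defines "D \<equiv> p $ 1 * w $ 2 - p $ 2 * w $ 1"
  assumes D: "D \<noteq> 0"
  shows "lborel = density (distr lborel borel (\<lambda>v::point. v $ 1 *\<^sub>R p + v $ 2 *\<^sub>R w)) (\<lambda>_. ennreal \<bar>D\<bar>)"
proof (rule lborel_eqI)
  let ?A = "\<lambda>v::point. v $ 1 *\<^sub>R p + v $ 2 *\<^sub>R w"
  \<comment> \<open>The inverse of \<open>?A\<close> by Cramer's rule; it presents the preimage of a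
    box as a linear image.\<close>
  define B where "B z = vec2 ((z $ 1 * w $ 2 - z $ 2 * w $ 1) / D) ((p $ 1 * z $ 2 - p $ 2 * z $ 1) / D)" for z :: point
  have lA: "linear ?A" by (intro linearI) (auto simp: algebra_simps)
  have lB: "linear B" by (intro linearI) (auto simp: B_def vec2_eq_iff D field_simps)
  have AB: "?A (B z) = z" for z
    using D by (simp add: vec2_eq_iff B_def field_simps) (simp add: D_def algebra_simps)
  have BA: "B (?A v) = v" for v
    using D by (simp add: vec2_eq_iff B_def field_simps) (simp add: D_def algebra_simps)
  have Am [measurable]: "?A \<in> borel_measurable borel"
    by (intro borel_measurable_continuous_onI linear_continuous_on) (simp add: lA linear_conv_bounded_linear[symmetric])
  have det: "det (matrix ?A) = D"
    by (simp add: det_2 matrix_def D_def axis_def)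
  fix l u :: point assume le: "\<And>b. b \<in> Basis \<Longrightarrow> l \<bullet> b \<le> u \<bullet> b"
  let ?S = "?A -` box l u"
  have SB: "?S = B ` box l u" using AB BA by (auto simp: image_iff) metis
  have S: "?S \<in> lmeasurable" unfolding SB by (rule measurable_linear_image[OF lB]) simp
  have "?A ` ?S = box l u" using AB by (auto simp: image_iff) metis
  then have "measure lebesgue (box l u) = \<bar>D\<bar> * measure lebesgue ?S"
    using measure_linear_image[OF lA S] det by simp
  then have "ennreal \<bar>D\<bar> * emeasure lebesgue ?S = ennreal (measure lebesgue (box l u))"
    using S by (simp add: emeasure_eq_measure2 ennreal_mult')
  moreover have "emeasure lebesgue ?S = emeasure lborel ?S"
    using measurable_sets[OF Am, of "box l u"] by simp
  moreover have "measure lebesgue (box l u) = (\<Prod>b\<in>Basis. (u - l) \<bullet> b)"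
    using le by (simp add: measure_completion inner_diff_left)
  ultimately show "emeasure (density (distr lborel borel ?A) (\<lambda>_. ennreal \<bar>D\<bar>)) (box l u) = ennreal (\<Prod>b\<in>Basis. (u - l) \<bullet> b)"
    by (simp add: emeasure_density_const emeasure_distr)
qed simp

text \<open>Oblique coordinates, with the determinant of \<open>p\<close> and \<open>w\<close> as
  Jacobian. As an inequality it is also true for parallel vectors.\<close>

lemma nn_integral_plane:
  fixes p w c :: point and F :: "point \<Rightarrow> ennreal"
  assumes [measurable]: "F \<in> borel_measurable borel"
  shows "ennreal \<bar>p $ 1 * w $ 2 - p $ 2 * w $ 1\<bar> * (\<integral>\<^sup>+s. (\<integral>\<^sup>+\<sigma>. F (c + (s *\<^sub>R p + \<sigma> *\<^sub>R w)) \<partial>lborel) \<partial>lborel)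
     \<le> (\<integral>\<^sup>+z. F z \<partial>lborel)"
proof (cases "p $ 1 * w $ 2 - p $ 2 * w $ 1 = 0")
  case False
  let ?D = "p $ 1 * w $ 2 - p $ 2 * w $ 1"
  have "(\<integral>\<^sup>+z. F z \<partial>lborel) = (\<integral>\<^sup>+z. F (c + z) \<partial>lborel)"
    using nn_integral_affine[of F 1 c] by (simp add: add.commute)
  also have "\<dots> = (\<integral>\<^sup>+z. F (c + z) \<partial>density (distr lborel borel (\<lambda>v::point. v $ 1 *\<^sub>R p + v $ 2 *\<^sub>R w)) (\<lambda>_. ennreal \<bar>?D\<bar>))"
    using lborel_linear_point[OF False] by (simp only:)
  also have "\<dots> = ennreal \<bar>?D\<bar> * (\<integral>\<^sup>+v. F (c + ((v::point) $ 1 *\<^sub>R p + v $ 2 *\<^sub>R w)) \<partial>lborel)"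
  proof -
    have [measurable]: "(\<lambda>v::point. v $ 1 *\<^sub>R p + v $ 2 *\<^sub>R w) \<in> borel_measurable borel"
      by (intro borel_measurable_continuous_onI continuous_intros)
    show ?thesis by (simp add: nn_integral_density nn_integral_distr nn_integral_cmult)
  qed
  also have "(\<integral>\<^sup>+v. F (c + ((v::point) $ 1 *\<^sub>R p + v $ 2 *\<^sub>R w)) \<partial>lborel)
      = (\<integral>\<^sup>+v. F (c + (v $ 1 *\<^sub>R p + v $ 2 *\<^sub>R w)) \<partial>distr (lborel \<Otimes>\<^sub>M lborel) borel (\<lambda>p. vec2 (fst p) (snd p)))"
    using lborel_point by simp
  also have "\<dots> = (\<integral>\<^sup>+q. F (c + (fst q *\<^sub>R p + snd q *\<^sub>R w)) \<partial>(lborel \<Otimes>\<^sub>M lborel))"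
  proof -
    have [measurable]: "(\<lambda>v::point. F (c + (v $ 1 *\<^sub>R p + v $ 2 *\<^sub>R w))) \<in> borel_measurable borel"
      by (rule measurable_compose[of _ _ borel], intro borel_measurable_continuous_onI continuous_intros) measurable
    show ?thesis by (subst nn_integral_distr) auto
  qed
  also have "\<dots> = (\<integral>\<^sup>+s. (\<integral>\<^sup>+\<sigma>. F (c + (s *\<^sub>R p + \<sigma> *\<^sub>R w)) \<partial>lborel) \<partial>lborel)"
    by (subst lborel.nn_integral_fst[symmetric]) auto
  finally show ?thesis by simp
qed simp

text \<open>In the plane the vectors orthogonal to a unit vector form a line, spanned by that vector
  turned by a right angle (\<open>rn\<close>).\<close>

lemma perp_collinear:
  fixes n v w :: point
  assumes "norm n = 1" "v \<bullet> n = 0" "w \<bullet> n = 0" "w \<noteq> 0"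
  shows "v = ((v \<bullet> w) / (w \<bullet> w)) *\<^sub>R w"
proof -
  define rn where "rn = vec2 (- n $ 2) (n $ 1)"
  have n1: "(n $ 1)\<^sup>2 + (n $ 2)\<^sup>2 = 1" using assms(1) by (simp add: norm_point)
  have rep: "u = (u \<bullet> rn) *\<^sub>R rn" if "u \<bullet> n = 0" for u
  proof -
    have a: "u $ 1 * n $ 1 + u $ 2 * n $ 2 = 0" using that by (simp add: inner_point)
    have "(u \<bullet> rn) * (- n $ 2) = u $ 1 * ((n $ 1)\<^sup>2 + (n $ 2)\<^sup>2) - n $ 1 * (u $ 1 * n $ 1 + u $ 2 * n $ 2)"
      by (simp add: rn_def inner_point algebra_simps power2_eq_square)
    moreover have "(u \<bullet> rn) * n $ 1 = u $ 2 * ((n $ 1)\<^sup>2 + (n $ 2)\<^sup>2) - n $ 2 * (u $ 1 * n $ 1 + u $ 2 * n $ 2)"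
      by (simp add: rn_def inner_point algebra_simps power2_eq_square)
    ultimately show ?thesis using a n1 by (simp add: vec2_eq_iff rn_def)
  qed
  have "rn \<bullet> rn = 1" using n1 by (simp add: rn_def inner_point power2_eq_square)
  moreover have "w \<bullet> rn \<noteq> 0" using rep[OF assms(3)] assms(4) by auto
  moreover have "v \<bullet> w = (v \<bullet> rn) * (w \<bullet> rn)"
    by (subst rep[OF assms(3)]) simp
  moreover have "w \<bullet> w = (w \<bullet> rn) * (w \<bullet> rn)"
    by (subst (2) rep[OF assms(3)]) simp
  ultimately have "((v \<bullet> w) / (w \<bullet> w)) *\<^sub>R w = (v \<bullet> rn) *\<^sub>R rn"
    by (subst rep[OF assms(3)]) simp
  then show ?thesis using rep[OF assms(2)] by simp
qed

text \<open>Up to sign \<open>w\<close> is \<open>n\<close> turned by a right angle, which turns the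
  determinant into an inner product. In \<open>trace_triangle\<close> this identifies the Jacobian
  with the distance of \<open>c\<close> from the line of the edge.\<close>

lemma cross_eq_inner_normal:
  fixes p w n :: point
  assumes "norm n = 1" "norm w = 1" "w \<bullet> n = 0"
  shows "\<bar>p $ 1 * w $ 2 - p $ 2 * w $ 1\<bar> = \<bar>p \<bullet> n\<bar>"
proof -
  define rn where "rn = vec2 (- n $ 2) (n $ 1)"
  have n1: "(n $ 1)\<^sup>2 + (n $ 2)\<^sup>2 = 1" using assms(1) by (simp add: norm_point)
  have "rn \<bullet> n = 0" "norm rn = 1" using n1 by (auto simp: rn_def inner_point norm_point)
  moreover from this have "rn \<noteq> 0" by auto
  ultimately have w: "w = ((w \<bullet> rn) / (rn \<bullet> rn)) *\<^sub>R rn"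
    by (intro perp_collinear[OF assms(1,3)])
  moreover have "rn \<bullet> rn = 1" using \<open>norm rn = 1\<close> by (simp add: norm_eq_1)
  ultimately have w: "w = (w \<bullet> rn) *\<^sub>R rn" by simp
  then have "\<bar>w \<bullet> rn\<bar> = 1" using assms(2) \<open>norm rn = 1\<close> by (metis mult.right_neutral norm_scaleR)
  moreover have "p $ 1 * w $ 2 - p $ 2 * w $ 1 = (w \<bullet> rn) * (p \<bullet> n)"
    by (subst (1 2) w) (simp add: rn_def inner_point algebra_simps)
  ultimately show ?thesis by (simp add: abs_mult)
qed

section \<open>Unit normals and arc length\<close>

lemma unit_normal_exists:
  assumes "fst e \<noteq> snd e" shows "\<exists>n. unit_normal e n"
proof -
  let ?w = "snd e - fst e"
  let ?n = "vec2 (- ?w $ 2) (?w $ 1)"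
  have "norm ?w \<noteq> 0" using assms by simp
  moreover have "norm ?n = norm ?w" unfolding norm_point vec2_nth power2_minus by (simp only: add.commute)
  moreover have "?n \<bullet> ?w = 0" unfolding inner_point vec2_nth by (simp add: algebra_simps)
  ultimately have "unit_normal e ((1 / norm ?w) *\<^sub>R ?n)"
    unfolding unit_normal_def by simp
  then show ?thesis by blast
qed

lemma unit_normal_cases:
  assumes "unit_normal e n" "unit_normal e n'" "fst e \<noteq> snd e"
  shows "n' = n \<or> n' = - n"
proof -
  let ?w = "snd e - fst e"
  let ?m = "(1 / norm ?w) *\<^sub>R ?w"
  have "norm ?m = 1" "n' \<bullet> ?m = 0" "n \<bullet> ?m = 0" "n \<noteq> 0" and n: "norm n = 1" "norm n' = 1"
    using assms by (auto simp: unit_normal_def)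
  then have *: "n' = ((n' \<bullet> n) / (n \<bullet> n)) *\<^sub>R n" by (intro perp_collinear)
  moreover have "n \<bullet> n = 1" using n by (simp add: norm_eq_1)
  ultimately obtain k where k: "n' = k *\<^sub>R n" by (metis div_by_1)
  then have "\<bar>k\<bar> = 1" using n by simp
  then have "k = 1 \<or> k = -1" by linarith
  then show ?thesis using k by auto
qed

lemma unit_normal_segment:
  assumes "unit_normal e n" "x \<in> segment e" shows "(x - c) \<bullet> n = (fst e - c) \<bullet> n"
proof -
  obtain u where "x = (1 - u) *\<^sub>R fst e + u *\<^sub>R snd e"
    using assms(2) by (auto simp: segment_def in_segment)
  then have eq: "x - c = (fst e - c) + u *\<^sub>R (snd e - fst e)" by (simp add: algebra_simps)
  have "(snd e - fst e) \<bullet> n = 0" using assms(1) by (simp add: unit_normal_def inner_commute)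
  then show ?thesis unfolding eq by (simp add: inner_add_left)
qed

lemma nn_integral_arclength:
  assumes "fst e \<noteq> snd e" and [measurable]: "f \<in> borel_measurable borel"
  shows "(\<integral>\<^sup>+x. f x \<partial>arclength e) = (\<integral>\<^sup>+\<tau>. f (fst e + \<tau> *\<^sub>R ((1 / edge_length e) *\<^sub>R (snd e - fst e))) * indicator {0<..<edge_length e} \<tau> \<partial>lborel)"
proof -
  let ?g = "\<lambda>s. fst e + (s / edge_length e) *\<^sub>R (snd e - fst e)"
  have [measurable]: "?g \<in> borel_measurable borel" by measurable
  have "(\<integral>\<^sup>+x. f x \<partial>arclength e) = (\<integral>\<^sup>+s. f (?g s) \<partial>restrict_space lborel {0..edge_length e})"
    unfolding arclength_def by (subst nn_integral_distr) (auto intro!: measurable_restrict_space1)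
  also have "\<dots> = (\<integral>\<^sup>+s. f (?g s) * indicator {0..edge_length e} s \<partial>lborel)"
    by (rule nn_integral_restrict_space) auto
  also have "\<dots> = (\<integral>\<^sup>+s. f (?g s) * indicator {0<..<edge_length e} s \<partial>lborel)"
  proof (rule nn_integral_cong_AE)
    show "AE s in lborel. f (?g s) * indicator {0..edge_length e} s = f (?g s) * indicator {0<..<edge_length e} s"
      using AE_lborel_singleton[of 0] AE_lborel_singleton[of "edge_length e"]
      by eventually_elim (auto simp: indicator_def)
  qed
  finally show ?thesis by simp
qed

lemma rel_segment_borel: "rel_segment e \<in> sets borel"
  unfolding rel_segment_def open_segment_def by auto

section \<open>The triangles spanned by the centre and the edges\<close>

context star_cell
begin

text \<open>Replace \<open>x\<close> by a nearby point \<open>x'\<close> of \<open>K\<close> and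
  compensate by moving \<open>y\<close> to \<open>y'\<close>, so that the convex combination stays
  the same. The disc is open, so \<open>y'\<close> remains in it.\<close>

lemma closure_star:
  assumes y: "y \<in> ball c r" and x: "x \<in> closure K" and t: "0 \<le> t" "t < 1"
  shows "(1 - t) *\<^sub>R y + t *\<^sub>R x \<in> K"
proof -
  \<comment> \<open>The compensation is \<open>t / (1 - t)\<close> times the displacement of
    \<open>x\<close>, so the slack \<open>r - dist c y\<close> is multiplied by
    \<open>1 - t\<close>.\<close>
  define \<epsilon> where "\<epsilon> = (1 - t) * (r - dist c y)"
  have \<epsilon>: "\<epsilon> > 0" using y t by (simp add: \<epsilon>_def)
  obtain x' where x': "x' \<in> K" "dist x' x < \<epsilon>" using x \<epsilon> by (meson closure_approachable)
  define y' where "y' = y + (t / (1 - t)) *\<^sub>R (x - x')"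
  have "dist y y' = t / (1 - t) * dist x' x"
    using t by (simp add: y'_def dist_norm norm_minus_commute)
  also have "\<dots> \<le> 1 / (1 - t) * dist x' x"
    using t by (intro mult_right_mono divide_right_mono) auto
  also have "\<dots> < 1 / (1 - t) * \<epsilon>" using t x'(2) by (intro mult_strict_left_mono) auto
  also have "\<dots> = r - dist c y" using t by (simp add: \<epsilon>_def)
  finally have "y' \<in> ball c r" using dist_triangle[of c y' y] by (simp add: dist_commute)
  from star[OF this x'(1)] have "closed_segment y' x' \<subseteq> K" .
  moreover have "(1 - t) *\<^sub>R y + t *\<^sub>R x = (1 - t) *\<^sub>R y' + t *\<^sub>R x'"
    using t by (simp add: y'_def scaleR_add_right) (simp add: algebra_simps)
  then have "(1 - t) *\<^sub>R y + t *\<^sub>R x \<in> closed_segment y' x'"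
    using t by (auto simp: in_segment)
  ultimately show ?thesis by blast
qed

definition boundary_edge :: "edge \<Rightarrow> bool" where
  "boundary_edge e \<longleftrightarrow> fst e \<noteq> snd e \<and> segment e \<subseteq> frontier K"

lemma frontier_K: "x \<in> frontier K \<Longrightarrow> x \<in> closure K \<and> x \<notin> K"
  using open_K by (simp add: frontier_def interior_open)

lemma ray_frontier:
  assumes "x \<in> closure K" "0 \<le> t" "t < 1" shows "c + t *\<^sub>R (x - c) \<in> K"
  using closure_star[OF _ assms, of c] r_pos by (simp add: algebra_simps)

text \<open>A point of the disc on this line would lie on the edge or see one end point behind the
  other. In the second case \<open>closure_star\<close> would place the nearer end point in
  \<open>K\<close>, but it is on the frontier.\<close>

lemma line_misses_ball:
  assumes e: "boundary_edge e"
  shows "fst e + \<tau> *\<^sub>R (snd e - fst e) \<notin> ball c r"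
proof
  let ?z = "fst e + \<tau> *\<^sub>R (snd e - fst e)"
  assume z: "?z \<in> ball c r"
  have seg: "segment e \<subseteq> frontier K" using e by (simp add: boundary_edge_def)
  have ab: "fst e \<in> frontier K" "snd e \<in> frontier K" using seg by (auto simp: segment_def)
  consider "0 \<le> \<tau>" "\<tau> \<le> 1" | "\<tau> < 0" | "\<tau> > 1" by linarith
  then show False
  proof cases
    case 1
    then have "?z \<in> segment e" by (auto simp: segment_def in_segment algebra_simps)
    then show False using seg z ball_subset frontier_K by blast
  next
    case 2
    \<comment> \<open>Chosen such that the combination of \<open>?z\<close> and \<open>snd e\<close>
      is \<open>fst e\<close>.\<close>
    let ?t = "- \<tau> / (1 - \<tau>)"
    have "(1 - ?t) *\<^sub>R ?z + ?t *\<^sub>R snd e \<in> K"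
      using 2 frontier_K[OF ab(2)] by (intro closure_star z) (auto simp: field_simps)
    moreover have "(1 - ?t) *\<^sub>R ?z + ?t *\<^sub>R snd e = fst e + ((1 - ?t) * \<tau> + ?t) *\<^sub>R (snd e - fst e)"
      by (simp add: algebra_simps)
    moreover have "(1 - ?t) * \<tau> + ?t = 0" using 2 by (simp add: field_simps)
    ultimately show False using frontier_K[OF ab(1)] by simp
  next
    case 3
    \<comment> \<open>Here the combination of \<open>?z\<close> and \<open>fst e\<close> is
      \<open>snd e\<close>.\<close>
    let ?t = "1 - 1 / \<tau>"
    have "(1 - ?t) *\<^sub>R ?z + ?t *\<^sub>R fst e \<in> K"
      using 3 frontier_K[OF ab(1)] by (intro closure_star z) (auto simp: field_simps)
    moreover have "(1 - ?t) *\<^sub>R ?z + ?t *\<^sub>R fst e = fst e + ((1 - ?t) * \<tau>) *\<^sub>R (snd e - fst e)"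
      by (simp add: algebra_simps)
    moreover have "(1 - ?t) * \<tau> = 1" using 3 by simp
    ultimately show False using frontier_K[OF ab(2)] by simp
  qed
qed

text \<open>The orthogonal projection of \<open>c\<close> to the line of the edge is a point of that
  line, hence outside the disc.\<close>

lemma unit_normal_distance:
  assumes e: "boundary_edge e" and n: "unit_normal e n"
  shows "r \<le> \<bar>(fst e - c) \<bullet> n\<bar>"
proof -
  let ?w = "snd e - fst e"
  let ?d = "(fst e - c) \<bullet> n"
  have nn: "norm n = 1" "?w \<bullet> n = 0" using n by (auto simp: unit_normal_def inner_commute)
  have n1: "n \<bullet> n = 1" using nn by (simp add: norm_eq_1)
  define v where "v = c + ?d *\<^sub>R n - fst e"
  have "v \<bullet> n = 0" by (simp add: v_def inner_diff_left inner_add_left n1)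
  then have "v = ((v \<bullet> ?w) / (?w \<bullet> ?w)) *\<^sub>R ?w"
    using e by (intro perp_collinear[OF nn(1) _ nn(2)]) (auto simp: boundary_edge_def)
  then have "c + ?d *\<^sub>R n = fst e + ((v \<bullet> ?w) / (?w \<bullet> ?w)) *\<^sub>R ?w" by (simp add: v_def algebra_simps)
  then have "c + ?d *\<^sub>R n \<notin> ball c r" using line_misses_ball[OF e] by metis
  then show ?thesis using nn by (simp add: dist_norm)
qed

text \<open>The unit normal pointing away from the disc. Fixed by an inequality instead of a limit,
  it gives at once the lower bound \<open>r\<close> for the heights of the triangles;
  \<open>outer_normal_eq\<close> identifies it with the outer normal.\<close>

definition onormal :: "edge \<Rightarrow> point" where
  "onormal e = (SOME n. unit_normal e n \<and> r \<le> (fst e - c) \<bullet> n)"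

lemma onormal:
  assumes "boundary_edge e"
  shows "unit_normal e (onormal e)" "r \<le> (fst e - c) \<bullet> onormal e"
proof -
  obtain n where n: "unit_normal e n" using unit_normal_exists[of e] assms unfolding boundary_edge_def by blast
  then have n': "unit_normal e (- n)" by (simp add: unit_normal_def)
  have "\<exists>n. unit_normal e n \<and> r \<le> (fst e - c) \<bullet> n"
    using unit_normal_distance[OF assms n] n n' by (cases "(fst e - c) \<bullet> n \<ge> 0") force+
  from someI_ex[OF this] show "unit_normal e (onormal e)" "r \<le> (fst e - c) \<bullet> onormal e"
    by (auto simp: onormal_def)
qed

text \<open>Polar coordinates around \<open>c\<close>: the open triangle spanned by \<open>c\<close> and \<open>e\<close> is swept by the dilates of
  \<open>e\<close> by factors \<open>radius e z\<close> in \<open>(0, 1)\<close>, and \<open>foot e z\<close> is the point of \<open>e\<close> on the ray of \<open>z\<close>.\<close>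

definition radius :: "edge \<Rightarrow> point \<Rightarrow> real" where
  "radius e z = ((z - c) \<bullet> onormal e) / ((fst e - c) \<bullet> onormal e)"

definition foot :: "edge \<Rightarrow> point \<Rightarrow> point" where
  "foot e z = c + (1 / radius e z) *\<^sub>R (z - c)"

definition triangle :: "edge \<Rightarrow> point set" where
  "triangle e = {z. 0 < radius e z \<and> radius e z < 1 \<and> foot e z \<in> rel_segment e}"

lemma triangle_borel [measurable]: "triangle e \<in> sets borel"
proof -
  have [measurable]: "radius e \<in> borel_measurable borel" unfolding radius_def by measurable
  have [measurable]: "foot e \<in> borel_measurable borel" unfolding foot_def by measurable
  have [measurable]: "rel_segment e \<in> sets borel" by (rule rel_segment_borel)
  have "{z \<in> space borel. 0 < radius e z \<and> radius e z < 1 \<and> foot e z \<in> rel_segment e} \<in> sets borel" by measurable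
  then show ?thesis by (simp add: triangle_def)
qed

lemma rel_segment_frontier: "boundary_edge e \<Longrightarrow> x \<in> rel_segment e \<Longrightarrow> x \<in> frontier K"
  unfolding boundary_edge_def segment_def rel_segment_def using segment_open_subset_closed by blast

lemma triangle_foot: "z \<in> triangle e \<Longrightarrow> z = c + radius e z *\<^sub>R (foot e z - c)"
  by (simp add: triangle_def foot_def)

lemma triangle_subset: "boundary_edge e \<Longrightarrow> triangle e \<subseteq> K"
proof
  fix z assume e: "boundary_edge e" and z: "z \<in> triangle e"
  then have "c + radius e z *\<^sub>R (foot e z - c) \<in> K"
    using frontier_K[OF rel_segment_frontier[OF e]] by (intro ray_frontier) (auto simp: triangle_def)
  then show "z \<in> K" using triangle_foot[OF z] by simp
qed

text \<open>A ray from \<open>c\<close> meets the frontier only once, by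
  \<open>ray_frontier\<close>. Hence both triangles assign the same radius and the same foot to a
  common point, but the feet lie on disjoint open edges.\<close>

lemma triangle_disjoint:
  assumes e: "boundary_edge e" "boundary_edge e'" and d: "rel_segment e \<inter> rel_segment e' = {}"
  shows "triangle e \<inter> triangle e' = {}"
proof (rule ccontr)
  assume "triangle e \<inter> triangle e' \<noteq> {}"
  then obtain z where z: "z \<in> triangle e" "z \<in> triangle e'" by blast
  have less: False if e: "boundary_edge e" "boundary_edge e'" and z: "z \<in> triangle e" "z \<in> triangle e'"
     and l: "radius e z < radius e' z" for e e'
  proof -
    have pos: "0 < radius e z" "foot e z \<in> closure K" "0 < radius e' z" "foot e' z \<notin> K"
      using z e rel_segment_frontier frontier_K by (auto simp: triangle_def)
    have "c + (radius e z / radius e' z) *\<^sub>R (foot e z - c) \<in> K"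
      using pos l by (intro ray_frontier) auto
    moreover have "c + (radius e z / radius e' z) *\<^sub>R (foot e z - c) = foot e' z"
      using pos by (simp add: foot_def)
    ultimately show False using pos by simp
  qed
  have "radius e z = radius e' z" using less[OF e z] less[OF e(2,1) z(2,1)] by (meson linorder_neqE_linordered_idom)
  then have "foot e z = foot e' z" by (simp add: foot_def)
  then show False using z d by (auto simp: triangle_def)
qed

lemma mem_triangle:
  assumes e: "boundary_edge e" and s: "0 < s" "s < 1" and y: "y \<in> rel_segment e"
  shows "c + s *\<^sub>R (y - c) \<in> triangle e"
proof -
  have d: "(fst e - c) \<bullet> onormal e > 0" using onormal(2)[OF e] r_pos by linarith
  have "y \<in> segment e" using y segment_open_subset_closed by (auto simp: segment_def rel_segment_def)
  then have "radius e (c + s *\<^sub>R (y - c)) = s"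
    using d unit_normal_segment[OF onormal(1)[OF e]] by (simp add: radius_def)
  then show ?thesis using s y by (simp add: triangle_def foot_def)
qed

text \<open>On each ray the function \<open>t\<^sup>2 * \<phi>(c + t (x - c))\<^sup>2\<close> vanishes at \<open>t = 0\<close>; its derivative carries the
  factor \<open>t\<close> of the Jacobian of the polar coordinates.\<close>

lemma trace_triangle:
  assumes e: "boundary_edge e" and \<phi>: "smooth \<phi>"
  shows "ennreal r * (\<integral>\<^sup>+x. ennreal ((\<phi> x)\<^sup>2) \<partial>arclength e)
    \<le> (\<integral>\<^sup>+z. ennreal \<bar>2 * (\<phi> z)\<^sup>2 + 2 * \<phi> z * ((z - c) \<bullet> gradient \<phi> z)\<bar> * indicator (triangle e) z \<partial>lborel)"
proof -
  let ?a = "fst e" and ?b = "snd e"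
  define l where "l = edge_length e"
  define w where "w = (1 / l) *\<^sub>R (?b - ?a)"
  define p where "p = ?a - c"
  define n where "n = onormal e"
  define d where "d = p \<bullet> n"
  define H where "H z = \<bar>2 * (\<phi> z)\<^sup>2 + 2 * \<phi> z * ((z - c) \<bullet> gradient \<phi> z)\<bar>" for z
  have ab: "?a \<noteq> ?b" using e by (simp add: boundary_edge_def)
  have l: "l > 0" using ab by (simp add: l_def edge_length_def)
  have n: "unit_normal e n" "r \<le> d" using onormal[OF e] by (auto simp: n_def d_def p_def)
  have d: "d > 0" using n r_pos by linarith
  have w1: "norm w = 1" using l by (simp add: w_def l_def edge_length_def dist_norm norm_minus_commute)
  have wn: "w \<bullet> n = 0" using n(1) by (simp add: w_def unit_normal_def inner_commute)
  \<comment> \<open>The determinant of the oblique coordinates is the distance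
    \<open>d \<ge> r\<close> from \<open>c\<close> to the line of \<open>e\<close>.\<close>
  have det: "\<bar>p $ 1 * w $ 2 - p $ 2 * w $ 1\<bar> = d"
    using cross_eq_inner_normal[OF _ w1 wn, of p] n(1) d by (simp add: unit_normal_def d_def)
  have [measurable]: "\<phi> \<in> borel_measurable borel" "gradient \<phi> \<in> borel_measurable borel"
    by (intro borel_measurable_continuous_onI smooth_continuous smooth_gradient_continuous \<phi>)+
  have [measurable]: "H \<in> borel_measurable borel" unfolding H_def by measurable
  have pt: "ennreal ((\<phi> y)\<^sup>2) \<le> (\<integral>\<^sup>+s. ennreal (s * H (c + s *\<^sub>R (y - c))) * indicator {0<..<1} s \<partial>lborel)" for y
  proof -
    let ?F = "\<lambda>s. s\<^sup>2 * (\<phi> (c + s *\<^sub>R (y - c)))\<^sup>2"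
    let ?f = "\<lambda>s. s * (2 * (\<phi> (c + s *\<^sub>R (y - c)))\<^sup>2 + 2 * \<phi> (c + s *\<^sub>R (y - c)) * ((c + s *\<^sub>R (y - c) - c) \<bullet> gradient \<phi> (c + s *\<^sub>R (y - c))))"
    have "ennreal (?F 1 - ?F 0) \<le> (\<integral>\<^sup>+s. ennreal (s * H (c + s *\<^sub>R (y - c))) * indicator {0..1} s \<partial>lborel)"
    proof (rule nn_integral_FTC_upper[where f = ?f])
      show "DERIV ?F s :> ?f s" for s
        by (rule DERIV_cong[OF DERIV_mult[OF DERIV_power[OF DERIV_ident] DERIV_power[OF smooth_along_line[OF \<phi>]]]])
           (simp add: power2_eq_square algebra_simps)
      have c1: "continuous_on UNIV (\<lambda>s. \<phi> (c + s *\<^sub>R (y - c)))"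
        by (rule continuous_on_compose2[OF smooth_continuous[OF \<phi>, of UNIV]]) (auto intro!: continuous_intros)
      have c2: "continuous_on UNIV (\<lambda>s. gradient \<phi> (c + s *\<^sub>R (y - c)))"
        by (rule continuous_on_compose2[OF smooth_gradient_continuous[OF \<phi>, of UNIV]]) (auto intro!: continuous_intros)
      show "continuous_on UNIV ?f" by (intro continuous_intros c1 c2)
      show "?f s \<le> s * H (c + s *\<^sub>R (y - c))" if "s \<in> {0..1}" for s
        using that unfolding H_def by (intro mult_left_mono) auto
    qed
    also have "\<dots> = (\<integral>\<^sup>+s. ennreal (s * H (c + s *\<^sub>R (y - c))) * indicator {0<..<1} s \<partial>lborel)"
    proof (rule nn_integral_cong_AE)
      show "AE s in lborel. ennreal (s * H (c + s *\<^sub>R (y - c))) * indicator {0..1} s = ennreal (s * H (c + s *\<^sub>R (y - c))) * indicator {0<..<1} s"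
        using AE_lborel_singleton[of 0] AE_lborel_singleton[of "1::real"]
        by eventually_elim (auto simp: indicator_def)
    qed
    finally show ?thesis by simp
  qed
  have "(\<integral>\<^sup>+x. ennreal ((\<phi> x)\<^sup>2) \<partial>arclength e) = (\<integral>\<^sup>+\<tau>. ennreal ((\<phi> (?a + \<tau> *\<^sub>R w))\<^sup>2) * indicator {0<..<l} \<tau> \<partial>lborel)"
    unfolding l_def w_def by (rule nn_integral_arclength[OF ab]) measurable
  also have "\<dots> \<le> (\<integral>\<^sup>+\<tau>. (\<integral>\<^sup>+s. ennreal (s * H (c + s *\<^sub>R (?a + \<tau> *\<^sub>R w - c))) * indicator {0<..<1} s \<partial>lborel) * indicator {0<..<l} \<tau> \<partial>lborel)"
    by (intro nn_integral_mono mult_right_mono pt) simp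
  also have "\<dots> = (\<integral>\<^sup>+\<tau>. (\<integral>\<^sup>+s. ennreal (s * H (c + s *\<^sub>R (?a + \<tau> *\<^sub>R w - c))) * indicator {0<..<1} s * indicator {0<..<l} \<tau> \<partial>lborel) \<partial>lborel)"
    by (intro nn_integral_cong nn_integral_multc[symmetric]) measurable
  also have "\<dots> = (\<integral>\<^sup>+s. (\<integral>\<^sup>+\<tau>. ennreal (s * H (c + s *\<^sub>R (?a + \<tau> *\<^sub>R w - c))) * indicator {0<..<1} s * indicator {0<..<l} \<tau> \<partial>lborel) \<partial>lborel)"
    by (rule lborel_pair.Fubini'[symmetric]) measurable
  also have "\<dots> \<le> (\<integral>\<^sup>+s. (\<integral>\<^sup>+\<sigma>. ennreal (H (c + (s *\<^sub>R p + \<sigma> *\<^sub>R w))) * indicator (triangle e) (c + (s *\<^sub>R p + \<sigma> *\<^sub>R w)) \<partial>lborel) \<partial>lborel)"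
  proof (rule nn_integral_mono)
    fix s :: real
    let ?f = "\<lambda>\<sigma>. ennreal (H (c + (s *\<^sub>R p + \<sigma> *\<^sub>R w))) * indicator (triangle e) (c + (s *\<^sub>R p + \<sigma> *\<^sub>R w))"
    show "(\<integral>\<^sup>+\<tau>. ennreal (s * H (c + s *\<^sub>R (?a + \<tau> *\<^sub>R w - c))) * indicator {0<..<1} s * indicator {0<..<l} \<tau> \<partial>lborel)
       \<le> (\<integral>\<^sup>+\<sigma>. ?f \<sigma> \<partial>lborel)"
    proof (cases "0 < s \<and> s < 1")
      case True
      then have s: "0 < s" "s < 1" by auto
      \<comment> \<open>The substitution \<open>\<sigma> = s * \<tau>\<close> absorbs the factor
        \<open>s\<close>, so that \<open>nn_integral_plane\<close> applies.\<close>
      have "(\<integral>\<^sup>+\<sigma>. ?f \<sigma> \<partial>lborel) = ennreal \<bar>s\<bar> * (\<integral>\<^sup>+\<tau>. ?f (0 + s * \<tau>) \<partial>lborel)"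
        by (rule nn_integral_real_affine) (use s in auto)
      also have "\<dots> = (\<integral>\<^sup>+\<tau>. ennreal s * ?f (0 + s * \<tau>) \<partial>lborel)"
        using s by (subst nn_integral_cmult) auto
      finally have eq: "(\<integral>\<^sup>+\<sigma>. ?f \<sigma> \<partial>lborel) = (\<integral>\<^sup>+\<tau>. ennreal s * ?f (0 + s * \<tau>) \<partial>lborel)" .
      show ?thesis unfolding eq
      proof (intro nn_integral_mono)
        fix \<tau> :: real
        have q: "c + (s *\<^sub>R p + (0 + s * \<tau>) *\<^sub>R w) = c + s *\<^sub>R (?a + \<tau> *\<^sub>R w - c)"
          by (simp add: p_def algebra_simps)
        show "ennreal (s * H (c + s *\<^sub>R (?a + \<tau> *\<^sub>R w - c))) * indicator {0<..<1} s * indicator {0<..<l} \<tau> \<le> ennreal s * ?f (0 + s * \<tau>)"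
        proof (cases "\<tau> \<in> {0<..<l}")
          case True
          have "?a + \<tau> *\<^sub>R w = (1 - \<tau> / l) *\<^sub>R ?a + (\<tau> / l) *\<^sub>R ?b" using l by (simp add: w_def algebra_simps)
          then have "?a + \<tau> *\<^sub>R w \<in> rel_segment e"
            using True ab l by (auto simp: rel_segment_def in_segment intro!: exI[of _ "\<tau> / l"])
          from mem_triangle[OF e s this] show ?thesis
            unfolding q using True s by (simp add: ennreal_mult H_def)
        qed simp
      qed
    qed auto
  qed
  finally have le: "(\<integral>\<^sup>+x. ennreal ((\<phi> x)\<^sup>2) \<partial>arclength e)
      \<le> (\<integral>\<^sup>+s. (\<integral>\<^sup>+\<sigma>. ennreal (H (c + (s *\<^sub>R p + \<sigma> *\<^sub>R w))) * indicator (triangle e) (c + (s *\<^sub>R p + \<sigma> *\<^sub>R w)) \<partial>lborel) \<partial>lborel)" .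
  have "ennreal r * (\<integral>\<^sup>+x. ennreal ((\<phi> x)\<^sup>2) \<partial>arclength e)
    \<le> ennreal d * (\<integral>\<^sup>+s. (\<integral>\<^sup>+\<sigma>. ennreal (H (c + (s *\<^sub>R p + \<sigma> *\<^sub>R w))) * indicator (triangle e) (c + (s *\<^sub>R p + \<sigma> *\<^sub>R w)) \<partial>lborel) \<partial>lborel)"
    using n(2) by (intro mult_mono le ennreal_leI) auto
  also have "\<dots> \<le> (\<integral>\<^sup>+z. ennreal (H z) * indicator (triangle e) z \<partial>lborel)"
    using nn_integral_plane[of "\<lambda>z. ennreal (H z) * indicator (triangle e) z" p w c] unfolding det by simp
  finally show ?thesis unfolding H_def .
qed

text \<open>The triangles over different edges are disjoint subsets of \<open>K\<close>, so the
  estimates of \<open>trace_triangle\<close> add up to one integral over \<open>K\<close>, whatever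
  the number of edges.\<close>

lemma trace_smooth:
  assumes A: "finite A" "\<And>e. e \<in> A \<Longrightarrow> boundary_edge e"
    and dis: "\<And>e e'. e \<in> A \<Longrightarrow> e' \<in> A \<Longrightarrow> e \<noteq> e' \<Longrightarrow> rel_segment e \<inter> rel_segment e' = {}"
    and h: "\<And>x. x \<in> K \<Longrightarrow> norm (x - c) \<le> h" and \<phi>: "smooth \<phi>"
  shows "r * (\<Sum>e\<in>A. LINT x|arclength e. (\<phi> x)\<^sup>2) \<le> 2 * (L2_norm M \<phi>)\<^sup>2 + 2 * h * L2_norm M \<phi> * H1_seminorm K \<phi>"
proof -
  define H where "H z = \<bar>2 * (\<phi> z)\<^sup>2 + 2 * \<phi> z * ((z - c) \<bullet> gradient \<phi> z)\<bar>" for z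
  have [measurable]: "\<phi> \<in> borel_measurable borel" "gradient \<phi> \<in> borel_measurable borel"
    by (intro borel_measurable_continuous_onI smooth_continuous smooth_gradient_continuous \<phi>)+
  have [measurable]: "H \<in> borel_measurable borel" unfolding H_def by measurable
  have [measurable]: "K \<in> sets borel" using open_K by auto
  have h0: "h \<ge> 0" using h[of c] ball_subset r_pos by force
  have s1: "square_integrable M (\<lambda>x. \<bar>\<phi> x\<bar>)" "square_integrable M (\<lambda>x. norm (gradient \<phi> x))"
    by (intro square_integrable_continuous open_K bounded_K continuous_intros smooth_continuous smooth_gradient_continuous \<phi>)+
  have iH: "integrable M (\<lambda>x. 2 * (\<phi> x)\<^sup>2 + 2 * h * (\<bar>\<phi> x\<bar> * norm (gradient \<phi> x)))"
    using square_integrable_power2[OF square_integrable_smooth[OF \<phi>]] square_integrable_mult[OF s1] by auto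
  \<comment> \<open>The estimate itself provides integrability on the edge, without which the
    Bochner integral would be 0 by default.\<close>
  have arc: "(\<integral>\<^sup>+x. ennreal ((\<phi> x)\<^sup>2) \<partial>arclength e) = ennreal (LINT x|arclength e. (\<phi> x)\<^sup>2)" if "e \<in> A" for e
  proof (rule nn_integral_eq_integral)
    have "ennreal r * (\<integral>\<^sup>+x. ennreal ((\<phi> x)\<^sup>2) \<partial>arclength e) \<le> (\<integral>\<^sup>+z. ennreal (H z) * indicator (triangle e) z \<partial>lborel)"
      using trace_triangle[OF A(2)[OF that] \<phi>] by (simp add: H_def)
    also have "\<dots> \<le> (\<integral>\<^sup>+z. ennreal (H z) * indicator K z \<partial>lborel)"
      using triangle_subset[OF A(2)[OF that]] by (intro nn_integral_mono) (auto simp: indicator_def)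
    also have "\<dots> = (\<integral>\<^sup>+z. ennreal (H z) \<partial>M)" by (intro nn_integral_restrict_space[symmetric]) auto
    also have "\<dots> < \<infinity>"
    proof -
      have "continuous_on UNIV H" unfolding H_def
        by (intro continuous_intros smooth_continuous smooth_gradient_continuous \<phi>)
      then have "integrable M H"
        by (intro square_integrable_integrable square_integrable_continuous open_K bounded_K)
      then show ?thesis by (subst nn_integral_eq_integral) (auto simp: H_def)
    qed
    finally have "(\<integral>\<^sup>+x. ennreal ((\<phi> x)\<^sup>2) \<partial>arclength e) < \<infinity>"
      using r_pos by (auto simp: ennreal_mult_less_top)
    then show "integrable (arclength e) (\<lambda>x. (\<phi> x)\<^sup>2)"
      by (intro integrableI_nonneg) (auto simp: arclength_def)
  qed simp
  have "ennreal (r * (\<Sum>e\<in>A. LINT x|arclength e. (\<phi> x)\<^sup>2)) = (\<Sum>e\<in>A. ennreal r * (\<integral>\<^sup>+x. ennreal ((\<phi> x)\<^sup>2) \<partial>arclength e))"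
    using r_pos by (simp add: arc ennreal_mult'[symmetric] sum_distrib_left sum_ennreal)
  also have "\<dots> \<le> (\<Sum>e\<in>A. \<integral>\<^sup>+z. ennreal (H z) * indicator (triangle e) z \<partial>lborel)"
    using trace_triangle[OF A(2) \<phi>] by (intro sum_mono) (auto simp: H_def)
  also have "\<dots> = (\<integral>\<^sup>+z. (\<Sum>e\<in>A. ennreal (H z) * indicator (triangle e) z) \<partial>lborel)"
    by (rule nn_integral_sum[symmetric]) measurable
  also have "\<dots> \<le> (\<integral>\<^sup>+z. ennreal (H z) * indicator K z \<partial>lborel)"
  proof (intro nn_integral_mono)
    fix z
    show "(\<Sum>e\<in>A. ennreal (H z) * indicator (triangle e) z) \<le> ennreal (H z) * indicator K z"
    proof (cases "\<exists>e\<in>A. z \<in> triangle e")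
      case True
      then obtain e where e: "e \<in> A" "z \<in> triangle e" by blast
      have "(\<Sum>e\<in>A. ennreal (H z) * indicator (triangle e) z) = (\<Sum>e'\<in>A. if e' = e then ennreal (H z) else 0)"
      proof (intro sum.cong refl)
        fix e' assume e': "e' \<in> A"
        have "z \<notin> triangle e'" if "e' \<noteq> e"
          using triangle_disjoint[OF A(2)[OF e(1)] A(2)[OF e'] dis[OF e(1) e']] that e(2) by blast
        then show "ennreal (H z) * indicator (triangle e') z = (if e' = e then ennreal (H z) else 0)"
          using e(2) by auto
      qed
      also have "\<dots> = ennreal (H z)" using e A(1) by simp
      finally show ?thesis using triangle_subset[OF A(2)[OF e(1)]] e(2) by auto
    qed auto
  qed
  also have "\<dots> = (\<integral>\<^sup>+z. ennreal (H z) \<partial>M)" by (intro nn_integral_restrict_space[symmetric]) auto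
  also have "\<dots> \<le> (\<integral>\<^sup>+x. ennreal (2 * (\<phi> x)\<^sup>2 + 2 * h * (\<bar>\<phi> x\<bar> * norm (gradient \<phi> x))) \<partial>M)"
  proof (intro nn_integral_mono ennreal_leI)
    fix x assume "x \<in> space M"
    then have x: "x \<in> K" by (simp add: space_M)
    have "\<bar>(x - c) \<bullet> gradient \<phi> x\<bar> \<le> norm (x - c) * norm (gradient \<phi> x)" by (rule Cauchy_Schwarz_ineq2)
    also have "\<dots> \<le> h * norm (gradient \<phi> x)" using h[OF x] by (intro mult_right_mono) auto
    finally have "\<bar>\<phi> x\<bar> * \<bar>(x - c) \<bullet> gradient \<phi> x\<bar> \<le> \<bar>\<phi> x\<bar> * (h * norm (gradient \<phi> x))" by (intro mult_left_mono) auto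
    moreover have "H x \<le> 2 * (\<phi> x)\<^sup>2 + 2 * (\<bar>\<phi> x\<bar> * \<bar>(x - c) \<bullet> gradient \<phi> x\<bar>)"
      unfolding H_def by (rule order_trans[OF abs_triangle_ineq]) (simp add: abs_mult)
    ultimately show "H x \<le> 2 * (\<phi> x)\<^sup>2 + 2 * h * (\<bar>\<phi> x\<bar> * norm (gradient \<phi> x))" by (simp add: mult_ac)
  qed
  also have "\<dots> = ennreal (LINT x|M. 2 * (\<phi> x)\<^sup>2 + 2 * h * (\<bar>\<phi> x\<bar> * norm (gradient \<phi> x)))"
    using h0 by (intro nn_integral_eq_integral[OF iH]) auto
  finally have "r * (\<Sum>e\<in>A. LINT x|arclength e. (\<phi> x)\<^sup>2) \<le> (LINT x|M. 2 * (\<phi> x)\<^sup>2 + 2 * h * (\<bar>\<phi> x\<bar> * norm (gradient \<phi> x)))"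
    using h0 by (subst (asm) ennreal_le_iff) (auto intro!: Bochner_Integration.integral_nonneg)
  also have "\<dots> = 2 * (L2_norm M \<phi>)\<^sup>2 + 2 * h * (LINT x|M. \<bar>\<phi> x\<bar> * norm (gradient \<phi> x))"
    using square_integrable_power2[OF square_integrable_smooth[OF \<phi>]] square_integrable_mult[OF s1]
    by (simp add: L2_norm_power2)
  also have "(LINT x|M. \<bar>\<phi> x\<bar> * norm (gradient \<phi> x)) \<le> L2_norm M \<phi> * H1_seminorm K \<phi>"
    using L2_Cauchy_Schwarz[OF s1] by (simp add: H1_seminorm_smooth[OF \<phi>]) (simp add: L2_norm_def)
  finally show ?thesis using h0 by (simp add: mult_left_mono mult.assoc)
qed

end

section \<open>Traces of Sobolev functions\<close>

lemma suminf_bound_telescope: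
  fixes f :: "nat \<Rightarrow> real"
  assumes d: "\<And>k. \<bar>f (Suc k) - f k\<bar> \<le> S / 2 ^ k"
  shows "convergent f" "\<bar>lim f - f k\<bar> \<le> 2 * S / 2 ^ k"
proof -
  have b: "\<bar>f (k + j) - f k\<bar> \<le> 2 * S / 2 ^ k - 2 * S / 2 ^ (k + j)" for k j
  proof (induction j)
    case (Suc j)
    have "\<bar>f (k + Suc j) - f k\<bar> \<le> \<bar>f (Suc (k + j)) - f (k + j)\<bar> + \<bar>f (k + j) - f k\<bar>" by simp
    also have "\<dots> \<le> S / 2 ^ (k + j) + (2 * S / 2 ^ k - 2 * S / 2 ^ (k + j))" using d Suc by (intro add_mono)
    also have "\<dots> = 2 * S / 2 ^ k - 2 * S / 2 ^ (k + Suc j)" by (simp add: field_simps)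
    finally show ?case .
  qed simp
  have S: "S \<ge> 0" using d[of 0] by simp
  have b': "\<bar>f m - f k\<bar> \<le> 2 * S / 2 ^ k" if mk: "m \<ge> k" for k m
  proof -
    obtain j where m: "m = k + j" using le_Suc_ex[OF mk] by (elim exE)
    have "2 * S / 2 ^ (k + j) \<ge> 0" using S by simp
    then show ?thesis using b[of k j] unfolding m by linarith
  qed
  have "Cauchy f"
  proof (rule CauchyI)
    fix e :: real assume e: "e > 0"
    obtain N where N: "2 * S / e < 2 ^ N" using real_arch_pow[of 2 "2 * S / e"] by auto
    then have N': "2 * S / 2 ^ N < e / 2 + e / 2" using e by (simp add: field_simps)
    obtain N2 where N2: "4 * S / e < 2 ^ N2" using real_arch_pow[of 2 "4 * S / e"] by auto
    then have N3: "2 * S / 2 ^ N2 < e / 2" using e by (simp add: field_simps)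
    show "\<exists>M. \<forall>m\<ge>M. \<forall>n\<ge>M. norm (f m - f n) < e"
    proof (intro exI allI impI)
      fix m n assume "m \<ge> N2" "n \<ge> N2"
      then show "norm (f m - f n) < e" using b'[of N2 m] b'[of N2 n] N3 unfolding real_norm_def by linarith
    qed
  qed
  then show c: "convergent f" by (rule Cauchy_convergent)
  then have "f \<longlonglongrightarrow> lim f" by (simp add: convergent_LIMSEQ_iff)
  then have "(\<lambda>m. \<bar>f m - f k\<bar>) \<longlonglongrightarrow> \<bar>lim f - f k\<bar>" by (intro tendsto_intros)
  then show "\<bar>lim f - f k\<bar> \<le> 2 * S / 2 ^ k"
    by (rule tendsto_upperbound) (auto intro!: eventually_sequentiallyI[of k] b')
qed

text \<open>Fast convergence implies convergence almost everywhere, so the limit can be given by the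
  pointwise formula \<open>lim\<close>. The formula does not mention the measure; therefore one
  function is the limit on all edges at once.\<close>

lemma L2_pointwise_limit:
  fixes f :: "nat \<Rightarrow> 'a \<Rightarrow> real"
  assumes f: "\<And>k. square_integrable M (f k)"
    and d: "\<And>k. L2_norm M (\<lambda>x. f (Suc k) x - f k x) \<le> C / 4 ^ k"
  defines "g \<equiv> \<lambda>x. lim (\<lambda>k. f k x)"
  shows "square_integrable M g" "(\<lambda>k. L2_norm M (\<lambda>x. f k x - g x)) \<longlonglongrightarrow> 0"
proof -
  have [measurable]: "f k \<in> borel_measurable M" for k using f by (rule square_integrable_measurable)
  have [measurable]: "g \<in> borel_measurable M" unfolding g_def by measurable
  have pow4: "((2::real) ^ k)\<^sup>2 = 4 ^ k" for k by (simp add: power2_eq_square power_mult_distrib[symmetric])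
  have C: "C \<ge> 0" using order_trans[OF L2_norm_nonneg d[of 0]] by simp
  \<comment> \<open>The weights \<open>4 ^ k\<close> are a compromise: the integral of
    \<open>H\<close> is still bounded by a geometric series, and finiteness of \<open>H x\<close>
    bounds the increments at \<open>x\<close> by \<open>sqrt (H x) / 2 ^ k\<close>.\<close>
  define H where "H x = (\<Sum>k. ennreal (4 ^ k * (f (Suc k) x - f k x)\<^sup>2))" for x
  have [measurable]: "H \<in> borel_measurable M" unfolding H_def by measurable
  have "(\<integral>\<^sup>+x. H x \<partial>M) = (\<Sum>k. \<integral>\<^sup>+x. ennreal (4 ^ k * (f (Suc k) x - f k x)\<^sup>2) \<partial>M)"
    unfolding H_def by (rule nn_integral_suminf) measurable
  also have "\<dots> \<le> (\<Sum>k. ennreal (C\<^sup>2 * (1/4) ^ k))"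
  proof (rule suminf_le)
    fix k
    have i: "integrable M (\<lambda>x. 4 ^ k * (f (Suc k) x - f k x)\<^sup>2)"
      using square_integrable_power2[OF square_integrable_diff[OF f f]] by simp
    have "(\<integral>\<^sup>+x. ennreal (4 ^ k * (f (Suc k) x - f k x)\<^sup>2) \<partial>M) = ennreal (4 ^ k * (L2_norm M (\<lambda>x. f (Suc k) x - f k x))\<^sup>2)"
      by (subst nn_integral_eq_integral[OF i]) (auto simp: L2_norm_power2)
    also have "\<dots> \<le> ennreal (4 ^ k * (C / 4 ^ k)\<^sup>2)"
      using d by (intro ennreal_leI mult_left_mono power_mono) auto
    also have "4 ^ k * (C / 4 ^ k)\<^sup>2 = C\<^sup>2 * (1/4) ^ k"
      by (simp add: power_divide power2_eq_square field_simps)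
    finally show "(\<integral>\<^sup>+x. ennreal (4 ^ k * (f (Suc k) x - f k x)\<^sup>2) \<partial>M) \<le> ennreal (C\<^sup>2 * (1/4) ^ k)" .
  qed auto
  also have "\<dots> = ennreal (\<Sum>k. C\<^sup>2 * (1/4) ^ k)"
    by (intro suminf_ennreal2 summable_mult) (auto intro: summable_geometric)
  finally have fin: "(\<integral>\<^sup>+x. H x \<partial>M) < \<infinity>" by (simp add: le_less_trans)
  then have AE: "AE x in M. H x \<noteq> \<infinity>" by (intro nn_integral_PInf_AE) auto
  have pt: "AE x in M. ennreal ((f k x - g x)\<^sup>2) \<le> ennreal (4 / 4 ^ k) * H x" for k
    using AE
  proof eventually_elim
    case (elim x)
    define S where "S = enn2real (H x)"
    have HS: "H x = ennreal S" using elim by (simp add: S_def less_top)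
    have S0: "S \<ge> 0" by (simp add: S_def)
    have "\<bar>f (Suc k) x - f k x\<bar> \<le> sqrt S / 2 ^ k" for k
    proof -
      have "ennreal (4 ^ k * (f (Suc k) x - f k x)\<^sup>2) \<le> H x"
      proof -
        have "(\<Sum>j\<in>{k}. ennreal (4 ^ j * (f (Suc j) x - f j x)\<^sup>2)) \<le> H x"
          unfolding H_def by (rule sum_le_suminf) auto
        then show ?thesis by simp
      qed
      then have "4 ^ k * (f (Suc k) x - f k x)\<^sup>2 \<le> S" unfolding HS using S0 by simp
      then have "(2 ^ k * (f (Suc k) x - f k x))\<^sup>2 \<le> S"
        by (simp only: power_mult_distrib pow4)
      then have "\<bar>2 ^ k * (f (Suc k) x - f k x)\<bar> \<le> sqrt S" by (metis real_sqrt_abs real_sqrt_le_iff)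
      then have "2 ^ k * \<bar>f (Suc k) x - f k x\<bar> \<le> sqrt S" by (simp only: abs_mult) simp
      then show ?thesis by (simp add: pos_le_divide_eq mult.commute)
    qed
    from suminf_bound_telescope(2)[of "\<lambda>k. f k x", OF this, of k]
    have "\<bar>f k x - g x\<bar> \<le> 2 * sqrt S / 2 ^ k" by (simp add: g_def abs_minus_commute)
    then have "\<bar>f k x - g x\<bar>\<^sup>2 \<le> (2 * sqrt S / 2 ^ k)\<^sup>2" by (rule power_mono) simp
    also have "(2 * sqrt S / 2 ^ k)\<^sup>2 = 4 / 4 ^ k * S"
      using S0 by (simp add: power_divide power_mult_distrib pow4)
    finally show ?case unfolding HS by (simp add: ennreal_mult'[symmetric] S0 ennreal_leI)
  qed
  have le: "(\<integral>\<^sup>+x. ennreal ((f k x - g x)\<^sup>2) \<partial>M) \<le> ennreal (4 / 4 ^ k) * (\<integral>\<^sup>+x. H x \<partial>M)" for k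
    by (subst nn_integral_cmult[symmetric], measurable) (rule nn_integral_mono_AE[OF pt])
  have i: "integrable M (\<lambda>x. (f k x - g x)\<^sup>2)" for k
  proof (rule integrableI_nonneg)
    show "(\<integral>\<^sup>+x. ennreal ((f k x - g x)\<^sup>2) \<partial>M) < \<infinity>"
      using le_less_trans[OF le[of k]] fin by (simp add: ennreal_mult_less_top)
  qed auto
  then have sd: "square_integrable M (\<lambda>x. f k x - g x)" for k by (intro square_integrableI) auto
  show "square_integrable M g" using square_integrable_diff[OF f sd, of 0 0] by simp
  define A where "A = enn2real (\<integral>\<^sup>+x. H x \<partial>M)"
  have A: "(\<integral>\<^sup>+x. H x \<partial>M) = ennreal A" using fin by (simp add: A_def less_top)
  have A0: "A \<ge> 0" by (simp add: A_def)
  have bd: "(L2_norm M (\<lambda>x. f k x - g x))\<^sup>2 \<le> 4 * A * (1/4) ^ k" for k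
  proof -
    have "ennreal ((L2_norm M (\<lambda>x. f k x - g x))\<^sup>2) = (\<integral>\<^sup>+x. ennreal ((f k x - g x)\<^sup>2) \<partial>M)"
      using i[of k] by (subst nn_integral_eq_integral) (auto simp: L2_norm_power2)
    also have "\<dots> \<le> ennreal (4 / 4 ^ k) * ennreal A" using le[of k] unfolding A .
    also have "\<dots> = ennreal (4 * A * (1/4) ^ k)"
      using A0 by (simp add: ennreal_mult'[symmetric] power_divide)
    finally show ?thesis using A0 by (subst (asm) ennreal_le_iff) auto
  qed
  have "(\<lambda>k. (L2_norm M (\<lambda>x. f k x - g x))\<^sup>2) \<longlonglongrightarrow> 0"
  proof (rule tendsto_sandwich[OF _ _ tendsto_const])
    have "(\<lambda>k. (1/4::real) ^ k) \<longlonglongrightarrow> 0" by (rule LIMSEQ_realpow_zero) auto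
    from tendsto_mult_right_zero[OF this] show "(\<lambda>k. 4 * A * (1/4) ^ k) \<longlonglongrightarrow> 0" .
  qed (use bd in auto)
  from tendsto_real_sqrt[OF this] show "(\<lambda>k. L2_norm M (\<lambda>x. f k x - g x)) \<longlonglongrightarrow> 0" by simp
qed

lemma L2_norm_tendsto:
  assumes f: "\<And>n. square_integrable M (f n)" and g: "square_integrable M g"
    and l: "(\<lambda>n. L2_norm M (\<lambda>x. f n x - g x)) \<longlonglongrightarrow> 0"
  shows "(\<lambda>n. L2_norm M (f n)) \<longlonglongrightarrow> L2_norm M g"
proof (rule LIM_zero_cancel, rule tendsto_rabs_zero_cancel, rule tendsto_sandwich[OF _ _ tendsto_const l])
  show "\<forall>\<^sub>F n in sequentially. \<bar>L2_norm M (f n) - L2_norm M g\<bar> \<le> L2_norm M (\<lambda>x. f n x - g x)"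
  proof (rule always_eventually, rule allI)
    fix n
    show "\<bar>L2_norm M (f n) - L2_norm M g\<bar> \<le> L2_norm M (\<lambda>x. f n x - g x)"
      using L2_norm_triangle_diff[OF f[of n] g] L2_norm_triangle_diff[OF g f[of n]]
        L2_norm_diff_commute[of M g "f n"] by linarith
  qed
qed auto

section \<open>The arc length measure of an edge\<close>

lemma sets_arclength [measurable_cong, simp]: "sets (arclength e) = sets borel"
  by (simp add: arclength_def)

lemma space_arclength [simp]: "space (arclength e) = UNIV"
  by (simp add: arclength_def)

lemma measurable_arclength [simp]: "f \<in> borel_measurable (arclength e) \<longleftrightarrow> f \<in> borel_measurable borel"
  unfolding measurable_cong_sets[OF sets_arclength refl] ..

lemma edge_length_nonneg [simp]: "edge_length e \<ge> 0" by (simp add: edge_length_def)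

lemma emeasure_arclength: "emeasure (arclength e) UNIV = ennreal (edge_length e)"
  unfolding arclength_def
  by (subst emeasure_distr) (auto intro!: measurable_restrict_space1 simp: emeasure_restrict_space space_restrict_space)

lemma finite_arclength: "finite_measure (arclength e)"
  by (rule finite_measureI) (simp add: emeasure_arclength)

lemma integral_arclength_const: "(LINT x|arclength e. (a::real)) = a * edge_length e"
  using emeasure_arclength by (simp add: measure_def mult.commute)

lemma integrable_arclength_iff:
  fixes f :: "point \<Rightarrow> 'b::{banach, second_countable_topology}"
  assumes [measurable]: "f \<in> borel_measurable borel"
  shows "integrable (arclength e) f \<longleftrightarrow> integrable (restrict_space lborel {0..edge_length e})
      (\<lambda>s. f (fst e + (s / edge_length e) *\<^sub>R (snd e - fst e)))"
  unfolding arclength_def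
  by (rule integrable_distr_eq) (auto intro!: measurable_restrict_space1)

lemma square_integrable_arclength:
  fixes f :: "point \<Rightarrow> real"
  assumes c: "continuous_on UNIV f"
  shows "square_integrable (arclength e) f"
proof (rule square_integrableI)
  have m [measurable]: "f \<in> borel_measurable borel" using c by (rule borel_measurable_continuous_onI)
  then show "f \<in> borel_measurable (arclength e)" by simp
  let ?g = "\<lambda>s. f (fst e + (s / edge_length e) *\<^sub>R (snd e - fst e))"
  have "continuous_on UNIV ?g"
    by (rule continuous_on_compose2[OF c]) (auto intro!: continuous_intros simp: divide_inverse)
  then have "compact (?g ` {0..edge_length e})"
    by (intro compact_continuous_image) (auto intro: continuous_on_subset)
  then have "bounded (?g ` {0..edge_length e})" by (rule compact_imp_bounded)
  then obtain B where "\<forall>y\<in>?g ` {0..edge_length e}. norm y \<le> B"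
    unfolding bounded_iff by (elim exE)
  then have B: "\<And>s. s \<in> {0..edge_length e} \<Longrightarrow> \<bar>?g s\<bar> \<le> B" by auto
  have fin: "finite_measure (restrict_space lborel {0..edge_length e})"
    by (rule finite_measureI) (simp add: emeasure_restrict_space space_restrict_space)
  show "integrable (arclength e) (\<lambda>x. (norm (f x))\<^sup>2)"
    unfolding real_norm_def power2_abs
  proof (subst integrable_arclength_iff)
    show "integrable (restrict_space lborel {0..edge_length e}) (\<lambda>s. (?g s)\<^sup>2)"
    proof (rule finite_measure.integrable_const_bound[OF fin, where B = "B\<^sup>2"])
      show "AE s in restrict_space lborel {0..edge_length e}. norm ((?g s)\<^sup>2) \<le> B\<^sup>2"
      proof (rule AE_I2)
        fix s assume "s \<in> space (restrict_space lborel {0..edge_length e})"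
        then have "\<bar>?g s\<bar> \<le> B" by (intro B) (simp add: space_restrict_space)
        then have "\<bar>?g s\<bar>\<^sup>2 \<le> B\<^sup>2" by (rule power_mono) simp
        then show "norm ((?g s)\<^sup>2) \<le> B\<^sup>2" by simp
      qed
      show "(\<lambda>s. (?g s)\<^sup>2) \<in> borel_measurable (restrict_space lborel {0..edge_length e})"
        by (intro measurable_restrict_space1) measurable
    qed
  qed measurable
qed

section \<open>Estimates with constants depending on the shape parameter only\<close>

locale cell = star_cell +
  fixes E :: "edge set" and h \<rho> :: real
  assumes finite_E: "finite E"
    and nondegenerate: "\<And>e. e \<in> E \<Longrightarrow> fst e \<noteq> snd e"
    and disjoint_edges: "\<And>e e'. e \<in> E \<Longrightarrow> e' \<in> E \<Longrightarrow> e \<noteq> e' \<Longrightarrow> rel_segment e \<inter> rel_segment e' = {}"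
    and h: "\<And>x y. x \<in> K \<Longrightarrow> y \<in> K \<Longrightarrow> norm (x - y) \<le> h"
    and \<rho>: "0 < \<rho>" "\<rho> * h \<le> 2 * r"
begin

abbreviation EK where "EK \<equiv> edges_of E K"

lemma finite_EK: "finite EK" using finite_E by (simp add: edges_of_def)

lemma EK_boundary: "e \<in> EK \<Longrightarrow> boundary_edge e"
  using nondegenerate by (auto simp: edges_of_def boundary_edge_def)

lemma EK_disjoint: "e \<in> EK \<Longrightarrow> e' \<in> EK \<Longrightarrow> e \<noteq> e' \<Longrightarrow> rel_segment e \<inter> rel_segment e' = {}"
  using disjoint_edges by (auto simp: edges_of_def)

lemma c_in_K: "c \<in> K" using ball_subset r_pos by auto

lemma h_c: "x \<in> K \<Longrightarrow> norm (x - c) \<le> h" using h c_in_K by blast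

lemma h_pos: "h > 0"
proof -
  have "c + (r / 2) *\<^sub>R axis 1 1 \<in> ball c r" using r_pos by (simp add: dist_norm)
  then have "c + (r / 2) *\<^sub>R axis 1 1 \<in> K" using ball_subset by blast
  from h_c[OF this] show ?thesis using r_pos by simp
qed

lemma measure_K_le: "measure lborel K \<le> pi * h\<^sup>2"
proof -
  have "measure lborel K \<le> measure lborel (cball c h)"
    using open_K emeasure_bounded_finite[OF bounded_K] emeasure_bounded_finite[OF bounded_cball, of c h] h_c
    by (intro measure_mono_fmeasurable) (auto simp: fmeasurable_def dist_norm norm_minus_commute)
  also have "\<dots> = pi * h\<^sup>2" using h_pos content_cball[of h c] by (simp add: unit_ball_vol_2)
  finally show ?thesis .
qed

lemma measure_K_ratio: "measure lborel K * r\<^sup>2 \<le> h\<^sup>2 * measure lborel (ball c r)"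
proof -
  have "measure lborel (ball c r) = pi * r\<^sup>2" using r_pos content_ball[of r c] by (simp add: unit_ball_vol_2)
  then show ?thesis using mult_right_mono[OF measure_K_le, of "r\<^sup>2"] by (simp add: mult_ac)
qed

lemma inverse_r: "1 / r \<le> 2 / (\<rho> * h)"
  using \<rho> h_pos r_pos by (simp add: field_simps)

definition P_const :: real where "P_const = 16 / \<rho>\<^sup>2"

text \<open>The trace constant after a factor \<open>h\<close> is split off. The factor
  \<open>2 / \<rho>\<close> comes from \<open>1 / r \<le> 2 / (\<rho> * h)\<close>; the bracket
  holds the two terms of \<open>trace_smooth\<close> after the Poincare inequality with constant
  \<open>4 / \<rho>\<close>, whose square is \<open>P_const\<close>.\<close>

definition T_const :: real where "T_const = 2 / \<rho> * (2 * P_const + 2 * (4 / \<rho>))"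

lemma P_const_pos: "P_const > 0" using \<rho> by (simp add: P_const_def)
lemma T_const_pos: "T_const > 0" using \<rho> P_const_pos by (simp add: T_const_def add_pos_pos)

text \<open>The areas of \<open>K\<close> and the disc have a ratio of at most
  \<open>(h / r)^2\<close>, and \<open>r \<ge> \<rho> * h / 2\<close>; this turns the constant of
  \<open>Poincare_smooth\<close> into the square of \<open>4 / \<rho> * h\<close>.\<close>

lemma Poincare_smooth_const:
  assumes \<phi>: "smooth \<phi>"
  shows "L2_norm M (\<lambda>x. \<phi> x - average K \<phi>) \<le> 4 / \<rho> * h * H1_seminorm K \<phi>"
proof -
  let ?N = "L2_norm M (\<lambda>x. \<phi> x - average K \<phi>)" and ?S = "H1_seminorm K \<phi>"
  let ?b = "measure lborel (ball c r)"
  have b: "?b > 0" by (rule measure_K_pos)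
  have "?b * (?N\<^sup>2 * r\<^sup>2) = (?b * ?N\<^sup>2) * r\<^sup>2" by simp
  also have "\<dots> \<le> (4 * h\<^sup>2 * measure lborel K * ?S\<^sup>2) * r\<^sup>2"
    by (intro mult_right_mono Poincare_smooth \<phi> h) auto
  also have "\<dots> = (4 * h\<^sup>2 * ?S\<^sup>2) * (measure lborel K * r\<^sup>2)" by simp
  also have "\<dots> \<le> (4 * h\<^sup>2 * ?S\<^sup>2) * (h\<^sup>2 * ?b)" by (intro mult_left_mono measure_K_ratio) auto
  also have "\<dots> = ?b * (4 * h ^ 4 * ?S\<^sup>2)" by (simp add: power2_eq_square power4_eq_xxxx)
  finally have "?N\<^sup>2 * r\<^sup>2 \<le> 4 * h ^ 4 * ?S\<^sup>2" using b by simp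
  then have "(?N * r)\<^sup>2 \<le> (2 * h\<^sup>2 * ?S)\<^sup>2" by (simp add: power_mult_distrib power_mult[symmetric])
  then have "?N * r \<le> 2 * h\<^sup>2 * ?S" by (rule power2_le_imp_le) simp
  moreover have "?N * (\<rho> * h) \<le> ?N * (2 * r)" using \<rho> by (intro mult_left_mono) auto
  ultimately have "?N * (\<rho> * h) \<le> 4 * h\<^sup>2 * ?S" by simp
  then show ?thesis using \<rho> h_pos by (simp add: field_simps power2_eq_square)
qed

lemma trace_smooth_const:
  assumes \<phi>: "smooth \<phi>"
  shows "(\<Sum>e\<in>EK. (L2_norm (arclength e) (\<lambda>x. \<phi> x - average K \<phi>))\<^sup>2) \<le> T_const * h * (H1_seminorm K \<phi>)\<^sup>2"
proof -
  let ?a = "average K \<phi>"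
  let ?\<psi> = "\<lambda>x. \<phi> x - ?a"
  let ?N = "L2_norm M ?\<psi>" and ?S = "H1_seminorm K \<phi>"
  have \<psi>: "smooth ?\<psi>" by (intro smooth_diff \<phi> smooth_const)
  have S: "H1_seminorm K ?\<psi> = ?S"
    using H1_seminorm_add_const[OF H1_smooth[OF \<phi>], of "- ?a"] by simp
  have N: "?N \<le> 4 / \<rho> * h * ?S" by (rule Poincare_smooth_const[OF \<phi>])
  have "r * (\<Sum>e\<in>EK. (L2_norm (arclength e) ?\<psi>)\<^sup>2) \<le> 2 * ?N\<^sup>2 + 2 * h * ?N * ?S"
    using trace_smooth[OF finite_EK EK_boundary EK_disjoint h_c \<psi>] by (simp add: L2_norm_power2 S)
  also have "\<dots> \<le> 2 * (4 / \<rho> * h * ?S)\<^sup>2 + 2 * h * (4 / \<rho> * h * ?S) * ?S"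
    using N h_pos by (intro add_mono mult_left_mono mult_right_mono power_mono) auto
  also have "\<dots> = h\<^sup>2 * (2 * P_const + 2 * (4 / \<rho>)) * ?S\<^sup>2"
    by (simp add: P_const_def power2_eq_square algebra_simps)
  finally have "(\<Sum>e\<in>EK. (L2_norm (arclength e) ?\<psi>)\<^sup>2) \<le> (1 / r) * (h\<^sup>2 * (2 * P_const + 2 * (4 / \<rho>)) * ?S\<^sup>2)"
    using r_pos by (simp add: field_simps)
  also have "\<dots> \<le> (2 / (\<rho> * h)) * (h\<^sup>2 * (2 * P_const + 2 * (4 / \<rho>)) * ?S\<^sup>2)"
    using P_const_pos \<rho> by (intro mult_right_mono inverse_r) auto
  also have "\<dots> = T_const * h * ?S\<^sup>2" using h_pos by (simp add: T_const_def power2_eq_square)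
  finally show ?thesis .
qed

text \<open>The trace estimate for the constant function 1. It bounds the total length without a
  bound on the number of edges.\<close>

lemma perimeter: "(\<Sum>e\<in>EK. edge_length e) \<le> 4 * pi / \<rho> * h"
proof -
  have "r * (\<Sum>e\<in>EK. LINT x|arclength e. 1\<^sup>2) \<le> 2 * (L2_norm M (\<lambda>x. 1::real))\<^sup>2 + 2 * h * L2_norm M (\<lambda>x. 1::real) * H1_seminorm K (\<lambda>x. 1)"
    by (rule trace_smooth[OF finite_EK EK_boundary EK_disjoint h_c smooth_const])
  then have "r * (\<Sum>e\<in>EK. edge_length e) \<le> 2 * measure lborel K"
    using integral_arclength_const[of _ 1] integral_const_M[of 1] by (simp add: H1_seminorm_const L2_norm_power2 del: lebesgue_integral_const)
  also have "\<dots> \<le> 2 * (pi * h\<^sup>2)" using measure_K_le by simp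
  finally have "(\<Sum>e\<in>EK. edge_length e) \<le> (1 / r) * (2 * (pi * h\<^sup>2))" using r_pos by (simp add: field_simps)
  also have "\<dots> \<le> (2 / (\<rho> * h)) * (2 * (pi * h\<^sup>2))" by (intro mult_right_mono inverse_r) auto
  also have "\<dots> = 4 * pi / \<rho> * h" using h_pos by (simp add: power2_eq_square)
  finally show ?thesis .
qed

text \<open>Here the constant may depend on the cell: the bound only serves to show that the traces
  of an approximating sequence converge.\<close>

lemma trace_bound_smooth:
  obtains B where "B \<ge> 0" "\<And>\<phi> e. smooth \<phi> \<Longrightarrow> e \<in> EK \<Longrightarrow> L2_norm (arclength e) \<phi> \<le> B * (L2_norm M \<phi> + H1_seminorm K \<phi>)"
proof
  show "sqrt ((2 + 2 * h) / r) \<ge> 0" using r_pos h_pos by simp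
  fix \<phi> e assume \<phi>: "smooth \<phi>" and e: "e \<in> EK"
  let ?N = "L2_norm M \<phi>" and ?S = "H1_seminorm K \<phi>"
  have "r * (L2_norm (arclength e) \<phi>)\<^sup>2 \<le> r * (\<Sum>e\<in>EK. (L2_norm (arclength e) \<phi>)\<^sup>2)"
    using r_pos e finite_EK by (intro mult_left_mono member_le_sum) auto
  also have "\<dots> \<le> 2 * ?N\<^sup>2 + 2 * h * ?N * ?S"
    using trace_smooth[OF finite_EK EK_boundary EK_disjoint h_c \<phi>] by (simp add: L2_norm_power2)
  also have "\<dots> \<le> (2 + 2 * h) * (?N + ?S)\<^sup>2"
  proof -
    have "?N\<^sup>2 \<le> (?N + ?S)\<^sup>2" "?N * ?S \<le> (?N + ?S)\<^sup>2"
      by (auto simp: power2_eq_square algebra_simps)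
    then have "2 * ?N\<^sup>2 + (2 * h) * (?N * ?S) \<le> 2 * (?N + ?S)\<^sup>2 + (2 * h) * (?N + ?S)\<^sup>2"
      using h_pos by (intro add_mono mult_left_mono) auto
    then show ?thesis by (simp add: algebra_simps)
  qed
  finally have "(L2_norm (arclength e) \<phi>)\<^sup>2 \<le> ((2 + 2 * h) / r) * (?N + ?S)\<^sup>2" using r_pos by (simp add: field_simps)
  then have "sqrt ((L2_norm (arclength e) \<phi>)\<^sup>2) \<le> sqrt (((2 + 2 * h) / r) * (?N + ?S)\<^sup>2)" by (rule real_sqrt_le_mono)
  then show "L2_norm (arclength e) \<phi> \<le> sqrt ((2 + 2 * h) / r) * (?N + ?S)"
    unfolding real_sqrt_mult real_sqrt_abs by simp
qed

section \<open>Existence, linearity and uniqueness of traces\<close>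

lemma has_trace_exists:
  assumes u: "u \<in> H1 K" shows "\<exists>g. has_trace E K u g"
proof -
  obtain \<phi>0 where \<phi>0: "\<And>n::nat. smooth (\<phi>0 n)" "(\<lambda>n. H1_norm K (\<lambda>x. \<phi>0 n x - u x)) \<longlonglongrightarrow> 0"
    using smooth_dense_H1[OF u] by blast
  \<comment> \<open>The rate \<open>1 / 4 ^ k\<close> is the one that
    \<open>L2_pointwise_limit\<close> requires.\<close>
  have "\<exists>\<psi>. smooth \<psi> \<and> H1_norm K (\<lambda>x. \<psi> x - u x) < 1 / 4 ^ k" for k :: nat
  proof -
    have "\<forall>\<^sub>F n in sequentially. H1_norm K (\<lambda>x. \<phi>0 n x - u x) < 1 / 4 ^ k"
      using order_tendstoD(2)[OF \<phi>0(2)] by simp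
    then show ?thesis using eventually_happens'[OF sequentially_bot] \<phi>0(1) by blast
  qed
  then obtain \<phi> where s: "\<And>k. smooth (\<phi> k)" and d: "\<And>k::nat. H1_norm K (\<lambda>x. \<phi> k x - u x) < 1 / 4 ^ k" by metis
  obtain B where B: "B \<ge> 0" "\<And>\<phi> e. smooth \<phi> \<Longrightarrow> e \<in> EK \<Longrightarrow> L2_norm (arclength e) \<phi> \<le> B * (L2_norm M \<phi> + H1_seminorm K \<phi>)"
    using trace_bound_smooth by blast
  define g where "g x = lim (\<lambda>k. \<phi> k x)" for x
  have sq: "square_integrable (arclength e) (\<phi> k)" for e k
    by (rule square_integrable_arclength[OF smooth_continuous[OF s]])
  \<comment> \<open>Two errors of at most \<open>1 / 4 ^ k\<close>, each counted in the square norm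
    and in the seminorm, make the factor 4.\<close>
  have step: "L2_norm (arclength e) (\<lambda>x. \<phi> (Suc k) x - \<phi> k x) \<le> (4 * B) / 4 ^ k" if "e \<in> EK" for e k
  proof -
    let ?a = "\<lambda>x. \<phi> (Suc k) x - u x" and ?b = "\<lambda>x. \<phi> k x - u x"
    have ab: "?a \<in> H1 K" "?b \<in> H1 K" by (intro H1_diff H1_smooth s u)+
    have eq: "(\<lambda>x. \<phi> (Suc k) x - \<phi> k x) = (\<lambda>x. ?a x - ?b x)" by auto
    have "L2_norm M (\<lambda>x. ?a x - ?b x) \<le> L2_norm M ?a + L2_norm M ?b"
      using L2_norm_triangle[OF H1_square_integrable[OF ab(1)] square_integrable_minus[OF H1_square_integrable[OF ab(2)]]]
      unfolding L2_norm_minus by simp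
    then have "L2_norm M (\<lambda>x. ?a x - ?b x) + H1_seminorm K (\<lambda>x. ?a x - ?b x)
        \<le> (L2_norm M ?a + L2_norm M ?b) + (H1_seminorm K ?a + H1_seminorm K ?b)"
      using H1_seminorm_diff[OF ab] by linarith
    also have "\<dots> \<le> 2 * (H1_norm K ?a + H1_norm K ?b)"
      using add_mono[OF add_mono[OF L2_le_H1_norm[of ?a] L2_le_H1_norm[of ?b]]
          add_mono[OF H1_seminorm_le_norm[of ?a] H1_seminorm_le_norm[of ?b]]] by simp
    also have "\<dots> \<le> 4 / 4 ^ k"
    proof -
      have "(1::real) / 4 ^ Suc k \<le> 1 / 4 ^ k" by (simp add: field_simps)
      then show ?thesis using d[of "Suc k"] d[of k] by simp
    qed
    finally have "B * (L2_norm M (\<lambda>x. ?a x - ?b x) + H1_seminorm K (\<lambda>x. ?a x - ?b x)) \<le> B * (4 / 4 ^ k)"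
      using B(1) by (rule mult_left_mono)
    moreover have "L2_norm (arclength e) (\<lambda>x. \<phi> (Suc k) x - \<phi> k x) \<le> B * (L2_norm M (\<lambda>x. ?a x - ?b x) + H1_seminorm K (\<lambda>x. ?a x - ?b x))"
      using B(2)[OF smooth_diff[OF s[of "Suc k"] s[of k]] that] unfolding eq .
    ultimately show ?thesis by (simp add: mult.commute)
  qed
  have "has_trace E K u g"
    unfolding has_trace_def
  proof (intro conjI ballI exI[of _ \<phi>] allI s)
    show "(\<lambda>n. H1_norm K (\<lambda>x. \<phi> n x - u x)) \<longlonglongrightarrow> 0"
    proof (rule tendsto_sandwich[OF _ _ tendsto_const])
      show "(\<lambda>n. 1 / 4 ^ n :: real) \<longlonglongrightarrow> 0"
        using LIMSEQ_realpow_zero[of "1/4"] by (simp add: power_divide)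
    qed (auto intro!: always_eventually less_imp_le d)
    fix e assume e: "e \<in> EK"
    show "square_integrable (arclength e) g" "(\<lambda>n. L2_norm (arclength e) (\<lambda>x. \<phi> n x - g x)) \<longlonglongrightarrow> 0"
      unfolding g_def by (rule L2_pointwise_limit[OF sq step[OF e]])+
  qed
  then show ?thesis by blast
qed

lemma H1_trace: "u \<in> H1 K \<Longrightarrow> has_trace E K u (H1_trace E K u)"
  unfolding H1_trace_def by (rule someI_ex[OF has_trace_exists])

lemma has_trace_lincomb:
  assumes u: "u \<in> H1 K" and v: "v \<in> H1 K" and tu: "has_trace E K u f" and tv: "has_trace E K v g"
  shows "has_trace E K (\<lambda>x. a * u x + b * v x) (\<lambda>x. a * f x + b * g x)"
proof -
  obtain \<phi> where \<phi>: "\<And>n. smooth (\<phi> n)" "(\<lambda>n::nat. H1_norm K (\<lambda>x. \<phi> n x - u x)) \<longlonglongrightarrow> 0"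
    "\<And>e. e \<in> EK \<Longrightarrow> (\<lambda>n. L2_norm (arclength e) (\<lambda>x. \<phi> n x - f x)) \<longlonglongrightarrow> 0"
    and f: "\<And>e. e \<in> EK \<Longrightarrow> square_integrable (arclength e) f"
    using tu unfolding has_trace_def by auto
  obtain \<psi> where \<psi>: "\<And>n. smooth (\<psi> n)" "(\<lambda>n::nat. H1_norm K (\<lambda>x. \<psi> n x - v x)) \<longlonglongrightarrow> 0"
    "\<And>e. e \<in> EK \<Longrightarrow> (\<lambda>n. L2_norm (arclength e) (\<lambda>x. \<psi> n x - g x)) \<longlonglongrightarrow> 0"
    and g: "\<And>e. e \<in> EK \<Longrightarrow> square_integrable (arclength e) g"
    using tv unfolding has_trace_def by auto
  have le: "L2_norm N (\<lambda>x. (a * p x + b * q x) - (a * p' x + b * q' x))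
     \<le> \<bar>a\<bar> * L2_norm N (\<lambda>x. p x - p' x) + \<bar>b\<bar> * L2_norm N (\<lambda>x. q x - q' x)"
    if "square_integrable N p" "square_integrable N q" "square_integrable N p'" "square_integrable N q'"
    for N and p q p' q' :: "point \<Rightarrow> real"
  proof -
    have "(\<lambda>x. (a * p x + b * q x) - (a * p' x + b * q' x)) = (\<lambda>x. a *\<^sub>R (p x - p' x) + b *\<^sub>R (q x - q' x))"
      by (auto simp: algebra_simps)
    then show ?thesis
      using L2_norm_triangle[OF square_integrable_scaleR[OF square_integrable_diff[OF that(1,3)], of a]
          square_integrable_scaleR[OF square_integrable_diff[OF that(2,4)], of b]]
      unfolding L2_norm_scaleR by simp
  qed
  have z: "(\<lambda>n. \<bar>a\<bar> * p n + \<bar>b\<bar> * q n) \<longlonglongrightarrow> 0" if "p \<longlonglongrightarrow> 0" "q \<longlonglongrightarrow> 0" for p q :: "nat \<Rightarrow> real"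
    using tendsto_add[OF tendsto_mult_right_zero[OF that(1)] tendsto_mult_right_zero[OF that(2)]] by simp
  show ?thesis
    unfolding has_trace_def
  proof (intro conjI ballI exI[of _ "\<lambda>n x. a * \<phi> n x + b * \<psi> n x"] allI)
    fix e assume e: "e \<in> EK"
    show "square_integrable (arclength e) (\<lambda>x. a * f x + b * g x)"
      by (intro square_integrable_add square_integrable_cmult f g e)
    show "(\<lambda>n. L2_norm (arclength e) (\<lambda>x. a * \<phi> n x + b * \<psi> n x - (a * f x + b * g x))) \<longlonglongrightarrow> 0"
    proof (rule tendsto_sandwich[OF _ _ tendsto_const z[OF \<phi>(3)[OF e] \<psi>(3)[OF e]]])
      show "\<forall>\<^sub>F n in sequentially. L2_norm (arclength e) (\<lambda>x. a * \<phi> n x + b * \<psi> n x - (a * f x + b * g x))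
        \<le> \<bar>a\<bar> * L2_norm (arclength e) (\<lambda>x. \<phi> n x - f x) + \<bar>b\<bar> * L2_norm (arclength e) (\<lambda>x. \<psi> n x - g x)"
        by (intro always_eventually allI le square_integrable_arclength smooth_continuous \<phi> \<psi> f g e)
    qed auto
  next
    show "smooth (\<lambda>x. a * \<phi> n x + b * \<psi> n x)" for n
      by (intro smooth_add smooth_cmult \<phi> \<psi>)
    show "(\<lambda>n. H1_norm K (\<lambda>x. a * \<phi> n x + b * \<psi> n x - (a * u x + b * v x))) \<longlonglongrightarrow> 0"
    proof (rule tendsto_sandwich[OF _ _ tendsto_const])
      let ?p = "\<lambda>n x. \<phi> n x - u x" and ?q = "\<lambda>n x. \<psi> n x - v x"
      have eq: "(\<lambda>x. a * \<phi> n x + b * \<psi> n x - (a * u x + b * v x)) = (\<lambda>x. a * ?p n x + b * ?q n x)" for n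
        by (auto simp: algebra_simps)
      have H: "?p n \<in> H1 K" "?q n \<in> H1 K" for n by (intro H1_diff H1_smooth \<phi> \<psi> u v)+
      have "H1_norm K (\<lambda>x. a * \<phi> n x + b * \<psi> n x - (a * u x + b * v x))
        \<le> \<bar>a\<bar> * (2 * H1_norm K (?p n)) + \<bar>b\<bar> * (2 * H1_norm K (?q n))" for n
      proof -
        have 1: "H1_seminorm K (\<lambda>x. a * ?p n x + b * ?q n x) \<le> \<bar>a\<bar> * H1_seminorm K (?p n) + \<bar>b\<bar> * H1_seminorm K (?q n)"
          using H1_seminorm_add[OF H1_cmult[OF H(1)] H1_cmult[OF H(2)], of a n b n] by (simp add: H1_seminorm_cmult H)
        have 2: "L2_norm M (\<lambda>x. a * ?p n x + b * ?q n x) \<le> \<bar>a\<bar> * L2_norm M (?p n) + \<bar>b\<bar> * L2_norm M (?q n)"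
          using le[of M "\<phi> n" "\<psi> n" u v] unfolding eq
          by (simp add: square_integrable_smooth \<phi> \<psi> H1_square_integrable u v)
        have "\<bar>a\<bar> * (L2_norm M (?p n) + H1_seminorm K (?p n)) \<le> \<bar>a\<bar> * (2 * H1_norm K (?p n))"
          using L2_le_H1_norm[of "?p n"] H1_seminorm_le_norm[of "?p n"] by (intro mult_left_mono) auto
        moreover have "\<bar>b\<bar> * (L2_norm M (?q n) + H1_seminorm K (?q n)) \<le> \<bar>b\<bar> * (2 * H1_norm K (?q n))"
          using L2_le_H1_norm[of "?q n"] H1_seminorm_le_norm[of "?q n"] by (intro mult_left_mono) auto
        ultimately show ?thesis
          using H1_norm_le[of "\<lambda>x. a * ?p n x + b * ?q n x"] 1 2 unfolding eq by (simp add: algebra_simps)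
      qed
      then show "\<forall>\<^sub>F n in sequentially. H1_norm K (\<lambda>x. a * \<phi> n x + b * \<psi> n x - (a * u x + b * v x))
        \<le> \<bar>a\<bar> * (2 * H1_norm K (?p n)) + \<bar>b\<bar> * (2 * H1_norm K (?q n))" by simp
      show "(\<lambda>n. \<bar>a\<bar> * (2 * H1_norm K (?p n)) + \<bar>b\<bar> * (2 * H1_norm K (?q n))) \<longlonglongrightarrow> 0"
        by (intro z tendsto_mult_right_zero \<phi> \<psi>)
    qed auto
  qed
qed

lemma average_diff: "f \<in> H1 K \<Longrightarrow> g \<in> H1 K \<Longrightarrow> average K (\<lambda>x. f x - g x) = average K f - average K g"
  using square_integrable_integrable[OF H1_square_integrable]
  by (simp add: average_def diff_divide_distrib)

lemma average_le:
  assumes f: "f \<in> H1 K" shows "\<bar>average K f\<bar> \<le> L2_norm M f / sqrt (measure lborel K)"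
proof -
  have m: "measure lborel K > 0" by (rule measure_K_pos)
  have "\<bar>LINT x|M. f x \<bullet> 1\<bar> \<le> L2_norm M f * L2_norm M (\<lambda>x. 1 :: real)"
    by (intro L2_Cauchy_Schwarz H1_square_integrable f square_integrable_const finite_M)
  also have "L2_norm M (\<lambda>x. 1 :: real) = sqrt (measure lborel K)"
    using integral_const_M[of 1] by (simp add: L2_norm_def del: lebesgue_integral_const)
  finally have "\<bar>average K f\<bar> \<le> L2_norm M f * sqrt (measure lborel K) / measure lborel K"
    using m by (simp add: average_def abs_divide divide_right_mono)
  also have "\<dots> = L2_norm M f / sqrt (measure lborel K)"
  proof -
    define q where "q = sqrt (measure lborel K)"
    have q: "q > 0" "measure lborel K = q * q" using m by (auto simp: q_def)
    show ?thesis unfolding q_def[symmetric] unfolding q(2) using q(1) by simp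
  qed
  finally show ?thesis .
qed

lemma H1_approx_limits:
  assumes u: "u \<in> H1 K" and \<phi>: "\<And>n. smooth (\<phi> n)" "(\<lambda>n::nat. H1_norm K (\<lambda>x. \<phi> n x - u x)) \<longlonglongrightarrow> 0"
  shows "(\<lambda>n. average K (\<phi> n)) \<longlonglongrightarrow> average K u" "(\<lambda>n. H1_seminorm K (\<phi> n)) \<longlonglongrightarrow> H1_seminorm K u"
    "(\<lambda>n. L2_norm M (\<lambda>x. \<phi> n x - u x)) \<longlonglongrightarrow> 0"
proof -
  have d: "(\<lambda>x. \<phi> n x - u x) \<in> H1 K" for n by (intro H1_diff H1_smooth \<phi> u)
  show L: "(\<lambda>n. L2_norm M (\<lambda>x. \<phi> n x - u x)) \<longlonglongrightarrow> 0"
    by (rule tendsto_sandwich[OF _ _ tendsto_const \<phi>(2)]) (auto simp: L2_le_H1_norm)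
  show "(\<lambda>n. average K (\<phi> n)) \<longlonglongrightarrow> average K u"
  proof (rule LIM_zero_cancel, rule tendsto_rabs_zero_cancel, rule tendsto_sandwich[OF _ _ tendsto_const])
    show "(\<lambda>n. L2_norm M (\<lambda>x. \<phi> n x - u x) / sqrt (measure lborel K)) \<longlonglongrightarrow> 0"
      using tendsto_divide[OF L tendsto_const[of "sqrt (measure lborel K)"]] measure_K_pos(2) by simp
    show "\<forall>\<^sub>F n in sequentially. \<bar>average K (\<phi> n) - average K u\<bar> \<le> L2_norm M (\<lambda>x. \<phi> n x - u x) / sqrt (measure lborel K)"
      using average_le[OF d] average_diff[OF H1_smooth[OF \<phi>(1)] u] by simp
  qed auto
  show "(\<lambda>n. H1_seminorm K (\<phi> n)) \<longlonglongrightarrow> H1_seminorm K u"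
  proof (rule LIM_zero_cancel, rule tendsto_rabs_zero_cancel, rule tendsto_sandwich[OF _ _ tendsto_const \<phi>(2)])
    have "\<bar>H1_seminorm K (\<phi> n) - H1_seminorm K u\<bar> \<le> H1_norm K (\<lambda>x. \<phi> n x - u x)" for n
      using H1_seminorm_add[OF d[of n] u] H1_seminorm_diff[OF H1_smooth[OF \<phi>(1)[of n]] d[of n]]
        H1_seminorm_le_norm[of "\<lambda>x. \<phi> n x - u x"] by simp
    then show "\<forall>\<^sub>F n in sequentially. \<bar>H1_seminorm K (\<phi> n) - H1_seminorm K u\<bar> \<le> H1_norm K (\<lambda>x. \<phi> n x - u x)" by simp
  qed auto
qed

lemma L2_norm_shift_tendsto:
  assumes f: "\<And>n. square_integrable N (f n)" "square_integrable N g" "finite_measure N"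
    and l: "(\<lambda>n. L2_norm N (\<lambda>x. f n x - g x)) \<longlonglongrightarrow> 0" and a: "a \<longlonglongrightarrow> b"
  shows "(\<lambda>n. L2_norm N (\<lambda>x. f n x - (a n :: real))) \<longlonglongrightarrow> L2_norm N (\<lambda>x. g x - b)"
proof (rule L2_norm_tendsto)
  have c: "square_integrable N (\<lambda>x. k)" for k :: real by (rule square_integrable_const[OF f(3)])
  show "square_integrable N (\<lambda>x. f n x - a n)" for n by (intro square_integrable_diff f c)
  show "square_integrable N (\<lambda>x. g x - b)" by (intro square_integrable_diff f c)
  show "(\<lambda>n. L2_norm N (\<lambda>x. f n x - a n - (g x - b))) \<longlonglongrightarrow> 0"
  proof (rule tendsto_sandwich[OF _ _ tendsto_const])
    have "L2_norm N (\<lambda>x. f n x - a n - (g x - b)) \<le> L2_norm N (\<lambda>x. f n x - g x) + \<bar>b - a n\<bar> * L2_norm N (\<lambda>x. 1::real)" for n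
    proof -
      have "(\<lambda>x. f n x - a n - (g x - b)) = (\<lambda>x. (f n x - g x) + (b - a n) *\<^sub>R 1)" by auto
      then show ?thesis
        using L2_norm_triangle[OF square_integrable_diff[OF f(1)[of n] f(2)] square_integrable_scaleR[OF c[of 1], of "b - a n"]]
        unfolding L2_norm_scaleR by simp
    qed
    then show "\<forall>\<^sub>F n in sequentially. L2_norm N (\<lambda>x. f n x - a n - (g x - b)) \<le> L2_norm N (\<lambda>x. f n x - g x) + \<bar>b - a n\<bar> * L2_norm N (\<lambda>x. 1::real)" by simp
    have "(\<lambda>n. \<bar>b - a n\<bar>) \<longlonglongrightarrow> 0" using tendsto_rabs[OF tendsto_diff[OF tendsto_const a, of b]] by simp
    from tendsto_add[OF l tendsto_mult_left_zero[OF this, of "L2_norm N (\<lambda>x. 1::real)"]]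
    show "(\<lambda>n. L2_norm N (\<lambda>x. f n x - g x) + \<bar>b - a n\<bar> * L2_norm N (\<lambda>x. 1::real)) \<longlonglongrightarrow> 0" by simp
  qed auto
qed

text \<open>By density of smooth functions. Formulated for any trace \<open>g\<close>, because
  uniqueness of traces is deduced from it.\<close>

lemma trace_Poincare:
  assumes u: "u \<in> H1 K" and t: "has_trace E K u g"
  shows "(\<Sum>e\<in>EK. (L2_norm (arclength e) (\<lambda>x. g x - average K u))\<^sup>2) \<le> T_const * h * (H1_seminorm K u)\<^sup>2"
proof -
  obtain \<phi> where \<phi>: "\<And>n. smooth (\<phi> n)" "(\<lambda>n::nat. H1_norm K (\<lambda>x. \<phi> n x - u x)) \<longlonglongrightarrow> 0"
    "\<And>e. e \<in> EK \<Longrightarrow> (\<lambda>n. L2_norm (arclength e) (\<lambda>x. \<phi> n x - g x)) \<longlonglongrightarrow> 0"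
    and g: "\<And>e. e \<in> EK \<Longrightarrow> square_integrable (arclength e) g"
    using t unfolding has_trace_def by auto
  note lim = H1_approx_limits[OF u \<phi>(1,2)]
  have 1: "(\<lambda>n. \<Sum>e\<in>EK. (L2_norm (arclength e) (\<lambda>x. \<phi> n x - average K (\<phi> n)))\<^sup>2)
      \<longlonglongrightarrow> (\<Sum>e\<in>EK. (L2_norm (arclength e) (\<lambda>x. g x - average K u))\<^sup>2)"
    by (intro tendsto_sum tendsto_power L2_norm_shift_tendsto square_integrable_arclength smooth_continuous \<phi> g
        finite_arclength lim(1))
  have 2: "(\<lambda>n. T_const * h * (H1_seminorm K (\<phi> n))\<^sup>2) \<longlonglongrightarrow> T_const * h * (H1_seminorm K u)\<^sup>2"
    by (intro tendsto_intros lim(2))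
  show ?thesis by (rule LIMSEQ_le[OF 1 2]) (use trace_smooth_const[OF \<phi>(1)] in blast)
qed

lemma Poincare:
  assumes u: "u \<in> H1 K" shows "L2_norm M (\<lambda>x. u x - average K u) \<le> 4 / \<rho> * h * H1_seminorm K u"
proof -
  obtain \<phi> where \<phi>: "\<And>n::nat. smooth (\<phi> n)" "(\<lambda>n. H1_norm K (\<lambda>x. \<phi> n x - u x)) \<longlonglongrightarrow> 0"
    using smooth_dense_H1[OF u] by blast
  note lim = H1_approx_limits[OF u \<phi>]
  have 1: "(\<lambda>n. L2_norm M (\<lambda>x. \<phi> n x - average K (\<phi> n))) \<longlonglongrightarrow> L2_norm M (\<lambda>x. u x - average K u)"
    by (intro L2_norm_shift_tendsto square_integrable_smooth \<phi> H1_square_integrable u finite_M lim)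
  have 2: "(\<lambda>n. 4 / \<rho> * h * H1_seminorm K (\<phi> n)) \<longlonglongrightarrow> 4 / \<rho> * h * H1_seminorm K u"
    by (intro tendsto_intros lim(2)) (use \<rho> in auto)
  show ?thesis by (rule LIMSEQ_le[OF 1 2]) (use Poincare_smooth_const[OF \<phi>(1)] in blast)
qed

text \<open>The difference of two traces is a trace of 0, and for 0 the right-hand side of
  \<open>trace_Poincare\<close> vanishes.\<close>

lemma has_trace_unique:
  assumes u: "u \<in> H1 K" and t: "has_trace E K u g" "has_trace E K u g'" and e: "e \<in> EK"
  shows "AE x in arclength e. g x = g' x"
proof -
  have t0: "has_trace E K (\<lambda>x. 0) (\<lambda>x. g x - g' x)" using has_trace_lincomb[OF u u t, of 1 "-1"] by simp
  have "(L2_norm (arclength e) (\<lambda>x. g x - g' x))\<^sup>2 \<le> (\<Sum>e\<in>EK. (L2_norm (arclength e) (\<lambda>x. g x - g' x))\<^sup>2)"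
    using e finite_EK by (intro member_le_sum) auto
  also have "\<dots> \<le> 0" using trace_Poincare[OF H1_const t0] by (simp add: H1_seminorm_const average_def)
  finally have "L2_norm (arclength e) (\<lambda>x. g x - g' x) = 0" by simp
  moreover have "square_integrable (arclength e) (\<lambda>x. g x - g' x)"
    using t e by (intro square_integrable_diff) (auto simp: has_trace_def)
  ultimately show ?thesis by (simp add: L2_norm_eq_0_iff)
qed

lemma has_trace_smooth: assumes "smooth \<phi>" shows "has_trace E K \<phi> \<phi>"
proof -
  have "H1_norm K (\<lambda>x. 0) = 0" using H1_norm_le[of "\<lambda>x. 0"] by (simp add: H1_seminorm_const L2_norm_def antisym)
  then show ?thesis unfolding has_trace_def
    using assms square_integrable_arclength[OF smooth_continuous[OF assms]]
    by (auto intro!: exI[of _ "\<lambda>n. \<phi>"] simp: L2_norm_def)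
qed

lemma trace_smooth_eq: "smooth \<phi> \<Longrightarrow> e \<in> EK \<Longrightarrow> AE x in arclength e. H1_trace E K \<phi> x = \<phi> x"
  by (rule has_trace_unique[OF H1_smooth H1_trace has_trace_smooth]) (auto intro: H1_smooth)

lemma trace_lincomb:
  assumes "u \<in> H1 K" "v \<in> H1 K" "e \<in> EK"
  shows "AE x in arclength e. H1_trace E K (\<lambda>x. a * u x + b * v x) x = a * H1_trace E K u x + b * H1_trace E K v x"
  by (rule has_trace_unique[OF H1_lincomb(1)[OF assms(1,2)] H1_trace[OF H1_lincomb(1)[OF assms(1,2)]]
        has_trace_lincomb[OF assms(1,2) H1_trace[OF assms(1)] H1_trace[OF assms(2)]] assms(3)])

lemma square_integrable_trace: "u \<in> H1 K \<Longrightarrow> e \<in> EK \<Longrightarrow> square_integrable (arclength e) (H1_trace E K u)"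
  using H1_trace by (auto simp: has_trace_def)

end

section \<open>Outer normals, fluxes and the dual seminorm\<close>

context star_cell
begin

text \<open>Near \<open>x\<close> the foot of \<open>z\<close> stays on the open edge by continuity.
  Membership in \<open>K\<close> is then decided by \<open>radius e z\<close> alone, and
  \<open>radius e z - 1\<close> is a positive multiple of the signed distance to the line of the
  edge.\<close>

lemma boundary_half_disc:
  assumes e: "boundary_edge e" and x: "x \<in> rel_segment e"
  shows "\<forall>\<^sub>F z in nhds x. ((z - x) \<bullet> onormal e < 0 \<longrightarrow> z \<in> K) \<and>
     (0 < (z - x) \<bullet> onormal e \<longrightarrow> z \<notin> closure K) \<and> ((z - x) \<bullet> onormal e \<le> 0 \<longrightarrow> z \<in> closure K)"
proof -
  let ?a = "fst e" and ?w = "snd e - fst e"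
  define n where "n = onormal e"
  define d where "d = (?a - c) \<bullet> n"
  \<comment> \<open>Coordinate on the line of the edge, with 0 and 1 at the end points.\<close>
  define \<tau> where "\<tau> y = ((y - ?a) \<bullet> ?w) / (?w \<bullet> ?w)" for y
  have ab: "?a \<noteq> snd e" using e by (simp add: boundary_edge_def)
  have n: "unit_normal e n" "d > 0" using onormal[OF e] r_pos by (auto simp: n_def d_def)
  have nn: "norm n = 1" "?w \<bullet> n = 0" using n(1) by (auto simp: unit_normal_def inner_commute)
  have ww: "?w \<bullet> ?w > 0" using ab by simp
  have xs: "x \<in> segment e" using x segment_open_subset_closed by (auto simp: segment_def rel_segment_def)
  have xd: "(x - c) \<bullet> n = d" using unit_normal_segment[OF n(1) xs] by (simp add: d_def)
  have rad: "radius e z - 1 = ((z - x) \<bullet> n) / d" for z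
  proof -
    have "(z - c) \<bullet> n = (z - x) \<bullet> n + d" using xd by (simp add: inner_diff_left)
    then show ?thesis using n(2) by (simp add: radius_def n_def[symmetric] d_def[symmetric] add_divide_distrib)
  qed
  have radx: "radius e x = 1" using rad[of x] by simp
  have footx: "foot e x = x" by (simp add: foot_def radx)
  have taux: "0 < \<tau> x" "\<tau> x < 1"
  proof -
    obtain u where u: "0 < u" "u < 1" "x = (1 - u) *\<^sub>R ?a + u *\<^sub>R snd e"
      using x by (auto simp: rel_segment_def in_segment)
    then have "x - ?a = u *\<^sub>R ?w" by (simp add: algebra_simps)
    then have "\<tau> x = u" using ww by (simp add: \<tau>_def)
    then show "0 < \<tau> x" "\<tau> x < 1" using u by auto
  qed
  have cr: "(radius e \<longlongrightarrow> radius e x) (nhds x)"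
    unfolding radius_def n_def[symmetric] d_def[symmetric] using n(2)
    by (intro tendsto_intros tendsto_inner) (auto simp: filterlim_ident)
  have cf: "(foot e \<longlongrightarrow> foot e x) (nhds x)"
    unfolding foot_def using radx by (intro tendsto_intros cr) (auto simp: filterlim_ident)
  have ct: "((\<lambda>z. \<tau> (foot e z)) \<longlongrightarrow> \<tau> x) (nhds x)"
    unfolding \<tau>_def using tendsto_inner[OF tendsto_diff[OF cf tendsto_const] tendsto_const, of ?a ?w] ww footx
    by (intro tendsto_divide) auto
  have "\<forall>\<^sub>F z in nhds x. radius e z > 0" using order_tendstoD(1)[OF cr] radx by simp
  moreover have "\<forall>\<^sub>F z in nhds x. \<tau> (foot e z) > 0" using order_tendstoD(1)[OF ct] taux by simp
  moreover have "\<forall>\<^sub>F z in nhds x. \<tau> (foot e z) < 1" using order_tendstoD(2)[OF ct] taux by simp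
  ultimately show ?thesis
  proof eventually_elim
    case (elim z)
    have "(foot e z - c) \<bullet> n = d"
      using elim(1) n(2) unfolding foot_def radius_def n_def[symmetric] d_def[symmetric]
      by (auto simp: zero_less_divide_iff)
    then have "(foot e z - ?a) \<bullet> n = 0" by (simp add: d_def inner_diff_left)
    then have "foot e z - ?a = \<tau> (foot e z) *\<^sub>R ?w"
      unfolding \<tau>_def using ab by (intro perp_collinear[OF nn(1) _ nn(2)]) auto
    then have "foot e z = (1 - \<tau> (foot e z)) *\<^sub>R ?a + \<tau> (foot e z) *\<^sub>R snd e"
      by (simp add: algebra_simps)
    then have "foot e z \<in> rel_segment e"
      using elim ab by (auto simp: rel_segment_def in_segment)
    then have f: "foot e z \<in> closure K" "foot e z \<notin> K" using rel_segment_frontier[OF e] frontier_K by auto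
    have z: "z = c + radius e z *\<^sub>R (foot e z - c)" using elim(1) by (simp add: foot_def)
    have 1: "z \<in> K" if "(z - x) \<bullet> n < 0"
    proof -
      have "((z - x) \<bullet> n) / d < 0" using that n(2) by (rule divide_neg_pos)
      then have "radius e z < 1" using rad[of z] by linarith
      then show ?thesis using ray_frontier[OF f(1), of "radius e z"] elim(1) z by simp
    qed
    have 2: "z \<notin> closure K" if "0 < (z - x) \<bullet> n"
    proof
      assume "z \<in> closure K"
      have "((z - x) \<bullet> n) / d > 0" using that n(2) by simp
      then have "radius e z > 1" using rad[of z] by linarith
      then have "c + (1 / radius e z) *\<^sub>R (z - c) \<in> K" by (intro ray_frontier \<open>z \<in> closure K\<close>) auto
      then show False using f by (simp add: foot_def)
    qed
    have 3: "z \<in> closure K" if "(z - x) \<bullet> n \<le> 0"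
    proof (cases "(z - x) \<bullet> n = 0")
      case True
      then have "radius e z = 1" using rad[of z] by simp
      then show ?thesis using f(1) by (simp add: foot_def)
    next
      case False
      then show ?thesis using 1 that closure_subset by force
    qed
    show ?case using 1 2 3 by (simp add: n_def)
  qed
qed

text \<open>Evaluates the definite description: the half discs of \<open>boundary_half_disc\<close>
  confirm this normal, and for the opposite one the same points would be both inside and outside
  \<open>K\<close>.\<close>

lemma outer_normal_eq:
  assumes e: "boundary_edge e" shows "outer_normal K e = onormal e"
  unfolding outer_normal_def
proof (rule the_equality)
  have ev: "\<forall>\<^sub>F s in at_right 0. x + s *\<^sub>R onormal e \<notin> closure K \<and> x - s *\<^sub>R onormal e \<in> K"
    if x: "x \<in> rel_segment e" for x
  proof -
    let ?n = "onormal e"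
    have nn: "?n \<bullet> ?n = 1" using onormal(1)[OF e] by (simp add: unit_normal_def norm_eq_1)
    have l: "((\<lambda>s. x + s *\<^sub>R ?n) \<longlongrightarrow> x) (at_right 0)" "((\<lambda>s. x - s *\<^sub>R ?n) \<longlongrightarrow> x) (at_right 0)"
      by (auto intro!: tendsto_eq_intros)
    have "\<forall>\<^sub>F s in at_right (0::real). s > 0" by (simp add: eventually_at_right_less)
    moreover note eventually_compose_filterlim[OF boundary_half_disc[OF e x] l(1)]
      eventually_compose_filterlim[OF boundary_half_disc[OF e x] l(2)]
    ultimately show ?thesis by eventually_elim (simp add: nn)
  qed
  then show "unit_normal e (onormal e) \<and> (\<forall>x\<in>rel_segment e. \<forall>\<^sub>F s in at_right 0. x + s *\<^sub>R onormal e \<notin> closure K \<and> x - s *\<^sub>R onormal e \<in> K)"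
    using onormal(1)[OF e] by blast
  fix n assume n: "unit_normal e n \<and> (\<forall>x\<in>rel_segment e. \<forall>\<^sub>F s in at_right 0. x + s *\<^sub>R n \<notin> closure K \<and> x - s *\<^sub>R n \<in> K)"
  have ab: "fst e \<noteq> snd e" using e by (simp add: boundary_edge_def)
  then obtain x where x: "x \<in> rel_segment e" unfolding rel_segment_def using open_segment_eq_empty by blast
  have "n \<noteq> - onormal e"
  proof
    assume m: "n = - onormal e"
    have "\<forall>\<^sub>F s in at_right (0::real). False"
      using ev[OF x] bspec[OF conjunct2[OF n] x]
    proof eventually_elim
      case (elim s)
      then show ?case using closure_subset[of K] by (auto simp: m)
    qed
    then show False by simp
  qed
  then show "n = onormal e" using unit_normal_cases[OF onormal(1)[OF e] conjunct1[OF n] ab] by blast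
qed

end

section \<open>Functionals on the Sobolev space\<close>

lemma sum_mult_le_sqrt:
  "(\<Sum>i\<in>I. a i * b i) \<le> sqrt (\<Sum>i\<in>I. (a i)\<^sup>2) * sqrt (\<Sum>i\<in>I. (b i)\<^sup>2)" for a b :: "'a \<Rightarrow> real"
proof -
  have "(\<Sum>i\<in>I. a i * b i) \<le> \<bar>\<Sum>i\<in>I. a i * b i\<bar>" by simp
  also have "\<dots> = sqrt ((\<Sum>i\<in>I. a i * b i)\<^sup>2)" by simp
  also have "\<dots> \<le> sqrt ((\<Sum>i\<in>I. (a i)\<^sup>2) * (\<Sum>i\<in>I. (b i)\<^sup>2))"
    by (rule real_sqrt_le_mono[OF Cauchy_Schwarz_ineq_sum])
  finally show ?thesis by (simp add: real_sqrt_mult)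
qed

lemma H1_dual_add: "F \<in> H1_dual K \<Longrightarrow> u \<in> H1 K \<Longrightarrow> v \<in> H1 K \<Longrightarrow> F (\<lambda>x. u x + v x) = F u + F v"
  by (simp add: H1_dual_def)

lemma H1_dual_cmult: "F \<in> H1_dual K \<Longrightarrow> u \<in> H1 K \<Longrightarrow> F (\<lambda>x. a * u x) = a * F u"
  by (simp add: H1_dual_def)

lemma H1_dual_lincomb:
  assumes "F \<in> H1_dual K" "G \<in> H1_dual K" shows "(\<lambda>\<phi>. a * F \<phi> + b * G \<phi>) \<in> H1_dual K"
proof -
  from assms obtain C D where C: "\<forall>u\<in>H1 K. \<bar>F u\<bar> \<le> C * H1_norm K u" and D: "\<forall>u\<in>H1 K. \<bar>G u\<bar> \<le> D * H1_norm K u"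
    by (auto simp: H1_dual_def)
  have "\<bar>a * F u + b * G u\<bar> \<le> (\<bar>a\<bar> * C + \<bar>b\<bar> * D) * H1_norm K u" if "u \<in> H1 K" for u
  proof -
    have "\<bar>a * F u + b * G u\<bar> \<le> \<bar>a\<bar> * \<bar>F u\<bar> + \<bar>b\<bar> * \<bar>G u\<bar>" by (metis abs_mult abs_triangle_ineq)
    also have "\<dots> \<le> \<bar>a\<bar> * (C * H1_norm K u) + \<bar>b\<bar> * (D * H1_norm K u)"
      using C D that by (intro add_mono mult_left_mono) auto
    finally show ?thesis by (simp add: algebra_simps)
  qed
  then have "\<exists>C. \<forall>u\<in>H1 K. \<bar>a * F u + b * G u\<bar> \<le> C * H1_norm K u" by blast
  moreover have "a * F (\<lambda>x. u x + v x) + b * G (\<lambda>x. u x + v x) = (a * F u + b * G u) + (a * F v + b * G v)"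
    if "u \<in> H1 K" "v \<in> H1 K" for u v
    using assms that by (simp add: H1_dual_add algebra_simps)
  moreover have "a * F (\<lambda>x. k * u x) + b * G (\<lambda>x. k * u x) = k * (a * F u + b * G u)" if "u \<in> H1 K" for u k
    using assms that by (simp add: H1_dual_cmult algebra_simps)
  ultimately show ?thesis unfolding H1_dual_def by blast
qed

lemma dual_seminorm_cong: "(\<And>u. u \<in> H1 K \<Longrightarrow> G u = F u) \<Longrightarrow> dual_seminorm K G = dual_seminorm K F"
  unfolding dual_seminorm_def by (rule arg_cong[of _ _ Sup]) (auto, metis)

section \<open>Fluxes and stiffness functionals on a cell\<close>

locale normal_cell = cell +
  fixes \<nu> :: "edge \<Rightarrow> point"
  assumes \<nu>: "\<And>e. e \<in> E \<Longrightarrow> unit_normal e (\<nu> e)"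
begin

definition sgn_edge :: "edge \<Rightarrow> real" where "sgn_edge e = \<nu> e \<bullet> outer_normal K e"

lemma sgn_edge: "e \<in> EK \<Longrightarrow> \<bar>sgn_edge e\<bar> = 1"
proof -
  assume e: "e \<in> EK"
  then have n: "unit_normal e (onormal e)" "unit_normal e (\<nu> e)" and ab: "fst e \<noteq> snd e"
    using onormal(1)[OF EK_boundary[OF e]] \<nu> nondegenerate by (auto simp: edges_of_def)
  have "onormal e \<bullet> onormal e = 1" using n(1) by (simp add: unit_normal_def norm_eq_1)
  then show ?thesis
    using unit_normal_cases[OF n ab] outer_normal_eq[OF EK_boundary[OF e]] by (auto simp: sgn_edge_def)
qed

lemma flux_eq: "flux E \<nu> K l v = (\<Sum>e\<in>EK. LINT x|arclength e. l x * sgn_edge e * H1_trace E K v x)"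
  by (simp add: flux_def sgn_edge_def)

lemma integrable_flux:
  assumes "square_integrable (arclength e) l" "v \<in> H1 K" "e \<in> EK"
  shows "integrable (arclength e) (\<lambda>x. l x * a * H1_trace E K v x)"
proof -
  have "integrable (arclength e) (\<lambda>x. a * (l x * H1_trace E K v x))"
    using square_integrable_mult[OF assms(1) square_integrable_trace[OF assms(2,3)]] by simp
  then show ?thesis by (simp add: mult_ac)
qed

definition L2_edges :: "(point \<Rightarrow> real) \<Rightarrow> bool" where
  "L2_edges l \<longleftrightarrow> (\<forall>e\<in>EK. square_integrable (arclength e) l)"

lemma flux_lincomb_right:
  assumes l: "L2_edges l" and u: "u \<in> H1 K" and v: "v \<in> H1 K"
  shows "flux E \<nu> K l (\<lambda>x. a * u x + b * v x) = a * flux E \<nu> K l u + b * flux E \<nu> K l v"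
proof -
  have "(LINT x|arclength e. l x * sgn_edge e * H1_trace E K (\<lambda>x. a * u x + b * v x) x)
     = a * (LINT x|arclength e. l x * sgn_edge e * H1_trace E K u x) + b * (LINT x|arclength e. l x * sgn_edge e * H1_trace E K v x)"
    if e: "e \<in> EK" for e
  proof -
    have le: "square_integrable (arclength e) l" using l e by (simp add: L2_edges_def)
    note i = integrable_flux[OF le u e, of "sgn_edge e"] integrable_flux[OF le v e, of "sgn_edge e"]
    have [measurable]: "l \<in> borel_measurable (arclength e)" "H1_trace E K u \<in> borel_measurable (arclength e)"
      "H1_trace E K v \<in> borel_measurable (arclength e)" "H1_trace E K (\<lambda>x. a * u x + b * v x) \<in> borel_measurable (arclength e)"
      by (intro square_integrable_measurable le square_integrable_trace H1_lincomb u v e)+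
    have "(LINT x|arclength e. l x * sgn_edge e * H1_trace E K (\<lambda>x. a * u x + b * v x) x)
      = (LINT x|arclength e. a * (l x * sgn_edge e * H1_trace E K u x) + b * (l x * sgn_edge e * H1_trace E K v x))"
    proof (rule integral_cong_AE)
      show "AE x in arclength e. l x * sgn_edge e * H1_trace E K (\<lambda>x. a * u x + b * v x) x
        = a * (l x * sgn_edge e * H1_trace E K u x) + b * (l x * sgn_edge e * H1_trace E K v x)"
        using trace_lincomb[OF u v e, of a b] by eventually_elim (simp add: algebra_simps)
    qed measurable
    then show ?thesis using i by simp
  qed
  then show ?thesis by (simp add: flux_eq sum.distrib sum_distrib_left)
qed

lemma flux_lincomb_left:
  assumes l: "L2_edges l" and m: "L2_edges m" and u: "u \<in> H1 K"
  shows "flux E \<nu> K (\<lambda>x. a * l x + b * m x) u = a * flux E \<nu> K l u + b * flux E \<nu> K m u"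
proof -
  have "(LINT x|arclength e. (a * l x + b * m x) * sgn_edge e * H1_trace E K u x)
     = a * (LINT x|arclength e. l x * sgn_edge e * H1_trace E K u x) + b * (LINT x|arclength e. m x * sgn_edge e * H1_trace E K u x)"
    if e: "e \<in> EK" for e
  proof -
    have le: "square_integrable (arclength e) l" "square_integrable (arclength e) m" using l m e by (auto simp: L2_edges_def)
    note i = integrable_flux[OF le(1) u e, of "sgn_edge e"] integrable_flux[OF le(2) u e, of "sgn_edge e"]
    have "(LINT x|arclength e. (a * l x + b * m x) * sgn_edge e * H1_trace E K u x)
      = (LINT x|arclength e. a * (l x * sgn_edge e * H1_trace E K u x) + b * (m x * sgn_edge e * H1_trace E K u x))"
      by (intro Bochner_Integration.integral_cong refl) (simp add: algebra_simps)
    then show ?thesis using i by simp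
  qed
  then show ?thesis by (simp add: flux_eq sum.distrib sum_distrib_left)
qed

lemma flux_const: "L2_edges l \<Longrightarrow> flux E \<nu> K l (\<lambda>x. a) = a * flux E \<nu> K l (\<lambda>x. 1)"
  using flux_lincomb_right[of l "\<lambda>x. 1" "\<lambda>x. 1" a 0] H1_const by simp

lemma flux_one: "flux E \<nu> K l (\<lambda>x. 1) = (\<Sum>e\<in>EK. sgn_edge e * (LINT x|arclength e. l x))" if "L2_edges l"
proof -
  have "(LINT x|arclength e. l x * sgn_edge e * H1_trace E K (\<lambda>x. 1) x) = sgn_edge e * (LINT x|arclength e. l x)"
    if e: "e \<in> EK" for e
  proof -
    have le: "square_integrable (arclength e) l" using \<open>L2_edges l\<close> e by (simp add: L2_edges_def)
    have [measurable]: "l \<in> borel_measurable (arclength e)" "H1_trace E K (\<lambda>x. 1) \<in> borel_measurable (arclength e)"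
      by (intro square_integrable_measurable le square_integrable_trace H1_const e)+
    have "(LINT x|arclength e. l x * sgn_edge e * H1_trace E K (\<lambda>x. 1) x) = (LINT x|arclength e. sgn_edge e * l x)"
    proof (rule integral_cong_AE)
      show "AE x in arclength e. l x * sgn_edge e * H1_trace E K (\<lambda>x. 1) x = sgn_edge e * l x"
        using trace_smooth_eq[OF smooth_const[of 1] e] by eventually_elim simp
    qed measurable
    then show ?thesis by simp
  qed
  then show ?thesis by (simp add: flux_eq)
qed

text \<open>The flux of a constant is explicit, so subtracting the mean leaves the trace minus the
  mean under the integrals. Cauchy-Schwarz on each edge and on the sum, together with
  \<open>trace_Poincare\<close>, gives a bound free of the number of edges.\<close>

lemma flux_bound:
  assumes l: "L2_edges l" and u: "u \<in> H1 K"
  shows "\<bar>flux E \<nu> K l u - average K u * flux E \<nu> K l (\<lambda>x. 1)\<bar>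
    \<le> sqrt (\<Sum>e\<in>EK. (L2_norm (arclength e) l)\<^sup>2) * (sqrt (T_const * h) * H1_seminorm K u)"
proof -
  let ?a = "average K u"
  have le: "square_integrable (arclength e) l" if "e \<in> EK" for e using l that by (simp add: L2_edges_def)
  have d: "square_integrable (arclength e) (\<lambda>x. H1_trace E K u x - ?a)" if "e \<in> EK" for e
    by (intro square_integrable_diff square_integrable_trace u that square_integrable_const finite_arclength)
  have "flux E \<nu> K l u - ?a * flux E \<nu> K l (\<lambda>x. 1)
     = (\<Sum>e\<in>EK. (LINT x|arclength e. l x * sgn_edge e * H1_trace E K u x) - ?a * (sgn_edge e * (LINT x|arclength e. l x)))"
    by (simp add: flux_one[OF l] flux_eq[of l u] sum_subtractf sum_distrib_left)
  also have "\<dots> = (\<Sum>e\<in>EK. sgn_edge e * (LINT x|arclength e. l x * (H1_trace E K u x - ?a)))"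
  proof (rule sum.cong[OF refl])
    fix e assume e: "e \<in> EK"
    have 1: "integrable (arclength e) (\<lambda>x. l x * H1_trace E K u x)"
      by (rule square_integrable_mult[OF le[OF e] square_integrable_trace[OF u e]])
    have 2: "integrable (arclength e) (\<lambda>x. l x * ?a)"
      by (rule square_integrable_mult[OF le[OF e] square_integrable_const[OF finite_arclength]])
    have "(LINT x|arclength e. l x * sgn_edge e * H1_trace E K u x) = sgn_edge e * (LINT x|arclength e. l x * H1_trace E K u x)"
      by (subst integral_mult_right_zero[symmetric]) (simp add: mult_ac)
    then show "(LINT x|arclength e. l x * sgn_edge e * H1_trace E K u x) - ?a * (sgn_edge e * (LINT x|arclength e. l x))
      = sgn_edge e * (LINT x|arclength e. l x * (H1_trace E K u x - ?a))"
      using 1 2 by (simp add: right_diff_distrib)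
  qed
  also have "\<bar>\<dots>\<bar> \<le> (\<Sum>e\<in>EK. L2_norm (arclength e) l * L2_norm (arclength e) (\<lambda>x. H1_trace E K u x - ?a))"
  proof (rule order_trans[OF sum_abs sum_mono])
    fix e assume e: "e \<in> EK"
    show "\<bar>sgn_edge e * (LINT x|arclength e. l x * (H1_trace E K u x - ?a))\<bar> \<le> L2_norm (arclength e) l * L2_norm (arclength e) (\<lambda>x. H1_trace E K u x - ?a)"
      using L2_Cauchy_Schwarz[OF le[OF e] d[OF e]] sgn_edge[OF e] by (simp add: abs_mult)
  qed
  also have "\<dots> \<le> sqrt (\<Sum>e\<in>EK. (L2_norm (arclength e) l)\<^sup>2) * sqrt (\<Sum>e\<in>EK. (L2_norm (arclength e) (\<lambda>x. H1_trace E K u x - ?a))\<^sup>2)"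
    by (rule sum_mult_le_sqrt)
  also have "\<dots> \<le> sqrt (\<Sum>e\<in>EK. (L2_norm (arclength e) l)\<^sup>2) * sqrt (T_const * h * (H1_seminorm K u)\<^sup>2)"
    by (intro mult_left_mono real_sqrt_le_mono trace_Poincare u H1_trace) (auto simp: sum_nonneg)
  also have "sqrt (T_const * h * (H1_seminorm K u)\<^sup>2) = sqrt (T_const * h) * H1_seminorm K u"
    unfolding real_sqrt_mult real_sqrt_abs by simp
  finally show ?thesis .
qed

lemma flux_H1_dual:
  assumes l: "L2_edges l" shows "flux E \<nu> K l \<in> H1_dual K"
proof -
  let ?A = "\<bar>flux E \<nu> K l (\<lambda>x. 1)\<bar> / sqrt (measure lborel K)"
  let ?B = "sqrt (\<Sum>e\<in>EK. (L2_norm (arclength e) l)\<^sup>2) * sqrt (T_const * h)"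
  have "\<bar>flux E \<nu> K l u\<bar> \<le> (?A + ?B) * H1_norm K u" if u: "u \<in> H1 K" for u
  proof -
    have "\<bar>flux E \<nu> K l u\<bar> \<le> \<bar>average K u\<bar> * \<bar>flux E \<nu> K l (\<lambda>x. 1)\<bar> + ?B * H1_seminorm K u"
      using flux_bound[OF l u] abs_triangle_ineq2[of "flux E \<nu> K l u" "average K u * flux E \<nu> K l (\<lambda>x. 1)"]
      by (simp add: abs_mult mult.assoc)
    also have "\<dots> \<le> (H1_norm K u / sqrt (measure lborel K)) * \<bar>flux E \<nu> K l (\<lambda>x. 1)\<bar> + ?B * H1_norm K u"
    proof (intro add_mono mult_right_mono mult_left_mono H1_seminorm_le_norm)
      show "\<bar>average K u\<bar> \<le> H1_norm K u / sqrt (measure lborel K)"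
        using average_le[OF u] L2_le_H1_norm[of u] by (meson divide_right_mono order_trans real_sqrt_ge_zero measure_nonneg)
      show "0 \<le> ?B" using T_const_pos h_pos by (simp add: sum_nonneg)
    qed simp
    finally show ?thesis by (simp add: algebra_simps)
  qed
  moreover have "flux E \<nu> K l (\<lambda>x. u x + v x) = flux E \<nu> K l u + flux E \<nu> K l v" if "u \<in> H1 K" "v \<in> H1 K" for u v
    using flux_lincomb_right[OF l that, of 1 1] by simp
  moreover have "flux E \<nu> K l (\<lambda>x. a * u x) = a * flux E \<nu> K l u" if "u \<in> H1 K" for u a
    using flux_lincomb_right[OF l that that, of a 0] by simp
  ultimately show ?thesis unfolding H1_dual_def by blast
qed

lemma stiffness_bound: "u \<in> H1 K \<Longrightarrow> v \<in> H1 K \<Longrightarrow> \<bar>stiffness K u v\<bar> \<le> H1_seminorm K u * H1_seminorm K v"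
  unfolding stiffness_def H1_seminorm_def by (intro L2_Cauchy_Schwarz grad_props)

lemma stiffness_self: "u \<in> H1 K \<Longrightarrow> stiffness K u u = (H1_seminorm K u)\<^sup>2"
  by (simp add: stiffness_def H1_seminorm_def L2_norm_power2 power2_norm_eq_inner)

lemma stiffness_commute: "stiffness K u v = stiffness K v u"
  by (simp add: stiffness_def inner_commute)

lemma stiffness_lincomb_right:
  assumes u: "u \<in> H1 K" and v: "v \<in> H1 K" and w: "w \<in> H1 K"
  shows "stiffness K u (\<lambda>x. a * v x + b * w x) = a * stiffness K u v + b * stiffness K u w"
proof -
  have [measurable]: "grad K u \<in> borel_measurable M" "grad K v \<in> borel_measurable M" "grad K w \<in> borel_measurable M"
    "grad K (\<lambda>x. a * v x + b * w x) \<in> borel_measurable M"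
    by (intro square_integrable_measurable grad_props H1_lincomb u v w)+
  have i: "integrable M (\<lambda>x. grad K u x \<bullet> grad K v x)" "integrable M (\<lambda>x. grad K u x \<bullet> grad K w x)"
    by (intro square_integrable_inner grad_props u v w)+
  have "stiffness K u (\<lambda>x. a * v x + b * w x) = (LINT x|M. a * (grad K u x \<bullet> grad K v x) + b * (grad K u x \<bullet> grad K w x))"
    unfolding stiffness_def
  proof (rule integral_cong_AE)
    show "AE x in M. grad K u x \<bullet> grad K (\<lambda>x. a * v x + b * w x) x = a * (grad K u x \<bullet> grad K v x) + b * (grad K u x \<bullet> grad K w x)"
      using H1_lincomb(2)[OF v w, of a b] by eventually_elim (simp add: inner_add_right)
  qed measurable
  then show ?thesis using i by (simp add: stiffness_def)
qed

lemma stiffness_const: "u \<in> H1 K \<Longrightarrow> stiffness K u (\<lambda>x. a) = 0" "u \<in> H1 K \<Longrightarrow> stiffness K (\<lambda>x. a) u = 0"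
  using stiffness_bound[OF _ H1_const, of u a] stiffness_commute[of u "\<lambda>x. a"] by (auto simp: H1_seminorm_const)

lemma stiffness_H1_dual: assumes u: "u \<in> H1 K" shows "stiffness K u \<in> H1_dual K"
proof -
  have "\<bar>stiffness K u v\<bar> \<le> H1_seminorm K u * H1_norm K v" if v: "v \<in> H1 K" for v
    by (rule order_trans[OF stiffness_bound[OF u v] mult_left_mono[OF H1_seminorm_le_norm]]) simp
  moreover have "stiffness K u (\<lambda>x. v x + w x) = stiffness K u v + stiffness K u w" if "v \<in> H1 K" "w \<in> H1 K" for v w
    using stiffness_lincomb_right[OF u that, of 1 1] by simp
  moreover have "stiffness K u (\<lambda>x. a * v x) = a * stiffness K u v" if "v \<in> H1 K" for v a
    using stiffness_lincomb_right[OF u that that, of a 0] by simp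
  ultimately show ?thesis unfolding H1_dual_def by blast
qed

section \<open>The dual seminorm as a supremum\<close>

lemma average_0_iff: "average K u = 0 \<longleftrightarrow> (LINT x|M. u x) = 0"
  using measure_K_pos(2) by (simp add: average_def)

lemma H1_seminorm_0_AE:
  assumes u: "u \<in> H1 K" and s: "H1_seminorm K u = 0" shows "AE x in M. u x = average K u"
proof -
  have "L2_norm M (\<lambda>x. u x - average K u) \<le> 0" using Poincare[OF u] s by simp
  then have "L2_norm M (\<lambda>x. u x - average K u) = 0" by (simp add: antisym)
  moreover have "square_integrable M (\<lambda>x. u x - average K u)"
    by (intro square_integrable_diff H1_square_integrable u square_integrable_const finite_M)
  ultimately show ?thesis by (simp add: L2_norm_eq_0_iff)
qed

lemma H1_norm_mean_zero:
  assumes u: "u \<in> H1 K" and 0: "(LINT x|M. u x) = 0"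
  shows "H1_norm K u \<le> (4 / \<rho> * h + 1) * H1_seminorm K u"
  using H1_norm_le[of u] Poincare[OF u] average_0_iff[of u] 0 by (simp add: algebra_simps)

lemma average_const: "average K (\<lambda>x. a) = a"
  using measure_K_pos(2) unfolding average_def integral_const_M by simp

text \<open>The supremum in \<open>dual_seminorm\<close> must range over a nonempty set. A
  coordinate minus its mean serves, as its gradient is a constant unit vector.\<close>

lemma exists_mean_zero:
  obtains \<phi> where "\<phi> \<in> H1 K" "(LINT x|M. \<phi> x) = 0" "\<not> (AE x in M. \<phi> x = 0)" "H1_seminorm K \<phi> > 0"
proof -
  define f where "f x = x $ 1" for x :: point
  define \<phi> where "\<phi> x = f x - average K f" for x
  have f: "f \<in> H1 K" unfolding f_def by (rule H1_smooth[OF smooth_nth])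
  have \<phi>: "\<phi> \<in> H1 K" unfolding \<phi>_def by (intro H1_diff f H1_const)
  have "average K \<phi> = average K f - average K (\<lambda>x. average K f)"
    unfolding \<phi>_def by (rule average_diff[OF f H1_const])
  also have "average K (\<lambda>x. average K f) = average K f"
    by (rule average_const)
  finally have 0: "(LINT x|M. \<phi> x) = 0" by (simp add: average_0_iff)
  have "H1_seminorm K \<phi> = H1_seminorm K f"
    using H1_seminorm_add_const[OF f, of "- average K f"] by (simp add: \<phi>_def[abs_def])
  also have "\<dots> = L2_norm M (\<lambda>x. axis 1 1 :: point)"
  proof -
    have "gradient (\<lambda>x. x $ 1) = (\<lambda>x. axis 1 1 :: point)" using gradient_eq[OF GDERIV_nth[of 1]] by auto
    then show ?thesis using H1_seminorm_smooth[OF smooth_nth[of 1]] by (simp add: f_def[abs_def])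
  qed
  also have "\<dots> = sqrt (measure lborel K)" using integral_const_M[of 1] by (simp add: L2_norm_def del: lebesgue_integral_const)
  finally have s: "H1_seminorm K \<phi> > 0" using measure_K_pos(2) by simp
  have "\<not> (AE x in M. \<phi> x = 0)"
  proof
    assume "AE x in M. \<phi> x = 0"
    then have "AE x in M. grad K \<phi> x = 0"
      using H1_AE_0[of \<phi>] square_integrable_measurable[OF H1_square_integrable[OF \<phi>]] by blast
    then have "H1_seminorm K \<phi> = 0"
      using L2_norm_eq_0_iff[OF grad_props(1)[OF \<phi>]] by (simp add: H1_seminorm_def)
    then show False using s by simp
  qed
  then show ?thesis using that \<phi> 0 s by blast
qed

text \<open>A real supremum bounds its set only if the set is bounded above; this comes from
  \<open>H1_norm_mean_zero\<close>. Functions of zero seminorm are treated apart, since their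
  quotients are 0 by the convention on division.\<close>

lemma dual_seminorm_bound_mean_zero:
  assumes F: "F \<in> H1_dual K" and u: "u \<in> H1 K" and 0: "(LINT x|M. u x) = 0"
  shows "\<bar>F u\<bar> \<le> dual_seminorm K F * H1_seminorm K u"
proof -
  obtain C where C: "\<And>u. u \<in> H1 K \<Longrightarrow> \<bar>F u\<bar> \<le> C * H1_norm K u" using F unfolding H1_dual_def by blast
  have C': "\<bar>F v\<bar> \<le> \<bar>C\<bar> * (4 / \<rho> * h + 1) * H1_seminorm K v" if v: "v \<in> H1 K" "(LINT x|M. v x) = 0" for v
  proof -
    have "\<bar>F v\<bar> \<le> \<bar>C\<bar> * H1_norm K v" using C[OF v(1)] mult_right_mono[OF abs_ge_self, of "H1_norm K v" C] by simp
    also have "\<dots> \<le> \<bar>C\<bar> * ((4 / \<rho> * h + 1) * H1_seminorm K v)" by (intro mult_left_mono H1_norm_mean_zero v) simp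
    finally show ?thesis by (simp add: mult.assoc)
  qed
  show ?thesis
  proof (cases "H1_seminorm K u = 0")
    case True then show ?thesis using C'[OF u 0] by simp
  next
    case False
    then have s: "H1_seminorm K u > 0" using H1_seminorm_nonneg[of u] by linarith
    let ?S = "{F \<phi> / H1_seminorm K \<phi> | \<phi>. \<phi> \<in> H1 K \<and> \<not> (AE x in M. \<phi> x = 0) \<and> (LINT x|M. \<phi> x) = 0}"
    have bdd: "bdd_above ?S"
    proof (rule bdd_aboveI)
      fix y assume "y \<in> ?S"
      then obtain \<phi> where \<phi>: "\<phi> \<in> H1 K" "(LINT x|M. \<phi> x) = 0" and y: "y = F \<phi> / H1_seminorm K \<phi>" by auto
      show "y \<le> \<bar>C\<bar> * (4 / \<rho> * h + 1)"
      proof (cases "H1_seminorm K \<phi> = 0")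
        case True then show ?thesis using y \<rho> h_pos by simp
      next
        case False
        then have "H1_seminorm K \<phi> > 0" using H1_seminorm_nonneg[of \<phi>] by linarith
        then show ?thesis using C'[OF \<phi>] unfolding y by (simp add: pos_divide_le_eq)
      qed
    qed
    have n0: "\<not> (AE x in M. v x = 0)" if v: "v \<in> H1 K" "H1_seminorm K v > 0" for v
    proof
      assume "AE x in M. v x = 0"
      then have "AE x in M. grad K v x = 0"
        using H1_AE_0[of v] square_integrable_measurable[OF H1_square_integrable[OF v(1)]] by blast
      then show False
        using L2_norm_eq_0_iff[OF grad_props(1)[OF v(1)]] v(2) by (simp add: H1_seminorm_def)
    qed
    have up: "F v \<le> dual_seminorm K F * H1_seminorm K v" if v: "v \<in> H1 K" "H1_seminorm K v > 0" "(LINT x|M. v x) = 0" for v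
    proof -
      have "F v / H1_seminorm K v \<le> dual_seminorm K F"
        unfolding dual_seminorm_def using v n0[OF v(1,2)] by (intro cSup_upper bdd) blast
      then show ?thesis using v by (simp add: pos_divide_le_eq)
    qed
    have m: "(\<lambda>x. (-1) * u x) \<in> H1 K" "H1_seminorm K (\<lambda>x. (-1) * u x) = H1_seminorm K u" "F (\<lambda>x. (-1) * u x) = - F u"
      using H1_cmult[OF u, of "-1"] H1_seminorm_cmult[OF u, of "-1"] H1_dual_cmult[OF F u, of "-1"] by auto
    have "- F u \<le> dual_seminorm K F * H1_seminorm K u"
      using up[OF m(1)] m s 0 by simp
    then show ?thesis using up[OF u s 0] by linarith
  qed
qed

lemma dual_seminorm_nonneg:
  assumes F: "F \<in> H1_dual K" shows "dual_seminorm K F \<ge> 0"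
proof -
  obtain \<phi> where \<phi>: "\<phi> \<in> H1 K" "(LINT x|M. \<phi> x) = 0" "H1_seminorm K \<phi> > 0" using exists_mean_zero by blast
  have "0 \<le> dual_seminorm K F * H1_seminorm K \<phi>"
    using dual_seminorm_bound_mean_zero[OF F \<phi>(1,2)] by linarith
  then show ?thesis using \<phi>(3) by (simp add: zero_le_mult_iff)
qed

lemma dual_seminorm_le:
  assumes C: "C \<ge> 0" and F: "\<And>u. u \<in> H1 K \<Longrightarrow> (LINT x|M. u x) = 0 \<Longrightarrow> F u \<le> C * H1_seminorm K u"
  shows "dual_seminorm K F \<le> C"
  unfolding dual_seminorm_def
proof (rule cSup_least)
  show "{F \<phi> / H1_seminorm K \<phi> | \<phi>. \<phi> \<in> H1 K \<and> \<not> (AE x in M. \<phi> x = 0) \<and> (LINT x|M. \<phi> x) = 0} \<noteq> {}"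
    using exists_mean_zero by blast
  fix y assume "y \<in> {F \<phi> / H1_seminorm K \<phi> | \<phi>. \<phi> \<in> H1 K \<and> \<not> (AE x in M. \<phi> x = 0) \<and> (LINT x|M. \<phi> x) = 0}"
  then obtain \<phi> where \<phi>: "\<phi> \<in> H1 K" "(LINT x|M. \<phi> x) = 0" and y: "y = F \<phi> / H1_seminorm K \<phi>" by auto
  show "y \<le> C"
  proof (cases "H1_seminorm K \<phi> = 0")
    case False
    then have "H1_seminorm K \<phi> > 0" using H1_seminorm_nonneg[of \<phi>] by linarith
    then show ?thesis using F[OF \<phi>] by (simp add: y pos_divide_le_eq)
  qed (simp add: y C)
qed

text \<open>Subtracting the mean makes \<open>u\<close> admissible in the supremum; what is
  subtracted is a multiple of the value at the constant 1.\<close>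

lemma dual_seminorm_bound:
  assumes F: "F \<in> H1_dual K" and u: "u \<in> H1 K"
  shows "\<bar>F u - average K u * F (\<lambda>x. 1)\<bar> \<le> dual_seminorm K F * H1_seminorm K u"
proof -
  let ?v = "\<lambda>x. u x + (- average K u) * 1"
  have v: "?v \<in> H1 K" by (intro H1_add u H1_cmult H1_const)
  have "F ?v = F u + F (\<lambda>x. (- average K u) * 1)" by (rule H1_dual_add[OF F u H1_cmult[OF H1_const]])
  also have "F (\<lambda>x. (- average K u) * 1) = (- average K u) * F (\<lambda>x. 1)" by (rule H1_dual_cmult[OF F H1_const])
  finally have Fv: "F ?v = F u - average K u * F (\<lambda>x. 1)" by simp
  have "(LINT x|M. u x + (- average K u) * 1) = (LINT x|M. u x) + (LINT x|M. - average K u)"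
    using square_integrable_integrable[OF H1_square_integrable[OF u]] finite_measure.integrable_const[OF finite_M, of "- average K u"]
    by (subst Bochner_Integration.integral_add) auto
  also have "\<dots> = 0" unfolding integral_const_M using measure_K_pos(2) by (simp add: average_def)
  finally have "(LINT x|M. ?v x) = 0" .
  from dual_seminorm_bound_mean_zero[OF F v this]
  have "\<bar>F ?v\<bar> \<le> dual_seminorm K F * H1_seminorm K ?v" .
  moreover have "H1_seminorm K ?v = H1_seminorm K u" using H1_seminorm_add_const[OF u, of "- average K u"] by simp
  ultimately show ?thesis unfolding Fv by simp
qed

lemma dual_seminorm_lincomb:
  assumes F: "F \<in> H1_dual K" and G: "G \<in> H1_dual K"
  shows "dual_seminorm K (\<lambda>\<phi>. a * F \<phi> + b * G \<phi>) \<le> \<bar>a\<bar> * dual_seminorm K F + \<bar>b\<bar> * dual_seminorm K G"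
proof (rule dual_seminorm_le)
  show "0 \<le> \<bar>a\<bar> * dual_seminorm K F + \<bar>b\<bar> * dual_seminorm K G" using dual_seminorm_nonneg F G by simp
  fix u assume u: "u \<in> H1 K" "(LINT x|M. u x) = 0"
  have "a * F u + b * G u \<le> \<bar>a\<bar> * \<bar>F u\<bar> + \<bar>b\<bar> * \<bar>G u\<bar>"
    by (metis abs_ge_self abs_mult add_mono)
  also have "\<dots> \<le> \<bar>a\<bar> * (dual_seminorm K F * H1_seminorm K u) + \<bar>b\<bar> * (dual_seminorm K G * H1_seminorm K u)"
    by (intro add_mono mult_left_mono dual_seminorm_bound_mean_zero F G u) auto
  finally show "a * F u + b * G u \<le> (\<bar>a\<bar> * dual_seminorm K F + \<bar>b\<bar> * dual_seminorm K G) * H1_seminorm K u"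
    by (simp add: algebra_simps)
qed

lemma dual_seminorm_stiffness: "u \<in> H1 K \<Longrightarrow> dual_seminorm K (stiffness K u) \<le> H1_seminorm K u"
  by (rule dual_seminorm_le) (auto intro: order_trans[OF abs_ge_self stiffness_bound])

lemma dual_seminorm_flux:
  assumes l: "L2_edges l"
  shows "dual_seminorm K (flux E \<nu> K l) \<le> sqrt (T_const * h) * sqrt (\<Sum>e\<in>EK. (L2_norm (arclength e) l)\<^sup>2)"
proof (rule dual_seminorm_le)
  show "0 \<le> sqrt (T_const * h) * sqrt (\<Sum>e\<in>EK. (L2_norm (arclength e) l)\<^sup>2)"
    using T_const_pos h_pos by (simp add: sum_nonneg)
  fix u assume u: "u \<in> H1 K" "(LINT x|M. u x) = 0"
  then have "average K u = 0" by (simp add: average_0_iff)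
  then show "flux E \<nu> K l u \<le> sqrt (T_const * h) * sqrt (\<Sum>e\<in>EK. (L2_norm (arclength e) l)\<^sup>2) * H1_seminorm K u"
    using flux_bound[OF l u(1)] by (simp add: mult_ac)
qed

section \<open>Bilinear forms on the dual\<close>

context
  fixes s :: "functional \<Rightarrow> functional \<Rightarrow> real" and Cs :: real
  assumes bil: "bilinear_dual K s"
    and bd: "\<And>F G. F \<in> H1_dual K \<Longrightarrow> G \<in> H1_dual K \<Longrightarrow> s F G \<le> Cs * dual_seminorm K F * dual_seminorm K G"
    and Cs: "Cs > 0"
begin

lemma bilinear_lincomb_left:
  assumes "F \<in> H1_dual K" "G \<in> H1_dual K" "J \<in> H1_dual K"
  shows "s (\<lambda>\<phi>. a * F \<phi> + b * G \<phi>) J = a * s F J + b * s G J"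
proof -
  have "(\<lambda>\<phi>. a * F \<phi>) \<in> H1_dual K" "(\<lambda>\<phi>. b * G \<phi>) \<in> H1_dual K"
    using H1_dual_lincomb[OF assms(1,1), of a 0] H1_dual_lincomb[OF assms(2,2), of b 0] by auto
  then show ?thesis using bil assms unfolding bilinear_dual_def by auto
qed

lemma bilinear_lincomb_right:
  assumes "F \<in> H1_dual K" "G \<in> H1_dual K" "J \<in> H1_dual K"
  shows "s J (\<lambda>\<phi>. a * F \<phi> + b * G \<phi>) = a * s J F + b * s J G"
proof -
  have "(\<lambda>\<phi>. a * F \<phi>) \<in> H1_dual K" "(\<lambda>\<phi>. b * G \<phi>) \<in> H1_dual K"
    using H1_dual_lincomb[OF assms(1,1), of a 0] H1_dual_lincomb[OF assms(2,2), of b 0] by auto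
  then show ?thesis using bil assms unfolding bilinear_dual_def by auto
qed

text \<open>The upper bound for \<open>-F\<close> is the lower bound for \<open>F\<close>.\<close>

lemma bilinear_bound:
  assumes F: "F \<in> H1_dual K" and G: "G \<in> H1_dual K"
  shows "\<bar>s F G\<bar> \<le> Cs * dual_seminorm K F * dual_seminorm K G"
proof -
  let ?m = "\<lambda>\<phi>. (-1) * F \<phi> + 0 * F \<phi>"
  have "- s F G = s ?m G" using bilinear_lincomb_left[OF F F G, of "-1" 0] by simp
  also have "\<dots> \<le> Cs * dual_seminorm K ?m * dual_seminorm K G" by (rule bd[OF H1_dual_lincomb[OF F F] G])
  also have "\<dots> \<le> Cs * dual_seminorm K F * dual_seminorm K G"
    using dual_seminorm_lincomb[OF F F, of "-1" 0] dual_seminorm_nonneg[OF G] Cs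
    by (intro mult_right_mono mult_left_mono) auto
  finally show ?thesis using bd[OF F G] by linarith
qed

text \<open>Functionals are total functions that may differ outside \<open>H1 K\<close>; the
  difference then has dual seminorm 0 and is not seen by \<open>s\<close>.\<close>

lemma bilinear_cong:
  assumes F: "F \<in> H1_dual K" and G: "G \<in> H1_dual K" "G' \<in> H1_dual K" and eq: "\<And>u. u \<in> H1 K \<Longrightarrow> G u = G' u"
  shows "s F G = s F G'"
proof -
  let ?d = "\<lambda>\<phi>. 1 * G \<phi> + (-1) * G' \<phi>"
  have d: "?d \<in> H1_dual K" by (rule H1_dual_lincomb[OF G])
  have "dual_seminorm K ?d \<le> 0" by (rule dual_seminorm_le) (auto simp: eq)
  then have "dual_seminorm K ?d = 0" using dual_seminorm_nonneg[OF d] by linarith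
  then have "s F ?d = 0" using bilinear_bound[OF F d] by simp
  then show ?thesis using bilinear_lincomb_right[OF G F, of 1 "-1"] by simp
qed

end

end

section \<open>The norm on the discrete space\<close>

lemma AE_arclength:
  assumes "Measurable.pred borel Q" "fst e \<noteq> snd e"
  shows "(AE x in arclength e. Q x) \<longleftrightarrow>
    (AE s in lborel. s \<in> {0<..<edge_length e} \<longrightarrow> Q (fst e + (s / edge_length e) *\<^sub>R (snd e - fst e)))"
proof -
  let ?g = "\<lambda>s. fst e + (s / edge_length e) *\<^sub>R (snd e - fst e)"
  have Q: "{x \<in> space borel. Q x} \<in> sets borel" using assms(1) by (simp add: pred_def)
  have g: "?g \<in> measurable (restrict_space lborel {0..edge_length e}) borel"
    by (intro measurable_restrict_space1) measurable
  have "(AE x in arclength e. Q x) \<longleftrightarrow> (AE s in restrict_space lborel {0..edge_length e}. Q (?g s))"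
    unfolding arclength_def by (rule AE_distr_iff[OF g Q])
  also have "\<dots> \<longleftrightarrow> (AE s in lborel. s \<in> {0..edge_length e} \<longrightarrow> Q (?g s))"
    by (rule AE_restrict_space_iff) simp
  also have "\<dots> \<longleftrightarrow> (AE s in lborel. s \<in> {0<..<edge_length e} \<longrightarrow> Q (?g s))"
  proof
    assume "AE s in lborel. s \<in> {0..edge_length e} \<longrightarrow> Q (?g s)"
    then show "AE s in lborel. s \<in> {0<..<edge_length e} \<longrightarrow> Q (?g s)" by eventually_elim auto
  next
    assume "AE s in lborel. s \<in> {0<..<edge_length e} \<longrightarrow> Q (?g s)"
    then show "AE s in lborel. s \<in> {0..edge_length e} \<longrightarrow> Q (?g s)"
      using AE_lborel_singleton[of 0] AE_lborel_singleton[of "edge_length e"]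
      by eventually_elim (metis atLeastAtMost_iff greaterThanLessThan_iff less_eq_real_def)
  qed
  finally show ?thesis .
qed

lemma edge_point_in_rel_segment:
  assumes "fst e \<noteq> snd e" "s \<in> {0<..<edge_length e}"
  shows "fst e + (s / edge_length e) *\<^sub>R (snd e - fst e) \<in> rel_segment e"
proof -
  have "fst e + (s / edge_length e) *\<^sub>R (snd e - fst e) = (1 - s / edge_length e) *\<^sub>R fst e + (s / edge_length e) *\<^sub>R snd e"
    by (simp add: algebra_simps)
  then show ?thesis using assms by (auto simp: rel_segment_def in_segment intro!: exI[of _ "s / edge_length e"])
qed

lemma AE_arclength_rel_segment: 
  assumes "fst e \<noteq> snd e" shows "AE x in arclength e. x \<in> rel_segment e"
proof -
  have "Measurable.pred borel (\<lambda>x. x \<in> rel_segment e)" using rel_segment_borel by simp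
  from AE_arclength[OF this assms] show ?thesis using edge_point_in_rel_segment[OF assms] by auto
qed

lemma AE_arclength_neq:
  assumes "fst e \<noteq> snd e" shows "AE x in arclength e. x \<noteq> v"
proof -
  let ?w = "snd e - fst e"
  have l: "edge_length e > 0" using assms by (simp add: edge_length_def)
  have "AE s in lborel. s \<noteq> ((v - fst e) \<bullet> ?w) / (?w \<bullet> ?w) * edge_length e" by (rule AE_lborel_singleton)
  then have "AE s in lborel. s \<in> {0<..<edge_length e} \<longrightarrow> fst e + (s / edge_length e) *\<^sub>R ?w \<noteq> v"
  proof eventually_elim
    case (elim s)
    show ?case
    proof (intro impI notI)
      assume "fst e + (s / edge_length e) *\<^sub>R ?w = v"
      then have "v - fst e = (s / edge_length e) *\<^sub>R ?w" by auto
      then have "(v - fst e) \<bullet> ?w = (s / edge_length e) * (?w \<bullet> ?w)" by simp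
      then show False using elim assms l by simp
    qed
  qed
  then show ?thesis by (subst AE_arclength[OF _ assms]) auto
qed

lemma polys_on_smooth:
  assumes "f \<in> polys_on n D"
  obtains P where "smooth P" "\<And>x. x \<in> D \<Longrightarrow> f x = P x"
proof -
  obtain c :: "nat \<Rightarrow> nat \<Rightarrow> real" where c: "\<forall>x\<in>D. f x = (\<Sum>i\<le>n. \<Sum>j\<le>n - i. c i j * (x $ 1) ^ i * (x $ 2) ^ j)"
    using assms by (auto simp: polys_on_def)
  have "smooth (\<lambda>x. \<Sum>i\<le>n. \<Sum>j\<le>n - i. c i j * (x $ 1) ^ i * (x $ 2) ^ j)"
    by (intro smooth_sum smooth_mult smooth_const smooth_power smooth_nth)
  then show ?thesis using that c by blast
qed

lemma polys_on_const: "(\<And>x. x \<in> D \<Longrightarrow> f x = a) \<Longrightarrow> f \<in> polys_on n D"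
proof -
  assume f: "\<And>x. x \<in> D \<Longrightarrow> f x = a"
  have "(\<Sum>i\<le>n. \<Sum>j\<le>n - i. (if i = 0 \<and> j = 0 then a else 0) * (x $ 1) ^ i * (x $ 2) ^ j) = a" for x :: point
  proof -
    have "(\<Sum>i\<le>n. \<Sum>j\<le>n - i. (if i = 0 \<and> j = 0 then a else 0) * (x $ 1) ^ i * (x $ 2) ^ j)
      = (\<Sum>i\<le>n. \<Sum>j\<le>n - i. if j = 0 then (if i = 0 then a else 0) else 0)"
      by (intro sum.cong refl) auto
    also have "\<dots> = a" by (simp add: sum.delta)
    finally show ?thesis .
  qed
  then show ?thesis using f unfolding polys_on_def
    by (auto intro!: exI[of _ "\<lambda>i j. if i = 0 \<and> j = 0 then a else 0"])
qed

lemma polys_on_lincomb: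
  assumes "f \<in> polys_on n D" "g \<in> polys_on n D"
  shows "(\<lambda>x. a * f x + b * g x) \<in> polys_on n D"
proof -
  obtain c d where c: "\<forall>x\<in>D. f x = (\<Sum>i\<le>n. \<Sum>j\<le>n - i. c i j * (x $ 1) ^ i * (x $ 2) ^ j)"
    and d: "\<forall>x\<in>D. g x = (\<Sum>i\<le>n. \<Sum>j\<le>n - i. d i j * (x $ 1) ^ i * (x $ 2) ^ j)"
    using assms by (auto simp: polys_on_def)
  have "\<forall>x\<in>D. a * f x + b * g x = (\<Sum>i\<le>n. \<Sum>j\<le>n - i. (a * c i j + b * d i j) * (x $ 1) ^ i * (x $ 2) ^ j)"
    using c d by (simp add: sum_distrib_left sum.distrib algebra_simps)
  then show ?thesis unfolding polys_on_def
    by (intro CollectI exI[of _ "\<lambda>i j. a * c i j + b * d i j"])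
qed

lemma unit_normal_norm: "unit_normal e n \<Longrightarrow> norm n = 1" by (simp add: unit_normal_def)

section \<open>Elements and edges of a tessellation\<close>

locale mesh =
  fixes \<Omega> :: "point set" and \<rho> :: real and T :: "point set set" and E :: "edge set" and \<nu> :: "edge \<Rightarrow> point"
  assumes tess: "tessellation \<Omega> \<rho> T E \<nu>" and \<rho>_pos: "\<rho> > 0"
begin

lemma tessellation_facts:
  shows finite_T: "finite T" and finite_E: "finite E"
    and "\<forall>e\<in>E. fst e \<noteq> snd e"
    and "\<forall>e\<in>E. \<forall>e'\<in>E. e \<noteq> e' \<longrightarrow> rel_segment e \<inter> rel_segment e' = {}"
    and "\<forall>K\<in>T. \<forall>K'\<in>T. K \<noteq> K' \<longrightarrow> K \<inter> K' = {}"
    and "\<forall>K\<in>T. frontier K = \<Union>(segment ` edges_of E K)"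
    and "\<forall>e\<in>E. card (elems_at T e) \<in> {1, 2}"
    and "\<forall>e\<in>E. unit_normal e (\<nu> e)"
    and "\<forall>K\<in>T. polygonal_domain K \<and> K \<subseteq> \<Omega> \<and> shape_regular \<rho> K"
proof -
  note t = tess[unfolded tessellation_def]
  show "finite T" using t by (elim conjE)
  show "finite E" using t by (elim conjE)
  show "\<forall>e\<in>E. fst e \<noteq> snd e" using t by (elim conjE)
  show "\<forall>e\<in>E. \<forall>e'\<in>E. e \<noteq> e' \<longrightarrow> rel_segment e \<inter> rel_segment e' = {}" using t by (elim conjE)
  show "\<forall>K\<in>T. \<forall>K'\<in>T. K \<noteq> K' \<longrightarrow> K \<inter> K' = {}" using t by (elim conjE)
  show "\<forall>K\<in>T. frontier K = \<Union>(segment ` edges_of E K)" using t by (elim conjE)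
  show "\<forall>e\<in>E. card (elems_at T e) \<in> {1, 2}" using t by (elim conjE)
  show "\<forall>e\<in>E. unit_normal e (\<nu> e)" using t by (elim conjE)
  show "\<forall>K\<in>T. polygonal_domain K \<and> K \<subseteq> \<Omega> \<and> shape_regular \<rho> K" using t by (elim conjE)
qed

lemma mesh_nondegenerate: "e \<in> E \<Longrightarrow> fst e \<noteq> snd e"
  using tessellation_facts(3) by blast

lemma mesh_disjoint_edges: "e \<in> E \<Longrightarrow> e' \<in> E \<Longrightarrow> e \<noteq> e' \<Longrightarrow> rel_segment e \<inter> rel_segment e' = {}"
  using tessellation_facts(4) by blast

lemma mesh_disjoint: "K \<in> T \<Longrightarrow> K' \<in> T \<Longrightarrow> K \<noteq> K' \<Longrightarrow> K \<inter> K' = {}"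
  using tessellation_facts(5) by blast

lemma mesh_frontier: "K \<in> T \<Longrightarrow> frontier K = \<Union>(segment ` edges_of E K)"
  using tessellation_facts(6) by blast

lemma mesh_card: "e \<in> E \<Longrightarrow> card (elems_at T e) \<in> {1, 2}"
  using tessellation_facts(7) by blast

lemma mesh_normal: "e \<in> E \<Longrightarrow> unit_normal e (\<nu> e)"
  using tessellation_facts(8) by blast

lemma mesh_element: "K \<in> T \<Longrightarrow> polygonal_domain K \<and> shape_regular \<rho> K"
  using tessellation_facts(9) by blast

lemma ex_cell:
  assumes K: "K \<in> T" shows "\<exists>c r. normal_cell K c r E (diameter K) \<rho> \<nu>"
proof -
  have o: "open K" "bounded K" "K \<noteq> {}" using mesh_element[OF K] by (auto simp: polygonal_domain_def)
  obtain c r where cr: "2 * r \<ge> \<rho> * diameter K" "\<And>y. y \<in> ball c r \<Longrightarrow> y \<in> K"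
     "\<And>y z. y \<in> ball c r \<Longrightarrow> z \<in> K \<Longrightarrow> closed_segment y z \<subseteq> K"
    using mesh_element[OF K] unfolding shape_regular_def by blast
  obtain x where x: "x \<in> K" using o(3) by blast
  obtain \<epsilon> where \<epsilon>: "\<epsilon> > 0" "ball x \<epsilon> \<subseteq> K" using o(1) x open_contains_ball by blast
  have "x + (\<epsilon> / 2) *\<^sub>R axis 1 1 \<in> ball x \<epsilon>" using \<epsilon>(1) by (simp add: dist_norm)
  then have "dist x (x + (\<epsilon> / 2) *\<^sub>R axis 1 1) \<le> diameter K"
    using \<epsilon>(2) x o(2) by (intro diameter_bounded_bound) auto
  then have d: "diameter K > 0" using \<epsilon>(1) by (simp add: dist_norm)
  then have r: "r > 0" using cr(1) \<rho>_pos mult_pos_pos[of \<rho> "diameter K"] by linarith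
  have "normal_cell K c r E (diameter K) \<rho> \<nu>"
  proof (unfold_locales)
    show "norm (x - y) \<le> diameter K" if "x \<in> K" "y \<in> K" for x y
      using diameter_bounded_bound[OF o(2) that] by (simp add: dist_norm)
    show "ball c r \<subseteq> K" using cr(2) by blast
    show "\<And>y z. y \<in> ball c r \<Longrightarrow> z \<in> K \<Longrightarrow> closed_segment y z \<subseteq> K" by (rule cr(3))
  qed (use o r cr(1) \<rho>_pos finite_E mesh_nondegenerate mesh_disjoint_edges mesh_normal in auto)
  then show ?thesis by blast
qed

definition centre :: "point set \<Rightarrow> point" where
  "centre K = (SOME c. \<exists>r. normal_cell K c r E (diameter K) \<rho> \<nu>)"

definition inradius :: "point set \<Rightarrow> real" where
  "inradius K = (SOME r. normal_cell K (centre K) r E (diameter K) \<rho> \<nu>)"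

lemma cell: "K \<in> T \<Longrightarrow> normal_cell K (centre K) (inradius K) E (diameter K) \<rho> \<nu>"
proof -
  assume "K \<in> T"
  then have "\<exists>r. normal_cell K (centre K) r E (diameter K) \<rho> \<nu>"
    unfolding centre_def by (rule someI_ex[OF ex_cell])
  then show ?thesis unfolding inradius_def by (rule someI_ex)
qed

lemma elems_at_iff: "K \<in> elems_at T e \<and> e \<in> E \<longleftrightarrow> K \<in> T \<and> e \<in> edges_of E K"
  by (auto simp: elems_at_def edges_of_def)

lemma finite_elems_at: "finite (elems_at T e)" using finite_T by (simp add: elems_at_def)

lemma sum_edges_swap: "(\<Sum>e\<in>E. \<Sum>K\<in>elems_at T e. f e K) = (\<Sum>K\<in>T. \<Sum>e\<in>edges_of E K. f e K)"
  unfolding elems_at_def edges_of_def by (rule sum.swap_restrict[OF finite_E finite_T])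

lemma outer_normal_unit:
  assumes "e \<in> E" "K \<in> elems_at T e" shows "unit_normal e (outer_normal K e)"
proof -
  have K: "K \<in> T" "e \<in> edges_of E K" using assms elems_at_iff[of K e] by simp_all
  interpret normal_cell K "centre K" "inradius K" E "diameter K" \<rho> \<nu> by (rule cell[OF K(1)])
  show ?thesis using onormal(1)[OF EK_boundary[OF K(2)]] outer_normal_eq[OF EK_boundary[OF K(2)]] by simp
qed

lemma elems_at_cases:
  assumes e: "e \<in> E" and K: "K \<in> elems_at T e"
  obtains "elems_at T e = {K}" | K' where "K' \<noteq> K" "elems_at T e = {K, K'}"
proof -
  consider "card (elems_at T e) = 1" | "card (elems_at T e) = 2" using mesh_card[OF e] by blast
  then show ?thesis
  proof cases
    case 1 then show ?thesis using K that(1) by (auto simp: card_1_singleton_iff)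
  next
    case 2
    then obtain x y where "elems_at T e = {x, y}" "x \<noteq> y" unfolding card_2_iff by (elim exE conjE)
    then show ?thesis using K that(2)[of x] that(2)[of y] by (auto simp: insert_commute)
  qed
qed

text \<open>The two outer normals at \<open>e\<close> are opposite, since equal ones would make the
  half discs of \<open>K\<close> and \<open>K'\<close> overlap. Opposite half discs with their
  common diameter fill a neighbourhood of \<open>x\<close>.\<close>

lemma two_sided_neighbourhood:
  assumes e: "e \<in> E" and el: "elems_at T e = {K, K'}" "K' \<noteq> K" and x: "x \<in> rel_segment e"
  shows "\<forall>\<^sub>F z in nhds x. z \<in> closure K \<union> closure K'"
proof -
  have KT: "K \<in> T" "e \<in> edges_of E K" "K' \<in> T" "e \<in> edges_of E K'" using e el elems_at_iff by blast+
  interpret C: normal_cell K "centre K" "inradius K" E "diameter K" \<rho> \<nu> by (rule cell[OF KT(1)])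
  interpret C': normal_cell K' "centre K'" "inradius K'" E "diameter K'" \<rho> \<nu> by (rule cell[OF KT(3)])
  note b = C.EK_boundary[OF KT(2)] and b' = C'.EK_boundary[OF KT(4)]
  let ?n = "C.onormal e"
  note h = C.boundary_half_disc[OF b x] and h' = C'.boundary_half_disc[OF b' x]
  have nn: "?n \<bullet> ?n = 1" using C.onormal(1)[OF b] by (simp add: unit_normal_def norm_eq_1)
  have "C'.onormal e \<noteq> ?n"
  proof
    assume eq: "C'.onormal e = ?n"
    have l: "((\<lambda>s. x - s *\<^sub>R ?n) \<longlongrightarrow> x) (at_right 0)" by (auto intro!: tendsto_eq_intros)
    have "\<forall>\<^sub>F s in at_right (0::real). s > 0" by (simp add: eventually_at_right_less)
    then have "\<forall>\<^sub>F s in at_right (0::real). False"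
      using eventually_compose_filterlim[OF h l] eventually_compose_filterlim[OF h' l]
    proof eventually_elim
      case (elim s)
      then have "x - s *\<^sub>R ?n \<in> K \<inter> K'" by (simp add: eq nn)
      then show ?case using mesh_disjoint[OF KT(1,3)] el(2) by auto
    qed
    then show False by simp
  qed
  then have eq: "C'.onormal e = - ?n"
    using unit_normal_cases[OF C.onormal(1)[OF b] C'.onormal(1)[OF b'] mesh_nondegenerate[OF e]] by blast
  from h h' show ?thesis by eventually_elim (auto simp: eq)
qed

text \<open>The closure \<open>A\<close> of the elements with \<open>w K \<noteq> 0\<close> is a neighbourhood of each of its points except
  for vertices. Since the plane without the vertices is connected, a nonempty \<open>A\<close> would be unbounded.\<close>

lemma jump_zero_imp_zero:
  assumes w: "\<And>e. e \<in> E \<Longrightarrow> jump T e w = 0" and K: "K \<in> T"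
  shows "w K = 0"
proof (rule ccontr)
  assume wK: "w K \<noteq> 0"
  let ?S = "{K \<in> T. w K \<noteq> 0}"
  define A where "A = (\<Union>K\<in>?S. closure K)"
  define V where "V = fst ` E \<union> snd ` E"
  have finV: "finite V" using finite_E by (simp add: V_def)
  have closed_A: "closed A" unfolding A_def using finite_T by (intro closed_UN) auto
  have nb: "\<forall>\<^sub>F z in nhds x. z \<in> A" if x: "x \<in> A" "x \<notin> V" for x
  proof -
    obtain K where K: "K \<in> T" "w K \<noteq> 0" "x \<in> closure K" using x(1) by (auto simp: A_def)
    interpret C: normal_cell K "centre K" "inradius K" E "diameter K" \<rho> \<nu> by (rule cell[OF K(1)])
    show ?thesis
    proof (cases "x \<in> K")
      case True
      have "\<forall>\<^sub>F z in nhds x. z \<in> K" by (rule eventually_nhds_in_open[OF C.open_K True])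
      then show ?thesis by eventually_elim (use K closure_subset in \<open>auto simp: A_def\<close>)
    next
      case False
      then have "x \<in> frontier K" using K(3) C.open_K by (simp add: frontier_def interior_open)
      then obtain e where e: "e \<in> edges_of E K" "x \<in> segment e" using mesh_frontier[OF K(1)] by auto
      then have eE: "e \<in> E" "K \<in> elems_at T e" using K(1) by (auto simp: edges_of_def elems_at_def)
      have "x \<noteq> fst e" "x \<noteq> snd e" using x(2) eE by (auto simp: V_def)
      then have xr: "x \<in> rel_segment e" using e(2) by (simp add: rel_segment_def segment_def open_segment_def)
      have nK: "norm (outer_normal K e) = 1" by (rule unit_normal_norm[OF outer_normal_unit[OF eE]])
      show ?thesis
        using eE
      proof (cases rule: elems_at_cases)
        case 1
        then have "w K *\<^sub>R outer_normal K e = 0" using w[OF eE(1)] by (simp add: jump_def)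
        then show ?thesis using K(2) nK by auto
      next
        case (2 K')
        have K'e: "K' \<in> elems_at T e" using 2 by simp
        have "w K *\<^sub>R outer_normal K e + w K' *\<^sub>R outer_normal K' e = 0"
          using w[OF eE(1)] 2 by (simp add: jump_def)
        then have "w K' \<noteq> 0" using K(2) nK by auto
        moreover have "K' \<in> T" using K'e by (simp add: elems_at_def)
        ultimately have "closure K \<union> closure K' \<subseteq> A" using K by (auto simp: A_def)
        then show ?thesis
          using two_sided_neighbourhood[OF eE(1) 2(2,1) xr] by (elim eventually_mono) blast
      qed
    qed
  qed
  have "connected (UNIV - V)"
    by (rule connected_open_diff_countable) (use finV in \<open>auto simp: countable_finite\<close>)
  moreover have "UNIV - V \<subseteq> interior A \<union> - A"
  proof
    fix x assume "x \<in> UNIV - V"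
    then show "x \<in> interior A \<union> - A"
      using nb[of x] by (auto simp: interior_def eventually_nhds subset_iff)
  qed
  moreover have "interior A \<inter> (- A) \<inter> (UNIV - V) = {}" using interior_subset by blast
  moreover have "open (interior A)" "open (- A)" using closed_A by auto
  ultimately have "interior A \<inter> (UNIV - V) = {} \<or> - A \<inter> (UNIV - V) = {}" by (intro connectedD)
  moreover have "interior A \<inter> (UNIV - V) \<noteq> {}"
  proof
    assume e: "interior A \<inter> (UNIV - V) = {}"
    interpret C: normal_cell K "centre K" "inradius K" E "diameter K" \<rho> \<nu> by (rule cell[OF K])
    have "K \<subseteq> A" using K wK closure_subset by (auto simp: A_def)
    then have "K \<subseteq> interior A" using C.open_K by (rule interior_maximal)
    then have "K \<subseteq> V" using e by blast
    then have "finite K" using finV finite_subset by blast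
    then show False using C.open_K C.c_in_K finite_imp_not_open by blast
  qed
  ultimately have "- A \<subseteq> V" by blast
  then have "bounded (A \<union> V)"
  proof -
    have "bounded (closure K)" if "K \<in> T" for K
      using mesh_element[OF that] by (simp add: polygonal_domain_def bounded_closure)
    then have "bounded A" unfolding A_def using finite_T by (intro bounded_UN) auto
    then show ?thesis using finV by (simp add: finite_imp_bounded)
  qed
  moreover have "A \<union> V = UNIV" using \<open>- A \<subseteq> V\<close> by blast
  ultimately show False using not_bounded_UNIV by metis
qed

lemma other_edges_avoid:
  assumes e: "e \<in> E" "e' \<in> E" "e \<noteq> e'" and x: "x \<in> rel_segment e" "x \<notin> fst ` E \<union> snd ` E"
  shows "x \<notin> segment e'"
proof
  assume s: "x \<in> segment e'"
  have "x \<noteq> fst e'" "x \<noteq> snd e'" using x(2) e(2) by auto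
  then have "x \<in> rel_segment e'" using s by (simp add: rel_segment_def segment_def open_segment_def)
  then show False using mesh_disjoint_edges[OF e] x(1) by blast
qed

text \<open>Test with \<open>P\<close> times a bump at a point of \<open>e\<close>, where
  \<open>P\<close> extends the polynomial \<open>l\<close> from the edge to the plane: up to sign
  the flux becomes the integral of \<open>P^2\<close> times the bump, so \<open>P\<close> vanishes
  at the point.\<close>

lemma flux_zero_imp_zero:
  assumes l: "l \<in> Lambda_discrete E k'" and K: "K \<in> T"
    and z: "\<And>\<phi>. \<phi> \<in> H1 K \<Longrightarrow> flux E \<nu> K l \<phi> = 0" and e: "e \<in> edges_of E K"
  shows "AE x in arclength e. l x = 0"
proof -
  interpret C: normal_cell K "centre K" "inradius K" E "diameter K" \<rho> \<nu> by (rule cell[OF K])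
  have eE: "e \<in> E" and ab: "fst e \<noteq> snd e" using e mesh_nondegenerate by (auto simp: edges_of_def)
  let ?V = "fst ` E \<union> snd ` E"
  have finV: "finite ?V" using finite_E by simp
  have le: "square_integrable (arclength e') l" if "e' \<in> E" for e'
    using l that by (simp add: Lambda_discrete_def L2_skeleton_def)
  obtain P where P: "smooth P" "\<And>x. x \<in> rel_segment e \<Longrightarrow> l x = P x"
    using l eE polys_on_smooth[of l k' "rel_segment e"] by (auto simp: Lambda_discrete_def)
  have P0: "P x0 = 0" if x0: "x0 \<in> rel_segment e" "x0 \<notin> ?V" for x0
  proof -
    \<comment> \<open>The bump must not touch any other edge, so the point is taken off all
      vertices.\<close>
    let ?O = "\<Union>(segment ` (E - {e}))"
    have "closed ?O" using finite_E by (intro closed_Union) (auto simp: segment_def)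
    moreover have "x0 \<notin> ?O" using other_edges_avoid[OF eE _ _ x0] by auto
    ultimately obtain \<delta> where \<delta>: "\<delta> > 0" "ball x0 \<delta> \<subseteq> - ?O"
      using open_contains_ball[of "- ?O"] by blast
    \<comment> \<open>The half width \<open>\<delta> / 3\<close> keeps the box within the ball, as
      the norm is at most the sum of the absolute coordinates.\<close>
    define a where "a = x0 - vec2 (\<delta> / 3) (\<delta> / 3)"
    define b where "b = x0 + vec2 (\<delta> / 3) (\<delta> / 3)"
    let ?\<beta> = "box_bump a b"
    have box: "x \<notin> ?O" if "?\<beta> x \<noteq> 0" for x
    proof -
      have "x \<in> box a b" using that box_bump_eq_0_iff by blast
      then have "\<bar>(x - x0) $ 1\<bar> < \<delta> / 3" "\<bar>(x - x0) $ 2\<bar> < \<delta> / 3"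
        unfolding mem_box_2 a_def b_def by (auto simp: abs_if)
      then have "norm (x - x0) < \<delta>" using norm_le_l1_cart[of "x - x0"] \<delta>(1) unfolding sum_2 by linarith
      then show ?thesis using \<delta>(2) by (auto simp: dist_norm norm_minus_commute)
    qed
    define \<theta> where "\<theta> x = P x * ?\<beta> x" for x
    have \<theta>: "smooth \<theta>" unfolding \<theta>_def by (intro smooth_mult P smooth_box_bump)
    have other: "(LINT x|arclength e'. l x * C.sgn_edge e' * H1_trace E K \<theta> x) = 0" if e': "e' \<in> edges_of E K - {e}" for e'
    proof -
      have e'K: "e' \<in> edges_of E K" using e' by simp
      have e'E: "e' \<in> E" "fst e' \<noteq> snd e'" using e' mesh_nondegenerate by (auto simp: edges_of_def)
      have "AE x in arclength e'. l x * C.sgn_edge e' * H1_trace E K \<theta> x = 0"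
        using AE_arclength_rel_segment[OF e'E(2)] C.trace_smooth_eq[OF \<theta> e'K]
      proof eventually_elim
        case (elim x)
        have "x \<in> segment e'" using elim(1) segment_open_subset_closed by (auto simp: segment_def rel_segment_def)
        then have "?\<beta> x = 0" using box[of x] e' e'E by blast
        then show ?case using elim e' by (simp add: \<theta>_def)
      qed
      then show ?thesis by (rule integral_eq_zero_AE)
    qed
    have fin: "finite (edges_of E K)" by (rule C.finite_EK)
    have "0 = flux E \<nu> K l \<theta>" using z[OF C.H1_smooth[OF \<theta>]] by simp
    also have "\<dots> = (LINT x|arclength e. l x * C.sgn_edge e * H1_trace E K \<theta> x)"
      unfolding C.flux_eq using fin e other by (simp add: sum.remove[OF fin e])
    also have "\<dots> = (LINT x|arclength e. C.sgn_edge e * ((P x)\<^sup>2 * ?\<beta> x))"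
    proof (rule integral_cong_AE)
      show "AE x in arclength e. l x * C.sgn_edge e * H1_trace E K \<theta> x = C.sgn_edge e * ((P x)\<^sup>2 * ?\<beta> x)"
        using AE_arclength_rel_segment[OF ab] C.trace_smooth_eq[OF \<theta> e]
        by eventually_elim (simp add: P(2) \<theta>_def power2_eq_square)
      have [measurable]: "l \<in> borel_measurable borel" "H1_trace E K \<theta> \<in> borel_measurable borel"
        using square_integrable_measurable[OF le[OF eE]] square_integrable_measurable[OF C.square_integrable_trace[OF C.H1_smooth[OF \<theta>] e]]
        by simp_all
      show "(\<lambda>x. l x * C.sgn_edge e * H1_trace E K \<theta> x) \<in> borel_measurable (arclength e)" by simp
      have [measurable]: "P \<in> borel_measurable borel" "?\<beta> \<in> borel_measurable borel"
        by (intro borel_measurable_continuous_onI smooth_continuous P smooth_box_bump)+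
      show "(\<lambda>x. C.sgn_edge e * ((P x)\<^sup>2 * ?\<beta> x)) \<in> borel_measurable (arclength e)" by simp
    qed
    finally have int0: "(LINT x|arclength e. (P x)\<^sup>2 * ?\<beta> x) = 0" using C.sgn_edge[OF e] by auto
    have sm: "smooth (\<lambda>x. (P x)\<^sup>2 * ?\<beta> x)" by (intro smooth_mult smooth_power P smooth_box_bump)
    have "integrable (arclength e) (\<lambda>x. ((P x)\<^sup>2 * ?\<beta> x) * 1)"
      by (intro square_integrable_mult square_integrable_arclength smooth_continuous sm smooth_const)
    then have AE: "AE x in arclength e. (P x)\<^sup>2 * ?\<beta> x = 0"
      using int0 by (subst (asm) integral_nonneg_eq_0_iff_AE) (auto simp: box_bump_nonneg)
    \<comment> \<open>Pulled back to the parameter interval, the points where the integrand is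
      nonzero form an open null set, which is empty.\<close>
    let ?g = "\<lambda>s. fst e + (s / edge_length e) *\<^sub>R (snd e - fst e)"
    let ?f = "\<lambda>s. (P (?g s))\<^sup>2 * ?\<beta> (?g s)"
    have c: "continuous_on UNIV ?f"
      by (rule continuous_on_compose2[OF smooth_continuous[OF sm, of UNIV]]) (auto intro!: continuous_intros simp: divide_inverse)
    have [measurable]: "(\<lambda>x. (P x)\<^sup>2 * ?\<beta> x) \<in> borel_measurable borel"
      by (intro borel_measurable_continuous_onI smooth_continuous sm)
    have AEs: "AE s in lborel. s \<in> {0<..<edge_length e} \<longrightarrow> ?f s = 0"
    proof -
      have "Measurable.pred borel (\<lambda>x. (P x)\<^sup>2 * ?\<beta> x = 0)" by measurable
      from AE_arclength[OF this ab] show ?thesis using AE by blast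
    qed
    define U where "U = {0<..<edge_length e} \<inter> {s. ?f s \<noteq> 0}"
    have oU: "open U" unfolding U_def by (intro open_Int open_Collect_neq c continuous_on_const) auto
    have "AE s in lborel. s \<notin> U" using AEs by eventually_elim (auto simp: U_def)
    then have "U \<in> null_sets lborel" using oU by (subst AE_iff_null_sets) auto
    then have "negligible U" by (simp add: negligible_iff_null_sets null_sets_completionI)
    then have U: "U = {}" using oU open_not_negligible by blast
    obtain u where u: "0 < u" "u < 1" "x0 = (1 - u) *\<^sub>R fst e + u *\<^sub>R snd e"
      using x0(1) by (auto simp: rel_segment_def in_segment)
    have l0: "edge_length e > 0" using ab by (simp add: edge_length_def)
    have "?g (u * edge_length e) = x0" using u l0 by (simp add: algebra_simps)
    moreover have "u * edge_length e \<in> {0<..<edge_length e}" using u l0 by simp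
    ultimately have "(P x0)\<^sup>2 * ?\<beta> x0 = 0" using U unfolding U_def by (metis (mono_tags, lifting) IntI empty_iff mem_Collect_eq)
    moreover have "x0 \<in> box a b" using \<delta>(1) by (simp add: mem_box_2 a_def b_def)
    then have "?\<beta> x0 \<noteq> 0" using box_bump_eq_0_iff by blast
    ultimately show ?thesis by simp
  qed
  have "AE x in arclength e. \<forall>v\<in>?V. x \<noteq> v"
    using finV by (intro AE_finite_allI AE_arclength_neq ab) auto
  with AE_arclength_rel_segment[OF ab] show ?thesis
  proof eventually_elim
    case (elim x)
    then have "x \<notin> ?V" by blast
    then show ?case using P0[of x] P(2)[of x] elim by simp
  qed
qed

section \<open>Definiteness of the norm on discrete pairs\<close>

lemma edge_length_pos: "e \<in> E \<Longrightarrow> edge_length e > 0"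
  using mesh_nondegenerate by (simp add: edge_length_def)

lemma diameter_pos: "K \<in> T \<Longrightarrow> diameter K > 0"
  using cell.h_pos normal_cell.axioms(1)[OF cell] by blast

lemma elems_at_nonempty: "e \<in> E \<Longrightarrow> elems_at T e \<noteq> {}"
  using mesh_card[of e] by auto

lemma edge_scale_ge: "K \<in> elems_at T e \<Longrightarrow> diameter K \<le> edge_scale T e"
  unfolding edge_scale_def using finite_elems_at by (intro Max_ge) auto

lemma edge_scale_pos: "e \<in> E \<Longrightarrow> edge_scale T e > 0"
  using elems_at_nonempty[of e] edge_scale_ge diameter_pos
  by (metis (no_types, lifting) elems_at_iff equals0I less_le_trans)

lemma L2_edges: "K \<in> T \<Longrightarrow> l \<in> L2_skeleton E \<Longrightarrow> normal_cell.L2_edges K E l"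
  using normal_cell.L2_edges_def[OF cell] by (auto simp: L2_skeleton_def edges_of_def)

lemma V_discrete_H1:
  assumes u: "u \<in> V_discrete T k" and K: "K \<in> T" shows "u K \<in> H1 K"
proof -
  interpret C: normal_cell K "centre K" "inradius K" E "diameter K" \<rho> \<nu> by (rule cell[OF K])
  obtain P where P: "smooth P" "\<And>x. x \<in> K \<Longrightarrow> u K x = P x"
    using u K polys_on_smooth[of "u K" k K] by (auto simp: V_discrete_def)
  show ?thesis by (rule C.H1_cong[OF P(2) C.H1_smooth[OF P(1)]])
qed

text \<open>At a nonzero pair of norm 0 every quotient would be 0 by the convention on division, and
  the infimum could not be positive. Zero seminorms and zero jumps leave zero averages by
  \<open>jump_zero_imp_zero\<close>; a vanishing flux functional leaves \<open>l = 0\<close> by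
  \<open>flux_zero_imp_zero\<close>.\<close>

lemma V_norm_zero:
  assumes u: "u \<in> V_discrete T k" and l: "l \<in> Lambda_discrete E k'" and z: "V_norm T E \<nu> (u, l) = 0"
  shows "V_zero T E (u, l)"
proof -
  have lL: "l \<in> L2_skeleton E" using l by (simp add: Lambda_discrete_def)
  have "(broken_norm T E u)\<^sup>2 + (skeleton_norm T E \<nu> l)\<^sup>2 = 0" using z by (simp add: V_norm_def)
  then have b: "broken_norm T E u = 0" and s: "skeleton_norm T E \<nu> l = 0"
    by (auto simp: sum_power2_eq_zero_iff)
  let ?w = "\<lambda>K. average K (u K)"
  let ?J = "\<Sum>e\<in>E. edge_length e / edge_scale T e * (norm (jump T e ?w))\<^sup>2"
  have J0: "?J \<ge> 0" using edge_scale_pos edge_length_pos by (intro sum_nonneg mult_nonneg_nonneg) (auto simp: less_imp_le)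
  have S0: "(\<Sum>K\<in>T. (H1_seminorm K (u K))\<^sup>2) \<ge> 0" by (simp add: sum_nonneg)
  have "(\<Sum>K\<in>T. (H1_seminorm K (u K))\<^sup>2) + ?J = 0" using b by (simp add: broken_norm_def)
  then have S: "(\<Sum>K\<in>T. (H1_seminorm K (u K))\<^sup>2) = 0" and J: "?J = 0" using J0 S0 by auto
  have semi: "H1_seminorm K (u K) = 0" if "K \<in> T" for K
    using S that finite_T by (subst (asm) sum_nonneg_eq_0_iff) auto
  have "jump T e ?w = 0" if "e \<in> E" for e
  proof -
    have "edge_length e / edge_scale T e * (norm (jump T e ?w))\<^sup>2 = 0"
      using J that finite_E edge_scale_pos edge_length_pos
      by (subst (asm) sum_nonneg_eq_0_iff) (auto intro!: mult_nonneg_nonneg simp: less_imp_le)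
    then show ?thesis using edge_scale_pos[OF that] edge_length_pos[OF that] by simp
  qed
  then have w0: "?w K = 0" if "K \<in> T" for K using jump_zero_imp_zero[of ?w K] that by simp
  have "AE x in area_on K. u K x = 0" if K: "K \<in> T" for K
  proof -
    interpret C: normal_cell K "centre K" "inradius K" E "diameter K" \<rho> \<nu> by (rule cell[OF K])
    show ?thesis using C.H1_seminorm_0_AE[OF V_discrete_H1[OF u K] semi[OF K]] w0[OF K] by simp
  qed
  moreover have "AE x in arclength e. l x = 0" if e: "e \<in> E" for e
  proof -
    obtain K where K: "K \<in> T" "e \<in> edges_of E K" using elems_at_nonempty[OF e] e elems_at_iff by blast
    interpret C: normal_cell K "centre K" "inradius K" E "diameter K" \<rho> \<nu> by (rule cell[OF K(1)])
    have L: "C.L2_edges l" by (rule L2_edges[OF K(1) lL])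
    have "(\<Sum>K\<in>T. (dual_norm K (flux E \<nu> K l))\<^sup>2) = 0" using s by (simp add: skeleton_norm_def)
    then have "(dual_norm K (flux E \<nu> K l))\<^sup>2 = 0" using K(1) finite_T by (subst (asm) sum_nonneg_eq_0_iff) auto
    then have "flux E \<nu> K l (\<lambda>x. 1) = 0" "dual_seminorm K (flux E \<nu> K l) = 0"
      by (auto simp: dual_norm_def sum_power2_eq_zero_iff)
    then have "flux E \<nu> K l \<phi> = 0" if "\<phi> \<in> H1 K" for \<phi>
      using C.dual_seminorm_bound[OF C.flux_H1_dual[OF L] that] by simp
    then show ?thesis using flux_zero_imp_zero[OF l K(1) _ K(2)] by blast
  qed
  ultimately show ?thesis by (simp add: V_zero_def)
qed

text \<open>Each edge is visited once for every adjacent element. With this the whole form becomes a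
  sum of local terms (\<open>stab_form_eq\<close>).\<close>

lemma skeleton_integral_eq:
  assumes l: "l \<in> L2_skeleton E" and v: "\<And>K. K \<in> T \<Longrightarrow> v K \<in> H1 K"
  shows "(\<Sum>e\<in>E. LINT x|arclength e. l x * (jump T e (\<lambda>K. H1_trace E K (v K) x) \<bullet> \<nu> e)) = (\<Sum>K\<in>T. flux E \<nu> K l (v K))"
proof -
  have "(\<Sum>e\<in>E. LINT x|arclength e. l x * (jump T e (\<lambda>K. H1_trace E K (v K) x) \<bullet> \<nu> e))
     = (\<Sum>e\<in>E. \<Sum>K\<in>elems_at T e. LINT x|arclength e. l x * (\<nu> e \<bullet> outer_normal K e) * H1_trace E K (v K) x)"
  proof (rule sum.cong[OF refl])
    fix e assume e: "e \<in> E"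
    have i: "integrable (arclength e) (\<lambda>x. l x * (\<nu> e \<bullet> outer_normal K e) * H1_trace E K (v K) x)" if "K \<in> elems_at T e" for K
    proof -
      have K: "K \<in> T" "e \<in> edges_of E K" using that e elems_at_iff[of K e] by simp_all
      interpret C: normal_cell K "centre K" "inradius K" E "diameter K" \<rho> \<nu> by (rule cell[OF K(1)])
      show ?thesis using l e by (intro C.integrable_flux v K) (auto simp: L2_skeleton_def)
    qed
    have "(LINT x|arclength e. l x * (jump T e (\<lambda>K. H1_trace E K (v K) x) \<bullet> \<nu> e))
      = (LINT x|arclength e. (\<Sum>K\<in>elems_at T e. l x * (\<nu> e \<bullet> outer_normal K e) * H1_trace E K (v K) x))"
      by (intro Bochner_Integration.integral_cong refl)
         (simp add: jump_def inner_sum_right sum_distrib_left inner_commute mult_ac)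
    also have "\<dots> = (\<Sum>K\<in>elems_at T e. LINT x|arclength e. l x * (\<nu> e \<bullet> outer_normal K e) * H1_trace E K (v K) x)"
      using i by (rule Bochner_Integration.integral_sum)
    finally show "(LINT x|arclength e. l x * (jump T e (\<lambda>K. H1_trace E K (v K) x) \<bullet> \<nu> e))
      = (\<Sum>K\<in>elems_at T e. LINT x|arclength e. l x * (\<nu> e \<bullet> outer_normal K e) * H1_trace E K (v K) x)" .
  qed
  also have "\<dots> = (\<Sum>K\<in>T. flux E \<nu> K l (v K))" unfolding sum_edges_swap flux_def ..
  finally show ?thesis .
qed

end

section \<open>Inf-sup condition and continuity\<close>

lemma power2_sum_le: "(a + b)\<^sup>2 \<le> 2 * a\<^sup>2 + 2 * (b::real)\<^sup>2"
  using sum_squares_bound[of a b] by (simp add: power2_sum)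

lemma young_inequality: "0 < c \<Longrightarrow> x * y \<le> x\<^sup>2 / (4 * c) + c * (y::real)\<^sup>2"
proof -
  assume c: "0 < c"
  have "0 \<le> (x - 2 * c * y)\<^sup>2 / (4 * c)" using c by simp
  also have "\<dots> = x\<^sup>2 / (4 * c) - x * y + c * y\<^sup>2" using c by (simp add: field_simps power2_eq_square)
  finally show ?thesis by simp
qed

section \<open>Edge weights and the energy of jumps\<close>

context mesh
begin

lemma sum_edges_le_twice:
  fixes f :: "edge \<Rightarrow> real"
  assumes "\<And>e. e \<in> E \<Longrightarrow> 0 \<le> f e"
  shows "(\<Sum>K\<in>T. \<Sum>e\<in>edges_of E K. f e) \<le> 2 * (\<Sum>e\<in>E. f e)"
proof -
  have "(\<Sum>K\<in>T. \<Sum>e\<in>edges_of E K. f e) = (\<Sum>e\<in>E. \<Sum>K\<in>elems_at T e. f e)"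
    by (rule sum_edges_swap[symmetric])
  also have "\<dots> \<le> (\<Sum>e\<in>E. 2 * f e)"
  proof (rule sum_mono)
    fix e assume e: "e \<in> E"
    have "real (card (elems_at T e)) \<le> 2" using mesh_card[OF e] by auto
    then show "(\<Sum>K\<in>elems_at T e. f e) \<le> 2 * f e" using assms[OF e] by (simp add: mult_right_mono)
  qed
  finally show ?thesis by (simp add: sum_distrib_left)
qed

lemma outer_normal_multiple:
  assumes "e \<in> E" "K \<in> elems_at T e"
  shows "outer_normal K e = (outer_normal K e \<bullet> \<nu> e) *\<^sub>R \<nu> e" "\<bar>outer_normal K e \<bullet> \<nu> e\<bar> = 1"
proof -
  have n: "unit_normal e (\<nu> e)" "unit_normal e (outer_normal K e)"
    using mesh_normal[OF assms(1)] outer_normal_unit[OF assms] by auto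
  have "\<nu> e \<bullet> \<nu> e = 1" using n(1) by (simp add: unit_normal_def norm_eq_1)
  then show "outer_normal K e = (outer_normal K e \<bullet> \<nu> e) *\<^sub>R \<nu> e" "\<bar>outer_normal K e \<bullet> \<nu> e\<bar> = 1"
    using unit_normal_cases[OF n mesh_nondegenerate[OF assms(1)]] by auto
qed

text \<open>The scalar jump with respect to \<open>\<nu> e\<close>; nothing is lost because all
  outer normals at \<open>e\<close> are plus or minus \<open>\<nu> e\<close>.\<close>

definition normal_jump :: "edge \<Rightarrow> (point set \<Rightarrow> real) \<Rightarrow> real" where
  "normal_jump e w = (\<Sum>K\<in>elems_at T e. w K * (outer_normal K e \<bullet> \<nu> e))"

lemma jump_eq: assumes e: "e \<in> E" shows "jump T e w = normal_jump e w *\<^sub>R \<nu> e"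
proof -
  have "jump T e w = (\<Sum>K\<in>elems_at T e. (w K * (outer_normal K e \<bullet> \<nu> e)) *\<^sub>R \<nu> e)"
    unfolding jump_def
  proof (rule sum.cong[OF refl])
    fix K assume "K \<in> elems_at T e"
    from outer_normal_multiple(1)[OF e this]
    show "w K *\<^sub>R outer_normal K e = (w K * (outer_normal K e \<bullet> \<nu> e)) *\<^sub>R \<nu> e" by (metis scaleR_scaleR)
  qed
  then show ?thesis by (simp add: normal_jump_def scaleR_sum_left)
qed

lemma norm_jump: "e \<in> E \<Longrightarrow> (norm (jump T e w))\<^sup>2 = (normal_jump e w)\<^sup>2"
  using jump_eq mesh_normal by (simp add: unit_normal_def)

lemma normal_jump_power2_le: assumes e: "e \<in> E" shows "(normal_jump e w)\<^sup>2 \<le> 2 * (\<Sum>K\<in>elems_at T e. (w K)\<^sup>2)"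
proof -
  have "(normal_jump e w)\<^sup>2 \<le> (\<Sum>K\<in>elems_at T e. (w K)\<^sup>2) * (\<Sum>K\<in>elems_at T e. (outer_normal K e \<bullet> \<nu> e)\<^sup>2)"
    unfolding normal_jump_def by (rule Cauchy_Schwarz_ineq_sum)
  also have "(\<Sum>K\<in>elems_at T e. (outer_normal K e \<bullet> \<nu> e)\<^sup>2) = (\<Sum>K\<in>elems_at T e. 1)"
    using outer_normal_multiple(2)[OF e] by (intro sum.cong refl) (metis one_power2 power2_abs)
  also have "(\<Sum>K\<in>elems_at T e. (w K)\<^sup>2) * \<dots> \<le> (\<Sum>K\<in>elems_at T e. (w K)\<^sup>2) * 2"
    using mesh_card[OF e] by (intro mult_left_mono) (auto simp: sum_nonneg)
  finally show ?thesis by simp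
qed

definition edge_weight :: "edge \<Rightarrow> real" where "edge_weight e = edge_length e / edge_scale T e"

lemma edge_weight_nonneg: "e \<in> E \<Longrightarrow> 0 \<le> edge_weight e"
  using edge_scale_pos edge_length_pos by (simp add: edge_weight_def less_imp_le)

text \<open>As \<open>edge_scale T e\<close> is at least \<open>diameter K\<close>, the weights are
  dominated by the lengths divided by the diameter, and these sum up by \<open>perimeter\<close>.
  This takes the place of a bound on the number of edges.\<close>

lemma sum_edge_weight: assumes K: "K \<in> T" shows "(\<Sum>e\<in>edges_of E K. edge_weight e) \<le> 4 * pi / \<rho>"
proof -
  interpret C: normal_cell K "centre K" "inradius K" E "diameter K" \<rho> \<nu> by (rule cell[OF K])
  have d: "diameter K > 0" by (rule diameter_pos[OF K])
  have "(\<Sum>e\<in>edges_of E K. edge_weight e) \<le> (\<Sum>e\<in>edges_of E K. edge_length e / diameter K)"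
  proof (rule sum_mono)
    fix e assume "e \<in> edges_of E K"
    then have "K \<in> elems_at T e" using K elems_at_iff by blast
    from edge_scale_ge[OF this] show "edge_weight e \<le> edge_length e / diameter K"
      unfolding edge_weight_def using d by (intro divide_left_mono) auto
  qed
  also have "\<dots> = (\<Sum>e\<in>edges_of E K. edge_length e) / diameter K" by (simp add: sum_divide_distrib)
  also have "\<dots> \<le> (4 * pi / \<rho> * diameter K) / diameter K" using d C.perimeter by (intro divide_right_mono) auto
  finally show ?thesis using d by simp
qed

definition jump_energy :: "(point set \<Rightarrow> real) \<Rightarrow> real" where
  "jump_energy w = (\<Sum>e\<in>E. edge_weight e * (normal_jump e w)\<^sup>2)"

lemma jump_energy_nonneg: "0 \<le> jump_energy w"
  unfolding jump_energy_def using edge_weight_nonneg by (intro sum_nonneg) auto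

text \<open>A squared jump is at most twice the sum of the squares on both sides, and the weights
  around an element add up to at most \<open>4 * pi / \<rho>\<close>. Applied below to the constants
  subtracted from \<open>u\<close>, it bounds their jumps by the fluxes of 1.\<close>

lemma jump_energy_le: "jump_energy w \<le> 8 * pi / \<rho> * (\<Sum>K\<in>T. (w K)\<^sup>2)"
proof -
  have "jump_energy w \<le> (\<Sum>e\<in>E. edge_weight e * (2 * (\<Sum>K\<in>elems_at T e. (w K)\<^sup>2)))"
    unfolding jump_energy_def by (intro sum_mono mult_left_mono normal_jump_power2_le edge_weight_nonneg)
  also have "\<dots> = 2 * (\<Sum>e\<in>E. \<Sum>K\<in>elems_at T e. edge_weight e * (w K)\<^sup>2)"
    by (simp add: sum_distrib_left mult_ac)
  also have "\<dots> = 2 * (\<Sum>K\<in>T. (\<Sum>e\<in>edges_of E K. edge_weight e) * (w K)\<^sup>2)"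
    unfolding sum_edges_swap by (simp add: sum_distrib_right)
  also have "\<dots> \<le> 2 * (\<Sum>K\<in>T. 4 * pi / \<rho> * (w K)\<^sup>2)"
    by (intro mult_left_mono sum_mono mult_right_mono sum_edge_weight) auto
  also have "\<dots> = 8 * pi / \<rho> * (\<Sum>K\<in>T. (w K)\<^sup>2)"
    unfolding sum_distrib_left[symmetric] by simp
  finally show ?thesis .
qed

lemma jump_energy_add: "jump_energy (\<lambda>K. w K + w' K) \<le> 2 * jump_energy w + 2 * jump_energy w'"
proof -
  have "jump_energy (\<lambda>K. w K + w' K) \<le> (\<Sum>e\<in>E. edge_weight e * (2 * (normal_jump e w)\<^sup>2 + 2 * (normal_jump e w')\<^sup>2))"
    unfolding jump_energy_def
  proof (intro sum_mono mult_left_mono edge_weight_nonneg)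
    fix e
    have "normal_jump e (\<lambda>K. w K + w' K) = normal_jump e w + normal_jump e w'"
      by (simp add: normal_jump_def distrib_right sum.distrib)
    then show "(normal_jump e (\<lambda>K. w K + w' K))\<^sup>2 \<le> 2 * (normal_jump e w)\<^sup>2 + 2 * (normal_jump e w')\<^sup>2"
      using power2_sum_le by simp
  qed
  then show ?thesis by (simp add: jump_energy_def sum_distrib_left sum.distrib algebra_simps)
qed

lemma V_norm_power2:
  "(V_norm T E \<nu> (u, l))\<^sup>2 = (\<Sum>K\<in>T. (H1_seminorm K (u K))\<^sup>2) + jump_energy (\<lambda>K. average K (u K))
     + (\<Sum>K\<in>T. (flux E \<nu> K l (\<lambda>x. 1))\<^sup>2) + (\<Sum>K\<in>T. (dual_seminorm K (flux E \<nu> K l))\<^sup>2)"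
proof -
  have J: "(\<Sum>e\<in>E. edge_length e / edge_scale T e * (norm (jump T e (\<lambda>K. average K (u K))))\<^sup>2) = jump_energy (\<lambda>K. average K (u K))"
    unfolding jump_energy_def edge_weight_def by (intro sum.cong refl) (simp add: norm_jump)
  have b: "(broken_norm T E u)\<^sup>2 = (\<Sum>K\<in>T. (H1_seminorm K (u K))\<^sup>2) + jump_energy (\<lambda>K. average K (u K))"
    unfolding broken_norm_def J using jump_energy_nonneg by (intro real_sqrt_pow2 add_nonneg_nonneg) (auto simp: sum_nonneg)
  have s: "(skeleton_norm T E \<nu> l)\<^sup>2 = (\<Sum>K\<in>T. (flux E \<nu> K l (\<lambda>x. 1))\<^sup>2) + (\<Sum>K\<in>T. (dual_seminorm K (flux E \<nu> K l))\<^sup>2)"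
    unfolding skeleton_norm_def by (simp add: sum_nonneg dual_norm_def sum.distrib)
  have "(V_norm T E \<nu> (u, l))\<^sup>2 = (broken_norm T E u)\<^sup>2 + (skeleton_norm T E \<nu> l)\<^sup>2" by (simp add: V_norm_def)
  then show ?thesis unfolding b s by simp
qed

lemma V_norm_nonneg: "0 \<le> V_norm T E \<nu> p" by (simp add: V_norm_def)

text \<open>Built from open segments: those of different edges are disjoint, so on each of them only
  one summand is nonzero.\<close>

definition edgewise :: "(edge \<Rightarrow> real) \<Rightarrow> point \<Rightarrow> real" where
  "edgewise a x = (\<Sum>e\<in>E. a e * indicator (rel_segment e) x)"

lemma edgewise_eq:
  assumes e: "e \<in> E" and x: "x \<in> rel_segment e" shows "edgewise a x = a e"
proof -
  have "edgewise a x = (\<Sum>e'\<in>E. if e' = e then a e else 0)"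
    unfolding edgewise_def
  proof (rule sum.cong[OF refl])
    fix e' assume "e' \<in> E"
    then show "a e' * indicator (rel_segment e') x = (if e' = e then a e else 0)"
      using mesh_disjoint_edges[of e e'] e x by (auto simp: indicator_def)
  qed
  then show ?thesis using e finite_E by simp
qed

lemma AE_edgewise: assumes e: "e \<in> E" shows "AE x in arclength e. edgewise a x = a e"
  using AE_arclength_rel_segment[OF mesh_nondegenerate[OF e]] by eventually_elim (rule edgewise_eq[OF e])

lemma edgewise_measurable: "edgewise a \<in> borel_measurable borel"
proof -
  note rel_segment_borel [measurable]
  show ?thesis unfolding edgewise_def by measurable
qed

lemma edgewise_Lambda: "edgewise a \<in> Lambda_discrete E k'"
proof -
  have "square_integrable (arclength e) (edgewise a)" if e: "e \<in> E" for e
    by (rule square_integrable_cong_AE[OF square_integrable_const[OF finite_arclength, where c = "a e"]])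
       (use AE_edgewise[OF e, of a] edgewise_measurable in auto)
  moreover have "edgewise a \<in> polys_on k' (rel_segment e)" if "e \<in> E" for e
    using edgewise_eq[OF that] by (rule polys_on_const)
  ultimately show ?thesis by (simp add: Lambda_discrete_def L2_skeleton_def)
qed

lemma integral_edgewise: assumes e: "e \<in> E"
  shows "(LINT x|arclength e. edgewise a x) = a e * edge_length e"
    and "(L2_norm (arclength e) (edgewise a))\<^sup>2 = (a e)\<^sup>2 * edge_length e"
proof -
  have "(LINT x|arclength e. edgewise a x) = (LINT x|arclength e. a e)"
    by (rule integral_cong_AE) (use AE_edgewise[OF e, of a] edgewise_measurable in auto)
  then show "(LINT x|arclength e. edgewise a x) = a e * edge_length e" unfolding integral_arclength_const .
  have "L2_norm (arclength e) (edgewise a) = L2_norm (arclength e) (\<lambda>x. a e)"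
    by (rule L2_norm_cong_AE) (use AE_edgewise[OF e, of a] edgewise_measurable in auto)
  then show "(L2_norm (arclength e) (edgewise a))\<^sup>2 = (a e)\<^sup>2 * edge_length e"
    using integral_arclength_const[of e "(a e)\<^sup>2"] by (simp add: L2_norm_power2 del: lebesgue_integral_const)
qed

section \<open>The skeleton part of the test pair\<close>

lemma Lambda_L2: "l \<in> Lambda_discrete E k' \<Longrightarrow> l \<in> L2_skeleton E"
  by (simp add: Lambda_discrete_def)

lemma Lambda_lincomb:
  assumes "l \<in> Lambda_discrete E k'" "m \<in> Lambda_discrete E k'"
  shows "(\<lambda>x. a * l x + b * m x) \<in> Lambda_discrete E k'"
  using assms unfolding Lambda_discrete_def L2_skeleton_def
  by (auto intro!: square_integrable_add square_integrable_cmult polys_on_lincomb)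

lemma V_discrete_add_const: "u \<in> V_discrete T k \<Longrightarrow> (\<lambda>K x. u K x + a K) \<in> V_discrete T k"
  unfolding V_discrete_def
proof (rule CollectI, rule ballI)
  fix K assume u: "u \<in> {u. \<forall>K\<in>T. u K \<in> polys_on k K}" and K: "K \<in> T"
  have "(\<lambda>x. a K) \<in> polys_on k K" by (rule polys_on_const) simp
  from polys_on_lincomb[OF _ this, of "u K" 1 1] show "(\<lambda>x. u K x + a K) \<in> polys_on k K" using u K by simp
qed

definition jump_flux :: "(point set \<Rightarrow> real) \<Rightarrow> point \<Rightarrow> real" where
  "jump_flux w = edgewise (\<lambda>e. normal_jump e w / edge_scale T e)"

lemma jump_flux_Lambda: "jump_flux w \<in> Lambda_discrete E k'"
  unfolding jump_flux_def by (rule edgewise_Lambda)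

lemma flux_one_jump_flux:
  assumes K: "K \<in> T"
  shows "flux E \<nu> K (jump_flux w) (\<lambda>x. 1) = (\<Sum>e\<in>edges_of E K. edge_weight e * normal_jump e w * (outer_normal K e \<bullet> \<nu> e))"
proof -
  interpret C: normal_cell K "centre K" "inradius K" E "diameter K" \<rho> \<nu> by (rule cell[OF K])
  have L: "C.L2_edges (jump_flux w)" by (rule L2_edges[OF K Lambda_L2[OF jump_flux_Lambda]])
  show ?thesis unfolding C.flux_one[OF L]
  proof (rule sum.cong[OF refl])
    fix e assume "e \<in> edges_of E K"
    then have e: "e \<in> E" by (simp add: edges_of_def)
    show "C.sgn_edge e * (LINT x|arclength e. jump_flux w x) = edge_weight e * normal_jump e w * (outer_normal K e \<bullet> \<nu> e)"
      unfolding jump_flux_def integral_edgewise(1)[OF e] by (simp add: C.sgn_edge_def edge_weight_def inner_commute)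
  qed
qed

text \<open>Regrouped by edges, the sum over the elements at \<open>e\<close> is again the normal
  jump, so each edge contributes its weight times the squared jump.\<close>

lemma sum_average_jump_flux:
  "(\<Sum>K\<in>T. w K * flux E \<nu> K (jump_flux w) (\<lambda>x. 1)) = jump_energy w"
proof -
  have "(\<Sum>K\<in>T. w K * flux E \<nu> K (jump_flux w) (\<lambda>x. 1))
     = (\<Sum>K\<in>T. \<Sum>e\<in>edges_of E K. edge_weight e * normal_jump e w * (w K * (outer_normal K e \<bullet> \<nu> e)))"
    by (intro sum.cong refl) (simp add: flux_one_jump_flux sum_distrib_left mult_ac)
  also have "\<dots> = (\<Sum>e\<in>E. \<Sum>K\<in>elems_at T e. edge_weight e * normal_jump e w * (w K * (outer_normal K e \<bullet> \<nu> e)))"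
    by (rule sum_edges_swap[symmetric])
  also have "\<dots> = jump_energy w"
    unfolding jump_energy_def by (intro sum.cong refl) (simp add: sum_distrib_left[symmetric] normal_jump_def[symmetric] power2_eq_square)
  finally show ?thesis .
qed

text \<open>Cauchy-Schwarz with the weight split into two square roots; the first factor is bounded
  by \<open>sum_edge_weight\<close>. An edge is counted for at most two elements, which doubles
  \<open>4 * pi / \<rho>\<close>.\<close>

lemma flux_one_jump_flux_bound:
  "(\<Sum>K\<in>T. (flux E \<nu> K (jump_flux w) (\<lambda>x. 1))\<^sup>2) \<le> 8 * pi / \<rho> * jump_energy w"
proof -
  have "(flux E \<nu> K (jump_flux w) (\<lambda>x. 1))\<^sup>2 \<le> 4 * pi / \<rho> * (\<Sum>e\<in>edges_of E K. edge_weight e * (normal_jump e w)\<^sup>2)"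
    if K: "K \<in> T" for K
  proof -
    have w0: "0 \<le> edge_weight e" if "e \<in> edges_of E K" for e using that edge_weight_nonneg by (simp add: edges_of_def)
    have eq: "flux E \<nu> K (jump_flux w) (\<lambda>x. 1)
        = (\<Sum>e\<in>edges_of E K. sqrt (edge_weight e) * (sqrt (edge_weight e) * normal_jump e w * (outer_normal K e \<bullet> \<nu> e)))"
      unfolding flux_one_jump_flux[OF K] using w0 by (intro sum.cong refl) (simp add: mult.assoc[symmetric])
    have "(flux E \<nu> K (jump_flux w) (\<lambda>x. 1))\<^sup>2 \<le> (\<Sum>e\<in>edges_of E K. (sqrt (edge_weight e))\<^sup>2)
         * (\<Sum>e\<in>edges_of E K. (sqrt (edge_weight e) * normal_jump e w * (outer_normal K e \<bullet> \<nu> e))\<^sup>2)"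
      unfolding eq by (rule Cauchy_Schwarz_ineq_sum)
    also have "(\<Sum>e\<in>edges_of E K. (sqrt (edge_weight e))\<^sup>2) = (\<Sum>e\<in>edges_of E K. edge_weight e)"
      using w0 by (intro sum.cong refl) simp
    also have "(\<Sum>e\<in>edges_of E K. (sqrt (edge_weight e) * normal_jump e w * (outer_normal K e \<bullet> \<nu> e))\<^sup>2)
        = (\<Sum>e\<in>edges_of E K. edge_weight e * (normal_jump e w)\<^sup>2)"
    proof (rule sum.cong[OF refl])
      fix e assume e: "e \<in> edges_of E K"
      then have "(outer_normal K e \<bullet> \<nu> e)\<^sup>2 = 1"
        using outer_normal_multiple(2)[of e K] elems_at_iff[of K e] K by (metis one_power2 power2_abs)
      then show "(sqrt (edge_weight e) * normal_jump e w * (outer_normal K e \<bullet> \<nu> e))\<^sup>2 = edge_weight e * (normal_jump e w)\<^sup>2"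
        using w0[OF e] by (simp add: power_mult_distrib)
    qed
    also have "(\<Sum>e\<in>edges_of E K. edge_weight e) * (\<Sum>e\<in>edges_of E K. edge_weight e * (normal_jump e w)\<^sup>2)
        \<le> 4 * pi / \<rho> * (\<Sum>e\<in>edges_of E K. edge_weight e * (normal_jump e w)\<^sup>2)"
      using w0 by (intro mult_right_mono sum_edge_weight K sum_nonneg) auto
    finally show ?thesis .
  qed
  then have "(\<Sum>K\<in>T. (flux E \<nu> K (jump_flux w) (\<lambda>x. 1))\<^sup>2)
      \<le> (\<Sum>K\<in>T. 4 * pi / \<rho> * (\<Sum>e\<in>edges_of E K. edge_weight e * (normal_jump e w)\<^sup>2))" by (rule sum_mono)
  also have "\<dots> = 4 * pi / \<rho> * (\<Sum>K\<in>T. \<Sum>e\<in>edges_of E K. edge_weight e * (normal_jump e w)\<^sup>2)" by (rule sum_distrib_left[symmetric])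
  also have "\<dots> \<le> 4 * pi / \<rho> * (2 * jump_energy w)"
    unfolding jump_energy_def using \<rho>_pos edge_weight_nonneg by (intro mult_left_mono sum_edges_le_twice) auto
  finally show ?thesis by simp
qed

text \<open>In \<open>dual_seminorm_flux\<close> the square norm on an edge carries the factor
  \<open>diameter K\<close>. It is absorbed by one of the two factors \<open>edge_scale T e\<close>
  in the denominator, because the scale is the maximum of the adjacent diameters; a comparison of
  these diameters does not enter.\<close>

lemma dual_seminorm_jump_flux_bound:
  "(\<Sum>K\<in>T. (dual_seminorm K (flux E \<nu> K (jump_flux w)))\<^sup>2) \<le> 2 * cell.T_const \<rho> * jump_energy w"
proof -
  have "(dual_seminorm K (flux E \<nu> K (jump_flux w)))\<^sup>2 \<le> cell.T_const \<rho> * (\<Sum>e\<in>edges_of E K. edge_weight e * (normal_jump e w)\<^sup>2)"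
    if K: "K \<in> T" for K
  proof -
    interpret C: normal_cell K "centre K" "inradius K" E "diameter K" \<rho> \<nu> by (rule cell[OF K])
    have L: "C.L2_edges (jump_flux w)" by (rule L2_edges[OF K Lambda_L2[OF jump_flux_Lambda]])
    let ?S = "\<Sum>e\<in>edges_of E K. (L2_norm (arclength e) (jump_flux w))\<^sup>2"
    have S0: "?S \<ge> 0" by (simp add: sum_nonneg)
    have "(dual_seminorm K (flux E \<nu> K (jump_flux w)))\<^sup>2 \<le> (sqrt (C.T_const * diameter K) * sqrt ?S)\<^sup>2"
      by (intro power_mono C.dual_seminorm_flux L C.dual_seminorm_nonneg C.flux_H1_dual)
    also have "\<dots> = C.T_const * (diameter K * ?S)"
      using S0 C.T_const_pos diameter_pos[OF K] by (simp add: power_mult_distrib)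
    also have "\<dots> \<le> C.T_const * (\<Sum>e\<in>edges_of E K. edge_weight e * (normal_jump e w)\<^sup>2)"
    proof (rule mult_left_mono)
      have "diameter K * ?S = (\<Sum>e\<in>edges_of E K. diameter K * (L2_norm (arclength e) (jump_flux w))\<^sup>2)" by (rule sum_distrib_left)
      also have "\<dots> \<le> (\<Sum>e\<in>edges_of E K. edge_weight e * (normal_jump e w)\<^sup>2)"
      proof (rule sum_mono)
        fix e assume e: "e \<in> edges_of E K"
        then have eE: "e \<in> E" "K \<in> elems_at T e" using K elems_at_iff by blast+
        have H: "edge_scale T e > 0" "diameter K \<le> edge_scale T e" using edge_scale_pos edge_scale_ge eE by auto
        have "diameter K * (L2_norm (arclength e) (jump_flux w))\<^sup>2 = diameter K * ((normal_jump e w / edge_scale T e)\<^sup>2 * edge_length e)"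
          unfolding jump_flux_def integral_edgewise(2)[OF eE(1)] ..
        also have "\<dots> \<le> edge_scale T e * ((normal_jump e w / edge_scale T e)\<^sup>2 * edge_length e)"
          using H by (intro mult_right_mono) auto
        also have "\<dots> = edge_weight e * (normal_jump e w)\<^sup>2"
          using H(1) by (simp add: edge_weight_def power2_eq_square)
        finally show "diameter K * (L2_norm (arclength e) (jump_flux w))\<^sup>2 \<le> edge_weight e * (normal_jump e w)\<^sup>2" .
      qed
      finally show "diameter K * ?S \<le> (\<Sum>e\<in>edges_of E K. edge_weight e * (normal_jump e w)\<^sup>2)" .
    qed (use C.T_const_pos in simp)
    finally show ?thesis .
  qed
  then have "(\<Sum>K\<in>T. (dual_seminorm K (flux E \<nu> K (jump_flux w)))\<^sup>2)
      \<le> (\<Sum>K\<in>T. cell.T_const \<rho> * (\<Sum>e\<in>edges_of E K. edge_weight e * (normal_jump e w)\<^sup>2))" by (rule sum_mono)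
  also have "\<dots> = cell.T_const \<rho> * (\<Sum>K\<in>T. \<Sum>e\<in>edges_of E K. edge_weight e * (normal_jump e w)\<^sup>2)" by (rule sum_distrib_left[symmetric])
  also have "\<dots> \<le> cell.T_const \<rho> * (2 * jump_energy w)"
  \<comment> \<open>The sign of the constant is known from a cell, that is, from some element;
    without elements there are no edges either.\<close>
  proof (cases "T = {}")
    case False
    then obtain K where "K \<in> T" by blast
    then have "cell.T_const \<rho> > 0" using cell.T_const_pos normal_cell.axioms(1)[OF cell] by blast
    then show ?thesis
      unfolding jump_energy_def using edge_weight_nonneg by (intro mult_left_mono sum_edges_le_twice) auto
  next
    case True
    then have "E = {}" using elems_at_nonempty by (auto simp: elems_at_def)
    then show ?thesis unfolding jump_energy_def using True by simp
  qed
  finally show ?thesis by simp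
qed

end

section \<open>Local stabilization and continuity\<close>

locale stabilized_mesh = mesh +
  fixes Cs cs :: real and k' :: nat and s :: "point set \<Rightarrow> functional \<Rightarrow> functional \<Rightarrow> real"
  assumes stab: "stabilization Cs cs T E \<nu> k' s" and Cs: "Cs > 0" and cs: "cs > 0"
begin

lemma s_bilinear: "K \<in> T \<Longrightarrow> bilinear_dual K (s K)"
  and s_upper: "K \<in> T \<Longrightarrow> F \<in> H1_dual K \<Longrightarrow> G \<in> H1_dual K \<Longrightarrow> s K F G \<le> Cs * dual_seminorm K F * dual_seminorm K G"
  and s_coercive: "K \<in> T \<Longrightarrow> l \<in> Lambda_discrete E k' \<Longrightarrow> s K (flux E \<nu> K l) (flux E \<nu> K l) \<ge> cs * (dual_seminorm K (flux E \<nu> K l))\<^sup>2"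
  using stab unfolding stabilization_def by auto

abbreviation defect :: "point set \<Rightarrow> (point \<Rightarrow> real) \<Rightarrow> (point \<Rightarrow> real) \<Rightarrow> functional" where
  "defect K u l \<equiv> \<lambda>\<phi>. stiffness K u \<phi> - flux E \<nu> K l \<phi>"

lemma defect_dual:
  assumes K: "K \<in> T" and u: "u \<in> H1 K" and l: "l \<in> L2_skeleton E"
  shows "(\<lambda>\<phi>. t * stiffness K u \<phi> - flux E \<nu> K l \<phi>) \<in> H1_dual K"
    "dual_seminorm K (\<lambda>\<phi>. t * stiffness K u \<phi> - flux E \<nu> K l \<phi>) \<le> \<bar>t\<bar> * H1_seminorm K u + dual_seminorm K (flux E \<nu> K l)"
proof -
  interpret C: normal_cell K "centre K" "inradius K" E "diameter K" \<rho> \<nu> by (rule cell[OF K])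
  note d = C.stiffness_H1_dual[OF u] C.flux_H1_dual[OF L2_edges[OF K l]]
  show "(\<lambda>\<phi>. t * stiffness K u \<phi> - flux E \<nu> K l \<phi>) \<in> H1_dual K"
    using H1_dual_lincomb[OF d, of t "-1"] by simp
  have "dual_seminorm K (\<lambda>\<phi>. t * stiffness K u \<phi> - flux E \<nu> K l \<phi>) \<le> \<bar>t\<bar> * dual_seminorm K (stiffness K u) + dual_seminorm K (flux E \<nu> K l)"
    using C.dual_seminorm_lincomb[OF d, of t "-1"] by simp
  also have "\<dots> \<le> \<bar>t\<bar> * H1_seminorm K u + dual_seminorm K (flux E \<nu> K l)"
    by (intro add_right_mono mult_left_mono C.dual_seminorm_stiffness u) simp
  finally show "dual_seminorm K (\<lambda>\<phi>. t * stiffness K u \<phi> - flux E \<nu> K l \<phi>) \<le> \<bar>t\<bar> * H1_seminorm K u + dual_seminorm K (flux E \<nu> K l)" .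
qed

lemma s_bound:
  assumes K: "K \<in> T" and F: "F \<in> H1_dual K" "dual_seminorm K F \<le> a" and G: "G \<in> H1_dual K" "dual_seminorm K G \<le> b"
  shows "\<bar>s K F G\<bar> \<le> Cs * a * b"
proof -
  interpret C: normal_cell K "centre K" "inradius K" E "diameter K" \<rho> \<nu> by (rule cell[OF K])
  have "\<bar>s K F G\<bar> \<le> Cs * dual_seminorm K F * dual_seminorm K G"
    by (rule C.bilinear_bound[OF s_bilinear[OF K] s_upper[OF K] Cs F(1) G(1)])
  also have "\<dots> \<le> Cs * a * b"
    using Cs F G C.dual_seminorm_nonneg[OF F(1)] C.dual_seminorm_nonneg[OF G(1)]
    by (intro mult_mono) auto
  finally show ?thesis .
qed

text \<open>The cost of the stabilization in terms of the squared seminorm of \<open>u\<close>: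
  \<open>Cs * \<bar>t\<bar>\<close> bounds the term quadratic in \<open>u\<close>, and the fraction
  is what remains of the mixed terms after half of the coercivity \<open>cs\<close> has been spent
  on them.\<close>

definition stab_const :: "real \<Rightarrow> real" where
  "stab_const t = Cs * \<bar>t\<bar> + Cs\<^sup>2 * (1 + \<bar>t\<bar>)\<^sup>2 / (2 * cs)"

text \<open>Of the four terms of the expanded form only the last is coercive. The mixed terms are
  bounded by \<open>(1 + \<bar>t\<bar>) * Cs\<close> times the product of the two seminorms and
  split by completing a square. As \<open>t\<close> may have any sign, a negative multiple of the
  squared seminorm of \<open>u\<close> has to be accepted.\<close>

lemma element_coercive:
  assumes K: "K \<in> T" and u: "u \<in> H1 K" and l: "l \<in> Lambda_discrete E k'"
  shows "s K (defect K u l) (\<lambda>\<phi>. t * stiffness K u \<phi> - flux E \<nu> K l \<phi>)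
    \<ge> cs / 2 * (dual_seminorm K (flux E \<nu> K l))\<^sup>2 - stab_const t * (H1_seminorm K u)\<^sup>2"
proof -
  interpret C: normal_cell K "centre K" "inradius K" E "diameter K" \<rho> \<nu> by (rule cell[OF K])
  let ?A = "stiffness K u" and ?B = "flux E \<nu> K l"
  let ?U = "H1_seminorm K u" and ?L = "dual_seminorm K (flux E \<nu> K l)"
  have A: "?A \<in> H1_dual K" "dual_seminorm K ?A \<le> ?U" using C.stiffness_H1_dual[OF u] C.dual_seminorm_stiffness[OF u] by auto
  have B: "?B \<in> H1_dual K" "dual_seminorm K ?B \<le> ?L" using C.flux_H1_dual[OF L2_edges[OF K Lambda_L2[OF l]]] by auto
  have br: "s K F (\<lambda>\<phi>. t * ?A \<phi> + (-1) * ?B \<phi>) = t * s K F ?A + (-1) * s K F ?B" if F: "F \<in> H1_dual K" for F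
    by (rule C.bilinear_lincomb_right[OF s_bilinear[OF K] s_upper[OF K] Cs A(1) B(1) F])
  have "s K (defect K u l) (\<lambda>\<phi>. t * ?A \<phi> - ?B \<phi>) = s K (\<lambda>\<phi>. 1 * ?A \<phi> + (-1) * ?B \<phi>) (\<lambda>\<phi>. t * ?A \<phi> + (-1) * ?B \<phi>)" by simp
  also have "\<dots> = 1 * s K ?A (\<lambda>\<phi>. t * ?A \<phi> + (-1) * ?B \<phi>) + (-1) * s K ?B (\<lambda>\<phi>. t * ?A \<phi> + (-1) * ?B \<phi>)"
    by (rule C.bilinear_lincomb_left[OF s_bilinear[OF K] s_upper[OF K] Cs A(1) B(1) H1_dual_lincomb[OF A(1) B(1)]])
  also have "\<dots> = t * s K ?A ?A - s K ?A ?B - t * s K ?B ?A + s K ?B ?B"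
    unfolding br[OF A(1)] br[OF B(1)] by (simp add: algebra_simps)
  finally have eq: "s K (defect K u l) (\<lambda>\<phi>. t * ?A \<phi> - ?B \<phi>) = t * s K ?A ?A - s K ?A ?B - t * s K ?B ?A + s K ?B ?B" .
  have AA: "\<bar>t * s K ?A ?A\<bar> \<le> \<bar>t\<bar> * (Cs * ?U * ?U)" unfolding abs_mult by (intro mult_left_mono s_bound K A) simp
  have BA: "\<bar>t * s K ?B ?A\<bar> \<le> \<bar>t\<bar> * (Cs * ?L * ?U)" unfolding abs_mult by (intro mult_left_mono s_bound K A B) simp
  have AB: "\<bar>s K ?A ?B\<bar> \<le> Cs * ?U * ?L" by (intro s_bound K A B)
  have BB: "s K ?B ?B \<ge> cs * ?L\<^sup>2" by (rule s_coercive[OF K l])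
  \<comment> \<open>The normalization by \<open>2 * cs\<close> gives the first square the
    coefficient \<open>cs / 2\<close>, half of the coercivity.\<close>
  have "0 \<le> (cs * ?L - Cs * (1 + \<bar>t\<bar>) * ?U)\<^sup>2 / (2 * cs)" using cs by simp
  also have "\<dots> = cs / 2 * ?L\<^sup>2 - (1 + \<bar>t\<bar>) * (Cs * ?U * ?L) + Cs\<^sup>2 * (1 + \<bar>t\<bar>)\<^sup>2 / (2 * cs) * ?U\<^sup>2"
    using cs by (simp add: power2_diff power_mult_distrib add_divide_distrib diff_divide_distrib) (simp add: power2_eq_square)
  finally have y: "(1 + \<bar>t\<bar>) * (Cs * ?U * ?L) \<le> cs / 2 * ?L\<^sup>2 + Cs\<^sup>2 * (1 + \<bar>t\<bar>)\<^sup>2 / (2 * cs) * ?U\<^sup>2" by simp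
  have "t * s K ?A ?A - s K ?A ?B - t * s K ?B ?A + s K ?B ?B
     \<ge> - (\<bar>t\<bar> * (Cs * ?U * ?U)) - Cs * ?U * ?L - \<bar>t\<bar> * (Cs * ?L * ?U) + cs * ?L\<^sup>2"
    using AA AB BA BB by linarith
  moreover have "- (\<bar>t\<bar> * (Cs * ?U * ?U)) - Cs * ?U * ?L - \<bar>t\<bar> * (Cs * ?L * ?U) + cs * ?L\<^sup>2
     = - (Cs * \<bar>t\<bar> * ?U\<^sup>2) - (1 + \<bar>t\<bar>) * (Cs * ?U * ?L) + cs * ?L\<^sup>2"
    by (simp add: algebra_simps power2_eq_square)
  moreover have "stab_const t * ?U\<^sup>2 = Cs * \<bar>t\<bar> * ?U\<^sup>2 + Cs\<^sup>2 * (1 + \<bar>t\<bar>)\<^sup>2 / (2 * cs) * ?U\<^sup>2"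
    by (simp add: stab_const_def algebra_simps)
  moreover have "cs * ?L\<^sup>2 = cs / 2 * ?L\<^sup>2 + cs / 2 * ?L\<^sup>2" by simp
  ultimately show ?thesis using y unfolding eq by linarith
qed

lemma stab_form_eq:
  assumes u: "\<And>K. K \<in> T \<Longrightarrow> u K \<in> H1 K" and v: "\<And>K. K \<in> T \<Longrightarrow> v K \<in> H1 K"
    and l: "l \<in> L2_skeleton E" and m: "m \<in> L2_skeleton E"
  shows "stab_form T E \<nu> s \<alpha> t (u, l) (v, m) = (\<Sum>K\<in>T. stiffness K (u K) (v K) - flux E \<nu> K l (v K) + flux E \<nu> K m (u K)
     + \<alpha> * s K (defect K (u K) l) (\<lambda>\<phi>. t * stiffness K (v K) \<phi> - flux E \<nu> K m \<phi>))"
  using skeleton_integral_eq[of l v, OF l v] skeleton_integral_eq[of m u, OF m u]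
  by (simp add: stab_form_def stiffness_def sum.distrib sum_subtractf sum_distrib_left)

text \<open>The norm contains averages only through jumps. The two conditions remove exactly the
  products of an average with a flux of 1: that of \<open>v\<close> with \<open>l\<close> and that
  of \<open>u\<close> with \<open>m\<close>. Everything else is bounded by products of local
  seminorms.\<close>

lemma conditional_continuity:
  assumes u: "\<And>K. K \<in> T \<Longrightarrow> u K \<in> H1 K" and v: "\<And>K. K \<in> T \<Longrightarrow> v K \<in> H1 K"
    and l: "l \<in> L2_skeleton E" and m: "m \<in> L2_skeleton E"
    and u0: "\<And>K. K \<in> T \<Longrightarrow> (LINT x|area_on K. u K x) = 0" and l0: "\<And>K. K \<in> T \<Longrightarrow> flux E \<nu> K l (\<lambda>x. 1) = 0"
    and \<alpha>: "\<alpha> > 0"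
  shows "stab_form T E \<nu> s \<alpha> t (u, l) (v, m) \<le> 2 * (1 + \<alpha> * Cs * (1 + \<bar>t\<bar>)) * V_norm T E \<nu> (u, l) * V_norm T E \<nu> (v, m)"
proof -
  define a where "a K = H1_seminorm K (u K) + dual_seminorm K (flux E \<nu> K l)" for K
  define b where "b K = H1_seminorm K (v K) + dual_seminorm K (flux E \<nu> K m)" for K
  define C where "C = 1 + \<alpha> * Cs * (1 + \<bar>t\<bar>)"
  have C: "C \<ge> 0" using \<alpha> Cs by (simp add: C_def)
  have "(\<Sum>K\<in>T. stiffness K (u K) (v K) - flux E \<nu> K l (v K) + flux E \<nu> K m (u K)
     + \<alpha> * s K (defect K (u K) l) (\<lambda>\<phi>. t * stiffness K (v K) \<phi> - flux E \<nu> K m \<phi>)) \<le> (\<Sum>K\<in>T. C * (a K * b K))"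
  proof (rule sum_mono)
    fix K assume K: "K \<in> T"
    interpret N: normal_cell K "centre K" "inradius K" E "diameter K" \<rho> \<nu> by (rule cell[OF K])
    let ?U = "H1_seminorm K (u K)" and ?V = "H1_seminorm K (v K)"
    let ?L = "dual_seminorm K (flux E \<nu> K l)" and ?M = "dual_seminorm K (flux E \<nu> K m)"
    have dl: "flux E \<nu> K l \<in> H1_dual K" and dm: "flux E \<nu> K m \<in> H1_dual K"
      by (intro N.flux_H1_dual L2_edges K l m)+
    have n: "0 \<le> ?U" "0 \<le> ?V" "0 \<le> ?L" "0 \<le> ?M" using N.dual_seminorm_nonneg[OF dl] N.dual_seminorm_nonneg[OF dm] by auto
    have 1: "stiffness K (u K) (v K) \<le> ?U * ?V" using N.stiffness_bound[OF u[OF K] v[OF K]] by linarith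
    have 2: "- flux E \<nu> K l (v K) \<le> ?L * ?V" using N.dual_seminorm_bound[OF dl v[OF K]] l0[OF K] by simp
    have 3: "flux E \<nu> K m (u K) \<le> ?M * ?U"
      using N.dual_seminorm_bound_mean_zero[OF dm u[OF K] u0[OF K]] by linarith
    have "\<bar>s K (defect K (u K) l) (\<lambda>\<phi>. t * stiffness K (v K) \<phi> - flux E \<nu> K m \<phi>)\<bar> \<le> Cs * (?U + ?L) * (\<bar>t\<bar> * ?V + ?M)"
      using defect_dual[OF K u[OF K] l, of 1] defect_dual[OF K v[OF K] m, of t] by (intro s_bound K) auto
    also have "\<dots> \<le> Cs * (?U + ?L) * ((1 + \<bar>t\<bar>) * (?V + ?M))"
      using n Cs by (intro mult_left_mono) (auto simp: algebra_simps)
    finally have "s K (defect K (u K) l) (\<lambda>\<phi>. t * stiffness K (v K) \<phi> - flux E \<nu> K m \<phi>) \<le> Cs * (1 + \<bar>t\<bar>) * (a K * b K)"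
      by (simp add: a_def b_def mult_ac)
    then have 4: "\<alpha> * s K (defect K (u K) l) (\<lambda>\<phi>. t * stiffness K (v K) \<phi> - flux E \<nu> K m \<phi>) \<le> \<alpha> * (Cs * (1 + \<bar>t\<bar>) * (a K * b K))"
      using \<alpha> by (intro mult_left_mono) auto
    have 5: "?U * ?V + ?L * ?V + ?M * ?U \<le> a K * b K" using n by (simp add: a_def b_def algebra_simps)
    have 6: "C * (a K * b K) = a K * b K + \<alpha> * (Cs * (1 + \<bar>t\<bar>) * (a K * b K))" by (simp add: C_def algebra_simps)
    show "stiffness K (u K) (v K) - flux E \<nu> K l (v K) + flux E \<nu> K m (u K)
       + \<alpha> * s K (defect K (u K) l) (\<lambda>\<phi>. t * stiffness K (v K) \<phi> - flux E \<nu> K m \<phi>) \<le> C * (a K * b K)"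
      unfolding 6 using 1 2 3 4 5 by linarith
  qed
  then have "stab_form T E \<nu> s \<alpha> t (u, l) (v, m) \<le> (\<Sum>K\<in>T. C * (a K * b K))"
    by (intro ord_eq_le_trans[OF stab_form_eq] u v l m)
  also have "\<dots> = C * (\<Sum>K\<in>T. a K * b K)" by (simp add: sum_distrib_left)
  also have "\<dots> \<le> C * (sqrt (\<Sum>K\<in>T. (a K)\<^sup>2) * sqrt (\<Sum>K\<in>T. (b K)\<^sup>2))"
    by (intro mult_left_mono sum_mult_le_sqrt C)
  \<comment> \<open>Squares of sums are at most twice the sums of squares; the two factors
    \<open>sqrt 2\<close> make the 2 in the constant.\<close>
  also have "\<dots> \<le> C * ((sqrt 2 * V_norm T E \<nu> (u, l)) * (sqrt 2 * V_norm T E \<nu> (v, m)))"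
  proof -
    have gen: "sqrt (\<Sum>K\<in>T. (H1_seminorm K (w K) + dual_seminorm K (flux E \<nu> K j))\<^sup>2) \<le> sqrt 2 * V_norm T E \<nu> (w, j)" for w j
    proof (rule real_le_lsqrt)
      show "0 \<le> sqrt 2 * V_norm T E \<nu> (w, j)" by (simp add: V_norm_nonneg)
      have "(\<Sum>K\<in>T. (H1_seminorm K (w K) + dual_seminorm K (flux E \<nu> K j))\<^sup>2)
         \<le> (\<Sum>K\<in>T. 2 * (H1_seminorm K (w K))\<^sup>2 + 2 * (dual_seminorm K (flux E \<nu> K j))\<^sup>2)"
        by (intro sum_mono power2_sum_le)
      also have "\<dots> = 2 * ((\<Sum>K\<in>T. (H1_seminorm K (w K))\<^sup>2) + (\<Sum>K\<in>T. (dual_seminorm K (flux E \<nu> K j))\<^sup>2))"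
        by (simp add: sum.distrib sum_distrib_left)
      also have "\<dots> \<le> 2 * (V_norm T E \<nu> (w, j))\<^sup>2"
      proof -
        have "0 \<le> (\<Sum>K\<in>T. (flux E \<nu> K j (\<lambda>x. 1))\<^sup>2)" by (simp add: sum_nonneg)
        then show ?thesis unfolding V_norm_power2 using jump_energy_nonneg[of "\<lambda>K. average K (w K)"] by simp
      qed
      finally show "(\<Sum>K\<in>T. (H1_seminorm K (w K) + dual_seminorm K (flux E \<nu> K j))\<^sup>2) \<le> (sqrt 2 * V_norm T E \<nu> (w, j))\<^sup>2"
        by (simp add: power_mult_distrib)
    qed
    show ?thesis using gen[of u l] gen[of v m] C unfolding a_def b_def
      by (intro mult_left_mono mult_mono) (auto simp: sum_nonneg V_norm_nonneg)
  qed
  also have "\<dots> = 2 * C * V_norm T E \<nu> (u, l) * V_norm T E \<nu> (v, m)" by simp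
  finally show ?thesis unfolding C_def .
qed

lemma stab_form_V_zero:
  assumes u: "\<And>K. K \<in> T \<Longrightarrow> u K \<in> H1 K" and v: "\<And>K. K \<in> T \<Longrightarrow> v K \<in> H1 K"
    and l: "l \<in> L2_skeleton E" and m: "m \<in> L2_skeleton E" and z: "V_zero T E (v, m)"
  shows "stab_form T E \<nu> s \<alpha> t (u, l) (v, m) = 0"
proof (rule trans[OF stab_form_eq[OF u v l m] sum.neutral], assumption+, rule ballI)
  fix K assume K: "K \<in> T"
  interpret N: normal_cell K "centre K" "inradius K" E "diameter K" \<rho> \<nu> by (rule cell[OF K])
  have v0: "AE x in area_on K. v K x = 0" using z K by (simp add: V_zero_def)
  have vm: "v K \<in> borel_measurable (area_on K)" by (rule square_integrable_measurable[OF N.H1_square_integrable[OF v[OF K]]])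
  have "AE x in area_on K. grad K (v K) x = 0" by (rule N.H1_AE_0(2)[OF vm v0])
  then have sv: "H1_seminorm K (v K) = 0"
    using L2_norm_eq_0_iff[OF N.grad_props(1)[OF v[OF K]]] by (simp add: H1_seminorm_def)
  have "(LINT x|area_on K. v K x) = 0" by (rule integral_eq_zero_AE[OF v0])
  then have av: "average K (v K) = 0" by (simp add: average_def)
  have dl: "flux E \<nu> K l \<in> H1_dual K" and dm: "flux E \<nu> K m \<in> H1_dual K"
    by (intro N.flux_H1_dual L2_edges K l m)+
  have 1: "stiffness K (u K) (v K) = 0" using N.stiffness_bound[OF u[OF K] v[OF K]] sv by simp
  have 2: "flux E \<nu> K l (v K) = 0" using N.dual_seminorm_bound[OF dl v[OF K]] sv av by simp
  have fm: "flux E \<nu> K m \<phi> = 0" for \<phi>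
    unfolding N.flux_eq
  proof (rule sum.neutral, rule ballI)
    fix e assume "e \<in> edges_of E K"
    then have "AE x in arclength e. m x = 0" using z by (simp add: V_zero_def edges_of_def)
    then have "AE x in arclength e. m x * N.sgn_edge e * H1_trace E K \<phi> x = 0" by eventually_elim simp
    then show "(LINT x|arclength e. m x * N.sgn_edge e * H1_trace E K \<phi> x) = 0" by (rule integral_eq_zero_AE)
  qed
  have "dual_seminorm K (flux E \<nu> K m) \<le> 0" by (rule N.dual_seminorm_le) (auto simp: fm)
  then have "\<bar>s K (defect K (u K) l) (\<lambda>\<phi>. t * stiffness K (v K) \<phi> - flux E \<nu> K m \<phi>)\<bar>
      \<le> Cs * (H1_seminorm K (u K) + dual_seminorm K (flux E \<nu> K l)) * 0"
    using defect_dual[OF K u[OF K] l, of 1] defect_dual[OF K v[OF K] m, of t] sv by (intro s_bound K) auto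
  then show "stiffness K (u K) (v K) - flux E \<nu> K l (v K) + flux E \<nu> K m (u K)
       + \<alpha> * s K (defect K (u K) l) (\<lambda>\<phi>. t * stiffness K (v K) \<phi> - flux E \<nu> K m \<phi>) = 0"
    using 1 2 fm by simp
qed

text \<open>The skew terms in \<open>l\<close> and \<open>u\<close> cancel, the constants in
  \<open>v\<close> contribute the squared fluxes of 1, and the edge function contributes
  \<open>\<delta>\<close> times the jump energy. Its mixed terms cost \<open>\<delta> * D\<close>
  times the squared local seminorms and half of that energy, so that for small
  \<open>\<delta>\<close> all four parts of the norm survive.\<close>

lemma inf_sup_test:
  fixes \<alpha> \<delta> t :: real
  assumes u: "u \<in> V_discrete T k" and l: "l \<in> Lambda_discrete E k'"
    and \<alpha>: "0 < \<alpha>" "\<alpha> * stab_const t \<le> 1/2" and \<delta>: "0 < \<delta>"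
    and D: "D = 2 * cell.T_const \<rho> * (1 + \<alpha> * Cs)\<^sup>2" and T0: "T \<noteq> {}"
  defines "v \<equiv> \<lambda>K x. u K x + - flux E \<nu> K l (\<lambda>x. 1)"
  defines "m \<equiv> \<lambda>x. 1 * l x + \<delta> * jump_flux (\<lambda>K. average K (u K)) x"
  shows "v \<in> V_discrete T k" "m \<in> Lambda_discrete E k'"
    and "stab_form T E \<nu> s \<alpha> t (u, l) (v, m) \<ge> (1/2 - \<delta> * D) * (\<Sum>K\<in>T. (H1_seminorm K (u K))\<^sup>2)
       + (\<alpha> * cs / 2 - \<delta> * D) * (\<Sum>K\<in>T. (dual_seminorm K (flux E \<nu> K l))\<^sup>2)
       + (\<Sum>K\<in>T. (flux E \<nu> K l (\<lambda>x. 1))\<^sup>2) + \<delta> / 2 * jump_energy (\<lambda>K. average K (u K))"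
    and "(V_norm T E \<nu> (v, m))\<^sup>2 \<le> (2 + 16 * pi / \<rho> + \<delta>\<^sup>2 * (16 * pi / \<rho> + 4 * cell.T_const \<rho>)) * (V_norm T E \<nu> (u, l))\<^sup>2"
proof -
  define w where "w K = average K (u K)" for K
  define \<mu> where "\<mu> = jump_flux w"
  define U where "U K = H1_seminorm K (u K)" for K
  define L where "L K = dual_seminorm K (flux E \<nu> K l)" for K
  define G where "G K = dual_seminorm K (flux E \<nu> K \<mu>)" for K
  define a where "a K = flux E \<nu> K l (\<lambda>x. 1)" for K
  define J where "J = jump_energy w"
  define \<tau> where "\<tau> = cell.T_const \<rho>"
  have J0: "J \<ge> 0" unfolding J_def by (rule jump_energy_nonneg)
  have \<tau>: "\<tau> > 0"
  proof -
    obtain K where "K \<in> T" using T0 by blast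
    then show ?thesis unfolding \<tau>_def using cell.T_const_pos normal_cell.axioms(1)[OF cell] by blast
  qed
  have m_eq: "m = (\<lambda>x. 1 * l x + \<delta> * \<mu> x)" unfolding m_def \<mu>_def w_def ..
  have v_eq: "v K = (\<lambda>x. u K x + - a K)" for K unfolding v_def a_def ..
  show vd: "v \<in> V_discrete T k" unfolding v_def by (rule V_discrete_add_const[OF u])
  have \<mu>: "\<mu> \<in> Lambda_discrete E k'" unfolding \<mu>_def by (rule jump_flux_Lambda)
  show md: "m \<in> Lambda_discrete E k'" unfolding m_eq by (rule Lambda_lincomb[OF l \<mu>])
  have uH: "u K \<in> H1 K" and vH: "v K \<in> H1 K" if "K \<in> T" for K using V_discrete_H1 u vd that by blast+
  have lL: "l \<in> L2_skeleton E" and mL: "m \<in> L2_skeleton E" and \<mu>L: "\<mu> \<in> L2_skeleton E"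
    using l md \<mu> Lambda_L2 by auto
  have G2: "(\<Sum>K\<in>T. (G K)\<^sup>2) \<le> 2 * \<tau> * J"
    unfolding G_def \<mu>_def \<tau>_def J_def by (rule dual_seminorm_jump_flux_bound)
  have element: "stiffness K (u K) (v K) - flux E \<nu> K l (v K) + flux E \<nu> K m (u K)
       + \<alpha> * s K (defect K (u K) l) (\<lambda>\<phi>. t * stiffness K (v K) \<phi> - flux E \<nu> K m \<phi>)
     \<ge> (1/2 - \<delta> * D) * (U K)\<^sup>2 + (\<alpha> * cs / 2 - \<delta> * D) * (L K)\<^sup>2 + (a K)\<^sup>2 + \<delta> * (w K * flux E \<nu> K \<mu> (\<lambda>x. 1)) - \<delta> * ((G K)\<^sup>2 / (4 * \<tau>))"
    if K: "K \<in> T" for K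
  proof -
    interpret N: normal_cell K "centre K" "inradius K" E "diameter K" \<rho> \<nu> by (rule cell[OF K])
    note uK = uH[OF K] and vK = vH[OF K]
    have Ll: "N.L2_edges l" and L\<mu>: "N.L2_edges \<mu>" by (intro L2_edges K lL \<mu>L)+
    note dl = N.flux_H1_dual[OF Ll] and d\<mu> = N.flux_H1_dual[OF L\<mu>]
    have n: "0 \<le> U K" "0 \<le> L K" "0 \<le> G K" unfolding U_def L_def G_def using N.dual_seminorm_nonneg dl d\<mu> by auto
    \<comment> \<open>Shifting by a constant is invisible to the stiffness functional, hence also to
      the stabilization.\<close>
    have stv: "stiffness K f (v K) = stiffness K f (u K)" if "f \<in> H1 K" for f
      using N.stiffness_lincomb_right[OF that uK N.H1_const, of 1 1 "- a K"] N.stiffness_const(1)[OF that] by (simp add: v_eq)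
    have 1: "stiffness K (u K) (v K) = (U K)\<^sup>2" using stv[OF uK] N.stiffness_self[OF uK] by (simp add: U_def)
    \<comment> \<open>This term enters the form with a minus sign, so the square of
      \<open>a K\<close> counts positively.\<close>
    have 2: "flux E \<nu> K l (v K) = flux E \<nu> K l (u K) - (a K)\<^sup>2"
      using N.flux_lincomb_right[OF Ll uK N.H1_const, of 1 1 "- a K"] N.flux_const[OF Ll, of "- a K"]
      by (simp add: v_eq a_def power2_eq_square)
    have 3: "flux E \<nu> K m (u K) = flux E \<nu> K l (u K) + \<delta> * flux E \<nu> K \<mu> (u K)"
      unfolding m_eq N.flux_lincomb_left[OF Ll L\<mu> uK] by simp
    have 4: "flux E \<nu> K \<mu> (u K) \<ge> w K * flux E \<nu> K \<mu> (\<lambda>x. 1) - G K * U K"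
      using N.dual_seminorm_bound[OF d\<mu> uK] by (simp add: w_def G_def U_def abs_le_iff)
    let ?X = "defect K (u K) l"
    let ?P = "\<lambda>\<phi>. t * stiffness K (u K) \<phi> - flux E \<nu> K l \<phi>"
    have dX: "?X \<in> H1_dual K" "dual_seminorm K ?X \<le> U K + L K" using defect_dual[OF K uK lL, of 1] by (auto simp: U_def L_def)
    have dP: "?P \<in> H1_dual K" by (rule defect_dual[OF K uK lL])
    have dQ: "(\<lambda>\<phi>. t * stiffness K (v K) \<phi> - flux E \<nu> K m \<phi>) \<in> H1_dual K" by (rule defect_dual[OF K vK mL])
    \<comment> \<open>The two second arguments are known to agree on \<open>H1 K\<close> only, hence
      \<open>bilinear_cong\<close>.\<close>
    have "s K ?X (\<lambda>\<phi>. t * stiffness K (v K) \<phi> - flux E \<nu> K m \<phi>) = s K ?X (\<lambda>\<phi>. 1 * ?P \<phi> + (- \<delta>) * flux E \<nu> K \<mu> \<phi>)"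
    proof (rule N.bilinear_cong[OF s_bilinear[OF K] s_upper[OF K] Cs dX(1) dQ H1_dual_lincomb[OF dP d\<mu>]])
      fix \<phi> assume \<phi>: "\<phi> \<in> H1 K"
      have "stiffness K (v K) \<phi> = stiffness K (u K) \<phi>"
        using stv[OF \<phi>] N.stiffness_commute by metis
      then show "t * stiffness K (v K) \<phi> - flux E \<nu> K m \<phi> = 1 * ?P \<phi> + (- \<delta>) * flux E \<nu> K \<mu> \<phi>"
        unfolding m_eq N.flux_lincomb_left[OF Ll L\<mu> \<phi>] by simp
    qed
    also have "\<dots> = 1 * s K ?X ?P + (- \<delta>) * s K ?X (flux E \<nu> K \<mu>)"
      by (rule N.bilinear_lincomb_right[OF s_bilinear[OF K] s_upper[OF K] Cs dP d\<mu> dX(1)])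
    finally have 5: "s K ?X (\<lambda>\<phi>. t * stiffness K (v K) \<phi> - flux E \<nu> K m \<phi>) = s K ?X ?P - \<delta> * s K ?X (flux E \<nu> K \<mu>)" by simp
    have 6: "s K ?X ?P \<ge> cs / 2 * (L K)\<^sup>2 - stab_const t * (U K)\<^sup>2"
      unfolding L_def U_def by (rule element_coercive[OF K uK l])
    have 7: "s K ?X (flux E \<nu> K \<mu>) \<le> Cs * (U K + L K) * G K"
      using s_bound[OF K dX d\<mu>, of "G K"] by (simp add: G_def)
    \<comment> \<open>Young's inequality with weight \<open>\<tau>\<close>: the squares of
      \<open>G K\<close> sum to at most \<open>2 * \<tau> * J\<close>, so after division by
      \<open>4 * \<tau>\<close> they cost half of \<open>J\<close>.\<close>
    have "G K * U K + \<alpha> * (Cs * (U K + L K) * G K) \<le> G K * ((1 + \<alpha> * Cs) * (U K + L K))"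
      using n by (simp add: algebra_simps)
    also have "\<dots> \<le> (G K)\<^sup>2 / (4 * \<tau>) + \<tau> * ((1 + \<alpha> * Cs) * (U K + L K))\<^sup>2"
      by (rule young_inequality[OF \<tau>])
    also have "\<tau> * ((1 + \<alpha> * Cs) * (U K + L K))\<^sup>2 \<le> D * ((U K)\<^sup>2 + (L K)\<^sup>2)"
    proof -
      have "\<tau> * ((1 + \<alpha> * Cs) * (U K + L K))\<^sup>2 = (\<tau> * (1 + \<alpha> * Cs)\<^sup>2) * (U K + L K)\<^sup>2" by (simp add: power_mult_distrib)
      also have "\<dots> \<le> (\<tau> * (1 + \<alpha> * Cs)\<^sup>2) * (2 * (U K)\<^sup>2 + 2 * (L K)\<^sup>2)"
        using \<tau> by (intro mult_left_mono power2_sum_le) auto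
      finally show ?thesis unfolding D \<tau>_def by (simp add: algebra_simps)
    qed
    finally have 8: "G K * U K + \<alpha> * (Cs * (U K + L K) * G K) \<le> (G K)\<^sup>2 / (4 * \<tau>) + D * ((U K)\<^sup>2 + (L K)\<^sup>2)" by simp
    have a6: "\<alpha> * s K ?X ?P \<ge> \<alpha> * cs / 2 * (L K)\<^sup>2 - 1/2 * (U K)\<^sup>2"
    proof -
      have "\<alpha> * s K ?X ?P \<ge> \<alpha> * (cs / 2 * (L K)\<^sup>2 - stab_const t * (U K)\<^sup>2)" using 6 \<alpha>(1) by (intro mult_left_mono) auto
      moreover have "(\<alpha> * stab_const t) * (U K)\<^sup>2 \<le> 1/2 * (U K)\<^sup>2" using \<alpha>(2) by (intro mult_right_mono) auto
      ultimately show ?thesis by (simp add: algebra_simps)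
    qed
    have a7: "\<alpha> * s K ?X (flux E \<nu> K \<mu>) \<le> \<alpha> * (Cs * (U K + L K) * G K)" using 7 \<alpha>(1) by (intro mult_left_mono) auto
    have "flux E \<nu> K \<mu> (u K) - \<alpha> * s K ?X (flux E \<nu> K \<mu>)
       \<ge> w K * flux E \<nu> K \<mu> (\<lambda>x. 1) - (G K)\<^sup>2 / (4 * \<tau>) - D * ((U K)\<^sup>2 + (L K)\<^sup>2)"
      using 4 8 a7 by linarith
    then have 9: "\<delta> * (flux E \<nu> K \<mu> (u K) - \<alpha> * s K ?X (flux E \<nu> K \<mu>))
       \<ge> \<delta> * (w K * flux E \<nu> K \<mu> (\<lambda>x. 1) - (G K)\<^sup>2 / (4 * \<tau>) - D * ((U K)\<^sup>2 + (L K)\<^sup>2))"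
      using \<delta> by (intro mult_left_mono) auto
    have "stiffness K (u K) (v K) - flux E \<nu> K l (v K) + flux E \<nu> K m (u K)
       + \<alpha> * s K (defect K (u K) l) (\<lambda>\<phi>. t * stiffness K (v K) \<phi> - flux E \<nu> K m \<phi>)
      = (U K)\<^sup>2 + (a K)\<^sup>2 + \<delta> * (flux E \<nu> K \<mu> (u K) - \<alpha> * s K ?X (flux E \<nu> K \<mu>)) + \<alpha> * s K ?X ?P"
      unfolding 1 2 3 5 by (simp add: algebra_simps)
    also have "\<dots> \<ge> (U K)\<^sup>2 + (a K)\<^sup>2 + \<delta> * (w K * flux E \<nu> K \<mu> (\<lambda>x. 1) - (G K)\<^sup>2 / (4 * \<tau>) - D * ((U K)\<^sup>2 + (L K)\<^sup>2))
         + (\<alpha> * cs / 2 * (L K)\<^sup>2 - 1/2 * (U K)\<^sup>2)"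
      using 9 a6 by linarith
    moreover have "(U K)\<^sup>2 + (a K)\<^sup>2 + \<delta> * (w K * flux E \<nu> K \<mu> (\<lambda>x. 1) - (G K)\<^sup>2 / (4 * \<tau>) - D * ((U K)\<^sup>2 + (L K)\<^sup>2))
         + (\<alpha> * cs / 2 * (L K)\<^sup>2 - 1/2 * (U K)\<^sup>2)
       = (1/2 - \<delta> * D) * (U K)\<^sup>2 + (\<alpha> * cs / 2 - \<delta> * D) * (L K)\<^sup>2 + (a K)\<^sup>2 + \<delta> * (w K * flux E \<nu> K \<mu> (\<lambda>x. 1)) - \<delta> * ((G K)\<^sup>2 / (4 * \<tau>))"
      by (simp add: algebra_simps)
    ultimately show ?thesis by linarith
  qed
  have "stab_form T E \<nu> s \<alpha> t (u, l) (v, m) \<ge> (\<Sum>K\<in>T. (1/2 - \<delta> * D) * (U K)\<^sup>2 + (\<alpha> * cs / 2 - \<delta> * D) * (L K)\<^sup>2 + (a K)\<^sup>2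
      + \<delta> * (w K * flux E \<nu> K \<mu> (\<lambda>x. 1)) - \<delta> * ((G K)\<^sup>2 / (4 * \<tau>)))"
    by (rule ord_le_eq_trans[OF sum_mono[OF element] stab_form_eq[OF uH vH lL mL, symmetric]])
  moreover have "(\<Sum>K\<in>T. (1/2 - \<delta> * D) * (U K)\<^sup>2 + (\<alpha> * cs / 2 - \<delta> * D) * (L K)\<^sup>2 + (a K)\<^sup>2
      + \<delta> * (w K * flux E \<nu> K \<mu> (\<lambda>x. 1)) - \<delta> * ((G K)\<^sup>2 / (4 * \<tau>)))
    = (1/2 - \<delta> * D) * (\<Sum>K\<in>T. (U K)\<^sup>2) + (\<alpha> * cs / 2 - \<delta> * D) * (\<Sum>K\<in>T. (L K)\<^sup>2) + (\<Sum>K\<in>T. (a K)\<^sup>2)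
      + \<delta> * (\<Sum>K\<in>T. w K * flux E \<nu> K \<mu> (\<lambda>x. 1)) - \<delta> * ((\<Sum>K\<in>T. (G K)\<^sup>2) / (4 * \<tau>))"
    by (simp only: sum.distrib sum_subtractf sum_distrib_left[symmetric] sum_divide_distrib[symmetric])
  moreover have "(\<Sum>K\<in>T. w K * flux E \<nu> K \<mu> (\<lambda>x. 1)) = J" unfolding \<mu>_def J_def by (rule sum_average_jump_flux)
  moreover have "\<delta> * ((\<Sum>K\<in>T. (G K)\<^sup>2) / (4 * \<tau>)) \<le> \<delta> * (J / 2)"
  proof (rule mult_left_mono)
    have "(\<Sum>K\<in>T. (G K)\<^sup>2) / (4 * \<tau>) \<le> (2 * \<tau> * J) / (4 * \<tau>)" using G2 \<tau> by (intro divide_right_mono) auto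
    then show "(\<Sum>K\<in>T. (G K)\<^sup>2) / (4 * \<tau>) \<le> J / 2" using \<tau> by simp
  qed (use \<delta> in simp)
  ultimately have "stab_form T E \<nu> s \<alpha> t (u, l) (v, m) \<ge> (1/2 - \<delta> * D) * (\<Sum>K\<in>T. (U K)\<^sup>2)
     + (\<alpha> * cs / 2 - \<delta> * D) * (\<Sum>K\<in>T. (L K)\<^sup>2) + (\<Sum>K\<in>T. (a K)\<^sup>2) + \<delta> / 2 * J"
    by (simp add: algebra_simps)
  then show "stab_form T E \<nu> s \<alpha> t (u, l) (v, m) \<ge> (1/2 - \<delta> * D) * (\<Sum>K\<in>T. (H1_seminorm K (u K))\<^sup>2)
       + (\<alpha> * cs / 2 - \<delta> * D) * (\<Sum>K\<in>T. (dual_seminorm K (flux E \<nu> K l))\<^sup>2)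
       + (\<Sum>K\<in>T. (flux E \<nu> K l (\<lambda>x. 1))\<^sup>2) + \<delta> / 2 * jump_energy (\<lambda>K. average K (u K))"
    unfolding U_def L_def a_def J_def w_def .
  have sv: "H1_seminorm K (v K) = U K" and avv: "average K (v K) = w K + - a K" 
    and fl1: "flux E \<nu> K m (\<lambda>x. 1) = a K + \<delta> * flux E \<nu> K \<mu> (\<lambda>x. 1)"
    and fl2: "0 \<le> dual_seminorm K (flux E \<nu> K m)" "dual_seminorm K (flux E \<nu> K m) \<le> L K + \<delta> * G K" if K: "K \<in> T" for K
  proof -
    interpret N: normal_cell K "centre K" "inradius K" E "diameter K" \<rho> \<nu> by (rule cell[OF K])
    have Ll: "N.L2_edges l" and L\<mu>: "N.L2_edges \<mu>" and Lm: "N.L2_edges m" by (intro L2_edges K lL \<mu>L mL)+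
    show "H1_seminorm K (v K) = U K" unfolding v_eq U_def by (rule N.H1_seminorm_add_const[OF uH[OF K]])
    show "average K (v K) = w K + - a K"
      using N.average_diff[OF uH[OF K] N.H1_const, of "a K"] by (simp add: v_eq w_def N.average_const)
    show "flux E \<nu> K m (\<lambda>x. 1) = a K + \<delta> * flux E \<nu> K \<mu> (\<lambda>x. 1)"
      unfolding m_eq N.flux_lincomb_left[OF Ll L\<mu> N.H1_const] by (simp add: a_def)
    show "0 \<le> dual_seminorm K (flux E \<nu> K m)" by (rule N.dual_seminorm_nonneg[OF N.flux_H1_dual[OF Lm]])
    have "dual_seminorm K (flux E \<nu> K m) = dual_seminorm K (\<lambda>\<phi>. 1 * flux E \<nu> K l \<phi> + \<delta> * flux E \<nu> K \<mu> \<phi>)"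
      unfolding m_eq by (rule dual_seminorm_cong) (rule N.flux_lincomb_left[OF Ll L\<mu>])
    also have "\<dots> \<le> \<bar>1\<bar> * dual_seminorm K (flux E \<nu> K l) + \<bar>\<delta>\<bar> * dual_seminorm K (flux E \<nu> K \<mu>)"
      by (rule N.dual_seminorm_lincomb[OF N.flux_H1_dual[OF Ll] N.flux_H1_dual[OF L\<mu>]])
    finally show "dual_seminorm K (flux E \<nu> K m) \<le> L K + \<delta> * G K" using \<delta> by (simp add: L_def G_def)
  qed
  define b where "b K = flux E \<nu> K \<mu> (\<lambda>x. 1)" for K
  have b2: "(\<Sum>K\<in>T. (b K)\<^sup>2) \<le> 8 * pi / \<rho> * J" unfolding b_def \<mu>_def J_def by (rule flux_one_jump_flux_bound)
  have e1: "(\<Sum>K\<in>T. (H1_seminorm K (v K))\<^sup>2) = (\<Sum>K\<in>T. (U K)\<^sup>2)" by (intro sum.cong refl) (simp add: sv)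
  \<comment> \<open>The shift of the averages by \<open>- a K\<close> has a jump energy bounded by
    the fluxes of 1.\<close>
  have e2: "jump_energy (\<lambda>K. average K (v K)) \<le> 2 * J + 16 * pi / \<rho> * (\<Sum>K\<in>T. (a K)\<^sup>2)"
  proof -
    have "jump_energy (\<lambda>K. average K (v K)) = jump_energy (\<lambda>K. w K + - a K)"
    proof -
      have "normal_jump e (\<lambda>K. average K (v K)) = normal_jump e (\<lambda>K. w K + - a K)" for e
        unfolding normal_jump_def by (intro sum.cong refl) (simp add: avv elems_at_def)
      then show ?thesis by (simp add: jump_energy_def)
    qed
    also have "\<dots> \<le> 2 * J + 2 * jump_energy (\<lambda>K. - a K)" unfolding J_def by (rule jump_energy_add)
    also have "jump_energy (\<lambda>K. - a K) \<le> 8 * pi / \<rho> * (\<Sum>K\<in>T. (- a K)\<^sup>2)" by (rule jump_energy_le)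
    finally show ?thesis by simp
  qed
  have e3: "(\<Sum>K\<in>T. (flux E \<nu> K m (\<lambda>x. 1))\<^sup>2) \<le> 2 * (\<Sum>K\<in>T. (a K)\<^sup>2) + \<delta>\<^sup>2 * (16 * pi / \<rho> * J)"
  proof -
    have "(\<Sum>K\<in>T. (flux E \<nu> K m (\<lambda>x. 1))\<^sup>2) \<le> (\<Sum>K\<in>T. 2 * (a K)\<^sup>2 + 2 * (\<delta> * b K)\<^sup>2)"
      by (intro sum_mono) (simp add: fl1 b_def power2_sum_le)
    also have "\<dots> = 2 * (\<Sum>K\<in>T. (a K)\<^sup>2) + 2 * \<delta>\<^sup>2 * (\<Sum>K\<in>T. (b K)\<^sup>2)"
      by (simp add: sum.distrib sum_distrib_left power_mult_distrib mult.assoc)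
    also have "2 * \<delta>\<^sup>2 * (\<Sum>K\<in>T. (b K)\<^sup>2) \<le> 2 * \<delta>\<^sup>2 * (8 * pi / \<rho> * J)" using b2 by (intro mult_left_mono) auto
    finally show ?thesis by (simp add: mult_ac)
  qed
  have e4: "(\<Sum>K\<in>T. (dual_seminorm K (flux E \<nu> K m))\<^sup>2) \<le> 2 * (\<Sum>K\<in>T. (L K)\<^sup>2) + \<delta>\<^sup>2 * (4 * \<tau> * J)"
  proof -
    have "(\<Sum>K\<in>T. (dual_seminorm K (flux E \<nu> K m))\<^sup>2) \<le> (\<Sum>K\<in>T. 2 * (L K)\<^sup>2 + 2 * (\<delta> * G K)\<^sup>2)"
    proof (rule sum_mono)
      fix K assume K: "K \<in> T"
      have "(dual_seminorm K (flux E \<nu> K m))\<^sup>2 \<le> (L K + \<delta> * G K)\<^sup>2" using fl2[OF K] by (intro power_mono)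
      also have "\<dots> \<le> 2 * (L K)\<^sup>2 + 2 * (\<delta> * G K)\<^sup>2" by (rule power2_sum_le)
      finally show "(dual_seminorm K (flux E \<nu> K m))\<^sup>2 \<le> 2 * (L K)\<^sup>2 + 2 * (\<delta> * G K)\<^sup>2" .
    qed
    also have "\<dots> = 2 * (\<Sum>K\<in>T. (L K)\<^sup>2) + 2 * \<delta>\<^sup>2 * (\<Sum>K\<in>T. (G K)\<^sup>2)"
      by (simp add: sum.distrib sum_distrib_left power_mult_distrib mult.assoc)
    also have "2 * \<delta>\<^sup>2 * (\<Sum>K\<in>T. (G K)\<^sup>2) \<le> 2 * \<delta>\<^sup>2 * (2 * \<tau> * J)" using G2 by (intro mult_left_mono) auto
    finally show ?thesis by simp
  qed
  define U2 where "U2 = (\<Sum>K\<in>T. (U K)\<^sup>2)"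
  define A2 where "A2 = (\<Sum>K\<in>T. (a K)\<^sup>2)"
  define L2 where "L2 = (\<Sum>K\<in>T. (L K)\<^sup>2)"
  have nn: "0 \<le> U2" "0 \<le> A2" "0 \<le> L2" by (auto simp: U2_def A2_def L2_def sum_nonneg)
  define p where "p = 16 * pi / \<rho>"
  have p0: "p \<ge> 0" using \<rho>_pos by (simp add: p_def)
  have "(V_norm T E \<nu> (v, m))\<^sup>2 \<le> U2 + (2 * J + p * A2) + (2 * A2 + \<delta>\<^sup>2 * (p * J)) + (2 * L2 + \<delta>\<^sup>2 * (4 * \<tau> * J))"
    unfolding V_norm_power2 using e1 e2 e3 e4 unfolding U2_def A2_def L2_def p_def by linarith
  also have "\<dots> \<le> (2 + p + \<delta>\<^sup>2 * (p + 4 * \<tau>)) * (U2 + J + A2 + L2)"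
  proof -
    have "0 \<le> p * U2" "0 \<le> p * J" "0 \<le> p * L2" "0 \<le> (\<delta>\<^sup>2 * (p + 4 * \<tau>)) * (U2 + A2 + L2)"
      using nn p0 J0 \<tau> by (auto intro!: mult_nonneg_nonneg add_nonneg_nonneg)
    moreover have "(2 + p + \<delta>\<^sup>2 * (p + 4 * \<tau>)) * (U2 + J + A2 + L2)
        = 2 * U2 + 2 * J + 2 * A2 + 2 * L2 + p * U2 + p * J + p * A2 + p * L2 + (\<delta>\<^sup>2 * (p + 4 * \<tau>)) * (U2 + A2 + L2) + \<delta>\<^sup>2 * (p * J) + \<delta>\<^sup>2 * (4 * \<tau> * J)"
      by (simp add: algebra_simps)
    ultimately show ?thesis using nn(1) by linarith
  qed
  also have "U2 + J + A2 + L2 = (V_norm T E \<nu> (u, l))\<^sup>2"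
    unfolding V_norm_power2 U2_def A2_def L2_def J_def U_def a_def L_def w_def by simp
  finally show "(V_norm T E \<nu> (v, m))\<^sup>2 \<le> (2 + 16 * pi / \<rho> + \<delta>\<^sup>2 * (16 * pi / \<rho> + 4 * cell.T_const \<rho>)) * (V_norm T E \<nu> (u, l))\<^sup>2"
    unfolding p_def \<tau>_def .
qed

end

section \<open>The inf-sup condition\<close>

lemma (in stabilized_mesh) V_norm_pos:
  assumes "p \<in> V_discrete_nonzero T E k k'"
  shows "0 < V_norm T E \<nu> p"
proof (rule ccontr)
  obtain u l where p: "p = (u, l)" by (cases p)
  with assms have u: "u \<in> V_discrete T k" and l: "l \<in> Lambda_discrete E k'" and nz: "\<not> V_zero T E (u, l)"
    by (auto simp: V_discrete_nonzero_def)
  assume "\<not> 0 < V_norm T E \<nu> p"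
  then have "V_norm T E \<nu> (u, l) = 0" using V_norm_nonneg[of p] p by simp
  then have "V_zero T E (u, l)" by (rule V_norm_zero[OF u l])
  then show False using nz by simp
qed

text \<open>\<open>c0\<close> is a lower bound for the four coefficients left by
  \<open>inf_sup_test\<close>, and \<open>q\<close> bounds the norm of the test pair by that of the
  given pair, so the quotient is at least \<open>c0 / q\<close>. All parameters enter as numbers, so
  that they can be fixed before the mesh.\<close>

lemma (in stabilized_mesh) inf_sup:
  assumes \<alpha>: "0 < \<alpha>" "\<alpha> * stab_const t \<le> 1/2" and \<delta>: "0 < \<delta>"
    and D: "\<delta> * (2 * cell.T_const \<rho> * (1 + \<alpha> * Cs)\<^sup>2) \<le> min (1/4) (\<alpha> * cs / 4)"
    and c0: "0 < c0" "c0 \<le> 1/4" "c0 \<le> \<alpha> * cs / 4" "c0 \<le> \<delta> / 2"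
    and q: "2 + 16 * pi / \<rho> + \<delta>\<^sup>2 * (16 * pi / \<rho> + 4 * cell.T_const \<rho>) \<le> q\<^sup>2" "0 < q"
  shows "(INF p\<in>V_discrete_nonzero T E k k'. SUP r\<in>V_discrete_nonzero T E k k'.
            ereal (stab_form T E \<nu> s \<alpha> t p r / (V_norm T E \<nu> p * V_norm T E \<nu> r))) \<ge> ereal (c0 / q)"
proof (rule INF_greatest)
  fix p assume p: "p \<in> V_discrete_nonzero T E k k'"
  obtain u l where ul: "p = (u, l)" by (cases p)
  with p have u: "u \<in> V_discrete T k" and l: "l \<in> Lambda_discrete E k'" and nz: "\<not> V_zero T E (u, l)"
    by (auto simp: V_discrete_nonzero_def)
  \<comment> \<open>Without elements there are no edges, and every discrete pair is zero.\<close>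
  have T0: "T \<noteq> {}"
  proof
    assume "T = {}"
    then show False using nz elems_at_nonempty by (auto simp: V_zero_def elems_at_def)
  qed
  define v where "v = (\<lambda>K x. u K x + - flux E \<nu> K l (\<lambda>x. 1))"
  define m where "m = (\<lambda>x. 1 * l x + \<delta> * jump_flux (\<lambda>K. average K (u K)) x)"
  note test = inf_sup_test[OF u l \<alpha> \<delta> refl T0, folded v_def m_def]
  let ?N = "V_norm T E \<nu> (u, l)" and ?M = "V_norm T E \<nu> (v, m)"
  have N: "0 < ?N" using V_norm_pos[OF p] ul by simp
  have "c0 * ?N\<^sup>2 = c0 * (\<Sum>K\<in>T. (H1_seminorm K (u K))\<^sup>2) + c0 * (\<Sum>K\<in>T. (dual_seminorm K (flux E \<nu> K l))\<^sup>2)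
      + c0 * (\<Sum>K\<in>T. (flux E \<nu> K l (\<lambda>x. 1))\<^sup>2) + c0 * jump_energy (\<lambda>K. average K (u K))"
    unfolding V_norm_power2 by (simp add: algebra_simps)
  also have "\<dots> \<le> (1/2 - \<delta> * (2 * cell.T_const \<rho> * (1 + \<alpha> * Cs)\<^sup>2)) * (\<Sum>K\<in>T. (H1_seminorm K (u K))\<^sup>2)
       + (\<alpha> * cs / 2 - \<delta> * (2 * cell.T_const \<rho> * (1 + \<alpha> * Cs)\<^sup>2)) * (\<Sum>K\<in>T. (dual_seminorm K (flux E \<nu> K l))\<^sup>2)
       + 1 * (\<Sum>K\<in>T. (flux E \<nu> K l (\<lambda>x. 1))\<^sup>2) + \<delta> / 2 * jump_energy (\<lambda>K. average K (u K))"
    using c0 D by (intro add_mono mult_right_mono jump_energy_nonneg sum_nonneg) auto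
  also have "\<dots> \<le> stab_form T E \<nu> s \<alpha> t (u, l) (v, m)" using test(3) by simp
  finally have low: "c0 * ?N\<^sup>2 \<le> stab_form T E \<nu> s \<alpha> t (u, l) (v, m)" .
  have "?M\<^sup>2 \<le> q\<^sup>2 * ?N\<^sup>2" by (rule order_trans[OF test(4) mult_right_mono[OF q(1)]]) simp
  then have "?M\<^sup>2 \<le> (q * ?N)\<^sup>2" by (simp add: power_mult_distrib)
  then have MN: "?M \<le> q * ?N" using q(2) N by (intro power2_le_imp_le[of ?M]) auto
  have pos: "0 < c0 * ?N\<^sup>2" using c0(1) N by simp
  have "\<not> V_zero T E (v, m)"
  proof
    assume z: "V_zero T E (v, m)"
    have "stab_form T E \<nu> s \<alpha> t (u, l) (v, m) = 0"
      by (intro stab_form_V_zero V_discrete_H1[OF u] V_discrete_H1[OF test(1)] Lambda_L2[OF l] Lambda_L2[OF test(2)] z)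
    then show False using low pos by linarith
  qed
  then have vm: "(v, m) \<in> V_discrete_nonzero T E k k'" using test(1,2) by (simp add: V_discrete_nonzero_def)
  have M: "0 < ?M" by (rule V_norm_pos[OF vm])
  have "c0 / q = c0 * ?N\<^sup>2 / (?N * (q * ?N))" using N q(2) by (simp add: power2_eq_square)
  also have "\<dots> \<le> c0 * ?N\<^sup>2 / (?N * ?M)" using MN M N pos by (intro divide_left_mono mult_left_mono) auto
  also have "\<dots> \<le> stab_form T E \<nu> s \<alpha> t (u, l) (v, m) / (?N * ?M)" using low M N by (intro divide_right_mono) auto
  finally show "ereal (c0 / q) \<le> (SUP r\<in>V_discrete_nonzero T E k k'.
            ereal (stab_form T E \<nu> s \<alpha> t p r / (V_norm T E \<nu> p * V_norm T E \<nu> r)))"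
    unfolding ul by (intro SUP_upper2[OF vm]) simp
qed

theorem lemma2p7:
  fixes \<Omega> :: "point set" and \<rho> Cs cs :: real and k :: nat
  assumes "polygonal_domain \<Omega>" and "\<rho> > 0" and "Cs > 0" and "cs > 0" and "k \<ge> 1"
  shows
    "(\<forall>t::real. \<exists>\<alpha>0>0. \<forall>\<alpha>::real. 0 < \<alpha> \<and> \<alpha> < \<alpha>0 \<longrightarrow>
        (\<exists>c>0. \<forall>T E \<nu> k' s.
           tessellation \<Omega> \<rho> T E \<nu> \<longrightarrow> k' \<in> {k, k - 1} \<longrightarrow> stabilization Cs cs T E \<nu> k' s \<longrightarrow>
           (INF p\<in>V_discrete_nonzero T E k k'. SUP q\<in>V_discrete_nonzero T E k k'.
              ereal (stab_form T E \<nu> s \<alpha> t p q / (V_norm T E \<nu> p * V_norm T E \<nu> q)))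
           \<ge> ereal c))
     \<and>
     (\<forall>\<alpha>>0. \<forall>t::real. \<exists>C::real. \<forall>T E \<nu> k' s.
        tessellation \<Omega> \<rho> T E \<nu> \<longrightarrow> k' \<in> {k, k - 1} \<longrightarrow> stabilization Cs cs T E \<nu> k' s \<longrightarrow>
        (\<forall>u\<in>H1_broken T. \<forall>v\<in>H1_broken T. \<forall>l\<in>L2_skeleton E. \<forall>m\<in>L2_skeleton E.
           (\<forall>K\<in>T. (LINT x|area_on K. u K x) = 0 \<and> flux E \<nu> K l (\<lambda>x. 1) = 0) \<longrightarrow>
           stab_form T E \<nu> s \<alpha> t (u, l) (v, m) \<le> C * V_norm T E \<nu> (u, l) * V_norm T E \<nu> (v, m)))"
proof -
  have mesh: "stabilized_mesh \<Omega> \<rho> T E \<nu> Cs cs k' s"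
    if "tessellation \<Omega> \<rho> T E \<nu>" "stabilization Cs cs T E \<nu> k' s" for T E \<nu> k' s
    using that assms by unfold_locales auto
  show ?thesis
  proof (intro conjI allI impI)
    fix t :: real
    \<comment> \<open>This is \<open>stab_const t\<close>, written out because it is needed before
      any mesh is given.\<close>
    define \<beta> where "\<beta> = Cs * \<bar>t\<bar> + Cs\<^sup>2 * (1 + \<bar>t\<bar>)\<^sup>2 / (2 * cs)"
    have \<beta>: "\<beta> \<ge> 0" using assms by (simp add: \<beta>_def)
    \<comment> \<open>Makes \<open>\<alpha> * \<beta> \<le> 1/2\<close>: at most half of the squared
      seminorm of \<open>u\<close> is lost to the stabilization.\<close>
    define \<alpha>0 where "\<alpha>0 = 1 / (2 * (\<beta> + 1))"
    have \<alpha>0: "0 < \<alpha>0" using \<beta> by (simp add: \<alpha>0_def)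
    have "\<exists>c>0. \<forall>T E \<nu> k' s.
           tessellation \<Omega> \<rho> T E \<nu> \<longrightarrow> k' \<in> {k, k - 1} \<longrightarrow> stabilization Cs cs T E \<nu> k' s \<longrightarrow>
           (INF p\<in>V_discrete_nonzero T E k k'. SUP q\<in>V_discrete_nonzero T E k k'.
              ereal (stab_form T E \<nu> s \<alpha> t p q / (V_norm T E \<nu> p * V_norm T E \<nu> q)))
           \<ge> ereal c" if \<alpha>: "0 < \<alpha>" "\<alpha> < \<alpha>0" for \<alpha> :: real
    proof -
      have "\<alpha> * \<beta> \<le> \<alpha>0 * \<beta>" using \<alpha> \<beta> by (intro mult_right_mono) auto
      also have "\<dots> \<le> 1/2" using \<beta> by (simp add: \<alpha>0_def field_simps)
      finally have \<alpha>\<beta>: "\<alpha> * \<beta> \<le> 1/2" .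
      define D where "D = 2 * cell.T_const \<rho> * (1 + \<alpha> * Cs)\<^sup>2"
      define \<kappa> where "\<kappa> = min (1/4) (\<alpha> * cs / 4)"
      have \<kappa>: "0 < \<kappa>" using \<alpha> assms by (simp add: \<kappa>_def)
      \<comment> \<open>Bounds \<open>\<delta> * D\<close> by \<open>\<kappa>\<close>. The absolute
        value is taken because the sign of \<open>D\<close> is established only inside a
        cell.\<close>
      define \<delta> where "\<delta> = \<kappa> / (\<bar>D\<bar> + 1)"
      have \<delta>: "0 < \<delta>" using \<kappa> by (simp add: \<delta>_def)
      have "\<delta> * D \<le> \<delta> * (\<bar>D\<bar> + 1)" using \<delta> by (intro mult_left_mono) auto
      also have "\<dots> = \<kappa>" by (simp add: \<delta>_def)
      finally have \<delta>D: "\<delta> * D \<le> \<kappa>" .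
      define c0 where "c0 = min \<kappa> (\<delta> / 2)"
      have c0: "0 < c0" "c0 \<le> 1/4" "c0 \<le> \<alpha> * cs / 4" "c0 \<le> \<delta> / 2" using \<kappa> \<delta> by (auto simp: c0_def \<kappa>_def)
      \<comment> \<open>The maximum with 1 makes the square root positive whatever the sign of the
        other entry.\<close>
      define Q where "Q = max 1 (2 + 16 * pi / \<rho> + \<delta>\<^sup>2 * (16 * pi / \<rho> + 4 * cell.T_const \<rho>))"
      have Q: "2 + 16 * pi / \<rho> + \<delta>\<^sup>2 * (16 * pi / \<rho> + 4 * cell.T_const \<rho>) \<le> (sqrt Q)\<^sup>2" "0 < sqrt Q"
        by (auto simp: Q_def)
      show ?thesis
      proof (intro exI conjI allI impI)
        show "0 < c0 / sqrt Q" using c0(1) Q(2) by simp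
      next
        fix T E \<nu> k' s
        assume "tessellation \<Omega> \<rho> T E \<nu>" "stabilization Cs cs T E \<nu> k' s"
        then interpret S: stabilized_mesh \<Omega> \<rho> T E \<nu> Cs cs k' s by (rule mesh)
        show "(INF p\<in>V_discrete_nonzero T E k k'. SUP q\<in>V_discrete_nonzero T E k k'.
              ereal (stab_form T E \<nu> s \<alpha> t p q / (V_norm T E \<nu> p * V_norm T E \<nu> q))) \<ge> ereal (c0 / sqrt Q)"
          using \<alpha>\<beta> \<delta>D by (intro S.inf_sup[OF \<alpha>(1) _ \<delta> _ c0 Q]) (auto simp: \<beta>_def S.stab_const_def D_def \<kappa>_def)
      qed
    qed
    then show "\<exists>\<alpha>0>0. \<forall>\<alpha>::real. 0 < \<alpha> \<and> \<alpha> < \<alpha>0 \<longrightarrow>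
        (\<exists>c>0. \<forall>T E \<nu> k' s.
           tessellation \<Omega> \<rho> T E \<nu> \<longrightarrow> k' \<in> {k, k - 1} \<longrightarrow> stabilization Cs cs T E \<nu> k' s \<longrightarrow>
           (INF p\<in>V_discrete_nonzero T E k k'. SUP q\<in>V_discrete_nonzero T E k k'.
              ereal (stab_form T E \<nu> s \<alpha> t p q / (V_norm T E \<nu> p * V_norm T E \<nu> q)))
           \<ge> ereal c)"
      using \<alpha>0 by blast
  next
    fix \<alpha> t :: real assume \<alpha>: "\<alpha> > 0"
    show "\<exists>C::real. \<forall>T E \<nu> k' s.
      tessellation \<Omega> \<rho> T E \<nu> \<longrightarrow> k' \<in> {k, k - 1} \<longrightarrow> stabilization Cs cs T E \<nu> k' s \<longrightarrow>
      (\<forall>u\<in>H1_broken T. \<forall>v\<in>H1_broken T. \<forall>l\<in>L2_skeleton E. \<forall>m\<in>L2_skeleton E.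
         (\<forall>K\<in>T. (LINT x|area_on K. u K x) = 0 \<and> flux E \<nu> K l (\<lambda>x. 1) = 0) \<longrightarrow>
         stab_form T E \<nu> s \<alpha> t (u, l) (v, m) \<le> C * V_norm T E \<nu> (u, l) * V_norm T E \<nu> (v, m))"
    proof (intro exI allI impI ballI)
      fix T E \<nu> k' s u v l m
      assume "tessellation \<Omega> \<rho> T E \<nu>" "stabilization Cs cs T E \<nu> k' s"
        and ass: "u \<in> H1_broken T" "v \<in> H1_broken T" "l \<in> L2_skeleton E" "m \<in> L2_skeleton E"
        "\<forall>K\<in>T. (LINT x|area_on K. u K x) = 0 \<and> flux E \<nu> K l (\<lambda>x. 1) = 0"
      then interpret S: stabilized_mesh \<Omega> \<rho> T E \<nu> Cs cs k' s by (intro mesh)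
      show "stab_form T E \<nu> s \<alpha> t (u, l) (v, m)
          \<le> (2 * (1 + \<alpha> * Cs * (1 + \<bar>t\<bar>))) * V_norm T E \<nu> (u, l) * V_norm T E \<nu> (v, m)"
        using ass by (intro S.conditional_continuity \<alpha>) (auto simp: H1_broken_def)
    qed
  qed
qed

end
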